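(* Let $y$ be a modified massive Arratia flow, i.e. a random element of $D([0,1],C[0,T])$ satisfying (C1)–(C4) of the context, and let $\mu_t:=y(\cdot,t)_\#\lambda$, $t\in[0,T]$. Then, for each twice continuously differentiable function $f$ on $\mathbb{R}$ with bounded derivatives up to the second order, $$M^f_t:=\langle f,\mu_t\rangle-\int_0^t\langle f,\Gamma(\mu_s)\rangle\,ds,\qquad t\in[0,T],$$ is a continuous local martingale with quadratic variation process $$[M^f]_t=\int_0^t\langle (f')^2,\mu_s\rangle\,ds,$$ where, for a probability measure $\nu$ on $\mathbb{R}$ with finite support, $$\langle f,\Gamma(\nu)\rangle=\frac12\sum_{x\in\mathrm{supp}(\nu)}f''(x).$$
   Context: Fix $T>0$ and let $\lambda$ be Lebesgue measure on $[0,1]$. $D([0,1],C[0,T])$ is the Skorokhod space of càdlàg functions from $[0,1]$ into $C[0,T]$ with the uniform distance. A random element $y=\{y(u,t),\ u\in[0,1],\ t\in[0,T]\}$ of $D([0,1],C[0,T])$ is required to satisfy: (C1) for all $u\in[0,1]$ the process $y(u,\cdot)$ is a continuous square integrable martingale with respect to the filtration $\mathcal{F}_t=\sigma(y(v,s),\ v\in[0,1],\ s\le t)$, $t\in[0,T]$; (C2) $y(u,0)=u$ for all $u\in[0,1]$; (C3) $y(u,t)\le y(v,t)$ for all $u<v$ in $[0,1]$ and $t\in[0,T]$; (C4) for all $u,v\in[0,1]$ the joint quadratic variation is $[y(u,\cdot),y(v,\cdot)]_t=\int_0^t\frac{\mathbb{I}_{\{\tau_{u,v}\le s\}}}{m(u,s)}ds$,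 where $m(u,t)=\lambda\{v:\ \exists s\le t,\ y(v,s)=y(u,s)\}$ and $\tau_{u,v}=\inf\{t:\ y(u,t)=y(v,t)\}\wedge T$. The measure $y(\cdot,t)_\#\lambda$ is the image measure $A\mapsto\lambda\{u:\ y(u,t)\in A\}$ on $\mathbb{R}$, and $\langle f,\nu\rangle=\int f\,d\nu$. Almost surely, for all $t\in(0,T]$, $y(\cdot,t)$ is a step function with finitely many jumps, so $\mathrm{supp}(\mu_t)$ is finite and $\Gamma(\mu_t)$ is well defined for all $t\in(0,T]$. The martingale property refers to the filtration $(\mathcal{F}_t)$. *)

theory Defs
  imports "HOL-Probability.Probability"
begin

section \<open>The Skorokhod space of functions from [0,1] into C[0,T]\<close>

text \<open>
  An element of \<open>D([0,1], C[0,T])\<close> is a curried function \<open>x u t\<close>; its values outside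
  \<open>[0,1] \<times> [0,T]\<close> are irrelevant. Right continuity and left limits are with respect to the
  uniform distance on \<open>C[0,T]\<close>.
\<close>

definition skorokhod_space :: "real \<Rightarrow> (real \<Rightarrow> real \<Rightarrow> real) set" where
  "skorokhod_space T = {x.
     (\<forall>u\<in>{0..1}. continuous_on {0..T} (x u)) \<and>
     (\<forall>u\<in>{0..<1}. uniform_limit {0..T} x (x u) (at_right u)) \<and>
     (\<forall>u\<in>{0<..1}. \<exists>l. continuous_on {0..T} l \<and> uniform_limit {0..T} x l (at_left u))}"

definition time_change :: "(real \<Rightarrow> real) \<Rightarrow> bool" where
  "time_change h \<longleftrightarrow> continuous_on {0..1} h \<and> strict_mono_on {0..1} h \<and> h 0 = 0 \<and> h 1 = 1"

definition skorokhod_dist ::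
    "real \<Rightarrow> (real \<Rightarrow> real \<Rightarrow> real) \<Rightarrow> (real \<Rightarrow> real \<Rightarrow> real) \<Rightarrow> real" where
  "skorokhod_dist T x z = Inf {e. \<exists>h. time_change h \<and>
     (\<forall>u\<in>{0..1}. \<bar>h u - u\<bar> \<le> e) \<and> (\<forall>u\<in>{0..1}. \<forall>t\<in>{0..T}. \<bar>x u t - z (h u) t\<bar> \<le> e)}"

definition skorokhod_open :: "real \<Rightarrow> (real \<Rightarrow> real \<Rightarrow> real) set \<Rightarrow> bool" where
  "skorokhod_open T U \<longleftrightarrow> U \<subseteq> skorokhod_space T \<and>
     (\<forall>x\<in>U. \<exists>e>0. \<forall>z\<in>skorokhod_space T. skorokhod_dist T x z < e \<longrightarrow> z \<in> U)"

definition skorokhod_borel :: "real \<Rightarrow> (real \<Rightarrow> real \<Rightarrow> real) measure" where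
  "skorokhod_borel T = sigma (skorokhod_space T) {U. skorokhod_open T U}"


section \<open>Martingales and quadratic variation on the time interval [0,T]\<close>

text \<open>Processes are functions \<open>X t \<omega>\<close>, of which only the times in \<open>[0,T]\<close> matter.\<close>

definition martingale_on ::
    "'a measure \<Rightarrow> (real \<Rightarrow> 'a measure) \<Rightarrow> real \<Rightarrow> (real \<Rightarrow> 'a \<Rightarrow> real) \<Rightarrow> bool" where
  "martingale_on P F T X \<longleftrightarrow>
     (\<forall>t\<in>{0..T}. X t \<in> borel_measurable (F t) \<and> integrable P (X t)) \<and>
     (\<forall>s\<in>{0..T}. \<forall>t\<in>{s..T}. AE \<omega> in P. real_cond_exp P (F s) (X t) \<omega> = X s \<omega>)"

definition square_integrable_martingale_on ::
    "'a measure \<Rightarrow> (real \<Rightarrow> 'a measure) \<Rightarrow> real \<Rightarrow> (real \<Rightarrow> 'a \<Rightarrow> real) \<Rightarrow> bool" where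
  "square_integrable_martingale_on P F T X \<longleftrightarrow>
     martingale_on P F T X \<and> (\<forall>t\<in>{0..T}. integrable P (\<lambda>\<omega>. (X t \<omega>)\<^sup>2))"

definition continuous_process_on ::
    "'a measure \<Rightarrow> real \<Rightarrow> (real \<Rightarrow> 'a \<Rightarrow> real) \<Rightarrow> bool" where
  "continuous_process_on P T X \<longleftrightarrow> (AE \<omega> in P. continuous_on {0..T} (\<lambda>t. X t \<omega>))"

text \<open>
  Since the time interval is the closed interval \<open>[0,T]\<close>, a localizing sequence consists of
  \<open>[0,T]\<close>-valued stopping times that almost surely are eventually equal to \<open>T\<close>.
\<close>

definition local_martingale_on ::
    "'a measure \<Rightarrow> (real \<Rightarrow> 'a measure) \<Rightarrow> real \<Rightarrow> (real \<Rightarrow> 'a \<Rightarrow> real) \<Rightarrow> bool" where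
  "local_martingale_on P F T X \<longleftrightarrow>
     (\<forall>t\<in>{0..T}. X t \<in> borel_measurable (F t)) \<and>
     (\<exists>\<tau>::nat \<Rightarrow> 'a \<Rightarrow> real.
        (\<forall>n. stopping_time F (\<tau> n)) \<and>
        (\<forall>n. \<forall>\<omega>\<in>space P. \<tau> n \<omega> \<in> {0..T} \<and> \<tau> n \<omega> \<le> \<tau> (Suc n) \<omega>) \<and>
        (AE \<omega> in P. \<forall>\<^sub>F n in sequentially. \<tau> n \<omega> = T) \<and>
        (\<forall>n. martingale_on P F T (\<lambda>t \<omega>. X (min t (\<tau> n \<omega>)) \<omega> - X 0 \<omega>)))"

definition interval_partition :: "real \<Rightarrow> nat \<Rightarrow> (nat \<Rightarrow> real) \<Rightarrow> bool" where
  "interval_partition t n p \<longleftrightarrow> p 0 = 0 \<and> p n = t \<and> (\<forall>i<n. p i \<le> p (Suc i))"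

text \<open>
  \<open>A\<close> is (a version of) the joint quadratic variation \<open>[X,Y]\<close>: it has continuous paths and
  for every \<open>t\<close> the sums of products of increments over partitions of \<open>[0,t]\<close> converge to
  \<open>A t\<close> in probability as the mesh tends to 0. This determines \<open>A\<close> up to
  indistinguishability, and gives \<open>A 0 = 0\<close> almost surely.
\<close>

definition joint_quadratic_variation ::
    "'a measure \<Rightarrow> real \<Rightarrow> (real \<Rightarrow> 'a \<Rightarrow> real) \<Rightarrow> (real \<Rightarrow> 'a \<Rightarrow> real) \<Rightarrow> (real \<Rightarrow> 'a \<Rightarrow> real) \<Rightarrow> bool" where
  "joint_quadratic_variation P T X Y A \<longleftrightarrow>
     (\<forall>t\<in>{0..T}. A t \<in> borel_measurable P) \<and>
     continuous_process_on P T A \<and>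
     (\<forall>t\<in>{0..T}. \<forall>\<epsilon>>0. \<forall>\<eta>>0. \<exists>\<delta>>0. \<forall>n p.
        interval_partition t n p \<and> (\<forall>i<n. p (Suc i) - p i < \<delta>) \<longrightarrow>
        measure P {\<omega>\<in>space P.
          \<bar>(\<Sum>i<n. (X (p (Suc i)) \<omega> - X (p i) \<omega>) * (Y (p (Suc i)) \<omega> - Y (p i) \<omega>)) - A t \<omega>\<bar> > \<epsilon>} < \<eta>)"

definition quadratic_variation ::
    "'a measure \<Rightarrow> real \<Rightarrow> (real \<Rightarrow> 'a \<Rightarrow> real) \<Rightarrow> (real \<Rightarrow> 'a \<Rightarrow> real) \<Rightarrow> bool" where
  "quadratic_variation P T X A \<longleftrightarrow> joint_quadratic_variation P T X X A"


section \<open>The modified massive Arratia flow\<close>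

definition flow_filtration ::
    "'a measure \<Rightarrow> real \<Rightarrow> ('a \<Rightarrow> real \<Rightarrow> real \<Rightarrow> real) \<Rightarrow> real \<Rightarrow> 'a measure" where
  "flow_filtration P T y t = sigma (space P)
     {(\<lambda>\<omega>. y \<omega> v s) -` B \<inter> space P | v s B.
        v \<in> {0..1} \<and> s \<in> {0..T} \<and> s \<le> t \<and> B \<in> sets borel}"

text \<open>For one path \<open>x\<close> of the flow: the mass \<open>m(u,t)\<close> and the meeting time \<open>\<tau>\<^sub>u\<^sub>,\<^sub>v\<close>.
  Inserting \<open>T\<close> into the set implements both the minimum with \<open>T\<close> and the convention that
  the infimum of the empty set is infinite.\<close>

definition mass :: "(real \<Rightarrow> real \<Rightarrow> real) \<Rightarrow> real \<Rightarrow> real \<Rightarrow> ennreal" where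
  "mass x u t = emeasure lborel {v\<in>{0..1}. \<exists>s\<in>{0..t}. x v s = x u s}"

definition meeting_time :: "real \<Rightarrow> (real \<Rightarrow> real \<Rightarrow> real) \<Rightarrow> real \<Rightarrow> real \<Rightarrow> real" where
  "meeting_time T x u v = Inf (insert T {t\<in>{0..T}. x u t = x v t})"

text \<open>
  The integral in (C4) is taken in the extended nonnegative reals (where \<open>1 / 0 = \<infinity>\<close>), so
  that its finiteness is part of the assumption that it equals the joint quadratic variation.
\<close>

locale modified_massive_arratia_flow = prob_space P
  for P :: "'a measure" +
  fixes T :: real and y :: "'a \<Rightarrow> real \<Rightarrow> real \<Rightarrow> real"
  assumes T_pos: "T > 0"
    and random_element: "y \<in> measurable P (skorokhod_borel T)"
    and C1: "\<And>u. u \<in> {0..1} \<Longrightarrow>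
      continuous_process_on P T (\<lambda>t \<omega>. y \<omega> u t) \<and>
      square_integrable_martingale_on P (flow_filtration P T y) T (\<lambda>t \<omega>. y \<omega> u t)"
    and C2: "AE \<omega> in P. \<forall>u\<in>{0..1}. y \<omega> u 0 = u"
    and C3: "AE \<omega> in P. \<forall>u\<in>{0..1}. \<forall>v\<in>{0..1}. \<forall>t\<in>{0..T}. u < v \<longrightarrow> y \<omega> u t \<le> y \<omega> v t"
    and C4: "\<And>u v. u \<in> {0..1} \<Longrightarrow> v \<in> {0..1} \<Longrightarrow>
      \<exists>A. joint_quadratic_variation P T (\<lambda>t \<omega>. y \<omega> u t) (\<lambda>t \<omega>. y \<omega> v t) A \<and>
        (AE \<omega> in P. \<forall>t\<in>{0..T}. 0 \<le> A t \<omega> \<and>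
          ennreal (A t \<omega>) =
            (\<integral>\<^sup>+s\<in>{0..t}. (if meeting_time T (y \<omega>) u v \<le> s then 1 else 0) / mass (y \<omega>) u s \<partial>lborel))"


section \<open>The measure-valued process\<close>

definition image_measure :: "(real \<Rightarrow> real \<Rightarrow> real) \<Rightarrow> real \<Rightarrow> real measure" where
  "image_measure x t = distr (restrict_space lborel {0..1}) borel (\<lambda>u. x u t)"

definition measure_support :: "real measure \<Rightarrow> real set" where
  "measure_support \<nu> = {x. \<forall>U. open U \<and> x \<in> U \<longrightarrow> emeasure \<nu> U > 0}"

text \<open>Meaningful for finitely supported measures only. Along the flow, almost surely, this covers
  all times \<open>t > 0\<close>; at time 0 the sum over the infinite support is 0 by convention.\<close>

definition Gamma_pairing :: "(real \<Rightarrow> real) \<Rightarrow> real measure \<Rightarrow> real" where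
  "Gamma_pairing f \<nu> = (1 / 2) * (\<Sum>x\<in>measure_support \<nu>. deriv (deriv f) x)"

definition flow_process ::
    "('a \<Rightarrow> real \<Rightarrow> real \<Rightarrow> real) \<Rightarrow> (real \<Rightarrow> real) \<Rightarrow> real \<Rightarrow> 'a \<Rightarrow> real" where
  "flow_process y f t \<omega> = (\<integral>x. f x \<partial>image_measure (y \<omega>) t)
     - (LBINT s:{0..t}. Gamma_pairing f (image_measure (y \<omega>) s))"

end

theory Submission
  imports Defs "HOL-Library.Diagonal_Subsequence"
begin

text \<open>
  For a square integrable martingale \<open>Y\<close> with quadratic variation \<open>A\<close> the sums of squared increments
  converge to \<open>A\<close> even in mean: Fatou's lemma gives \<open>E A\<^sub>t \<le> E (Y\<^sub>t\<^sup>2 - Y\<^sub>0\<^sup>2)\<close>, and a truncation of the square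
  to linear growth gives the converse. Hence \<open>Y\<^sup>2 - A\<close> is a martingale, and a second order Taylor expansion
  along partitions shows that \<open>f (Y\<^sub>t) - 1/2 \<integral>\<^sub>0\<^sup>t f'' (Y) dA\<close> is a martingale too, without stochastic integrals.

  In the flow, particles that have met stay together, because a nonnegative martingale is absorbed at 0.
  So \<open>m(u,s)\<close> is the mass of the atom of \<open>\<mu>\<^sub>s\<close> at \<open>y(u,s)\<close>, and averaging \<open>f''(y(u,s)) / m(u,s)\<close> over \<open>u\<close> gives
  the sum of \<open>f''\<close> over the support of \<open>\<mu>\<^sub>s\<close>. As \<open>E \<integral>\<^sub>0\<^sup>T 1/m(u,s) ds = E (y(u,T)\<^sup>2 - y(u,0)\<^sup>2)\<close> is bounded in
  \<open>u\<close>, Fubini's theorem applies and \<open>M\<^sup>f\<close> is a true martingale, the average over \<open>u\<close> of those above.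

  The squared increments of \<open>\<langle>f, \<mu>\<rangle>\<close> are averages over \<open>(u,v)\<close> of products of increments of \<open>f(y(u,\<cdot>))\<close>
  and \<open>f(y(v,\<cdot>))\<close>. For fixed \<open>u, v\<close> their sums converge in mean to the integral of
  \<open>f'(y(u,s)) f'(y(v,s)) / m(u,s)\<close> over the times \<open>s\<close> with \<open>y(u,s) = y(v,s)\<close>; averaging over \<open>v\<close> cancels \<open>m(u,s)\<close>
  and leaves \<open>\<integral>\<^sub>0\<^sup>t \<langle>(f')\<^sup>2, \<mu>\<^sub>s\<rangle> ds\<close>. The drift has finite variation and does not contribute.
\<close>

section \<open>Convergence in probability and in mean\<close>

text \<open>The flow's quadratic variations are given for fixed \<open>u\<close>, \<open>v\<close>
  and only in probability, while the claim concerns averages over all particles. The exceptional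
  sets depend on \<open>u\<close> and \<open>v\<close>, so pathwise limits cannot be averaged. What
  survives averaging by Fubini's theorem is convergence in mean with bounds uniform in
  \<open>u\<close> and \<open>v\<close>. Passing from probability to mean needs uniform
  integrability of the quadratic sums; it is extracted from the fact that their expectations are the
  same for all partitions of an interval. Almost sure limits are taken only along subsequences,
  which is enough for statements in probability or in mean.

  Finiteness of the support of the image measure at almost every time is derived as well: the
  integral of \<open>1 / \<nu> {x}\<close> with respect to \<nu> counts the atoms of \<nu>, and the
  averaged rates are almost surely finite. The filtration is not completed, so adaptedness has to
  hold on every path; this is the origin of the version of the flow clamped at the current
  time.\<close>

lemma LIMSEQ_subsubseqI:
  fixes x :: "nat \<Rightarrow> 'b::metric_space"
  assumes "\<And>r::nat\<Rightarrow>nat. strict_mono r \<Longrightarrow> \<exists>r'. strict_mono r' \<and> (x \<circ> r \<circ> r') \<longlonglongrightarrow> l"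
  shows "x \<longlonglongrightarrow> l"
proof (rule ccontr)
  assume "\<not> x \<longlonglongrightarrow> l"
  then obtain e where e: "e > 0" "\<not> (\<forall>\<^sub>F n in sequentially. dist (x n) l < e)"
    unfolding tendsto_iff by blast
  from e(2) have "\<exists>\<^sub>F n in sequentially. \<not> dist (x n) l < e"
    by (simp only: not_eventually not_not)
  then have "infinite {n. \<not> dist (x n) l < e}"
    by (simp add: frequently_cofinite[symmetric] cofinite_eq_sequentially)
  then obtain r :: "nat \<Rightarrow> nat" where r: "strict_mono r" "\<And>n. r n \<in> {n. \<not> dist (x n) l < e}"
    using infinite_enumerate by blast
  obtain r' where "strict_mono r'" "(x \<circ> r \<circ> r') \<longlonglongrightarrow> l"
    using assms[OF r(1)] by blast
  then have "\<forall>\<^sub>F n in sequentially. dist (x (r (r' n))) l < e"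
    using e(1) by (auto simp: tendsto_iff)
  then obtain n where "dist (x (r (r' n))) l < e"
    by (auto simp: eventually_sequentially)
  then show False using r(2) by auto
qed

lemma LIMSEQ_squeeze_0:
  fixes a b :: "nat \<Rightarrow> real"
  assumes "b \<longlonglongrightarrow> 0" "\<And>n. 0 \<le> a n" "\<And>n. a n \<le> b n"
  shows "a \<longlonglongrightarrow> 0"
  by (rule tendsto_sandwich[OF _ _ tendsto_const assms(1)]) (use assms in auto)

definition tendsto_prob :: "'a measure \<Rightarrow> (nat \<Rightarrow> 'a \<Rightarrow> real) \<Rightarrow> ('a \<Rightarrow> real) \<Rightarrow> bool" where
  "tendsto_prob M X Z \<longleftrightarrow>
     (\<forall>\<epsilon>>0. (\<lambda>n. measure M {\<omega>\<in>space M. \<bar>X n \<omega> - Z \<omega>\<bar> > \<epsilon>}) \<longlonglongrightarrow> 0)"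

definition tendsto_L1 :: "'a measure \<Rightarrow> (nat \<Rightarrow> 'a \<Rightarrow> real) \<Rightarrow> ('a \<Rightarrow> real) \<Rightarrow> bool" where
  "tendsto_L1 M X Z \<longleftrightarrow> (\<forall>n. integrable M (X n)) \<and> integrable M Z \<and>
     (\<lambda>n. \<integral>\<omega>. \<bar>X n \<omega> - Z \<omega>\<bar> \<partial>M) \<longlonglongrightarrow> 0"

lemma tendsto_prob_subseq:
  "tendsto_prob M X Z \<Longrightarrow> strict_mono (r::nat\<Rightarrow>nat) \<Longrightarrow> tendsto_prob M (\<lambda>n. X (r n)) Z"
  unfolding tendsto_prob_def using LIMSEQ_subseq_LIMSEQ by (fastforce simp: comp_def)

lemma tendsto_L1_subseq:
  "tendsto_L1 M X Z \<Longrightarrow> strict_mono (r::nat\<Rightarrow>nat) \<Longrightarrow> tendsto_L1 M (\<lambda>n. X (r n)) Z"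
  unfolding tendsto_L1_def using LIMSEQ_subseq_LIMSEQ by (fastforce simp: comp_def)

text \<open>Splitting \<open>g\<close> at a level \<open>n\<close>: the part above \<open>n\<close>
  has integral below \<open>\<epsilon> / 2\<close> by dominated convergence, the rest contributes at
  most \<open>n\<close> times the measure of \<open>H\<close>.\<close>

lemma (in finite_measure) integral_indicator_abs_cont:
  fixes g :: "'a \<Rightarrow> real"
  assumes g[measurable]: "integrable M g" and "\<And>x. x \<in> space M \<Longrightarrow> 0 \<le> g x" and "\<epsilon> > 0"
  shows "\<exists>\<delta>>0. \<forall>H\<in>sets M. measure M H < \<delta> \<longrightarrow> (\<integral>x. g x * indicator H x \<partial>M) < \<epsilon>"
proof -
  have "(\<lambda>n. \<integral>x. g x * indicator {x\<in>space M. g x > real n} x \<partial>M) \<longlonglongrightarrow> (\<integral>x. 0 \<partial>M)"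
  proof (rule integral_dominated_convergence[where w=g])
    show "AE x in M. (\<lambda>n. g x * indicator {x\<in>space M. g x > real n} x) \<longlonglongrightarrow> 0"
    proof (rule AE_I2, rule tendsto_eventually)
      fix x
      obtain N :: nat where "g x < N" using reals_Archimedean2 by blast
      then show "\<forall>\<^sub>F n in sequentially. g x * indicator {x\<in>space M. g x > real n} x = 0"
        by (intro eventually_sequentiallyI[of N]) (auto simp: indicator_def)
    qed
  qed (use assms in \<open>auto simp: indicator_def\<close>)
  then have "\<forall>\<^sub>F n in sequentially. (\<integral>x. g x * indicator {x\<in>space M. g x > real n} x \<partial>M) < \<epsilon>/2"
    using assms(3) by (intro order_tendstoD(2)[where y="0::real"]) auto
  then obtain n where n: "(\<integral>x. g x * indicator {x\<in>space M. g x > real n} x \<partial>M) < \<epsilon>/2"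
    by (auto simp: eventually_sequentially)
  show ?thesis
  proof (intro exI[of _ "\<epsilon> / (2 * (real n + 1))"] conjI ballI impI)
    show "0 < \<epsilon> / (2 * (real n + 1))" using assms(3) by auto
    fix H assume H[measurable]: "H \<in> sets M" and m: "measure M H < \<epsilon> / (2 * (real n + 1))"
    have i: "integrable M (\<lambda>x. g x * indicator H x)" "integrable M (\<lambda>x. g x * indicator {x\<in>space M. g x > real n} x)"
        "integrable M (\<lambda>x. real n * indicator H x)"
      by (auto intro!: integrable_real_mult_indicator[OF _ g] integrable_mult_right integrable_real_indicator
          simp: emeasure_finite less_top[symmetric] simp del: integrable_indicator_iff)
    have "(\<integral>x. g x * indicator H x \<partial>M) \<le>
        (\<integral>x. g x * indicator {x\<in>space M. g x > real n} x + real n * indicator H x \<partial>M)"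
      using assms(2) by (intro integral_mono Bochner_Integration.integrable_add i) (auto simp: indicator_def)
    also have "\<dots> = (\<integral>x. g x * indicator {x\<in>space M. g x > real n} x \<partial>M) + real n * measure M H"
      by (subst Bochner_Integration.integral_add[OF i(2,3)]) simp
    also have "\<dots> < \<epsilon>/2 + \<epsilon>/2"
    proof (intro add_less_le_mono n)
      have "real n * measure M H \<le> (real n + 1) * measure M H" by (simp add: mult_right_mono)
      also have "\<dots> \<le> (real n + 1) * (\<epsilon> / (2 * (real n + 1)))"
        using m by (intro mult_left_mono) auto
      also have "\<dots> = \<epsilon>/2" by (simp add: field_simps)
      finally show "real n * measure M H \<le> \<epsilon> / 2" .
    qed
    finally show "(\<integral>x. g x * indicator H x \<partial>M) < \<epsilon>" by simp
  qed
qed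

text \<open>A form of Vitali's theorem: convergence to 0 in probability becomes convergence in mean
  because the majorants are uniformly integrable, \<open>g\<close> being one integrable function and
  the \<open>N n\<close> being bounded in \<open>L\<^sup>2\<close>.\<close>

lemma (in prob_space) integral_tendsto_0_L2_bound:
  fixes g :: "'a \<Rightarrow> real" and N h :: "nat \<Rightarrow> 'a \<Rightarrow> real"
  assumes g: "integrable M g" "\<And>x. x \<in> space M \<Longrightarrow> 0 \<le> g x"
    and [measurable]: "\<And>n. N n \<in> borel_measurable M" "\<And>n. h n \<in> borel_measurable M"
    and N: "\<And>n. integrable M (\<lambda>x. (N n x)\<^sup>2)" "\<And>n. (\<integral>x. (N n x)\<^sup>2 \<partial>M) \<le> B"
    and h: "\<And>n x. x \<in> space M \<Longrightarrow> 0 \<le> h n x" "\<And>n x. x \<in> space M \<Longrightarrow> h n x \<le> g x + \<bar>N n x\<bar>"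
    and prob: "\<And>\<epsilon>. \<epsilon> > 0 \<Longrightarrow> (\<lambda>n. measure M {x\<in>space M. h n x > \<epsilon>}) \<longlonglongrightarrow> 0"
  shows "(\<lambda>n. \<integral>x. h n x \<partial>M) \<longlonglongrightarrow> 0"
proof (rule tendstoI)
  fix e :: real assume e: "e > 0"
  \<comment> \<open>Four contributions get \<open>e / 4\<close> each: the level
    \<open>e / 4\<close>, the integral of \<open>g\<close> over \<open>H n\<close>,
    \<open>\<alpha>\<close> times the second moment of \<open>N n\<close>, and
    \<open>measure M (H n) / (4 * \<alpha>)\<close>. The last two come from Young's inequality for
    \<open>\<bar>N n x\<bar>\<close> on \<open>H n\<close>.\<close>
  define \<alpha> where "\<alpha> = e / (4 * (\<bar>B\<bar> + 1))"
  have \<alpha>: "\<alpha> > 0" using e by (auto simp: \<alpha>_def)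
  have "\<alpha> * B \<le> \<alpha> * (\<bar>B\<bar> + 1)" using \<alpha> by (intro mult_left_mono) auto
  also have "\<dots> = e / 4"
  proof -
    have "\<alpha> * c = e / 4" if "\<alpha> = e / (4 * c)" "c > 0" for c using that by simp
    from this[OF \<alpha>_def] show ?thesis by simp
  qed
  finally have \<alpha>B: "\<alpha> * B \<le> e / 4" .
  have NI: "integrable M (N n)" for n
    by (rule square_integrable_imp_integrable) (use N in auto)
  obtain \<delta> where \<delta>: "\<delta> > 0" "\<And>H. H \<in> sets M \<Longrightarrow> measure M H < \<delta> \<Longrightarrow> (\<integral>x. g x * indicator H x \<partial>M) < e/4"
    using integral_indicator_abs_cont[OF g, of "e/4"] e by auto
  define H where "H n = {x\<in>space M. h n x > e/4}" for n
  have [measurable]: "H n \<in> sets M" for n unfolding H_def by measurable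
  have lim: "(\<lambda>n. measure M (H n)) \<longlonglongrightarrow> 0" unfolding H_def using prob[of "e/4"] e by simp
  have "\<forall>\<^sub>F n in sequentially. measure M (H n) < \<delta>"
    by (rule order_tendstoD(2)[OF lim \<delta>(1)])
  moreover have "\<forall>\<^sub>F n in sequentially. measure M (H n) < \<alpha> * e"
    by (rule order_tendstoD(2)[OF lim]) (use \<alpha> e in simp)
  ultimately show "\<forall>\<^sub>F n in sequentially. dist (\<integral>x. h n x \<partial>M) 0 < e"
  proof eventually_elim
    case (elim n)
    have gi: "integrable M (\<lambda>x. g x * indicator (H n) x)"
      by (intro integrable_real_mult_indicator g) auto
    have hi: "integrable M (h n)"
      by (rule Bochner_Integration.integrable_bound[where f="\<lambda>x. g x + \<bar>N n x\<bar>"])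
        (use g NI h in \<open>auto intro!: AE_I2 order_trans[OF h(2)]\<close>)
    have "(\<integral>x. h n x \<partial>M) \<le> (\<integral>x. e/4 + g x * indicator (H n) x + \<alpha> * (N n x)\<^sup>2 + indicator (H n) x / (4 * \<alpha>) \<partial>M)"
    proof (rule integral_mono)
      show "integrable M (\<lambda>x. e/4 + g x * indicator (H n) x + \<alpha> * (N n x)\<^sup>2 + indicator (H n) x / (4 * \<alpha>))"
        by (intro Bochner_Integration.integrable_add gi integrable_const integrable_mult_right N
            integrable_divide integrable_real_indicator) (auto simp: emeasure_finite less_top[symmetric])
      fix x assume x: "x \<in> space M"
      show "h n x \<le> e/4 + g x * indicator (H n) x + \<alpha> * (N n x)\<^sup>2 + indicator (H n) x / (4 * \<alpha>)"
      proof (cases "x \<in> H n")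
        case True
        have "0 \<le> (2 * \<alpha> * \<bar>N n x\<bar> - 1)\<^sup>2 / (4 * \<alpha>)" using \<alpha> by auto
        also have "\<dots> = \<alpha> * (N n x)\<^sup>2 + 1 / (4 * \<alpha>) - \<bar>N n x\<bar>"
          using \<alpha> by (simp add: field_simps power2_eq_square)
        finally show ?thesis using h(2)[OF x, of n] True e by simp
      next
        case False
        then have "h n x \<le> e/4" using x by (auto simp: H_def)
        moreover have "0 \<le> \<alpha> * (N n x)\<^sup>2" using \<alpha> by auto
        ultimately show ?thesis using False by simp
      qed
    qed (fact hi)
    also have "\<dots> = e/4 + (\<integral>x. g x * indicator (H n) x \<partial>M) + \<alpha> * (\<integral>x. (N n x)\<^sup>2 \<partial>M) + measure M (H n) / (4 * \<alpha>)"
      by (simp add: gi N prob_space integrable_real_indicator emeasure_finite less_top[symmetric])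
    also have "\<dots> < e/4 + e/4 + e/4 + e/4"
    proof -
      have "\<alpha> * (\<integral>x. (N n x)\<^sup>2 \<partial>M) \<le> \<alpha> * B" using \<alpha> N by (intro mult_left_mono) auto
      moreover have "measure M (H n) / (4 * \<alpha>) \<le> e / 4"
        using elim \<alpha> by (simp add: field_simps)
      ultimately show ?thesis using \<delta>(2)[of "H n"] elim \<alpha>B by auto
    qed
    finally show ?case using h by (auto simp: integral_nonneg_AE)
  qed
qed

lemma (in prob_space) integral_tendsto_0_dominated_prob:
  fixes g :: "'a \<Rightarrow> real" and h :: "nat \<Rightarrow> 'a \<Rightarrow> real"
  assumes "integrable M g" "\<And>x. x \<in> space M \<Longrightarrow> 0 \<le> g x"
    and "\<And>n. h n \<in> borel_measurable M"
    and "\<And>n x. x \<in> space M \<Longrightarrow> 0 \<le> h n x" "\<And>n x. x \<in> space M \<Longrightarrow> h n x \<le> g x"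
    and "\<And>\<epsilon>. \<epsilon> > 0 \<Longrightarrow> (\<lambda>n. measure M {x\<in>space M. h n x > \<epsilon>}) \<longlonglongrightarrow> 0"
  shows "(\<lambda>n. \<integral>x. h n x \<partial>M) \<longlonglongrightarrow> 0"
  by (rule integral_tendsto_0_L2_bound[where g=g and N="\<lambda>_ _. 0" and B=0]) (use assms in auto)

lemma (in prob_space) tendsto_prob_measure_le:
  assumes X: "tendsto_prob M X Z" and [measurable]: "\<And>n. X n \<in> borel_measurable M" "Z \<in> borel_measurable M"
    and h: "\<And>n x. x \<in> space M \<Longrightarrow> h n x \<le> \<bar>X n x - Z x\<bar>" and "\<epsilon> > 0"
  shows "(\<lambda>n. measure M {x\<in>space M. h n x > \<epsilon>}) \<longlonglongrightarrow> 0"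
proof (rule tendsto_sandwich[OF _ _ tendsto_const])
  show "(\<lambda>n. measure M {x\<in>space M. \<bar>X n x - Z x\<bar> > \<epsilon>}) \<longlonglongrightarrow> 0"
    using X \<open>\<epsilon> > 0\<close> by (auto simp: tendsto_prob_def)
  show "\<forall>\<^sub>F n in sequentially. measure M {x\<in>space M. h n x > \<epsilon>} \<le> measure M {x\<in>space M. \<bar>X n x - Z x\<bar> > \<epsilon>}"
  proof (intro always_eventually allI finite_measure_mono subsetI)
    fix n x assume "x \<in> {x\<in>space M. h n x > \<epsilon>}"
    then show "x \<in> {x\<in>space M. \<bar>X n x - Z x\<bar> > \<epsilon>}" using h[of x n] by auto
  qed measurable
qed auto

text \<open>Truncating the distance at 1 turns convergence in probability into convergence in mean,
  which has almost surely convergent subsequences; a truncated distance that tends to 0 eventually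
  equals the untruncated one.\<close>

lemma (in prob_space) tendsto_prob_AE_subseq:
  assumes X: "tendsto_prob M X Z" and [measurable]: "\<And>n. X n \<in> borel_measurable M" "Z \<in> borel_measurable M"
  shows "\<exists>r::nat\<Rightarrow>nat. strict_mono r \<and> (AE x in M. (\<lambda>n. X (r n) x) \<longlonglongrightarrow> Z x)"
proof -
  have "(\<lambda>n. \<integral>x. min 1 \<bar>X n x - Z x\<bar> \<partial>M) \<longlonglongrightarrow> 0"
  proof (rule integral_tendsto_0_dominated_prob[where g="\<lambda>_. 1"])
    show "(\<lambda>n. measure M {x\<in>space M. min 1 \<bar>X n x - Z x\<bar> > \<epsilon>}) \<longlonglongrightarrow> 0" if "\<epsilon> > 0" for \<epsilon>
      by (rule tendsto_prob_measure_le[OF X _ _ _ that]) (rule assms min.cobounded2)+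
  qed simp_all
  moreover have "integrable M (\<lambda>x. min 1 \<bar>X n x - Z x\<bar>)" for n
    by (rule integrable_const_bound[where B=1]) auto
  ultimately obtain r :: "nat \<Rightarrow> nat" where r: "strict_mono r"
      "AE x in M. (\<lambda>n. min 1 \<bar>X (r n) x - Z x\<bar>) \<longlonglongrightarrow> 0"
    using tendsto_L1_AE_subseq[of M "\<lambda>n x. min 1 \<bar>X n x - Z x\<bar>"] by auto
  have "(\<lambda>n. X (r n) x) \<longlonglongrightarrow> Z x" if lim: "(\<lambda>n. min 1 \<bar>X (r n) x - Z x\<bar>) \<longlonglongrightarrow> 0" for x
  proof -
    have "\<forall>\<^sub>F n in sequentially. min 1 \<bar>X (r n) x - Z x\<bar> < 1"
      by (rule order_tendstoD(2)[OF lim]) auto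
    then have "\<forall>\<^sub>F n in sequentially. min 1 \<bar>X (r n) x - Z x\<bar> = \<bar>X (r n) x - Z x\<bar>"
      by eventually_elim auto
    then have "(\<lambda>n. \<bar>X (r n) x - Z x\<bar>) \<longlonglongrightarrow> 0" using lim by (rule Lim_transform_eventually[rotated])
    then show ?thesis by (rule LIM_zero_cancel[OF tendsto_rabs_zero_cancel])
  qed
  with r(2) have "AE x in M. (\<lambda>n. X (r n) x) \<longlonglongrightarrow> Z x" by (auto elim!: eventually_mono)
  with r(1) show ?thesis by blast
qed

lemma (in prob_space) tendsto_L1_imp_prob:
  assumes "tendsto_L1 M X Z"
  shows "tendsto_prob M X Z"
  unfolding tendsto_prob_def
proof safe
  fix e :: real assume e: "e > 0"
  have XZ: "integrable M (X n)" "integrable M Z" for n using assms by (auto simp: tendsto_L1_def)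
  note [measurable] = XZ[THEN borel_measurable_integrable]
  have "(\<lambda>n. (\<integral>\<omega>. \<bar>X n \<omega> - Z \<omega>\<bar> \<partial>M) / e) \<longlonglongrightarrow> 0 / e"
    using assms e by (intro tendsto_intros) (auto simp: tendsto_L1_def)
  then have lim: "(\<lambda>n. (\<integral>\<omega>. \<bar>X n \<omega> - Z \<omega>\<bar> \<partial>M) / e) \<longlonglongrightarrow> 0" by simp
  have "measure M {\<omega>\<in>space M. \<bar>X n \<omega> - Z \<omega>\<bar> > e} \<le> (\<integral>\<omega>. \<bar>X n \<omega> - Z \<omega>\<bar> \<partial>M) / e" for n
  proof -
    have i: "integrable M (\<lambda>\<omega>. \<bar>X n \<omega> - Z \<omega>\<bar>)" using XZ by simp
    have "measure M {\<omega>\<in>space M. \<bar>X n \<omega> - Z \<omega>\<bar> > e} \<le> measure M {\<omega>\<in>space M. \<bar>X n \<omega> - Z \<omega>\<bar> \<ge> e}"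
      by (rule finite_measure_mono) auto
    also have "\<dots> \<le> (\<integral>\<omega>. \<bar>X n \<omega> - Z \<omega>\<bar> \<partial>M) / e"
      by (rule integral_Markov_inequality_measure[OF i, of "{}" e]) (use e in auto)
    finally show ?thesis .
  qed
  then show "(\<lambda>n. measure M {\<omega>\<in>space M. \<bar>X n \<omega> - Z \<omega>\<bar> > e}) \<longlonglongrightarrow> 0"
    by (intro tendsto_sandwich[OF _ _ tendsto_const lim]) auto
qed

text \<open>\<open>\<bar>X - Z\<bar> = (X - Z) + 2 * max 0 (Z - X)\<close>. The first part has
  nonpositive expectation, the second is dominated by the positive part of \<open>Z\<close> and
  tends to 0 in probability.\<close>

lemma (in prob_space) tendsto_L1_Scheffe:
  assumes X: "tendsto_prob M X Z" and Xi: "\<And>n. integrable M (X n)" and Zi: "integrable M Z"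
    and nn: "\<And>n x. x \<in> space M \<Longrightarrow> 0 \<le> X n x" and "AE x in M. 0 \<le> Z x"
    and E: "\<And>n. (\<integral>x. X n x \<partial>M) \<le> (\<integral>x. Z x \<partial>M)"
  shows "tendsto_L1 M X Z"
proof -
  note [measurable] = borel_measurable_integrable[OF Xi] borel_measurable_integrable[OF Zi]
  have i: "integrable M (\<lambda>x. max 0 (Z x - X n x))" for n
    by (rule integrable_max) (auto intro: Xi Zi)
  have "(\<lambda>n. \<integral>x. max 0 (Z x - X n x) \<partial>M) \<longlonglongrightarrow> 0"
  proof (rule integral_tendsto_0_dominated_prob[where g="\<lambda>x. max 0 (Z x)"])
    show "integrable M (\<lambda>x. max 0 (Z x))" using Zi by auto
    show "max 0 (Z x - X n x) \<le> max 0 (Z x)" if "x \<in> space M" for n x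
      using nn[OF that, of n] by auto
    show "(\<lambda>n. measure M {x\<in>space M. max 0 (Z x - X n x) > \<epsilon>}) \<longlonglongrightarrow> 0" if "\<epsilon> > 0" for \<epsilon>
      by (rule tendsto_prob_measure_le[OF X _ _ _ that]) auto
  qed simp_all
  then have lim: "(\<lambda>n. 2 * (\<integral>x. max 0 (Z x - X n x) \<partial>M)) \<longlonglongrightarrow> 2 * 0" by (intro tendsto_intros)
  have le: "(\<integral>x. \<bar>X n x - Z x\<bar> \<partial>M) \<le> 2 * (\<integral>x. max 0 (Z x - X n x) \<partial>M)" for n
  proof -
    have "(\<integral>x. \<bar>X n x - Z x\<bar> \<partial>M) = (\<integral>x. X n x - Z x + 2 * max 0 (Z x - X n x) \<partial>M)"
      by (intro Bochner_Integration.integral_cong) (auto simp: max_def)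
    also have "\<dots> = (\<integral>x. X n x \<partial>M) - (\<integral>x. Z x \<partial>M) + 2 * (\<integral>x. max 0 (Z x - X n x) \<partial>M)"
      using i Xi Zi by simp
    finally show ?thesis using E[of n] by simp
  qed
  have "(\<lambda>n. \<integral>x. \<bar>X n x - Z x\<bar> \<partial>M) \<longlonglongrightarrow> 0"
    by (rule LIMSEQ_squeeze_0[OF _ _ le]) (use lim in auto)
  then show ?thesis using Xi Zi by (auto simp: tendsto_L1_def)
qed

lemma tendsto_L1_diff:
  assumes "tendsto_L1 M X Z" "tendsto_L1 M X' Z'"
  shows "tendsto_L1 M (\<lambda>n x. X n x - X' n x) (\<lambda>x. Z x - Z' x)"
proof -
  have i: "integrable M (X n)" "integrable M Z" "integrable M (X' n)" "integrable M Z'" for n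
    using assms by (auto simp: tendsto_L1_def)
  have lim: "(\<lambda>n. (\<integral>x. \<bar>X n x - Z x\<bar> \<partial>M) + (\<integral>x. \<bar>X' n x - Z' x\<bar> \<partial>M)) \<longlonglongrightarrow> 0 + 0"
    using assms by (intro tendsto_intros) (auto simp: tendsto_L1_def)
  have "(\<integral>x. \<bar>X n x - X' n x - (Z x - Z' x)\<bar> \<partial>M) \<le> (\<integral>x. \<bar>X n x - Z x\<bar> + \<bar>X' n x - Z' x\<bar> \<partial>M)" for n
    by (intro integral_mono) (use i in auto)
  then have le: "(\<integral>x. \<bar>X n x - X' n x - (Z x - Z' x)\<bar> \<partial>M) \<le> (\<integral>x. \<bar>X n x - Z x\<bar> \<partial>M) + (\<integral>x. \<bar>X' n x - Z' x\<bar> \<partial>M)" for n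
    using i by simp
  have "(\<lambda>n. \<integral>x. \<bar>X n x - X' n x - (Z x - Z' x)\<bar> \<partial>M) \<longlonglongrightarrow> 0"
    by (rule LIMSEQ_squeeze_0[OF _ _ le]) (use lim in auto)
  then show ?thesis using i by (auto simp: tendsto_L1_def)
qed

lemma tendsto_L1_add:
  assumes "tendsto_L1 M X Z" "tendsto_L1 M X' Z'"
  shows "tendsto_L1 M (\<lambda>n x. X n x + X' n x) (\<lambda>x. Z x + Z' x)"
proof -
  have "tendsto_L1 M (\<lambda>n x. - X' n x) (\<lambda>x. - Z' x)"
    using assms(2) by (auto simp: tendsto_L1_def abs_minus_commute)
  from tendsto_L1_diff[OF assms(1) this] show ?thesis by simp
qed

text \<open>Dominated convergence with a moving majorant: subtracting
  \<open>D n = C * \<bar>Q n - A\<bar>\<close>, which tends to 0 in mean, leaves something below the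
  fixed integrable function \<open>2 * C * A\<close>.\<close>

lemma (in prob_space) integral_abs_tendsto_0_L1_dominated:
  assumes Q: "tendsto_L1 M Q A" and [measurable]: "\<And>n. g n \<in> borel_measurable M"
    and bound: "\<And>n. AE x in M. \<bar>g n x\<bar> \<le> C * (Q n x + A x)"
    and C: "C \<ge> 0" and A: "AE x in M. 0 \<le> A x"
    and lim: "AE x in M. (\<lambda>n. g n x) \<longlonglongrightarrow> 0"
  shows "(\<lambda>n. \<integral>x. \<bar>g n x\<bar> \<partial>M) \<longlonglongrightarrow> 0"
proof -
  have Qi: "integrable M (Q n)" and Ai: "integrable M A" for n using Q by (auto simp: tendsto_L1_def)
  note [measurable] = borel_measurable_integrable[OF Qi] borel_measurable_integrable[OF Ai]
  define D where "D n x = C * \<bar>Q n x - A x\<bar>" for n x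
  have Di: "integrable M (D n)" for n unfolding D_def using Qi Ai by auto
  note [measurable] = borel_measurable_integrable[OF Di]
  have Dlim: "(\<lambda>n. \<integral>x. D n x \<partial>M) \<longlonglongrightarrow> 0"
  proof -
    have "(\<lambda>n. C * (\<integral>x. \<bar>Q n x - A x\<bar> \<partial>M)) \<longlonglongrightarrow> C * 0"
      using Q by (intro tendsto_intros) (auto simp: tendsto_L1_def)
    then show ?thesis unfolding D_def by simp
  qed
  have D0: "0 \<le> D n x" for n x using C by (auto simp: D_def)
  have "(\<lambda>n. \<integral>x. max 0 (\<bar>g n x\<bar> - D n x) \<partial>M) \<longlonglongrightarrow> (\<integral>x. 0 \<partial>M)"
  proof (rule integral_dominated_convergence[where w="\<lambda>x. 2 * C * A x"])
    show "AE x in M. (\<lambda>n. max 0 (\<bar>g n x\<bar> - D n x)) \<longlonglongrightarrow> 0"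
      using lim
    proof eventually_elim
      case (elim x)
      have l: "(\<lambda>n. \<bar>g n x\<bar>) \<longlonglongrightarrow> 0" using elim by (rule tendsto_rabs_zero)
      show ?case
        by (rule tendsto_sandwich[OF _ _ tendsto_const l]) (use D0 in \<open>auto intro!: always_eventually simp: add_increasing2\<close>)
    qed
    show "AE x in M. norm (max 0 (\<bar>g n x\<bar> - D n x)) \<le> 2 * C * A x" for n
      using bound[of n] A
    proof eventually_elim
      case (elim x)
      have "C * (Q n x + A x) \<le> C * (\<bar>Q n x - A x\<bar> + 2 * A x)"
        using C by (intro mult_left_mono) auto
      then have "\<bar>g n x\<bar> - D n x \<le> 2 * C * A x"
        using elim by (simp add: D_def algebra_simps)
      moreover have "0 \<le> 2 * C * A x" using C elim by auto
      ultimately show ?case by auto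
    qed
  qed (use Ai in auto)
  then have lim2: "(\<lambda>n. (\<integral>x. max 0 (\<bar>g n x\<bar> - D n x) \<partial>M) + (\<integral>x. D n x \<partial>M)) \<longlonglongrightarrow> 0 + 0"
    by (intro tendsto_add Dlim) simp
  have gi: "integrable M (g n)" for n
    by (rule Bochner_Integration.integrable_bound[where f="\<lambda>x. C * (Q n x + A x)"])
      (use Qi Ai bound[of n] in \<open>auto elim!: eventually_mono\<close>)
  have le: "(\<integral>x. \<bar>g n x\<bar> \<partial>M) \<le> (\<integral>x. max 0 (\<bar>g n x\<bar> - D n x) \<partial>M) + (\<integral>x. D n x \<partial>M)" for n
  proof -
    have i: "integrable M (\<lambda>x. max 0 (\<bar>g n x\<bar> - D n x))"
      by (rule integrable_max) (use gi Di in auto)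
    have "(\<integral>x. \<bar>g n x\<bar> \<partial>M) \<le> (\<integral>x. max 0 (\<bar>g n x\<bar> - D n x) + D n x \<partial>M)"
      by (rule integral_mono) (use gi Di i in auto)
    then show ?thesis using i Di by simp
  qed
  show ?thesis
    by (rule LIMSEQ_squeeze_0[OF _ _ le]) (use lim2 in auto)
qed

text \<open>Pathwise convergence of \<open>g\<close> will be available only along subsequences,
  namely those on which quadratic sums converge almost surely; for convergence of the means this
  suffices.\<close>

lemma (in prob_space) integral_abs_tendsto_0_L1_dominated_subseq:
  assumes Q: "tendsto_L1 M Q A" and g: "\<And>n. g n \<in> borel_measurable M"
    and bound: "\<And>n. AE x in M. \<bar>g n x\<bar> \<le> C * (Q n x + A x)"
    and C: "C \<ge> 0" and A: "AE x in M. 0 \<le> A x"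
    and lim: "\<And>r::nat\<Rightarrow>nat. strict_mono r \<Longrightarrow>
      \<exists>r'::nat\<Rightarrow>nat. strict_mono r' \<and> (AE x in M. (\<lambda>n. g (r (r' n)) x) \<longlonglongrightarrow> 0)"
  shows "(\<lambda>n. \<integral>x. \<bar>g n x\<bar> \<partial>M) \<longlonglongrightarrow> 0"
proof (rule LIMSEQ_subsubseqI)
  fix r :: "nat \<Rightarrow> nat" assume r: "strict_mono r"
  from lim[OF r] obtain r' where r': "strict_mono r'" "AE x in M. (\<lambda>n. g (r (r' n)) x) \<longlonglongrightarrow> 0" by blast
  have Q': "tendsto_L1 M (\<lambda>n. Q (r (r' n))) A"
    using tendsto_L1_subseq[OF Q, of "r \<circ> r'"] r r' by (simp add: strict_mono_o)
  have "(\<lambda>n. \<integral>x. \<bar>g (r (r' n)) x\<bar> \<partial>M) \<longlonglongrightarrow> 0"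
    by (rule integral_abs_tendsto_0_L1_dominated[OF Q' g bound C A r'(2)])
  with r'(1) show "\<exists>r'. strict_mono r' \<and> ((\<lambda>n. \<integral>x. \<bar>g n x\<bar> \<partial>M) \<circ> r \<circ> r') \<longlonglongrightarrow> 0"
    by (intro exI[of _ r']) (simp add: comp_def)
qed

section \<open>Square integrable martingales and their quadratic variation\<close>

lemma partition_mono:
  fixes p :: "nat \<Rightarrow> 'a::order"
  assumes "\<And>i. i < n \<Longrightarrow> p i \<le> p (Suc i)" "i \<le> j" "j \<le> n"
  shows "p i \<le> p j"
  using assms(2,3)
proof (induction j rule: dec_induct)
  case (step k)
  then show ?case using order_trans[OF _ assms(1)[of k]] by simp
qed simp

section \<open>Square integrable functions\<close>

definition square_integrable :: "'a measure \<Rightarrow> ('a \<Rightarrow> real) \<Rightarrow> bool" where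
  "square_integrable M f \<longleftrightarrow> f \<in> borel_measurable M \<and> integrable M (\<lambda>x. (f x)\<^sup>2)"

lemma abs_mult_le_sum_squares: "\<bar>u * v\<bar> \<le> u\<^sup>2 + (v::real)\<^sup>2"
proof -
  have "2 * \<bar>u\<bar> * \<bar>v\<bar> \<le> u\<^sup>2 + v\<^sup>2" using sum_squares_bound[of "\<bar>u\<bar>" "\<bar>v\<bar>"] by simp
  moreover have "0 \<le> \<bar>u\<bar> * \<bar>v\<bar>" by simp
  ultimately show ?thesis unfolding abs_mult by linarith
qed

lemma square_integrable_mult:
  assumes "square_integrable M f" "square_integrable M g"
  shows "integrable M (\<lambda>x. f x * g x)"
proof (rule Bochner_Integration.integrable_bound[where f="\<lambda>x. (f x)\<^sup>2 + (g x)\<^sup>2"])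
  show "AE x in M. norm (f x * g x) \<le> norm ((f x)\<^sup>2 + (g x)\<^sup>2)"
    using abs_mult_le_sum_squares by (intro AE_I2) simp
qed (use assms in \<open>auto simp: square_integrable_def\<close>)

lemma square_integrable_add:
  assumes "square_integrable M f" "square_integrable M g"
  shows "square_integrable M (\<lambda>x. f x + g x)"
  using assms square_integrable_mult[OF assms]
  by (auto simp: square_integrable_def power2_sum mult.assoc)

lemma square_integrable_bounded_mult:
  fixes K :: real
  assumes "square_integrable M f" and [measurable]: "h \<in> borel_measurable M"
    and h: "\<And>x. x \<in> space M \<Longrightarrow> \<bar>h x\<bar> \<le> K"
  shows "square_integrable M (\<lambda>x. h x * f x)"
  unfolding square_integrable_def
proof (intro conjI)
  show "integrable M (\<lambda>x. (h x * f x)\<^sup>2)"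
  proof (rule Bochner_Integration.integrable_bound[where f="\<lambda>x. K\<^sup>2 * (f x)\<^sup>2"])
    show "AE x in M. norm ((h x * f x)\<^sup>2) \<le> norm (K\<^sup>2 * (f x)\<^sup>2)"
    proof (rule AE_I2)
      fix x assume "x \<in> space M"
      then have "(h x)\<^sup>2 \<le> K\<^sup>2" using power_mono[OF h, of x 2] by simp
      then show "norm ((h x * f x)\<^sup>2) \<le> norm (K\<^sup>2 * (f x)\<^sup>2)"
        by (simp add: power_mult_distrib mult_right_mono)
    qed
  qed (use assms in \<open>auto simp: square_integrable_def\<close>)
qed (use assms in \<open>auto simp: square_integrable_def\<close>)

lemma square_integrable_minus: "square_integrable M f \<Longrightarrow> square_integrable M (\<lambda>x. - f x)"
  by (simp add: square_integrable_def)

lemma square_integrable_diff: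
  assumes "square_integrable M f" "square_integrable M g"
  shows "square_integrable M (\<lambda>x. f x - g x)"
  using square_integrable_add[OF assms(1) square_integrable_minus[OF assms(2)]] by simp

lemma square_integrable_zero: "square_integrable M (\<lambda>x. 0)"
  by (simp add: square_integrable_def)

lemma (in finite_measure) square_integrable_bounded:
  fixes h :: "'a \<Rightarrow> real"
  assumes [measurable]: "h \<in> borel_measurable M" and "\<And>x. x \<in> space M \<Longrightarrow> \<bar>h x\<bar> \<le> K"
  shows "square_integrable M h"
  using square_integrable_bounded_mult[of M "\<lambda>x. 1" h K] assms by (simp add: square_integrable_def)

lemma (in finite_measure) square_integrable_imp_integrable':
  "square_integrable M f \<Longrightarrow> integrable M (f :: 'a \<Rightarrow> real)"
  unfolding square_integrable_def using square_integrable_imp_integrable by blast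

section \<open>The square truncated to linear growth\<close>

definition clip :: "real \<Rightarrow> real \<Rightarrow> real" where "clip K x = max (- K) (min K x)"

text \<open>Replaces the square on \<open>[-K, K]\<close> by a convex function of linear growth with derivative \<open>2 * clip K\<close>:
  the martingale transforms it generates are bounded in \<open>L\<^sup>2\<close>, hence uniformly integrable.\<close>

definition truncated_square :: "real \<Rightarrow> real \<Rightarrow> real" where
  "truncated_square K x = 2 * clip K x * x - (clip K x)\<^sup>2"

lemma abs_clip_le: "K \<ge> 0 \<Longrightarrow> \<bar>clip K x\<bar> \<le> K"
  by (auto simp: clip_def)

lemma truncated_square_bounds:
  assumes "K \<ge> 0"
  shows "0 \<le> truncated_square K x" "truncated_square K x \<le> x\<^sup>2"
proof -
  have "x\<^sup>2 - truncated_square K x = (x - clip K x)\<^sup>2"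
    by (simp add: truncated_square_def power2_diff)
  then show "truncated_square K x \<le> x\<^sup>2" by (metis diff_ge_0_iff_ge zero_le_power2)
  have "0 \<le> clip K x * (x - clip K x)"
    using assms mult_nonneg_nonpos[of K "x + K"]
    by (auto simp: clip_def max_def min_def mult_nonneg_nonneg mult_nonpos_nonpos)
  moreover have "truncated_square K x = 2 * (clip K x * (x - clip K x)) + (clip K x)\<^sup>2"
    by (simp add: truncated_square_def algebra_simps power2_eq_square)
  ultimately show "0 \<le> truncated_square K x" by simp
qed

text \<open>The derivative \<open>2 * clip K\<close> is Lipschitz with constant 2, so the second
  order remainder is at most the square. In the algebra, the gap is the square of the increment of
  \<open>x - clip K x\<close> minus twice a product; the product is nonpositive because
  \<open>x - clip K x\<close> vanishes unless \<open>clip K x\<close> is already extremal on the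
  side of \<open>x\<close>.\<close>

lemma truncated_square_taylor:
  assumes "K \<ge> 0"
  shows "truncated_square K y - truncated_square K x - 2 * clip K x * (y - x) \<le> (y - x)\<^sup>2"
proof -
  have "(clip K y - clip K x) * (x - clip K x) \<le> 0"
    using assms by (auto simp: clip_def max_def min_def mult_nonneg_nonpos mult_nonpos_nonneg)
  moreover have "(y - x)\<^sup>2 - (truncated_square K y - truncated_square K x - 2 * clip K x * (y - x))
      = ((y - clip K y) - (x - clip K x))\<^sup>2 - 2 * ((clip K y - clip K x) * (x - clip K x))"
    by (simp add: truncated_square_def algebra_simps power2_eq_square)
  moreover have "0 \<le> ((y - clip K y) - (x - clip K x))\<^sup>2" by simp
  ultimately show ?thesis by linarith
qed

lemma borel_measurable_clip[measurable]: "clip K \<in> borel_measurable borel"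
  unfolding clip_def by measurable

lemma borel_measurable_truncated_square[measurable]: "truncated_square K \<in> borel_measurable borel"
  unfolding truncated_square_def by measurable

section \<open>Square integrable martingales along partitions\<close>

locale L2_martingale = prob_space P for P :: "'a measure" +
  fixes F :: "real \<Rightarrow> 'a measure" and T :: real and Y :: "real \<Rightarrow> 'a \<Rightarrow> real"
  assumes subalg: "subalgebra P (F t)"
    and filtration: "s \<le> t \<Longrightarrow> subalgebra (F t) (F s)"
    and mart: "square_integrable_martingale_on P F T Y"
begin

lemma measurable_F: "f \<in> borel_measurable (F t) \<Longrightarrow> f \<in> borel_measurable P"
  using measurable_from_subalg[OF subalg] by blast

lemma measurable_F_mono: "s \<le> t \<Longrightarrow> f \<in> borel_measurable (F s) \<Longrightarrow> f \<in> borel_measurable (F t)"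
  using measurable_from_subalg[OF filtration] by blast

lemma adapted: "t \<in> {0..T} \<Longrightarrow> Y t \<in> borel_measurable (F t)"
  using mart by (auto simp: square_integrable_martingale_on_def martingale_on_def)

lemma square_integrable_Y: "t \<in> {0..T} \<Longrightarrow> square_integrable P (Y t)"
  using mart measurable_F[OF adapted]
  by (auto simp: square_integrable_martingale_on_def martingale_on_def square_integrable_def)

text \<open>\<open>h\<close> is pulled out of the conditional expectation of \<open>Y t\<close>
  given \<open>F s\<close>; square integrability of both factors makes the products integrable. From
  here on the martingale property of \<open>Y\<close> is used in this form.\<close>

lemma martingale_orthogonal:
  assumes st: "0 \<le> s" "s \<le> t" "t \<le> T"
    and h: "h \<in> borel_measurable (F s)" "square_integrable P h"
  shows "(\<integral>\<omega>. h \<omega> * (Y t \<omega> - Y s \<omega>) \<partial>P) = 0"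
proof -
  interpret finite_measure_subalgebra P "F s"
    by unfold_locales (rule subalg)
  have Yt: "square_integrable P (Y t)" and Ys: "square_integrable P (Y s)"
    using st by (auto intro!: square_integrable_Y)
  have i: "integrable P (\<lambda>\<omega>. h \<omega> * Y t \<omega>)" "integrable P (\<lambda>\<omega>. h \<omega> * Y s \<omega>)"
    using h Yt Ys by (auto intro!: square_integrable_mult)
  have m: "Y t \<in> borel_measurable P" using Yt by (simp add: square_integrable_def)
  have ae: "AE \<omega> in P. real_cond_exp P (F s) (Y t) \<omega> = Y s \<omega>"
    using mart st by (auto simp: square_integrable_martingale_on_def martingale_on_def)
  have hm: "h \<in> borel_measurable P" "Y s \<in> borel_measurable P"
    using h Ys by (auto simp: square_integrable_def)
  have "(\<integral>\<omega>. h \<omega> * Y t \<omega> \<partial>P) = (\<integral>\<omega>. h \<omega> * real_cond_exp P (F s) (Y t) \<omega> \<partial>P)"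
    using real_cond_exp_intg(2)[OF i(1) h(1) m] by simp
  also have "\<dots> = (\<integral>\<omega>. h \<omega> * Y s \<omega> \<partial>P)"
    using ae hm by (intro integral_cong_AE) auto
  finally show ?thesis using i by (simp add: right_diff_distrib)
qed

text \<open>Expanding the square leaves the cross term \<open>h * Y s * (Y t - Y s)\<close>, which
  has mean 0 since \<open>h * Y s\<close> is known at time \<open>s\<close>; boundedness of
  \<open>h\<close> keeps \<open>h * Y s\<close> square integrable.\<close>

lemma martingale_square_increment:
  assumes st: "0 \<le> s" "s \<le> t" "t \<le> T"
    and h: "h \<in> borel_measurable (F s)" "\<And>\<omega>. \<omega> \<in> space P \<Longrightarrow> \<bar>h \<omega>\<bar> \<le> K"
  shows "(\<integral>\<omega>. h \<omega> * (Y t \<omega> - Y s \<omega>)\<^sup>2 \<partial>P) = (\<integral>\<omega>. h \<omega> * (Y t \<omega>)\<^sup>2 \<partial>P) - (\<integral>\<omega>. h \<omega> * (Y s \<omega>)\<^sup>2 \<partial>P)"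
    and "integrable P (\<lambda>\<omega>. h \<omega> * (Y t \<omega>)\<^sup>2)" "integrable P (\<lambda>\<omega>. h \<omega> * (Y t \<omega> - Y s \<omega>)\<^sup>2)"
proof -
  have Y: "square_integrable P (Y t)" "square_integrable P (Y s)" using st by (auto intro!: square_integrable_Y)
  have hm[measurable]: "h \<in> borel_measurable P" by (rule measurable_F[OF h(1)])
  have hb: "square_integrable P (\<lambda>\<omega>. h \<omega> * f \<omega>)" if "square_integrable P f" for f
    by (rule square_integrable_bounded_mult[OF that hm h(2)])
  have i: "integrable P (\<lambda>\<omega>. h \<omega> * (f \<omega>)\<^sup>2)" if "square_integrable P f" for f
    using square_integrable_mult[OF hb[OF that] that] by (simp add: power2_eq_square mult.assoc)
  have "(\<integral>\<omega>. h \<omega> * (Y t \<omega> - Y s \<omega>)\<^sup>2 \<partial>P)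
      = (\<integral>\<omega>. h \<omega> * (Y t \<omega>)\<^sup>2 - h \<omega> * (Y s \<omega>)\<^sup>2 - 2 * ((h \<omega> * Y s \<omega>) * (Y t \<omega> - Y s \<omega>)) \<partial>P)"
    by (intro Bochner_Integration.integral_cong) (auto simp: power2_eq_square algebra_simps)
  also have "\<dots> = (\<integral>\<omega>. h \<omega> * (Y t \<omega>)\<^sup>2 \<partial>P) - (\<integral>\<omega>. h \<omega> * (Y s \<omega>)\<^sup>2 \<partial>P)
      - 2 * (\<integral>\<omega>. (h \<omega> * Y s \<omega>) * (Y t \<omega> - Y s \<omega>) \<partial>P)"
    using i[OF Y(1)] i[OF Y(2)] square_integrable_mult[OF hb[OF Y(2)] square_integrable_diff[OF Y]] by simp
  also have "(\<integral>\<omega>. (h \<omega> * Y s \<omega>) * (Y t \<omega> - Y s \<omega>) \<partial>P) = 0"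
    using st by (intro martingale_orthogonal hb Y borel_measurable_times h adapted) auto
  finally show "(\<integral>\<omega>. h \<omega> * (Y t \<omega> - Y s \<omega>)\<^sup>2 \<partial>P) = (\<integral>\<omega>. h \<omega> * (Y t \<omega>)\<^sup>2 \<partial>P) - (\<integral>\<omega>. h \<omega> * (Y s \<omega>)\<^sup>2 \<partial>P)"
    by simp
  show "integrable P (\<lambda>\<omega>. h \<omega> * (Y t \<omega>)\<^sup>2)" "integrable P (\<lambda>\<omega>. h \<omega> * (Y t \<omega> - Y s \<omega>)\<^sup>2)"
    by (rule i[OF Y(1)], rule i[OF square_integrable_diff[OF Y]])
qed

lemmas martingale_square_increment_1 =
  martingale_square_increment[where h="\<lambda>_. 1" and K=1, simplified]

text \<open>Ito's isometry for a simple integrand, as an inequality: the next increment is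
  orthogonal to the sum so far, and \<open>H\<close> is bounded by \<open>K\<close>. Adaptedness,
  square integrability and \<open>p 0 \<le> p n\<close> belong to the claim because the induction
  step uses them.\<close>

lemma martingale_transform:
  assumes p: "0 \<le> p 0" "p n \<le> T" "\<And>i. i < n \<Longrightarrow> p i \<le> p (Suc i)"
    and H: "\<And>i. i < n \<Longrightarrow> H i \<in> borel_measurable (F (p i))"
      "\<And>i \<omega>. i < n \<Longrightarrow> \<omega> \<in> space P \<Longrightarrow> \<bar>H i \<omega>\<bar> \<le> K"
  shows "(\<lambda>\<omega>. \<Sum>i<n. H i \<omega> * (Y (p (Suc i)) \<omega> - Y (p i) \<omega>)) \<in> borel_measurable (F (p n)) \<and>
    square_integrable P (\<lambda>\<omega>. \<Sum>i<n. H i \<omega> * (Y (p (Suc i)) \<omega> - Y (p i) \<omega>)) \<and>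
    (\<integral>\<omega>. (\<Sum>i<n. H i \<omega> * (Y (p (Suc i)) \<omega> - Y (p i) \<omega>)) \<partial>P) = 0 \<and>
    (\<integral>\<omega>. (\<Sum>i<n. H i \<omega> * (Y (p (Suc i)) \<omega> - Y (p i) \<omega>))\<^sup>2 \<partial>P)
      \<le> K\<^sup>2 * ((\<integral>\<omega>. (Y (p n) \<omega>)\<^sup>2 \<partial>P) - (\<integral>\<omega>. (Y (p 0) \<omega>)\<^sup>2 \<partial>P)) \<and> p 0 \<le> p n"
  using p H
proof (induction n)
  case 0
  then show ?case by (simp add: square_integrable_zero)
next
  case (Suc n)
  define N where "N \<omega> = (\<Sum>i<n. H i \<omega> * (Y (p (Suc i)) \<omega> - Y (p i) \<omega>))" for \<omega>
  have pn: "p n \<le> p (Suc n)" "p (Suc n) \<le> T" using Suc.prems by auto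
  have IH: "N \<in> borel_measurable (F (p n))" "square_integrable P N" "(\<integral>\<omega>. N \<omega> \<partial>P) = 0"
    "(\<integral>\<omega>. (N \<omega>)\<^sup>2 \<partial>P) \<le> K\<^sup>2 * ((\<integral>\<omega>. (Y (p n) \<omega>)\<^sup>2 \<partial>P) - (\<integral>\<omega>. (Y (p 0) \<omega>)\<^sup>2 \<partial>P))"
    and p0: "p 0 \<le> p n"
    using Suc.IH pn Suc.prems unfolding N_def by auto
  have pn0: "0 \<le> p n" using p0 Suc.prems by simp
  define d where "d \<omega> = Y (p (Suc n)) \<omega> - Y (p n) \<omega>" for \<omega>
  have Y: "square_integrable P (Y (p (Suc n)))" "square_integrable P (Y (p n))"
    using pn pn0 by (auto intro!: square_integrable_Y)
  have d: "square_integrable P d" unfolding d_def by (rule square_integrable_diff[OF Y])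
  have Hm: "H n \<in> borel_measurable (F (p n))" "\<And>\<omega>. \<omega> \<in> space P \<Longrightarrow> \<bar>H n \<omega>\<bar> \<le> K"
    using Suc.prems by auto
  have HP: "H n \<in> borel_measurable P" by (rule measurable_F[OF Hm(1)])
  have Hd: "square_integrable P (\<lambda>\<omega>. H n \<omega> * d \<omega>)" and HN: "square_integrable P (\<lambda>\<omega>. H n \<omega> * N \<omega>)"
    by (rule square_integrable_bounded_mult[OF _ HP Hm(2)], fact d, assumption,
        rule square_integrable_bounded_mult[OF _ HP Hm(2)], fact IH, assumption)
  have Hs: "square_integrable P (H n)" by (rule square_integrable_bounded[OF HP Hm(2)])
  have eq: "(\<Sum>i<Suc n. H i \<omega> * (Y (p (Suc i)) \<omega> - Y (p i) \<omega>)) = N \<omega> + H n \<omega> * d \<omega>" for \<omega>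
    by (simp add: N_def d_def)
  have z1: "(\<integral>\<omega>. H n \<omega> * d \<omega> \<partial>P) = 0"
    unfolding d_def by (rule martingale_orthogonal[OF pn0 pn Hm(1) Hs])
  have z2: "(\<integral>\<omega>. (H n \<omega> * N \<omega>) * d \<omega> \<partial>P) = 0"
    unfolding d_def by (rule martingale_orthogonal[OF pn0 pn _ HN]) (intro borel_measurable_times Hm IH)
  have "(\<integral>\<omega>. (N \<omega> + H n \<omega> * d \<omega>)\<^sup>2 \<partial>P) =
      (\<integral>\<omega>. (N \<omega>)\<^sup>2 + (H n \<omega> * d \<omega>)\<^sup>2 + 2 * ((H n \<omega> * N \<omega>) * d \<omega>) \<partial>P)"
    by (intro Bochner_Integration.integral_cong) (auto simp: power2_eq_square algebra_simps)
  also have "\<dots> = (\<integral>\<omega>. (N \<omega>)\<^sup>2 \<partial>P) + (\<integral>\<omega>. (H n \<omega> * d \<omega>)\<^sup>2 \<partial>P)"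
    using IH(2) Hd square_integrable_mult[OF HN d] z2 by (simp add: square_integrable_def)
  also have "(\<integral>\<omega>. (H n \<omega> * d \<omega>)\<^sup>2 \<partial>P) \<le> (\<integral>\<omega>. K\<^sup>2 * (d \<omega>)\<^sup>2 \<partial>P)"
  proof (rule integral_mono)
    fix \<omega> assume "\<omega> \<in> space P"
    then have "(H n \<omega>)\<^sup>2 \<le> K\<^sup>2" using power_mono[OF Hm(2), of \<omega> 2] by simp
    then show "(H n \<omega> * d \<omega>)\<^sup>2 \<le> K\<^sup>2 * (d \<omega>)\<^sup>2"
      by (simp add: power_mult_distrib mult_right_mono)
  qed (use Hd d in \<open>auto simp: square_integrable_def\<close>)
  also have "\<dots> = K\<^sup>2 * ((\<integral>\<omega>. (Y (p (Suc n)) \<omega>)\<^sup>2 \<partial>P) - (\<integral>\<omega>. (Y (p n) \<omega>)\<^sup>2 \<partial>P))"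
    using martingale_square_increment_1(1)[OF pn0 pn] by (simp add: d_def)
  finally have sq: "(\<integral>\<omega>. (N \<omega> + H n \<omega> * d \<omega>)\<^sup>2 \<partial>P)
      \<le> K\<^sup>2 * ((\<integral>\<omega>. (Y (p (Suc n)) \<omega>)\<^sup>2 \<partial>P) - (\<integral>\<omega>. (Y (p 0) \<omega>)\<^sup>2 \<partial>P))"
    using IH(4) by (simp add: algebra_simps)
  have mean: "(\<integral>\<omega>. N \<omega> + H n \<omega> * d \<omega> \<partial>P) = 0"
    using IH(3) z1 square_integrable_imp_integrable'[OF IH(2)] square_integrable_imp_integrable'[OF Hd] by simp
  have "d \<in> borel_measurable (F (p (Suc n)))"
    unfolding d_def using pn pn0
    by (intro borel_measurable_diff adapted measurable_F_mono[OF pn(1)]) auto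
  then have "(\<lambda>\<omega>. N \<omega> + H n \<omega> * d \<omega>) \<in> borel_measurable (F (p (Suc n)))"
    using measurable_F_mono[OF pn(1) IH(1)] measurable_F_mono[OF pn(1) Hm(1)] by simp
  then show ?case
    unfolding eq using sq mean square_integrable_add[OF IH(2) Hd] p0 pn by simp
qed

definition qsum :: "(nat \<Rightarrow> real) \<Rightarrow> nat \<Rightarrow> 'a \<Rightarrow> real" where
  "qsum p n \<omega> = (\<Sum>i<n. (Y (p (Suc i)) \<omega> - Y (p i) \<omega>)\<^sup>2)"

text \<open>Each squared increment contributes a difference of second moments, and these telescope,
  so the value depends on the end points only. The weight \<open>h\<close>, known at the first
  point, makes this an identity between conditional expectations given
  \<open>F (p 0)\<close>.\<close>

lemma qsum_expectation:
  assumes p: "0 \<le> p 0" "p n \<le> T" "\<And>i. i < n \<Longrightarrow> p i \<le> p (Suc i)"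
    and h: "h \<in> borel_measurable (F (p 0))" "\<And>\<omega>. \<omega> \<in> space P \<Longrightarrow> \<bar>h \<omega>\<bar> \<le> K"
  shows "integrable P (\<lambda>\<omega>. h \<omega> * qsum p n \<omega>) \<and>
    (\<integral>\<omega>. h \<omega> * qsum p n \<omega> \<partial>P) = (\<integral>\<omega>. h \<omega> * (Y (p n) \<omega>)\<^sup>2 \<partial>P) - (\<integral>\<omega>. h \<omega> * (Y (p 0) \<omega>)\<^sup>2 \<partial>P) \<and> p 0 \<le> p n"
  using p
proof (induction n)
  case 0
  then show ?case by (simp add: qsum_def)
next
  case (Suc n)
  then have IH: "integrable P (\<lambda>\<omega>. h \<omega> * qsum p n \<omega>)"
    "(\<integral>\<omega>. h \<omega> * qsum p n \<omega> \<partial>P) = (\<integral>\<omega>. h \<omega> * (Y (p n) \<omega>)\<^sup>2 \<partial>P) - (\<integral>\<omega>. h \<omega> * (Y (p 0) \<omega>)\<^sup>2 \<partial>P)"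
    and p0: "p 0 \<le> p n"
    using order_trans[of "p n" "p (Suc n)" T] by auto
  have pn: "0 \<le> p n" "p n \<le> p (Suc n)" "p (Suc n) \<le> T" using Suc.prems p0 by auto
  note m = martingale_square_increment[OF pn measurable_F_mono[OF p0 h(1)] h(2)]
  show ?case
    using IH m p0 pn by (simp add: qsum_def distrib_left)
qed

lemmas qsum_expectation_1 = qsum_expectation[where h="\<lambda>_. 1" and K=1, simplified]

lemma measurable_qsum:
  assumes "0 \<le> p 0" "p n \<le> T" "\<And>i. i < n \<Longrightarrow> p i \<le> p (Suc i)"
  shows "qsum p n \<in> borel_measurable P"
  using qsum_expectation_1[of p n] assms by auto

text \<open>Telescoping the truncated square along the partition gives
  \<open>R k \<le> qsum (p k) (n k)\<close>, where \<open>R k\<close> is the increment of the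
  truncated square minus a martingale transform. The transform has mean 0 and is bounded in
  \<open>L\<^sup>2\<close>, so the excess of \<open>R k\<close> over \<open>A\<close> tends to 0 in
  mean; afterwards \<open>K\<close> tends to infinity.\<close>

lemma quadratic_variation_expectation_ge:
  fixes p :: "nat \<Rightarrow> nat \<Rightarrow> real" and n :: "nat \<Rightarrow> nat"
  assumes a: "0 \<le> a" "t \<le> T"
    and p: "\<And>k. p k 0 = a" "\<And>k. p k (n k) = t" "\<And>k i. i < n k \<Longrightarrow> p k i \<le> p k (Suc i)"
    and A: "integrable P A" "AE \<omega> in P. 0 \<le> A \<omega>"
    and lim: "tendsto_prob P (\<lambda>k. qsum (p k) (n k)) A"
  shows "(\<integral>\<omega>. (Y t \<omega>)\<^sup>2 \<partial>P) - (\<integral>\<omega>. (Y a \<omega>)\<^sup>2 \<partial>P) \<le> (\<integral>\<omega>. A \<omega> \<partial>P)"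
proof -
  note [measurable] = borel_measurable_integrable[OF A(1)]
  have pk: "0 \<le> p k 0" "p k (n k) \<le> T" "\<And>i. i < n k \<Longrightarrow> p k i \<le> p k (Suc i)" for k
    using p a by auto
  have Qm[measurable]: "qsum (p k) (n k) \<in> borel_measurable P" for k
    by (rule measurable_qsum[OF pk])
  have at: "a \<le> t" using qsum_expectation_1[of "p 0" "n 0"] a p by simp
  have Ysq: "square_integrable P (Y t)" "square_integrable P (Y a)"
    using a at by (auto intro!: square_integrable_Y)
  then have [measurable]: "Y t \<in> borel_measurable P" "Y a \<in> borel_measurable P"
    by (auto simp: square_integrable_def)
  define c where "c = (\<integral>\<omega>. (Y t \<omega>)\<^sup>2 \<partial>P) - (\<integral>\<omega>. (Y a \<omega>)\<^sup>2 \<partial>P)"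
  have main: "(\<integral>\<omega>. truncated_square K (Y t \<omega>) \<partial>P) - (\<integral>\<omega>. truncated_square K (Y a \<omega>) \<partial>P) \<le> (\<integral>\<omega>. A \<omega> \<partial>P)"
    if K: "K \<ge> 0" for K
  proof -
    have gi: "integrable P (\<lambda>\<omega>. truncated_square K (Y s \<omega>))" if "square_integrable P (Y s)" for s
      by (rule Bochner_Integration.integrable_bound[where f="\<lambda>\<omega>. (Y s \<omega>)\<^sup>2"])
        (use that truncated_square_bounds[OF K] in \<open>auto simp: square_integrable_def\<close>)
    define N where "N k \<omega> = (\<Sum>i<n k. (2 * clip K (Y (p k i) \<omega>)) * (Y (p k (Suc i)) \<omega> - Y (p k i) \<omega>))" for k \<omega>
    have pki: "0 \<le> p k i" "p k i \<le> T" if "i \<le> n k" for k i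
    proof -
      have "p k 0 \<le> p k i" "p k i \<le> p k (n k)"
        using that by (auto intro!: partition_mono[where n="n k"] p(3))
      then show "0 \<le> p k i" "p k i \<le> T" using pk[of k] by auto
    qed
    have trans: "square_integrable P (N k) \<and> (\<integral>\<omega>. N k \<omega> \<partial>P) = 0 \<and> (\<integral>\<omega>. (N k \<omega>)\<^sup>2 \<partial>P) \<le> (2*K)\<^sup>2 * c" for k
    proof -
      have 1: "(\<lambda>\<omega>. 2 * clip K (Y (p k i) \<omega>)) \<in> borel_measurable (F (p k i))" if "i < n k" for i
        using measurable_compose[OF adapted borel_measurable_clip[of K]] pki[of i k] that by simp
      have 2: "\<bar>2 * clip K (Y (p k i) \<omega>)\<bar> \<le> 2 * K" for i \<omega>
        using abs_clip_le[OF K] by (simp add: abs_mult)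
      have "0 \<le> p k 0" "p k (n k) \<le> T" "\<And>i. i < n k \<Longrightarrow> p k i \<le> p k (Suc i)" using p a by auto
      from martingale_transform[where p="p k" and n="n k", OF this 1 2]
      show ?thesis unfolding N_def c_def using p by simp
    qed
    have Nm[measurable]: "N k \<in> borel_measurable P" for k using trans by (simp add: square_integrable_def)
    define R where "R k \<omega> = truncated_square K (Y t \<omega>) - truncated_square K (Y a \<omega>) - N k \<omega>" for k \<omega>
    have Ri: "integrable P (R k)" and RE: "(\<integral>\<omega>. R k \<omega> \<partial>P) =
       (\<integral>\<omega>. truncated_square K (Y t \<omega>) \<partial>P) - (\<integral>\<omega>. truncated_square K (Y a \<omega>) \<partial>P)" for k
      unfolding R_def using gi[OF Ysq(1)] gi[OF Ysq(2)] trans[of k] square_integrable_imp_integrable'[of "N k"] by auto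
    have RQ: "R k \<omega> \<le> qsum (p k) (n k) \<omega>" for k \<omega>
    proof -
      have "truncated_square K (Y t \<omega>) - truncated_square K (Y a \<omega>) =
          (\<Sum>i<n k. truncated_square K (Y (p k (Suc i)) \<omega>) - truncated_square K (Y (p k i) \<omega>))"
        using sum_lessThan_telescope[of "\<lambda>i. truncated_square K (Y (p k i) \<omega>)" "n k"] p by simp
      then have "R k \<omega> = (\<Sum>i<n k. truncated_square K (Y (p k (Suc i)) \<omega>) - truncated_square K (Y (p k i) \<omega>)
           - 2 * clip K (Y (p k i) \<omega>) * (Y (p k (Suc i)) \<omega> - Y (p k i) \<omega>))"
        by (simp add: R_def N_def sum_subtractf)
      also have "\<dots> \<le> qsum (p k) (n k) \<omega>"
        unfolding qsum_def by (intro sum_mono truncated_square_taylor K)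
      finally show ?thesis .
    qed
    \<comment> \<open>\<open>A\<close> is nonnegative only almost surely, while the majorant of
      \<open>h\<close> is required at every point of the space; hence
      \<open>max 0 (A \<omega>)\<close>.\<close>
    define h where "h k \<omega> = max 0 (R k \<omega> - max 0 (A \<omega>))" for k \<omega>
    note [measurable] = borel_measurable_integrable[OF Ri]
    have hm[measurable]: "h k \<in> borel_measurable P" for k unfolding h_def by measurable
    have hlim: "(\<lambda>k. \<integral>\<omega>. h k \<omega> \<partial>P) \<longlonglongrightarrow> 0"
    proof (rule integral_tendsto_0_L2_bound)
      show "integrable P (\<lambda>\<omega>. truncated_square K (Y t \<omega>) + truncated_square K (Y a \<omega>))"
        using gi[OF Ysq(1)] gi[OF Ysq(2)] by simp
      show "0 \<le> truncated_square K (Y t \<omega>) + truncated_square K (Y a \<omega>)" for \<omega>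
        using truncated_square_bounds[OF K] by simp
      show "h k \<omega> \<le> truncated_square K (Y t \<omega>) + truncated_square K (Y a \<omega>) + \<bar>N k \<omega>\<bar>" for k \<omega>
        using truncated_square_bounds(1)[OF K, of "Y t \<omega>"] truncated_square_bounds(1)[OF K, of "Y a \<omega>"]
        by (auto simp: h_def R_def)
      show "integrable P (\<lambda>\<omega>. (N k \<omega>)\<^sup>2)" "(\<integral>\<omega>. (N k \<omega>)\<^sup>2 \<partial>P) \<le> (2*K)\<^sup>2 * c" for k
        using trans[of k] by (auto simp: square_integrable_def)
      show "(\<lambda>k. measure P {\<omega>\<in>space P. h k \<omega> > \<epsilon>}) \<longlonglongrightarrow> 0" if "\<epsilon> > 0" for \<epsilon>
      proof (rule tendsto_prob_measure_le[OF lim _ _ _ that])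
        show "h k \<omega> \<le> \<bar>qsum (p k) (n k) \<omega> - A \<omega>\<bar>" for k \<omega>
          using RQ[of k \<omega>] by (auto simp: h_def)
      qed auto
    qed (auto simp: h_def)
    have "(\<integral>\<omega>. truncated_square K (Y t \<omega>) \<partial>P) - (\<integral>\<omega>. truncated_square K (Y a \<omega>) \<partial>P) \<le> (\<integral>\<omega>. A \<omega> \<partial>P) + (\<integral>\<omega>. h k \<omega> \<partial>P)" for k
    proof -
      have hi: "integrable P (h k)" unfolding h_def
        by (intro integrable_max Bochner_Integration.integrable_diff Ri A) auto
      have "(\<integral>\<omega>. R k \<omega> \<partial>P) \<le> (\<integral>\<omega>. A \<omega> + h k \<omega> \<partial>P)"
        using A(2) by (intro integral_mono_AE Ri Bochner_Integration.integrable_add A hi) (auto simp: h_def elim!: eventually_mono)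
      then show ?thesis using RE[of k] A(1) hi by simp
    qed
    moreover have "(\<lambda>k. (\<integral>\<omega>. A \<omega> \<partial>P) + (\<integral>\<omega>. h k \<omega> \<partial>P)) \<longlonglongrightarrow> (\<integral>\<omega>. A \<omega> \<partial>P) + 0"
      by (intro tendsto_intros hlim)
    ultimately show ?thesis
      by (intro tendsto_lowerbound[of _ "(\<integral>\<omega>. A \<omega> \<partial>P)" sequentially]) auto
  qed
  have lim2: "(\<lambda>k. \<integral>\<omega>. truncated_square (real k) (Y s \<omega>) \<partial>P) \<longlonglongrightarrow> (\<integral>\<omega>. (Y s \<omega>)\<^sup>2 \<partial>P)"
    if "square_integrable P (Y s)" for s
  proof (rule integral_dominated_convergence[where w="\<lambda>\<omega>. (Y s \<omega>)\<^sup>2"])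
    show "AE \<omega> in P. (\<lambda>k. truncated_square (real k) (Y s \<omega>)) \<longlonglongrightarrow> (Y s \<omega>)\<^sup>2"
    proof (rule AE_I2, rule tendsto_eventually)
      fix \<omega>
      obtain N :: nat where "\<bar>Y s \<omega>\<bar> < N" using reals_Archimedean2 by blast
      then show "\<forall>\<^sub>F k in sequentially. truncated_square (real k) (Y s \<omega>) = (Y s \<omega>)\<^sup>2"
        by (intro eventually_sequentiallyI[of N]) (auto simp: truncated_square_def clip_def power2_eq_square)
    qed
  qed (use that truncated_square_bounds in \<open>auto simp: square_integrable_def\<close>)
  have "(\<lambda>k. (\<integral>\<omega>. truncated_square (real k) (Y t \<omega>) \<partial>P) - (\<integral>\<omega>. truncated_square (real k) (Y a \<omega>) \<partial>P))
     \<longlonglongrightarrow> (\<integral>\<omega>. (Y t \<omega>)\<^sup>2 \<partial>P) - (\<integral>\<omega>. (Y a \<omega>)\<^sup>2 \<partial>P)"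
    by (intro tendsto_diff lim2 Ysq)
  then show ?thesis by (rule LIMSEQ_le_const2) (use main in auto)
qed

text \<open>All the sums have the same expectation \<open>c\<close>. The two inequalities identify
  \<open>c\<close> with the mean of \<open>A\<close>, and this equality of expectations upgrades
  convergence in probability by Scheffe's argument.\<close>

lemma quadratic_variation_tendsto_L1:
  fixes p :: "nat \<Rightarrow> nat \<Rightarrow> real" and n :: "nat \<Rightarrow> nat"
  assumes a: "0 \<le> a" "t \<le> T"
    and p: "\<And>k. p k 0 = a" "\<And>k. p k (n k) = t" "\<And>k i. i < n k \<Longrightarrow> p k i \<le> p k (Suc i)"
    and A[measurable]: "A \<in> borel_measurable P" and A0: "AE \<omega> in P. 0 \<le> A \<omega>"
    and lim: "tendsto_prob P (\<lambda>k. qsum (p k) (n k)) A"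
  shows "tendsto_L1 P (\<lambda>k. qsum (p k) (n k)) A"
    and "(\<integral>\<omega>. A \<omega> \<partial>P) = (\<integral>\<omega>. (Y t \<omega>)\<^sup>2 \<partial>P) - (\<integral>\<omega>. (Y a \<omega>)\<^sup>2 \<partial>P)"
proof -
  have pk: "0 \<le> p k 0" "p k (n k) \<le> T" "\<And>i. i < n k \<Longrightarrow> p k i \<le> p k (Suc i)" for k
    using p a by auto
  have Qm[measurable]: "qsum (p k) (n k) \<in> borel_measurable P" for k
    by (rule measurable_qsum[OF pk])
  define c where "c = (\<integral>\<omega>. (Y t \<omega>)\<^sup>2 \<partial>P) - (\<integral>\<omega>. (Y a \<omega>)\<^sup>2 \<partial>P)"
  have Qi: "integrable P (qsum (p k) (n k))" and QE: "(\<integral>\<omega>. qsum (p k) (n k) \<omega> \<partial>P) = c" for k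
    using qsum_expectation_1[of "p k" "n k"] a p by (auto simp: c_def)
  have Q0: "0 \<le> qsum (p k) (n k) \<omega>" for k \<omega> by (auto simp: qsum_def intro!: sum_nonneg)
  have c0: "0 \<le> c" unfolding QE[of 0, symmetric] by (intro Bochner_Integration.integral_nonneg Q0)
  obtain r :: "nat \<Rightarrow> nat" where r: "strict_mono r" "AE \<omega> in P. (\<lambda>k. qsum (p (r k)) (n (r k)) \<omega>) \<longlonglongrightarrow> A \<omega>"
    using tendsto_prob_AE_subseq[OF lim] by auto
  have "AE \<omega> in P. ennreal (A \<omega>) = liminf (\<lambda>k. ennreal (qsum (p (r k)) (n (r k)) \<omega>))"
    using r(2)
  proof eventually_elim
    case (elim \<omega>)
    then have "(\<lambda>k. ennreal (qsum (p (r k)) (n (r k)) \<omega>)) \<longlonglongrightarrow> ennreal (A \<omega>)"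
      by (rule tendsto_ennrealI)
    then show ?case by (intro lim_imp_Liminf[symmetric]) auto
  qed
  then have "(\<integral>\<^sup>+\<omega>. ennreal (A \<omega>) \<partial>P) = (\<integral>\<^sup>+\<omega>. liminf (\<lambda>k. ennreal (qsum (p (r k)) (n (r k)) \<omega>)) \<partial>P)"
    by (rule nn_integral_cong_AE)
  also have "\<dots> \<le> liminf (\<lambda>k. \<integral>\<^sup>+\<omega>. ennreal (qsum (p (r k)) (n (r k)) \<omega>) \<partial>P)"
    by (rule nn_integral_liminf) auto
  also have "\<dots> = ennreal c"
    using Qi QE Q0 by (simp add: nn_integral_eq_integral Liminf_const)
  finally have le: "(\<integral>\<^sup>+\<omega>. ennreal (A \<omega>) \<partial>P) \<le> ennreal c" .
  have Ai: "integrable P A"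
  proof (rule integrableI_nonneg[OF A A0])
    show "(\<integral>\<^sup>+\<omega>. ennreal (A \<omega>) \<partial>P) < \<infinity>" using le by (rule le_less_trans) simp
  qed
  have "ennreal (\<integral>\<omega>. A \<omega> \<partial>P) \<le> ennreal c"
    using le nn_integral_eq_integral[OF Ai A0] by simp
  then have 1: "(\<integral>\<omega>. A \<omega> \<partial>P) \<le> c" using c0 by simp
  have 2: "c \<le> (\<integral>\<omega>. A \<omega> \<partial>P)"
    unfolding c_def by (rule quadratic_variation_expectation_ge[OF a p Ai A0 lim])
  show "(\<integral>\<omega>. A \<omega> \<partial>P) = (\<integral>\<omega>. (Y t \<omega>)\<^sup>2 \<partial>P) - (\<integral>\<omega>. (Y a \<omega>)\<^sup>2 \<partial>P)" using 1 2 by (simp add: c_def)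
  show "tendsto_L1 P (\<lambda>k. qsum (p k) (n k)) A"
    by (rule tendsto_L1_Scheffe[OF lim Qi Ai Q0 A0]) (use QE 2 in auto)
qed

end

section \<open>The Ito formula in mean\<close>

definition mesh_vanishes :: "(nat \<Rightarrow> nat) \<Rightarrow> (nat \<Rightarrow> nat \<Rightarrow> real) \<Rightarrow> bool" where
  "mesh_vanishes n p \<longleftrightarrow> (\<forall>\<delta>>0. \<forall>\<^sub>F k in sequentially. \<forall>i<n k. p k (Suc i) - p k i < \<delta>)"

lemma mesh_vanishes_subseq:
  assumes "mesh_vanishes n p" "strict_mono r"
  shows "mesh_vanishes (\<lambda>k. n (r k)) (\<lambda>k. p (r k))"
  unfolding mesh_vanishes_def
proof (intro allI impI)
  fix \<delta> :: real assume "\<delta> > 0"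
  with assms(1) have "\<forall>\<^sub>F k in sequentially. \<forall>i<n k. p k (Suc i) - p k i < \<delta>" by (simp add: mesh_vanishes_def)
  then show "\<forall>\<^sub>F k in sequentially. \<forall>i<n (r k). p (r k) (Suc i) - p (r k) i < \<delta>"
    by (rule eventually_compose_filterlim[OF _ filterlim_subseq[OF assms(2)]])
qed

lemma joint_quadratic_variation_tendsto_prob:
  assumes qv: "joint_quadratic_variation P T X Y A" and t: "t \<in> {0..T}"
    and p: "\<And>k. interval_partition t (n k) (p k)" and mesh: "mesh_vanishes n p"
  shows "tendsto_prob P (\<lambda>k \<omega>. \<Sum>i<n k. (X (p k (Suc i)) \<omega> - X (p k i) \<omega>) * (Y (p k (Suc i)) \<omega> - Y (p k i) \<omega>)) (A t)"
  unfolding tendsto_prob_def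
proof (intro allI impI tendstoI)
  fix \<epsilon> \<eta> :: real assume "\<epsilon> > 0" "\<eta> > 0"
  then obtain \<delta> where "\<delta> > 0" and \<delta>: "\<And>n p. interval_partition t n p \<and> (\<forall>i<n. p (Suc i) - p i < \<delta>) \<Longrightarrow>
        measure P {\<omega>\<in>space P.
          \<bar>(\<Sum>i<n. (X (p (Suc i)) \<omega> - X (p i) \<omega>) * (Y (p (Suc i)) \<omega> - Y (p i) \<omega>)) - A t \<omega>\<bar> > \<epsilon>} < \<eta>"
    using qv t unfolding joint_quadratic_variation_def by meson
  have "\<forall>\<^sub>F k in sequentially. \<forall>i<n k. p k (Suc i) - p k i < \<delta>"
    using mesh \<open>\<delta> > 0\<close> by (auto simp: mesh_vanishes_def)
  then show "\<forall>\<^sub>F k in sequentially. dist (measure P {\<omega>\<in>space P.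
      \<bar>(\<Sum>i<n k. (X (p k (Suc i)) \<omega> - X (p k i) \<omega>) * (Y (p k (Suc i)) \<omega> - Y (p k i) \<omega>)) - A t \<omega>\<bar> > \<epsilon>}) 0 < \<eta>"
  proof eventually_elim
    case (elim k)
    then show ?case using \<delta>[of "n k" "p k"] p[of k] by simp
  qed
qed

text \<open>Index \<open>k\<close> stands for \<open>Suc k\<close> subintervals, which avoids the
  empty partition and a division by 0.\<close>

definition uniform_points :: "real \<Rightarrow> real \<Rightarrow> nat \<Rightarrow> nat \<Rightarrow> real" where
  "uniform_points s t k i = s + (t - s) * (real i / real (Suc k))"

lemma uniform_points_0 [simp]: "uniform_points s t k 0 = s"
  by (simp add: uniform_points_def)

lemma uniform_points_end [simp]: "uniform_points s t k (Suc k) = t"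
proof -
  have "real (Suc k) / real (Suc k) = 1" by (rule divide_self) simp
  then show ?thesis unfolding uniform_points_def by (simp only: mult_1_right add.commute diff_add_cancel)
qed

lemma uniform_points_step: "uniform_points s t k (Suc i) - uniform_points s t k i = (t - s) / real (Suc k)"
proof -
  have "real (Suc i) / real (Suc k) - real i / real (Suc k) = 1 / real (Suc k)"
    by (simp add: diff_divide_distrib[symmetric] del: of_nat_Suc)
  then have "(t - s) * (real (Suc i) / real (Suc k)) - (t - s) * (real i / real (Suc k)) = (t - s) / real (Suc k)"
    by (simp only: right_diff_distrib[symmetric]) simp
  then show ?thesis unfolding uniform_points_def by linarith
qed

lemma uniform_points_mono: "s \<le> t \<Longrightarrow> uniform_points s t k i \<le> uniform_points s t k (Suc i)"
  using uniform_points_step[of s t k i] divide_nonneg_pos[of "t - s" "real (Suc k)"] by linarith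

lemma eventually_uniform_step_less:
  assumes "\<delta> > 0"
  shows "\<forall>\<^sub>F k in sequentially. (t - s) / real (Suc k) < \<delta>"
proof -
  have "(\<lambda>k. (t - s) * inverse (real (Suc k))) \<longlonglongrightarrow> (t - s) * 0"
    by (intro tendsto_intros LIMSEQ_inverse_real_of_nat)
  then have "(\<lambda>k. (t - s) / real (Suc k)) \<longlonglongrightarrow> 0" by (simp add: divide_inverse)
  then show ?thesis by (rule order_tendstoD) (fact assms)
qed

text \<open>The uniform grid of \<open>[0, s]\<close> followed by that of \<open>[s, t]\<close>.
  Quadratic variation is defined through partitions starting at 0, so sums over
  \<open>[s, t]\<close> are reached as a sum over this concatenation minus a sum over its first
  half.\<close>

definition concat_points :: "real \<Rightarrow> real \<Rightarrow> nat \<Rightarrow> nat \<Rightarrow> real" where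
  "concat_points s t k i = (if i \<le> Suc k then uniform_points 0 s k i else uniform_points s t k (i - Suc k))"

lemma concat_points_add: "concat_points s t k (Suc k + i) = uniform_points s t k i"
  by (cases i) (simp_all add: concat_points_def)

lemma concat_points_step:
  "concat_points s t k (Suc i) - concat_points s t k i =
     (if i < Suc k then s / real (Suc k) else (t - s) / real (Suc k))"
proof (cases "i < Suc k")
  case True
  then show ?thesis using uniform_points_step[of 0 s k i] by (simp add: concat_points_def)
next
  case False
  then obtain j where j: "i = Suc k + j" using le_Suc_ex by (metis not_less)
  have "concat_points s t k (Suc i) = uniform_points s t k (Suc j)"
    using concat_points_add[of s t k "Suc j"] j by simp
  then show ?thesis using False uniform_points_step[of s t k j] concat_points_add[of s t k j] j by simp
qed

context
  fixes s t :: real assumes st: "0 \<le> s" "s \<le> t"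
begin

lemma interval_partition_concat_points: "interval_partition t (Suc k + Suc k) (concat_points s t k)"
proof -
  have "concat_points s t k i \<le> concat_points s t k (Suc i)" for i
  proof -
    have "0 \<le> (t - s) / real (Suc k)" "0 \<le> s / real (Suc k)" using st by auto
    then have "0 \<le> concat_points s t k (Suc i) - concat_points s t k i"
      unfolding concat_points_step by (cases "i < Suc k") simp_all
    then show ?thesis by simp
  qed
  moreover have "concat_points s t k (Suc k + Suc k) = t" unfolding concat_points_add by simp
  moreover have "concat_points s t k 0 = 0" by (simp add: concat_points_def)
  ultimately show ?thesis by (simp add: interval_partition_def)
qed

lemma mesh_vanishes_concat_points: "mesh_vanishes (\<lambda>k. Suc k + Suc k) (concat_points s t)"
  unfolding mesh_vanishes_def
proof safe
  fix \<delta> :: real assume "\<delta> > 0"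
  from eventually_uniform_step_less[OF this, of s 0] eventually_uniform_step_less[OF this, of t s]
  show "\<forall>\<^sub>F k in sequentially. \<forall>i<Suc k + Suc k. concat_points s t k (Suc i) - concat_points s t k i < \<delta>"
    by eventually_elim (simp add: concat_points_step)
qed

end

lemma interval_partition_uniform_points:
  "0 \<le> t \<Longrightarrow> interval_partition t (Suc k) (uniform_points 0 t k)"
  by (simp add: interval_partition_def uniform_points_mono)

lemma mesh_vanishes_uniform_points: "mesh_vanishes Suc (uniform_points s t)"
  unfolding mesh_vanishes_def uniform_points_step
  by (intro allI impI eventually_mono[OF eventually_uniform_step_less])

section \<open>Time integrals along a partition\<close>

lemma set_lborel_integral_split:
  fixes g :: "real \<Rightarrow> real"
  assumes "set_integrable lborel {a..c} g" "a \<le> b" "b \<le> c"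
  shows "(LBINT x:{a..c}. g x) = (LBINT x:{a..b}. g x) + (LBINT x:{b..c}. g x)"
proof -
  have i: "set_integrable lborel {a..b} g" "set_integrable lborel {b..c} g"
    by (rule set_integrable_subset[OF assms(1)]; use assms in auto)+
  have "{a..c} = {a..b} \<union> {b..c}" using assms by auto
  moreover have "AE x in lborel. \<not> (x \<in> {a..b} \<and> x \<in> {b..c})"
    using AE_lborel_singleton[of b] by eventually_elim auto
  ultimately show ?thesis using set_integral_Un_AE[of "{a..b}" "{b..c}" lborel g] i by simp
qed

lemma set_lborel_integral_sum:
  fixes g :: "real \<Rightarrow> real"
  assumes "\<And>i. i < n \<Longrightarrow> p i \<le> p (Suc i)" "set_integrable lborel {p 0..p n} g"
  shows "(LBINT x:{p 0..p n}. g x) = (\<Sum>i<n. LBINT x:{p i..p (Suc i)}. g x)"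
  using assms
proof (induction n)
  case 0
  have "AE x in lborel. indicator {p 0} x *\<^sub>R g x = 0"
    using AE_lborel_singleton[of "p 0"] by eventually_elim auto
  then have "(\<integral>x. indicator {p 0} x *\<^sub>R g x \<partial>lborel) = 0" by (rule integral_eq_zero_AE)
  then show ?case by (simp add: set_lebesgue_integral_def)
next
  case (Suc n)
  have p: "p 0 \<le> p n" "p n \<le> p (Suc n)"
    using partition_mono[of n p 0 n] Suc.prems(1) by auto
  have "set_integrable lborel {p 0..p n} g"
    by (rule set_integrable_subset[OF Suc.prems(2)]) (use p in auto)
  with Suc.prems(1) have "(LBINT x:{p 0..p n}. g x) = (\<Sum>i<n. LBINT x:{p i..p (Suc i)}. g x)"
    by (intro Suc.IH) auto
  with set_lborel_integral_split[OF Suc.prems(2) p] show ?case by (simp only: sum.lessThan_Suc)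
qed

lemma set_integrable_bounded_mult:
  fixes a c :: "real \<Rightarrow> real"
  assumes a: "set_integrable lborel S a" and S: "S \<in> sets lborel"
    and c: "set_borel_measurable lborel S c" "\<And>x. x \<in> S \<Longrightarrow> \<bar>c x\<bar> \<le> C"
  shows "set_integrable lborel S (\<lambda>x. c x * a x)"
  unfolding set_integrable_def
proof (rule Bochner_Integration.integrable_bound)
  show "integrable lborel (\<lambda>x. C * (indicator S x *\<^sub>R a x))"
    using a by (auto simp: set_integrable_def)
  have "(\<lambda>x. (indicator S x *\<^sub>R c x) * (indicator S x *\<^sub>R a x)) \<in> borel_measurable lborel"
    using a c by (intro borel_measurable_times) (auto simp: set_integrable_def set_borel_measurable_def)
  also have "(\<lambda>x. (indicator S x *\<^sub>R c x) * (indicator S x *\<^sub>R a x)) = (\<lambda>x. indicator S x *\<^sub>R (c x * a x))"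
    by (auto simp: indicator_def)
  finally show "(\<lambda>x. indicator S x *\<^sub>R (c x * a x)) \<in> borel_measurable lborel" .
  show "AE x in lborel. norm (indicator S x *\<^sub>R (c x * a x)) \<le> norm (C * (indicator S x *\<^sub>R a x))"
  proof (rule AE_I2)
    fix x
    have "x \<in> S \<Longrightarrow> \<bar>c x\<bar> * \<bar>a x\<bar> \<le> \<bar>C\<bar> * \<bar>a x\<bar>"
      using c(2)[of x] by (intro mult_right_mono) auto
    then show "norm (indicator S x *\<^sub>R (c x * a x)) \<le> norm (C * (indicator S x *\<^sub>R a x))"
      by (auto simp: indicator_def abs_mult)
  qed
qed

lemma set_borel_measurable_continuous_lborel:
  fixes c :: "real \<Rightarrow> real"
  shows "continuous_on S c \<Longrightarrow> S \<in> sets borel \<Longrightarrow> set_borel_measurable lborel S c"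
  unfolding set_borel_measurable_def
  using borel_measurable_continuous_on_indicator[of S c] by simp

text \<open>The intermediate point of a Taylor remainder lies between two values of the path, so it
  is a value of the path at a time in the same partition interval. The modulus of continuity in time
  thereby controls the remainder.\<close>

lemma path_value_between:
  fixes Y :: "real \<Rightarrow> real"
  assumes "continuous_on {a..b} Y" "a \<le> b" "Y a \<le> z \<and> z \<le> Y b \<or> Y b \<le> z \<and> z \<le> Y a"
  shows "\<exists>r\<in>{a..b}. Y r = z"
  using assms(3)
proof
  assume "Y a \<le> z \<and> z \<le> Y b"
  then obtain r where "a \<le> r" "r \<le> b" "Y r = z" using IVT'[of Y a z b] assms by blast
  then show ?thesis by (intro bexI[of _ r]) auto
next
  assume "Y b \<le> z \<and> z \<le> Y a"
  then obtain r where "a \<le> r" "r \<le> b" "Y r = z" using IVT2'[of Y b z a] assms by blast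
  then show ?thesis by (intro bexI[of _ r]) auto
qed

section \<open>Taylor expansion for functions with bounded derivatives\<close>

locale C2_bounded =
  fixes f f' f'' :: "real \<Rightarrow> real" and C1 C2 :: real
  assumes deriv1: "(f has_real_derivative f' x) (at x)"
    and deriv2: "(f' has_real_derivative f'' x) (at x)"
    and cont2: "continuous_on UNIV f''"
    and bound1: "\<bar>f' x\<bar> \<le> C1" and bound2: "\<bar>f'' x\<bar> \<le> C2"
begin

lemma C1_nonneg: "C1 \<ge> 0" and C2_nonneg: "C2 \<ge> 0"
  using bound1[of 0] bound2[of 0] by auto

lemma cont0: "continuous_on UNIV f" and cont1: "continuous_on UNIV f'"
  using deriv1 deriv2 by (auto intro!: continuous_at_imp_continuous_on DERIV_isCont)

lemma measurable_f [measurable]: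
  "f \<in> borel_measurable borel" "f' \<in> borel_measurable borel" "f'' \<in> borel_measurable borel"
  by (intro borel_measurable_continuous_onI cont0 cont1 cont2)+

lemma mean_value: "\<exists>z. (x \<le> z \<and> z \<le> y \<or> y \<le> z \<and> z \<le> x) \<and> f y - f x = f' z * (y - x)"
proof (cases x y rule: linorder_cases)
  case less
  then obtain z where "x < z" "z < y" "f y - f x = (y - x) * f' z"
    using MVT2[of x y f f'] deriv1 by blast
  then show ?thesis by (intro exI[of _ z]) auto
next
  case greater
  then obtain z where "y < z" "z < x" "f x - f y = (x - y) * f' z"
    using MVT2[of y x f f'] deriv1 by blast
  then show ?thesis by (intro exI[of _ z]) (auto simp: algebra_simps)
qed auto

lemma lipschitz: "\<bar>f y - f x\<bar> \<le> C1 * \<bar>y - x\<bar>"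
proof -
  obtain z where "f y - f x = f' z * (y - x)" using mean_value[of x y] by blast
  then show ?thesis using bound1[of z] by (simp add: abs_mult mult_right_mono)
qed

text \<open>\<open>f\<close> itself may be unbounded; integrability of \<open>f (Y t)\<close> is
  inherited from \<open>Y t\<close> by this estimate.\<close>

lemma linear_growth: "\<bar>f x\<bar> \<le> \<bar>f 0\<bar> + C1 * \<bar>x\<bar>"
  using lipschitz[of x 0] by auto

text \<open>The Lagrange point \<open>z\<close> is kept instead of an estimate of the remainder,
  since it will be realised as a path value at an intermediate time.\<close>

lemma taylor2:
  "\<exists>z. (x \<le> z \<and> z \<le> y \<or> y \<le> z \<and> z \<le> x) \<and>
    f y - f x - f' x * (y - x) - f'' x * (y - x)\<^sup>2 / 2 = (f'' z - f'' x) * (y - x)\<^sup>2 / 2"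
proof (cases "x = y")
  case False
  define diff where "diff m = (if m = 0 then f else if m = 1 then f' else f'')" for m :: nat
  have "\<exists>t. (if y < x then y < t \<and> t < x else x < t \<and> t < y) \<and>
      f y = (\<Sum>m<2. (diff m x / fact m) * (y - x)^m) + (diff 2 t / fact 2) * (y - x)^2"
  proof (rule Taylor[where a="min x y" and b="max x y"])
    show "\<forall>m t. m < 2 \<and> min x y \<le> t \<and> t \<le> max x y \<longrightarrow> DERIV (diff m) t :> diff (Suc m) t"
      using deriv1 deriv2 by (auto simp: diff_def less_2_cases_iff)
  qed (use False in \<open>auto simp: diff_def\<close>)
  then obtain t where t: "if y < x then y < t \<and> t < x else x < t \<and> t < y"
    "f y = (\<Sum>m<2. (diff m x / fact m) * (y - x)^m) + (diff 2 t / fact 2) * (y - x)^2" by blast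
  show ?thesis
  proof (intro exI[of _ t] conjI)
    show "x \<le> t \<and> t \<le> y \<or> y \<le> t \<and> t \<le> x" using t(1) by (auto split: if_splits)
    have "(\<Sum>m<2. (diff m x / fact m) * (y - x)^m) = f x + f' x * (y - x)"
      by (simp add: diff_def numeral_2_eq_2)
    then have "f y = f x + f' x * (y - x) + f'' t / 2 * (y - x)\<^sup>2"
      using t(2) by (simp add: diff_def)
    then show "f y - f x - f' x * (y - x) - f'' x * (y - x)\<^sup>2 / 2 = (f'' t - f'' x) * (y - x)\<^sup>2 / 2"
      by (simp add: left_diff_distrib diff_divide_distrib)
  qed
qed auto

text \<open>A purely pathwise estimate. Two errors arise on each interval: the Taylor remainder, and
  freezing \<open>f''\<close> at the left end point inside the time integral. Both are governed by
  the oscillation \<open>e\<close> of \<open>f'' (Y r)\<close> on the interval, the first together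
  with the squared increment, the second with the integral of \<open>a\<close>. The factors 1/2 are
  given away.\<close>

lemma ito_remainder_bound:
  fixes Y a :: "real \<Rightarrow> real"
  assumes p: "\<And>i. i < n \<Longrightarrow> p i \<le> p (Suc i)"
    and Y: "continuous_on {p 0..p n} Y"
    and a: "set_integrable lborel {p 0..p n} a" "\<And>r. 0 \<le> a r"
    and e: "\<And>i r r'. i < n \<Longrightarrow> r \<in> {p i..p (Suc i)} \<Longrightarrow> r' \<in> {p i..p (Suc i)} \<Longrightarrow> \<bar>f'' (Y r) - f'' (Y r')\<bar> \<le> e"
  shows "\<bar>f (Y (p n)) - f (Y (p 0)) - (LBINT r:{p 0..p n}. f'' (Y r) * a r) / 2
      - (\<Sum>i<n. f' (Y (p i)) * (Y (p (Suc i)) - Y (p i)))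
      - (\<Sum>i<n. f'' (Y (p i)) * ((Y (p (Suc i)) - Y (p i))\<^sup>2 - (LBINT r:{p i..p (Suc i)}. a r))) / 2\<bar>
    \<le> e * ((\<Sum>i<n. (Y (p (Suc i)) - Y (p i))\<^sup>2) + (LBINT r:{p 0..p n}. a r))"
proof -
  have sub: "{p i..p (Suc i)} \<subseteq> {p 0..p n}" if "i < n" for i
    using partition_mono[of n p 0 i] partition_mono[of n p "Suc i" n] p that by fastforce
  have fY: "continuous_on {p 0..p n} (\<lambda>r. f'' (Y r))"
    by (rule continuous_on_compose2[OF cont2 Y]) auto
  have fa: "set_integrable lborel {p 0..p n} (\<lambda>r. f'' (Y r) * a r)"
    by (rule set_integrable_bounded_mult[OF a(1) _ set_borel_measurable_continuous_lborel[OF fY], where C=C2])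
      (auto intro: bound2)
  have summand: "\<bar>f (Y (p (Suc i))) - f (Y (p i)) - (LBINT r:{p i..p (Suc i)}. f'' (Y r) * a r) / 2
      - f' (Y (p i)) * (Y (p (Suc i)) - Y (p i))
      - f'' (Y (p i)) * ((Y (p (Suc i)) - Y (p i))\<^sup>2 - (LBINT r:{p i..p (Suc i)}. a r)) / 2\<bar>
    \<le> e * ((Y (p (Suc i)) - Y (p i))\<^sup>2 + (LBINT r:{p i..p (Suc i)}. a r))" if i: "i < n" for i
  proof -
    have Yi: "continuous_on {p i..p (Suc i)} Y" by (rule continuous_on_subset[OF Y sub[OF i]])
    have ai: "set_integrable lborel {p i..p (Suc i)} a" "set_integrable lborel {p i..p (Suc i)} (\<lambda>r. f'' (Y r) * a r)"
      by (rule set_integrable_subset[OF a(1) _ sub[OF i]], simp, rule set_integrable_subset[OF fa _ sub[OF i]], simp)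
    let ?x = "Y (p i)" and ?y = "Y (p (Suc i))"

    obtain z where z: "?x \<le> z \<and> z \<le> ?y \<or> ?y \<le> z \<and> z \<le> ?x"
      and tz: "f ?y - f ?x - f' ?x * (?y - ?x) - f'' ?x * (?y - ?x)\<^sup>2 / 2 = (f'' z - f'' ?x) * (?y - ?x)\<^sup>2 / 2"
      using taylor2 by blast
    obtain r where r: "r \<in> {p i..p (Suc i)}" "Y r = z"
      using path_value_between[OF Yi p[OF i] z] by blast
    have "\<bar>f'' z - f'' ?x\<bar> \<le> e" using e[OF i r(1), of "p i"] r p[OF i] by auto
    then have 1: "\<bar>(f'' z - f'' ?x) * (?y - ?x)\<^sup>2\<bar> \<le> e * (?y - ?x)\<^sup>2"
      by (simp add: abs_mult mult_right_mono)
    have 2: "\<bar>(LBINT r:{p i..p (Suc i)}. f'' (Y r) * a r) - f'' ?x * (LBINT r:{p i..p (Suc i)}. a r)\<bar>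
        \<le> e * (LBINT r:{p i..p (Suc i)}. a r)"
    proof -
      have ax: "set_integrable lborel {p i..p (Suc i)} (\<lambda>r. f'' ?x * a r)" using ai by simp
      have "(LBINT r:{p i..p (Suc i)}. f'' (Y r) * a r) - f'' ?x * (LBINT r:{p i..p (Suc i)}. a r)
          = (LBINT r:{p i..p (Suc i)}. f'' (Y r) * a r - f'' ?x * a r)"
        using set_integral_diff(2)[OF ai(2) ax] by simp
      also have "\<bar>\<dots>\<bar> \<le> (LBINT r:{p i..p (Suc i)}. \<bar>f'' (Y r) * a r - f'' ?x * a r\<bar>)"
        using set_integral_norm_bound[OF set_integral_diff(1)[OF ai(2) ax]] by simp
      also have "\<dots> \<le> (LBINT r:{p i..p (Suc i)}. e * a r)"
      proof (rule set_integral_mono)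
        show "set_integrable lborel {p i..p (Suc i)} (\<lambda>r. \<bar>f'' (Y r) * a r - f'' ?x * a r\<bar>)"
          using set_integrable_abs[OF set_integral_diff(1)[OF ai(2) ax]] .
        show "set_integrable lborel {p i..p (Suc i)} (\<lambda>r. e * a r)" using ai by simp
        fix r assume r: "r \<in> {p i..p (Suc i)}"
        have "\<bar>f'' (Y r) - f'' ?x\<bar> * a r \<le> e * a r"
          using e[OF i r, of "p i"] p[OF i] a(2)[of r] by (intro mult_right_mono) auto
        then show "\<bar>f'' (Y r) * a r - f'' ?x * a r\<bar> \<le> e * a r"
          using a(2)[of r] by (simp add: left_diff_distrib[symmetric] abs_mult)
      qed
      finally show ?thesis by simp
    qed

    have "f ?y - f ?x - (LBINT r:{p i..p (Suc i)}. f'' (Y r) * a r) / 2 - f' ?x * (?y - ?x)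
        - f'' ?x * ((?y - ?x)\<^sup>2 - (LBINT r:{p i..p (Suc i)}. a r)) / 2 =
       (f'' z - f'' ?x) * (?y - ?x)\<^sup>2 / 2
        - ((LBINT r:{p i..p (Suc i)}. f'' (Y r) * a r) - f'' ?x * (LBINT r:{p i..p (Suc i)}. a r)) / 2"
      unfolding tz[symmetric] by (simp add: field_simps)
    moreover have "\<bar>u / 2 - v / 2\<bar> \<le> q + r" if "\<bar>u\<bar> \<le> q" "\<bar>v\<bar> \<le> r" for u v q r :: real
      using that by linarith
    from this[OF 1 2] have "\<bar>(f'' z - f'' ?x) * (?y - ?x)\<^sup>2 / 2
        - ((LBINT r:{p i..p (Suc i)}. f'' (Y r) * a r) - f'' ?x * (LBINT r:{p i..p (Suc i)}. a r)) / 2\<bar>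
      \<le> e * ((?y - ?x)\<^sup>2 + (LBINT r:{p i..p (Suc i)}. a r))"
      by (simp only: distrib_left)
    ultimately show ?thesis by (simp only:)
  qed
  have s1: "(LBINT r:{p 0..p n}. f'' (Y r) * a r) = (\<Sum>i<n. LBINT r:{p i..p (Suc i)}. f'' (Y r) * a r)"
    by (rule set_lborel_integral_sum[OF p fa])
  have s2: "(LBINT r:{p 0..p n}. a r) = (\<Sum>i<n. LBINT r:{p i..p (Suc i)}. a r)"
    by (rule set_lborel_integral_sum[OF p a(1)])
  have s3: "f (Y (p n)) - f (Y (p 0)) = (\<Sum>i<n. f (Y (p (Suc i))) - f (Y (p i)))"
    using sum_lessThan_telescope[of "\<lambda>i. f (Y (p i))" n] by simp
  have eq: "f (Y (p n)) - f (Y (p 0)) - (LBINT r:{p 0..p n}. f'' (Y r) * a r) / 2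
      - (\<Sum>i<n. f' (Y (p i)) * (Y (p (Suc i)) - Y (p i)))
      - (\<Sum>i<n. f'' (Y (p i)) * ((Y (p (Suc i)) - Y (p i))\<^sup>2 - (LBINT r:{p i..p (Suc i)}. a r))) / 2
    = (\<Sum>i<n. f (Y (p (Suc i))) - f (Y (p i)) - (LBINT r:{p i..p (Suc i)}. f'' (Y r) * a r) / 2
      - f' (Y (p i)) * (Y (p (Suc i)) - Y (p i))
      - f'' (Y (p i)) * ((Y (p (Suc i)) - Y (p i))\<^sup>2 - (LBINT r:{p i..p (Suc i)}. a r)) / 2)"
    unfolding s1 s3 by (simp add: sum_subtractf sum_divide_distrib)
  show ?thesis
    unfolding eq
  proof (rule order_trans[OF sum_abs])
    have "(\<Sum>i<n. \<bar>f (Y (p (Suc i))) - f (Y (p i)) - (LBINT r:{p i..p (Suc i)}. f'' (Y r) * a r) / 2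
      - f' (Y (p i)) * (Y (p (Suc i)) - Y (p i))
      - f'' (Y (p i)) * ((Y (p (Suc i)) - Y (p i))\<^sup>2 - (LBINT r:{p i..p (Suc i)}. a r)) / 2\<bar>) \<le> (\<Sum>i<n. e * ((Y (p (Suc i)) - Y (p i))\<^sup>2 + (LBINT r:{p i..p (Suc i)}. a r)))"
      by (rule sum_mono, rule summand) simp
  also have "\<dots> = e * ((\<Sum>i<n. (Y (p (Suc i)) - Y (p i))\<^sup>2) + (LBINT r:{p 0..p n}. a r))"
      by (simp only: s2 sum.distrib sum_distrib_left[symmetric])
    finally show "(\<Sum>i<n. \<bar>f (Y (p (Suc i))) - f (Y (p i)) - (LBINT r:{p i..p (Suc i)}. f'' (Y r) * a r) / 2
      - f' (Y (p i)) * (Y (p (Suc i)) - Y (p i))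
      - f'' (Y (p i)) * ((Y (p (Suc i)) - Y (p i))\<^sup>2 - (LBINT r:{p i..p (Suc i)}. a r)) / 2\<bar>)
     \<le> e * ((\<Sum>i<n. (Y (p (Suc i)) - Y (p i))\<^sup>2) + (LBINT r:{p 0..p n}. a r))" .
  qed
qed

end

lemma sum_lessThan_add_split:
  fixes g :: "nat \<Rightarrow> 'b::comm_monoid_add"
  shows "(\<Sum>i<m + n. g i) = (\<Sum>i<m. g i) + (\<Sum>i<n. g (m + i))"
  by (induction n) (simp_all add: add.assoc)

section \<open>Martingales whose quadratic variation has a density in time\<close>

locale qv_martingale = L2_martingale P F T Y
  for P :: "'a measure" and F T Y +
  fixes A :: "real \<Rightarrow> 'a \<Rightarrow> real" and a :: "'a \<Rightarrow> real \<Rightarrow> real"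
  assumes qv: "joint_quadratic_variation P T Y Y A"
    and paths: "\<omega> \<in> space P \<Longrightarrow> continuous_on {0..T} (\<lambda>t. Y t \<omega>)"
    and density_nonneg: "0 \<le> a \<omega> r"
    and density: "AE \<omega> in P. set_integrable lborel {0..T} (a \<omega>) \<and> (\<forall>t\<in>{0..T}. A t \<omega> = (LBINT r:{0..t}. a \<omega> r))"
begin

lemma measurable_A: "t \<in> {0..T} \<Longrightarrow> A t \<in> borel_measurable P"
  using qv by (auto simp: joint_quadratic_variation_def)

lemma A_increment:
  "AE \<omega> in P. set_integrable lborel {0..T} (a \<omega>) \<and>
    (\<forall>s t. 0 \<le> s \<longrightarrow> s \<le> t \<longrightarrow> t \<le> T \<longrightarrow>
      A t \<omega> - A s \<omega> = (LBINT r:{s..t}. a \<omega> r) \<and> 0 \<le> (LBINT r:{s..t}. a \<omega> r))"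
  using density
proof eventually_elim
  case (elim \<omega>)
  show ?case
  proof (intro conjI allI impI)
    fix s t assume st: "0 \<le> s" "s \<le> t" "t \<le> T"
    have "set_integrable lborel {0..t} (a \<omega>)"
      by (rule set_integrable_subset[of _ "{0..T}"]) (use elim st in auto)
    from set_lborel_integral_split[OF this st(1,2)]
    show "A t \<omega> - A s \<omega> = (LBINT r:{s..t}. a \<omega> r)" using elim st by auto
    show "0 \<le> (LBINT r:{s..t}. a \<omega> r)"
      unfolding set_lebesgue_integral_def using density_nonneg
      by (intro Bochner_Integration.integral_nonneg) auto
  qed (use elim in auto)
qed

lemma A_nonneg: "t \<in> {0..T} \<Longrightarrow> AE \<omega> in P. 0 \<le> A t \<omega>"
  using density
proof eventually_elim
  case (elim \<omega>)
  then have "A t \<omega> = (LBINT r:{0..t}. a \<omega> r)" by auto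
  also have "0 \<le> \<dots>"
    unfolding set_lebesgue_integral_def using density_nonneg
    by (intro Bochner_Integration.integral_nonneg) auto
  finally show ?case .
qed

lemma qsum_tendsto_L1_0:
  assumes t: "t \<in> {0..T}" and p: "\<And>k. interval_partition t (n k) (p k)" and mesh: "mesh_vanishes n p"
  shows "tendsto_L1 P (\<lambda>k. qsum (p k) (n k)) (A t)"
    and "(\<integral>\<omega>. A t \<omega> \<partial>P) = (\<integral>\<omega>. (Y t \<omega>)\<^sup>2 \<partial>P) - (\<integral>\<omega>. (Y 0 \<omega>)\<^sup>2 \<partial>P)"
proof -
  have p': "\<And>k. p k 0 = 0" "\<And>k. p k (n k) = t" "\<And>k i. i < n k \<Longrightarrow> p k i \<le> p k (Suc i)"
    using p by (auto simp: interval_partition_def)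
  have lim: "tendsto_prob P (\<lambda>k. qsum (p k) (n k)) (A t)"
    using joint_quadratic_variation_tendsto_prob[OF qv t p mesh]
    by (simp add: qsum_def[abs_def] power2_eq_square)
  have t': "t \<le> T" using t by simp
  show "tendsto_L1 P (\<lambda>k. qsum (p k) (n k)) (A t)"
    by (rule quadratic_variation_tendsto_L1(1)[OF order_refl t' p' measurable_A[OF t] A_nonneg[OF t] lim])
  show "(\<integral>\<omega>. A t \<omega> \<partial>P) = (\<integral>\<omega>. (Y t \<omega>)\<^sup>2 \<partial>P) - (\<integral>\<omega>. (Y 0 \<omega>)\<^sup>2 \<partial>P)"
    by (rule quadratic_variation_tendsto_L1(2)[OF order_refl t' p' measurable_A[OF t] A_nonneg[OF t] lim])
qed

lemma integrable_A: "t \<in> {0..T} \<Longrightarrow> integrable P (A t)"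
  and expectation_A: "t \<in> {0..T} \<Longrightarrow>
    (\<integral>\<omega>. A t \<omega> \<partial>P) = (\<integral>\<omega>. (Y t \<omega>)\<^sup>2 \<partial>P) - (\<integral>\<omega>. (Y 0 \<omega>)\<^sup>2 \<partial>P)"
proof -
  assume t: "t \<in> {0..T}"
  then have "0 \<le> t" by simp
  note Q = qsum_tendsto_L1_0[OF t interval_partition_uniform_points[OF this] mesh_vanishes_uniform_points]
  show "integrable P (A t)" using Q(1) by (simp add: tendsto_L1_def)
  show "(\<integral>\<omega>. A t \<omega> \<partial>P) = (\<integral>\<omega>. (Y t \<omega>)\<^sup>2 \<partial>P) - (\<integral>\<omega>. (Y 0 \<omega>)\<^sup>2 \<partial>P)" by (rule Q(2))
qed

lemma qsum_tendsto_L1: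
  assumes st: "0 \<le> s" "s \<le> t" "t \<le> T"
  shows "tendsto_L1 P (\<lambda>k. qsum (uniform_points s t k) (Suc k)) (\<lambda>\<omega>. A t \<omega> - A s \<omega>)"
proof -
  have "tendsto_L1 P (\<lambda>k \<omega>. qsum (concat_points s t k) (Suc k + Suc k) \<omega> - qsum (uniform_points 0 s k) (Suc k) \<omega>)
      (\<lambda>\<omega>. A t \<omega> - A s \<omega>)"
    using st by (intro tendsto_L1_diff qsum_tendsto_L1_0 interval_partition_uniform_points
        mesh_vanishes_uniform_points interval_partition_concat_points mesh_vanishes_concat_points) auto
  moreover have "qsum (concat_points s t k) (Suc k + Suc k) \<omega> =
      qsum (uniform_points 0 s k) (Suc k) \<omega> + qsum (uniform_points s t k) (Suc k) \<omega>" for k \<omega>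
  proof -
    let ?g = "\<lambda>i. (Y (concat_points s t k (Suc i)) \<omega> - Y (concat_points s t k i) \<omega>)\<^sup>2"
    have "(\<Sum>i<Suc k + Suc k. ?g i) = (\<Sum>i<Suc k. ?g i) + (\<Sum>i<Suc k. ?g (Suc k + i))"
      by (simp only: sum_lessThan_add_split)
    also have "(\<Sum>i<Suc k. ?g i) = qsum (uniform_points 0 s k) (Suc k) \<omega>"
      unfolding qsum_def by (intro sum.cong) (auto simp: concat_points_def)
    also have "(\<Sum>i<Suc k. ?g (Suc k + i)) = qsum (uniform_points s t k) (Suc k) \<omega>"
      unfolding qsum_def by (intro sum.cong refl) (simp only: concat_points_add add_Suc_right[symmetric])
    finally show ?thesis unfolding qsum_def[of "concat_points s t k"] .
  qed
  ultimately show ?thesis by simp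
qed

text \<open>The mean of \<open>h\<close> times the quadratic sum is the same for all uniform grids
  of \<open>[s, t]\<close>, and a bounded weight preserves convergence in mean. This is the
  martingale property of \<open>Y\<^sup>2 - A\<close>; it is tested against \<open>h\<close> because
  \<open>A\<close> is only known to be measurable with respect to \<open>P\<close>.\<close>

lemma square_increment:
  assumes st: "0 \<le> s" "s \<le> t" "t \<le> T"
    and h: "h \<in> borel_measurable (F s)" "\<And>\<omega>. \<omega> \<in> space P \<Longrightarrow> \<bar>h \<omega>\<bar> \<le> K"
  shows "(\<integral>\<omega>. h \<omega> * (A t \<omega> - A s \<omega>) \<partial>P) = (\<integral>\<omega>. h \<omega> * (Y t \<omega> - Y s \<omega>)\<^sup>2 \<partial>P)"
    and "integrable P (\<lambda>\<omega>. h \<omega> * (A t \<omega> - A s \<omega>))"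
proof -
  let ?Q = "\<lambda>k. qsum (uniform_points s t k) (Suc k)"
  have hm[measurable]: "h \<in> borel_measurable P" by (rule measurable_F[OF h(1)])
  have Ai: "integrable P (\<lambda>\<omega>. A t \<omega> - A s \<omega>)" using integrable_A st by auto
  have bm: "integrable P (\<lambda>\<omega>. h \<omega> * g \<omega>)" if "integrable P g" for g
    by (rule Bochner_Integration.integrable_bound[where f="\<lambda>\<omega>. K * g \<omega>"])
      (use that h(2) in \<open>auto simp: abs_mult intro!: AE_I2 mult_right_mono order_trans[OF h(2)]\<close>)
  show hA: "integrable P (\<lambda>\<omega>. h \<omega> * (A t \<omega> - A s \<omega>))" by (rule bm[OF Ai])
  have Q: "tendsto_L1 P ?Q (\<lambda>\<omega>. A t \<omega> - A s \<omega>)" by (rule qsum_tendsto_L1[OF st])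
  have Qi: "integrable P (?Q k)" for k using Q by (simp add: tendsto_L1_def)
  have e: "(\<integral>\<omega>. h \<omega> * ?Q k \<omega> \<partial>P) = (\<integral>\<omega>. h \<omega> * (Y t \<omega> - Y s \<omega>)\<^sup>2 \<partial>P)" for k
    using qsum_expectation[of "uniform_points s t k" "Suc k" h K] martingale_square_increment(1)[OF st h]
      st h uniform_points_mono[OF st(2)] by auto
  have "\<bar>(\<integral>\<omega>. h \<omega> * (Y t \<omega> - Y s \<omega>)\<^sup>2 \<partial>P) - (\<integral>\<omega>. h \<omega> * (A t \<omega> - A s \<omega>) \<partial>P)\<bar>
      \<le> K * (\<integral>\<omega>. \<bar>?Q k \<omega> - (A t \<omega> - A s \<omega>)\<bar> \<partial>P)" for k
  proof -
    have i: "integrable P (\<lambda>\<omega>. \<bar>?Q k \<omega> - (A t \<omega> - A s \<omega>)\<bar>)" using Qi[of k] Ai by auto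
    have "(\<integral>\<omega>. h \<omega> * (Y t \<omega> - Y s \<omega>)\<^sup>2 \<partial>P) - (\<integral>\<omega>. h \<omega> * (A t \<omega> - A s \<omega>) \<partial>P)
        = (\<integral>\<omega>. h \<omega> * (?Q k \<omega> - (A t \<omega> - A s \<omega>)) \<partial>P)"
      unfolding e[of k, symmetric] right_diff_distrib[of _ "?Q k _"]
      by (rule Bochner_Integration.integral_diff[symmetric]) (rule bm[OF Qi] hA)+
    also have "\<bar>\<dots>\<bar> \<le> (\<integral>\<omega>. \<bar>h \<omega> * (?Q k \<omega> - (A t \<omega> - A s \<omega>))\<bar> \<partial>P)" by (rule integral_abs_bound)
    also have "\<dots> \<le> (\<integral>\<omega>. K * \<bar>?Q k \<omega> - (A t \<omega> - A s \<omega>)\<bar> \<partial>P)"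
    proof (rule integral_mono)
      show "integrable P (\<lambda>\<omega>. \<bar>h \<omega> * (?Q k \<omega> - (A t \<omega> - A s \<omega>))\<bar>)"
        using bm[of "\<lambda>\<omega>. ?Q k \<omega> - (A t \<omega> - A s \<omega>)"] Qi[of k] Ai by auto
    qed (use i h(2) in \<open>auto simp: abs_mult intro!: mult_right_mono\<close>)
    finally show ?thesis by simp
  qed
  moreover have "(\<lambda>k. K * (\<integral>\<omega>. \<bar>?Q k \<omega> - (A t \<omega> - A s \<omega>)\<bar> \<partial>P)) \<longlonglongrightarrow> K * 0"
    using Q by (intro tendsto_intros) (simp add: tendsto_L1_def)
  ultimately have "\<bar>(\<integral>\<omega>. h \<omega> * (Y t \<omega> - Y s \<omega>)\<^sup>2 \<partial>P) - (\<integral>\<omega>. h \<omega> * (A t \<omega> - A s \<omega>) \<partial>P)\<bar> \<le> K * 0"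
    by (intro LIMSEQ_le_const[of _ "K * 0"]) auto
  then show "(\<integral>\<omega>. h \<omega> * (A t \<omega> - A s \<omega>) \<partial>P) = (\<integral>\<omega>. h \<omega> * (Y t \<omega> - Y s \<omega>)\<^sup>2 \<partial>P)" by simp
qed

text \<open>In the decomposition \<open>L = N k + S k / 2 + R k\<close> the first order sums
  \<open>N k\<close> vanish against \<open>h\<close> by orthogonality, the second order sums
  \<open>S k\<close> by \<open>square_increment\<close>, and the remainder \<open>R k\<close> tends
  to 0 in mean. As \<open>L\<close> does not depend on \<open>k\<close>, its mean against
  \<open>h\<close> is 0.\<close>

lemma ito_expectation:
  assumes f: "C2_bounded f f' f'' C1 C2"
    and st: "0 \<le> s" "s \<le> t" "t \<le> T"
    and h: "h \<in> borel_measurable (F s)" "\<And>\<omega>. \<omega> \<in> space P \<Longrightarrow> \<bar>h \<omega>\<bar> \<le> K"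
    and I[measurable]: "(\<lambda>\<omega>. LBINT r:{s..t}. f'' (Y r \<omega>) * a \<omega> r) \<in> borel_measurable P"
  shows "(\<integral>\<omega>. h \<omega> * (f (Y t \<omega>) - f (Y s \<omega>) - (LBINT r:{s..t}. f'' (Y r \<omega>) * a \<omega> r) / 2) \<partial>P) = 0"
proof -
  interpret C2_bounded f f' f'' C1 C2 by fact
  define p where "p = uniform_points s t"
  have pmono: "p k i \<le> p k (Suc i)" for k i unfolding p_def by (rule uniform_points_mono[OF st(2)])
  have pends: "p k 0 = s" "p k (Suc k) = t" for k by (simp_all add: p_def)
  have prange: "s \<le> p k i" "p k i \<le> t" if "i \<le> Suc k" for k i
    using partition_mono[of "Suc k" "p k" 0 i] partition_mono[of "Suc k" "p k" i "Suc k"] pmono that pends by auto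
  have prange': "0 \<le> p k i" "p k i \<le> T" if "i \<le> Suc k" for k i
    using prange[OF that] st by auto
  define Iint where "Iint \<omega> = (LBINT r:{s..t}. f'' (Y r \<omega>) * a \<omega> r)" for \<omega>
  have [measurable]: "Iint \<in> borel_measurable P" unfolding Iint_def by (rule I)
  define Q where "Q k = qsum (p k) (Suc k)" for k
  have Q: "tendsto_L1 P Q (\<lambda>\<omega>. A t \<omega> - A s \<omega>)" unfolding Q_def p_def by (rule qsum_tendsto_L1[OF st])
  have Qi: "integrable P (Q k)" for k using Q by (simp add: tendsto_L1_def)
  note [measurable] = borel_measurable_integrable[OF Qi]
  have Ai: "integrable P (\<lambda>\<omega>. A t \<omega> - A s \<omega>)" using integrable_A st by auto
  have Ym: "Y r \<in> borel_measurable P" if "r \<in> {0..T}" for r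
    using square_integrable_Y[OF that] by (simp add: square_integrable_def)
  have [measurable]: "Y s \<in> borel_measurable P" "Y t \<in> borel_measurable P" "A s \<in> borel_measurable P" "A t \<in> borel_measurable P"
    using st by (auto intro!: Ym measurable_A)
  have hm[measurable]: "h \<in> borel_measurable P" by (rule measurable_F[OF h(1)])
  have Km: "0 \<le> K" using h(2) not_empty by fastforce
  define N where "N k \<omega> = (\<Sum>i<Suc k. f' (Y (p k i) \<omega>) * (Y (p k (Suc i)) \<omega> - Y (p k i) \<omega>))" for k \<omega>
  define S where "S k \<omega> = (\<Sum>i<Suc k. f'' (Y (p k i) \<omega>) *
      ((Y (p k (Suc i)) \<omega> - Y (p k i) \<omega>)\<^sup>2 - (A (p k (Suc i)) \<omega> - A (p k i) \<omega>)))" for k \<omega>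
  define L where "L \<omega> = f (Y t \<omega>) - f (Y s \<omega>) - Iint \<omega> / 2" for \<omega>
  define R where "R k \<omega> = L \<omega> - N k \<omega> - S k \<omega> / 2" for k \<omega>
  have bm: "integrable P (\<lambda>\<omega>. h \<omega> * g \<omega>)" if "integrable P g" for g
    by (rule Bochner_Integration.integrable_bound[where f="\<lambda>\<omega>. K * g \<omega>"])
      (use that h(2) Km in \<open>auto simp: abs_mult intro!: AE_I2 mult_right_mono\<close>)
  have ipk: "Suc k \<ge> Suc i" "Suc k \<ge> i" if "i < Suc k" for i k using that by auto
  have term1: "(\<integral>\<omega>. h \<omega> * (f' (Y (p k i) \<omega>) * (Y (p k (Suc i)) \<omega> - Y (p k i) \<omega>)) \<partial>P) = 0 \<and>
      integrable P (\<lambda>\<omega>. h \<omega> * (f' (Y (p k i) \<omega>) * (Y (p k (Suc i)) \<omega> - Y (p k i) \<omega>)))" if i: "i < Suc k" for k i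
  proof -
    have st': "0 \<le> p k i" "p k i \<le> p k (Suc i)" "p k (Suc i) \<le> T"
      using prange'[OF ipk(1)[OF i]] prange'[OF ipk(2)[OF i]] pmono by auto
    have m: "(\<lambda>\<omega>. h \<omega> * f' (Y (p k i) \<omega>)) \<in> borel_measurable (F (p k i))"
      using prange[OF ipk(2)[OF i]] prange'[OF ipk(2)[OF i]]
      by (intro borel_measurable_times measurable_F_mono[OF _ h(1)] measurable_compose[OF adapted measurable_f(2)]) auto
    have b: "\<bar>h \<omega> * f' (Y (p k i) \<omega>)\<bar> \<le> K * C1" if "\<omega> \<in> space P" for \<omega>
      unfolding abs_mult using h(2)[OF that] bound1 Km by (intro mult_mono) auto
    have sq: "square_integrable P (\<lambda>\<omega>. h \<omega> * f' (Y (p k i) \<omega>))"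
      by (rule square_integrable_bounded[OF measurable_F[OF m] b])
    show ?thesis
      using martingale_orthogonal[OF st' m sq]
        square_integrable_mult[OF sq square_integrable_diff[OF square_integrable_Y[of "p k (Suc i)"] square_integrable_Y[of "p k i"]]] st'
      by (simp add: mult.assoc)
  qed
  have term2: "(\<integral>\<omega>. h \<omega> * (f'' (Y (p k i) \<omega>) * ((Y (p k (Suc i)) \<omega> - Y (p k i) \<omega>)\<^sup>2 - (A (p k (Suc i)) \<omega> - A (p k i) \<omega>))) \<partial>P) = 0 \<and>
      integrable P (\<lambda>\<omega>. h \<omega> * (f'' (Y (p k i) \<omega>) * ((Y (p k (Suc i)) \<omega> - Y (p k i) \<omega>)\<^sup>2 - (A (p k (Suc i)) \<omega> - A (p k i) \<omega>))))" if i: "i < Suc k" for k i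
  proof -
    have st': "0 \<le> p k i" "p k i \<le> p k (Suc i)" "p k (Suc i) \<le> T"
      using prange'[OF ipk(1)[OF i]] prange'[OF ipk(2)[OF i]] pmono by auto
    have m: "(\<lambda>\<omega>. h \<omega> * f'' (Y (p k i) \<omega>)) \<in> borel_measurable (F (p k i))"
      using prange[OF ipk(2)[OF i]] prange'[OF ipk(2)[OF i]]
      by (intro borel_measurable_times measurable_F_mono[OF _ h(1)] measurable_compose[OF adapted measurable_f(3)]) auto
    have b: "\<bar>h \<omega> * f'' (Y (p k i) \<omega>)\<bar> \<le> K * C2" if "\<omega> \<in> space P" for \<omega>
      unfolding abs_mult using h(2)[OF that] bound2 Km by (intro mult_mono) auto
    have eq: "h \<omega> * (f'' (Y (p k i) \<omega>) * ((Y (p k (Suc i)) \<omega> - Y (p k i) \<omega>)\<^sup>2 - (A (p k (Suc i)) \<omega> - A (p k i) \<omega>))) =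
        h \<omega> * f'' (Y (p k i) \<omega>) * (Y (p k (Suc i)) \<omega> - Y (p k i) \<omega>)\<^sup>2 -
        h \<omega> * f'' (Y (p k i) \<omega>) * (A (p k (Suc i)) \<omega> - A (p k i) \<omega>)" for \<omega>
      by (simp only: mult.assoc right_diff_distrib)
    show ?thesis
      unfolding eq using square_increment[OF st' m b] martingale_square_increment(3)[OF st' m b]
      by simp
  qed
  have hN: "(\<integral>\<omega>. h \<omega> * N k \<omega> \<partial>P) = 0 \<and> integrable P (\<lambda>\<omega>. h \<omega> * N k \<omega>)" for k
    unfolding N_def sum_distrib_left using term1
    by (subst Bochner_Integration.integral_sum) (auto simp del: sum.lessThan_Suc intro!: Bochner_Integration.integrable_sum)
  have hS: "(\<integral>\<omega>. h \<omega> * S k \<omega> \<partial>P) = 0 \<and> integrable P (\<lambda>\<omega>. h \<omega> * S k \<omega>)" for k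
    unfolding S_def sum_distrib_left using term2
    by (subst Bochner_Integration.integral_sum) (auto simp del: sum.lessThan_Suc intro!: Bochner_Integration.integrable_sum)
  have ae: "AE \<omega> in P. set_integrable lborel {0..T} (a \<omega>) \<and> \<omega> \<in> space P \<and>
    (\<forall>s t. 0 \<le> s \<longrightarrow> s \<le> t \<longrightarrow> t \<le> T \<longrightarrow>
      A t \<omega> - A s \<omega> = (LBINT r:{s..t}. a \<omega> r) \<and> 0 \<le> (LBINT r:{s..t}. a \<omega> r))"
    using A_increment AE_space by eventually_elim auto
  \<comment> \<open>Stated for an arbitrary oscillation \<open>e\<close>: with \<open>2 * C2\<close>
    it provides the majorant, with small \<open>e\<close> the almost sure convergence.\<close>
  have bound: "\<bar>R k \<omega>\<bar> \<le> e * (Q k \<omega> + (A t \<omega> - A s \<omega>))"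
    if \<omega>: "set_integrable lborel {0..T} (a \<omega>) \<and> \<omega> \<in> space P \<and>
      (\<forall>s t. 0 \<le> s \<longrightarrow> s \<le> t \<longrightarrow> t \<le> T \<longrightarrow>
      A t \<omega> - A s \<omega> = (LBINT r:{s..t}. a \<omega> r) \<and> 0 \<le> (LBINT r:{s..t}. a \<omega> r))"
    and e: "\<And>i r r'. i < Suc k \<Longrightarrow> r \<in> {p k i..p k (Suc i)} \<Longrightarrow> r' \<in> {p k i..p k (Suc i)} \<Longrightarrow>
       \<bar>f'' (Y r \<omega>) - f'' (Y r' \<omega>)\<bar> \<le> e" for k \<omega> e
  proof -
    have ai: "set_integrable lborel {p k 0..p k (Suc k)} (a \<omega>)"
      unfolding pends by (rule set_integrable_subset[of _ "{0..T}"]) (use \<omega> st in auto)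
    have co: "continuous_on {p k 0..p k (Suc k)} (\<lambda>r. Y r \<omega>)"
      unfolding pends by (rule continuous_on_subset[OF paths]) (use \<omega> st in auto)
    have S: "S k \<omega> = (\<Sum>i<Suc k. f'' (Y (p k i) \<omega>) *
      ((Y (p k (Suc i)) \<omega> - Y (p k i) \<omega>)\<^sup>2 - (LBINT r:{p k i..p k (Suc i)}. a \<omega> r)))"
      unfolding S_def
    proof (intro sum.cong refl)
      fix i assume "i \<in> {..<Suc k}"
      then have "A (p k (Suc i)) \<omega> - A (p k i) \<omega> = (LBINT r:{p k i..p k (Suc i)}. a \<omega> r)"
        using \<omega> prange'[of i k] prange'[of "Suc i" k] pmono[of k i] by auto
      then show "f'' (Y (p k i) \<omega>) * ((Y (p k (Suc i)) \<omega> - Y (p k i) \<omega>)\<^sup>2 - (A (p k (Suc i)) \<omega> - A (p k i) \<omega>))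
        = f'' (Y (p k i) \<omega>) * ((Y (p k (Suc i)) \<omega> - Y (p k i) \<omega>)\<^sup>2 - (LBINT r:{p k i..p k (Suc i)}. a \<omega> r))"
        by simp
    qed
    have At: "A t \<omega> - A s \<omega> = (LBINT r:{s..t}. a \<omega> r)" using \<omega> st by auto
    from ito_remainder_bound[where n="Suc k" and p="p k" and Y="\<lambda>r. Y r \<omega>", OF pmono co ai density_nonneg e]
    show ?thesis
      unfolding R_def S L_def N_def Iint_def Q_def qsum_def At pends by simp
  qed
  have Rbound: "AE \<omega> in P. \<bar>R k \<omega>\<bar> \<le> 2 * C2 * (Q k \<omega> + (A t \<omega> - A s \<omega>))" for k
    using ae
  proof eventually_elim
    case (elim \<omega>)
    show ?case
    proof (rule bound[OF elim])
      show "\<bar>f'' (Y r \<omega>) - f'' (Y r' \<omega>)\<bar> \<le> 2 * C2" for r r'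
        using bound2[of "Y r \<omega>"] bound2[of "Y r' \<omega>"] by linarith
    qed
  qed
  have Rlim0: "(\<lambda>k. R (r k) \<omega>) \<longlonglongrightarrow> 0" if \<omega>: "set_integrable lborel {0..T} (a \<omega>) \<and> \<omega> \<in> space P \<and>
      (\<forall>s t. 0 \<le> s \<longrightarrow> s \<le> t \<longrightarrow> t \<le> T \<longrightarrow>
      A t \<omega> - A s \<omega> = (LBINT r:{s..t}. a \<omega> r) \<and> 0 \<le> (LBINT r:{s..t}. a \<omega> r))"
    and r: "strict_mono r" and Qr: "(\<lambda>k. Q (r k) \<omega>) \<longlonglongrightarrow> A t \<omega> - A s \<omega>" for \<omega> and r :: "nat \<Rightarrow> nat"
  proof (rule tendstoI)
    fix e :: real assume e: "e > 0"
    \<comment> \<open>Eventually \<open>Q\<close> is below its limit plus 1, so \<open>B\<close>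
      bounds the factor that multiplies the oscillation; the 2 in \<open>e / (2 * B)\<close> makes
      the final inequality strict.\<close>
    define B where "B = 2 * (A t \<omega> - A s \<omega>) + 1"
    have B: "B > 0" using \<omega> st unfolding B_def by (smt (verit))
    have "uniformly_continuous_on {s..t} (\<lambda>r. f'' (Y r \<omega>))"
      by (intro compact_uniformly_continuous continuous_on_compose2[OF cont2] continuous_on_subset[OF paths])
        (use \<omega> st in auto)
    then obtain \<delta> where \<delta>: "\<delta> > 0" "\<And>r r'. r \<in> {s..t} \<Longrightarrow> r' \<in> {s..t} \<Longrightarrow> dist r' r < \<delta> \<Longrightarrow>
        dist (f'' (Y r' \<omega>)) (f'' (Y r \<omega>)) < e / (2 * B)"
      using e B unfolding uniformly_continuous_on_def by (metis divide_pos_pos mult_pos_pos zero_less_numeral)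
    have "\<forall>\<^sub>F k in sequentially. (t - s) / real (Suc k) < \<delta>" by (rule eventually_uniform_step_less[OF \<delta>(1)])
    then have "\<forall>\<^sub>F k in sequentially. (t - s) / real (Suc (r k)) < \<delta>"
      by (rule eventually_compose_filterlim[OF _ filterlim_subseq[OF r]])
    moreover have "\<forall>\<^sub>F k in sequentially. Q (r k) \<omega> < A t \<omega> - A s \<omega> + 1"
      by (rule order_tendstoD(2)[OF Qr]) simp
    ultimately show "\<forall>\<^sub>F k in sequentially. dist (R (r k) \<omega>) 0 < e"
    proof eventually_elim
      case (elim k)
      have "\<bar>R (r k) \<omega>\<bar> \<le> e / (2 * B) * (Q (r k) \<omega> + (A t \<omega> - A s \<omega>))"
      proof (rule bound[OF \<omega>])
        fix i u u' assume i: "i < Suc (r k)" and u: "u \<in> {p (r k) i..p (r k) (Suc i)}" "u' \<in> {p (r k) i..p (r k) (Suc i)}"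
        have "dist u' u \<le> p (r k) (Suc i) - p (r k) i" using u by (auto simp: dist_real_def)
        also have "\<dots> < \<delta>" using elim(1) unfolding p_def uniform_points_step .
        finally have "dist (f'' (Y u' \<omega>)) (f'' (Y u \<omega>)) < e / (2 * B)"
          using prange[of i "r k"] prange[of "Suc i" "r k"] i u by (intro \<delta>(2)) auto
        then show "\<bar>f'' (Y u \<omega>) - f'' (Y u' \<omega>)\<bar> \<le> e / (2 * B)" by (auto simp: dist_real_def)
      qed
      also have "\<dots> \<le> e / (2 * B) * B"
        using elim e B by (intro mult_left_mono) (auto simp: B_def)
      also have "\<dots> < e" using e B by (simp add: field_simps)
      finally show ?case by (simp add: dist_real_def)
    qed
  qed
  have Lm[measurable]: "L \<in> borel_measurable P" unfolding L_def by measurable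
  have Rm[measurable]: "R k \<in> borel_measurable P" for k
  proof -
    have [measurable]: "Y (p k i) \<in> borel_measurable P" "A (p k i) \<in> borel_measurable P" if "i \<le> Suc k" for i
      using prange'[OF that] by (auto intro!: Ym measurable_A)
    have "N k \<in> borel_measurable P" "S k \<in> borel_measurable P"
      unfolding N_def S_def by (auto intro!: borel_measurable_sum)
    then show ?thesis unfolding R_def by measurable
  qed
  have Rlim: "(\<lambda>k. \<integral>\<omega>. \<bar>R k \<omega>\<bar> \<partial>P) \<longlonglongrightarrow> 0"
  proof (rule integral_abs_tendsto_0_L1_dominated_subseq[OF Q Rm Rbound])
    show "0 \<le> 2 * C2" using C2_nonneg by simp
    show "AE \<omega> in P. 0 \<le> A t \<omega> - A s \<omega>" using ae by eventually_elim (use st in auto)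
    fix r :: "nat \<Rightarrow> nat" assume r: "strict_mono r"
    have "tendsto_prob P (\<lambda>k. Q (r k)) (\<lambda>\<omega>. A t \<omega> - A s \<omega>)"
      by (rule tendsto_L1_imp_prob[OF tendsto_L1_subseq[OF Q r]])
    then obtain r' :: "nat \<Rightarrow> nat" where r': "strict_mono r'" "AE \<omega> in P. (\<lambda>k. Q (r (r' k)) \<omega>) \<longlonglongrightarrow> A t \<omega> - A s \<omega>"
      using tendsto_prob_AE_subseq[of "\<lambda>k. Q (r k)" "\<lambda>\<omega>. A t \<omega> - A s \<omega>"] by auto
    have rr': "strict_mono (\<lambda>k. r (r' k))" using r r' by (auto simp: strict_mono_def)
    have "AE \<omega> in P. (\<lambda>k. R (r (r' k)) \<omega>) \<longlonglongrightarrow> 0"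
      using ae r'(2) by eventually_elim (rule Rlim0[OF _ rr'])
    with r'(1) show "\<exists>r'. strict_mono r' \<and> (AE \<omega> in P. (\<lambda>k. R (r (r' k)) \<omega>) \<longlonglongrightarrow> 0)" by blast
  qed
  have fY: "integrable P (\<lambda>\<omega>. f (Y r \<omega>))" if "r \<in> {0..T}" for r
  proof (rule Bochner_Integration.integrable_bound[where f="\<lambda>\<omega>. \<bar>f 0\<bar> + C1 * \<bar>Y r \<omega>\<bar>"])
    show "integrable P (\<lambda>\<omega>. \<bar>f 0\<bar> + C1 * \<bar>Y r \<omega>\<bar>)"
      using square_integrable_imp_integrable'[OF square_integrable_Y[OF that]] by auto
    show "(\<lambda>\<omega>. f (Y r \<omega>)) \<in> borel_measurable P" using Ym[OF that] by measurable
  qed (use linear_growth in \<open>auto intro: order_trans[OF _ abs_ge_self]\<close>)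
  have Ii: "integrable P Iint"
  proof (rule Bochner_Integration.integrable_bound[where f="\<lambda>\<omega>. C2 * (A t \<omega> - A s \<omega>)"])
    show "AE \<omega> in P. norm (Iint \<omega>) \<le> norm (C2 * (A t \<omega> - A s \<omega>))"
      using ae
    proof eventually_elim
      case (elim \<omega>)
      have ai: "set_integrable lborel {s..t} (a \<omega>)"
        by (rule set_integrable_subset[of _ "{0..T}"]) (use elim st in auto)
      have co: "continuous_on {s..t} (\<lambda>r. f'' (Y r \<omega>))"
        by (intro continuous_on_compose2[OF cont2] continuous_on_subset[OF paths]) (use elim st in auto)
      have fai: "set_integrable lborel {s..t} (\<lambda>r. f'' (Y r \<omega>) * a \<omega> r)"
        by (rule set_integrable_bounded_mult[OF ai _ set_borel_measurable_continuous_lborel[OF co], where C=C2])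
          (auto intro: bound2)
      have "\<bar>Iint \<omega>\<bar> \<le> (LBINT r:{s..t}. \<bar>f'' (Y r \<omega>) * a \<omega> r\<bar>)"
        unfolding Iint_def using set_integral_norm_bound[OF fai] by simp
      also have "\<dots> \<le> (LBINT r:{s..t}. C2 * a \<omega> r)"
        by (rule set_integral_mono)
          (use set_integrable_abs[OF fai] ai bound2 density_nonneg in \<open>auto simp: abs_mult intro!: mult_right_mono\<close>)
      also have "\<dots> = C2 * (A t \<omega> - A s \<omega>)" using elim st by auto
      finally show ?case by simp
    qed
  qed (use Ai in auto)
  have Li: "integrable P L" unfolding L_def using fY Ii st by auto
  have Ri: "integrable P (R k)" for k
    by (rule Bochner_Integration.integrable_bound[where f="\<lambda>\<omega>. 2 * C2 * (Q k \<omega> + (A t \<omega> - A s \<omega>))"])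
      (use Qi Ai Rbound[of k] in \<open>auto elim!: eventually_mono\<close>)
  have "\<bar>\<integral>\<omega>. h \<omega> * L \<omega> \<partial>P\<bar> \<le> K * (\<integral>\<omega>. \<bar>R k \<omega>\<bar> \<partial>P)" for k
  proof -
    have "(\<integral>\<omega>. h \<omega> * R k \<omega> \<partial>P) = (\<integral>\<omega>. h \<omega> * L \<omega> - h \<omega> * N k \<omega> - (h \<omega> * S k \<omega>) / 2 \<partial>P)"
      by (intro Bochner_Integration.integral_cong) (auto simp: R_def algebra_simps)
    also have "\<dots> = (\<integral>\<omega>. h \<omega> * L \<omega> \<partial>P)" using hN[of k] hS[of k] bm[OF Li] by simp
    finally have "\<bar>\<integral>\<omega>. h \<omega> * L \<omega> \<partial>P\<bar> = \<bar>\<integral>\<omega>. h \<omega> * R k \<omega> \<partial>P\<bar>" by simp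
    also have "\<dots> \<le> (\<integral>\<omega>. \<bar>h \<omega> * R k \<omega>\<bar> \<partial>P)" by (rule integral_abs_bound)
    also have "\<dots> \<le> (\<integral>\<omega>. K * \<bar>R k \<omega>\<bar> \<partial>P)"
    proof (rule integral_mono)
      show "integrable P (\<lambda>\<omega>. \<bar>h \<omega> * R k \<omega>\<bar>)" by (rule integrable_abs[OF bm[OF Ri]])
    qed (use Ri h(2) in \<open>auto simp: abs_mult intro!: mult_right_mono\<close>)
    finally show ?thesis by simp
  qed
  moreover have "(\<lambda>k. K * (\<integral>\<omega>. \<bar>R k \<omega>\<bar> \<partial>P)) \<longlonglongrightarrow> K * 0" by (intro tendsto_intros Rlim)
  ultimately have "\<bar>\<integral>\<omega>. h \<omega> * L \<omega> \<partial>P\<bar> \<le> K * 0"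
    by (intro LIMSEQ_le_const[of _ "K * 0"]) auto
  then show ?thesis by (simp add: L_def Iint_def)
qed

end

section \<open>Sums of products of increments\<close>

text \<open>Diagonal argument: beyond index \<open>j\<close> the diagonal sequence is a subsequence
  of the \<open>j\<close>-th one, hence the shift by \<open>Suc j\<close>. It serves to let sums
  stopped at countably many times converge along one common subsequence.\<close>

lemma (in prob_space) countable_tendsto_prob_AE_subseq:
  assumes X: "\<And>j. tendsto_prob M (X j) (Z j)"
    and m: "\<And>j n. X j n \<in> borel_measurable M" "\<And>j. Z j \<in> borel_measurable M"
  shows "\<exists>r::nat\<Rightarrow>nat. strict_mono r \<and> (AE x in M. \<forall>j::nat. (\<lambda>n. X j (r n) x) \<longlonglongrightarrow> Z j x)"
proof -
  interpret subseqs "\<lambda>j s. AE x in M. (\<lambda>n. X j (s n) x) \<longlonglongrightarrow> Z j x"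
  proof
    fix j and s :: "nat \<Rightarrow> nat" assume "strict_mono s"
    then have "tendsto_prob M (\<lambda>n. X j (s n)) (Z j)" by (rule tendsto_prob_subseq[OF X])
    then show "\<exists>r'. strict_mono r' \<and> (AE x in M. (\<lambda>n. X j ((s \<circ> r') n) x) \<longlonglongrightarrow> Z j x)"
      unfolding comp_def by (rule tendsto_prob_AE_subseq) (rule m)+
  qed
  have "AE x in M. (\<lambda>n. X j (diagseq n) x) \<longlonglongrightarrow> Z j x" for j
  proof -
    have "AE x in M. (\<lambda>n. X j ((diagseq \<circ> ((+) (Suc j))) n) x) \<longlonglongrightarrow> Z j x"
    proof (rule diagseq_holds)
      fix r s :: "nat \<Rightarrow> nat" and n assume r: "strict_mono r"
        and "AE x in M. (\<lambda>na. X n (s na) x) \<longlonglongrightarrow> Z n x"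
      from this(2) show "AE x in M. (\<lambda>na. X n ((s \<circ> r) na) x) \<longlonglongrightarrow> Z n x"
      proof eventually_elim
        case (elim x)
        from LIMSEQ_subseq_LIMSEQ[OF this r] show ?case by (simp add: comp_def)
      qed
    qed
    then show ?thesis
    proof eventually_elim
      case (elim x)
      then have "(\<lambda>n. X j (diagseq (n + Suc j)) x) \<longlonglongrightarrow> Z j x" by (simp add: comp_def add.commute)
      then show ?case by (rule LIMSEQ_offset)
    qed
  qed
  then show ?thesis using subseq_diagseq by (auto simp: AE_all_countable)
qed

text \<open>The sum is the step function equal to \<open>c l\<close> on
  \<open>[s l, s (Suc l))\<close> and to 0 from \<open>s m\<close> on. It is written with indicators
  of half-lines because convergence will be known for sums cut off at a time.\<close>

lemma step_function_value:
  fixes s :: "nat \<Rightarrow> real" and c :: "nat \<Rightarrow> real"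
  assumes mono: "\<And>l. s l \<le> s (Suc l)" and x: "s 0 \<le> x"
  shows "(x < s m \<longrightarrow> (\<exists>l<m. s l \<le> x \<and> x < s (Suc l) \<and>
      (\<Sum>l<m. c l * (of_bool (x < s (Suc l)) - of_bool (x < s l))) = c l)) \<and>
    (s m \<le> x \<longrightarrow> (\<Sum>l<m. c l * (of_bool (x < s (Suc l)) - of_bool (x < s l))) = 0)"
proof (induction m)
  case (Suc m)
  have le: "s m \<le> s (Suc m)" by (rule mono)
  consider "x < s m" | "s m \<le> x" "x < s (Suc m)" | "s (Suc m) \<le> x" by linarith
  then show ?case
  proof cases
    case 1
    then obtain l where l: "l < m" "s l \<le> x" "x < s (Suc l)"
        "(\<Sum>l<m. c l * (of_bool (x < s (Suc l)) - of_bool (x < s l))) = c l"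
      using Suc by blast
    then show ?thesis using 1 le by (auto intro!: exI[of _ l])
  next
    case 2
    then show ?thesis using Suc by (auto intro!: exI[of _ m])
  next
    case 3
    then show ?thesis using Suc le by auto
  qed
qed (use x in auto)

text \<open>The two sums differ only in the partition interval that has \<open>q\<close> in its interior.\<close>

lemma stopped_sum_diff_bound:
  fixes Y Z :: "real \<Rightarrow> real" and p :: "nat \<Rightarrow> real"
  assumes p: "\<And>i. i < N \<Longrightarrow> p i \<le> p (Suc i)"
    and osc: "\<And>i x x'. i < N \<Longrightarrow> x \<in> {p i..p (Suc i)} \<Longrightarrow> x' \<in> {p i..p (Suc i)} \<Longrightarrow>
      \<bar>Y x - Y x'\<bar> \<le> \<eta> \<and> \<bar>Z x - Z x'\<bar> \<le> \<eta>" and \<eta>: "\<eta> \<ge> 0"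
  shows "\<bar>(\<Sum>i<N. of_bool (p i < q) * ((Y (p (Suc i)) - Y (p i)) * (Z (p (Suc i)) - Z (p i)))) -
     (\<Sum>i<N. (Y (min (p (Suc i)) q) - Y (min (p i) q)) * (Z (min (p (Suc i)) q) - Z (min (p i) q)))\<bar> \<le> 2 * (\<eta> * \<eta>)"
proof -
  define D where "D i = of_bool (p i < q) * ((Y (p (Suc i)) - Y (p i)) * (Z (p (Suc i)) - Z (p i))) -
     (Y (min (p (Suc i)) q) - Y (min (p i) q)) * (Z (min (p (Suc i)) q) - Z (min (p i) q))" for i
  define I where "I = {i. i < N \<and> p i < q \<and> q < p (Suc i)}"
  have D0: "D i = 0" if "i < N" "i \<notin> I" for i
  proof (cases "p i < q")
    case True
    then show ?thesis using that by (simp add: D_def I_def min_def)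
  next
    case False
    then have "min (p (Suc i)) q = min (p i) q" using p[OF that(1)] by simp
    then show ?thesis using False by (simp add: D_def)
  qed
  have D1: "\<bar>D i\<bar> \<le> 2 * (\<eta> * \<eta>)" if "i \<in> I" for i
  proof -
    have i: "i < N" "p i < q" "q < p (Suc i)" using that by (auto simp: I_def)
    have o: "\<bar>Y x - Y x'\<bar> \<le> \<eta>" "\<bar>Z x - Z x'\<bar> \<le> \<eta>" if "x \<in> {p i..p (Suc i)}" "x' \<in> {p i..p (Suc i)}" for x x'
      using osc[OF i(1) that] by auto
    have 1: "\<bar>(Y (p (Suc i)) - Y (p i)) * (Z (p (Suc i)) - Z (p i))\<bar> \<le> \<eta> * \<eta>"
      unfolding abs_mult using i \<eta> by (intro mult_mono o) auto
    have 2: "\<bar>(Y q - Y (p i)) * (Z q - Z (p i))\<bar> \<le> \<eta> * \<eta>"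
      unfolding abs_mult using i \<eta> by (intro mult_mono o) auto
    show ?thesis using 1 2 i by (simp add: D_def min_def)
  qed
  have fin: "finite I" by (simp add: I_def)
  have uniq: "i = j" if "i \<in> I" "j \<in> I" for i j
  proof -
    have "\<not> i < j" if "i \<in> I" "j \<in> I" for i j
      using partition_mono[of N p "Suc i" j] p that by (force simp: I_def)
    with that show ?thesis by (metis nat_neq_iff)
  qed
  have card: "card I \<le> 1" using uniq by (simp add: card_le_Suc0_iff_eq[OF fin])
  have "(\<Sum>i<N. D i) = (\<Sum>i\<in>I. D i)"
    using D0 by (intro sum.mono_neutral_right) (auto simp: I_def)
  also have "\<bar>\<dots>\<bar> \<le> (\<Sum>i\<in>I. \<bar>D i\<bar>)" by (rule sum_abs)
  also have "\<dots> \<le> of_nat (card I) * (2 * (\<eta> * \<eta>))" using D1 by (intro sum_bounded_above) auto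
  also have "\<dots> \<le> 1 * (2 * (\<eta> * \<eta>))" using card \<eta> by (intro mult_right_mono) auto
  finally show ?thesis by (simp add: D_def sum_subtractf)
qed

lemma uniform_modulus:
  fixes c :: "real \<Rightarrow> real"
  assumes "continuous_on {a..b} c" "e > 0"
  obtains \<delta> where "\<delta> > 0" "\<And>x y. x \<in> {a..b} \<Longrightarrow> y \<in> {a..b} \<Longrightarrow> \<bar>x - y\<bar> < \<delta> \<Longrightarrow> \<bar>c x - c y\<bar> \<le> e"
proof -
  have "uniformly_continuous_on {a..b} c" by (rule compact_uniformly_continuous[OF assms(1)]) simp
  then obtain \<delta> where "\<delta> > 0" "\<And>x y. x \<in> {a..b} \<Longrightarrow> y \<in> {a..b} \<Longrightarrow> dist y x < \<delta> \<Longrightarrow> dist (c y) (c x) < e"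
    using assms(2) unfolding uniformly_continuous_on_def by metis
  then show ?thesis by (intro that[of \<delta>]) (auto simp: dist_real_def less_imp_le)
qed

text \<open>Weak convergence of signed measures: the products of increments, placed at the left ends
  of the partition intervals, form measures of total variation at most \<open>B\<close>, and
  \<open>conv\<close> amounts to convergence of their distribution functions at the points of all
  uniform grids. Hence integrals of step functions on such grids converge; the continuous
  \<open>c\<close>, and with it the weights \<open>w\<close>, are uniformly close to a step
  function.\<close>

lemma weighted_sums_tendsto:
  fixes Y Z c g :: "real \<Rightarrow> real" and p w :: "nat \<Rightarrow> nat \<Rightarrow> real" and N :: "nat \<Rightarrow> nat"
  assumes t: "0 \<le> t"
    and part: "\<And>n. interval_partition t (N n) (p n)" and mesh: "mesh_vanishes N p"
    and cY: "continuous_on {0..t} Y" and cZ: "continuous_on {0..t} Z" and cc: "continuous_on {0..t} c"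
    and g: "set_integrable lborel {0..t} g"
    and B: "\<And>n. (\<Sum>i<N n. \<bar>(Y (p n (Suc i)) - Y (p n i)) * (Z (p n (Suc i)) - Z (p n i))\<bar>) \<le> B"
    and w: "\<And>e. e > 0 \<Longrightarrow> \<forall>\<^sub>F n in sequentially. \<forall>i<N n. \<bar>w n i - c (p n i)\<bar> \<le> e"
    and conv: "\<And>l k. l \<le> Suc k \<Longrightarrow>
      (\<lambda>n. \<Sum>i<N n. (Y (min (p n (Suc i)) (uniform_points 0 t k l)) - Y (min (p n i) (uniform_points 0 t k l))) *
         (Z (min (p n (Suc i)) (uniform_points 0 t k l)) - Z (min (p n i) (uniform_points 0 t k l))))
      \<longlonglongrightarrow> (LBINT r:{0..uniform_points 0 t k l}. g r)"
  shows "(\<lambda>n. \<Sum>i<N n. w n i * ((Y (p n (Suc i)) - Y (p n i)) * (Z (p n (Suc i)) - Z (p n i))))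
    \<longlonglongrightarrow> (LBINT r:{0..t}. c r * g r)"
proof (rule tendstoI)
  fix \<epsilon> :: real assume \<epsilon>: "\<epsilon> > 0"
  define d where "d n i = (Y (p n (Suc i)) - Y (p n i)) * (Z (p n (Suc i)) - Z (p n i))" for n i
  define G where "G = (LBINT r:{0..t}. \<bar>g r\<bar>)"
  have G0: "0 \<le> G" unfolding G_def set_lebesgue_integral_def by (intro Bochner_Integration.integral_nonneg) auto
  have B0: "0 \<le> B" using B[of 0] by (rule order_trans[rotated]) (intro sum_nonneg, simp)
  \<comment> \<open>With this \<open>e\<close> the error \<open>2 * e * B\<close> of the sums and
    the error \<open>e * G\<close> of the limit together stay below half of \<epsilon>; the other
    half is left for the convergence of \<open>W\<close> to \<open>V\<close>.\<close>
  define e where "e = \<epsilon> / (2 * (2 * B + G + 1))"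
  have e: "e > 0" "e * (2 * B + G) < \<epsilon> / 2"
  proof -
    show "e > 0" using \<epsilon> B0 G0 by (simp add: e_def)
    then have "e * (2 * B + G) < e * (2 * B + G + 1)" by simp
    also have "\<dots> = \<epsilon> / 2"
    proof -
      have "x / (2 * y) * y = x / 2" if "y > 0" for x y :: real using that by simp
      from this[of "2 * B + G + 1" \<epsilon>] show ?thesis using B0 G0 by (simp add: e_def)
    qed
    finally show "e * (2 * B + G) < \<epsilon> / 2" .
  qed
  have pm: "p n i \<le> p n (Suc i)" if "i < N n" for n i using part[of n] that by (auto simp: interval_partition_def)
  have pr: "p n i \<in> {0..t}" if "i \<le> N n" for n i
    using partition_mono[of "N n" "p n" 0 i] partition_mono[of "N n" "p n" i "N n"] pm that part[of n]
    by (auto simp: interval_partition_def)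
  obtain \<delta> where \<delta>: "\<delta> > 0" "\<And>x y. x \<in> {0..t} \<Longrightarrow> y \<in> {0..t} \<Longrightarrow> \<bar>x - y\<bar> < \<delta> \<Longrightarrow> \<bar>c x - c y\<bar> \<le> e"
    using uniform_modulus[OF cc e(1)] by blast
  obtain K where K: "(t - 0) / real (Suc K) < \<delta>"
    using eventually_happens'[OF _ eventually_uniform_step_less[OF \<delta>(1), of t 0]] by auto
  define s where "s = uniform_points 0 t K"
  have sm: "s l \<le> s (Suc l)" for l unfolding s_def by (rule uniform_points_mono[OF t])
  have send: "s 0 = 0" "s (Suc K) = t" by (simp_all add: s_def)
  have sr: "s l \<in> {0..t}" if "l \<le> Suc K" for l
    using partition_mono[of "Suc K" s 0 l] partition_mono[of "Suc K" s l "Suc K"] sm that send by auto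
  have sstep: "s (Suc l) - s l < \<delta>" for l using K by (simp only: s_def uniform_points_step)
  \<comment> \<open>\<open>F n q\<close> takes whole increments of the intervals starting before
    \<open>q\<close>, whereas \<open>conv\<close> speaks of increments of paths stopped at
    \<open>q\<close>; the difference vanishes with the oscillation of the paths.\<close>
  define F where "F n q = (\<Sum>i<N n. of_bool (p n i < q) * d n i)" for n q
  have Flim: "(\<lambda>n. F n (s l)) \<longlonglongrightarrow> (LBINT r:{0..s l}. g r)" if l: "l \<le> Suc K" for l
  proof -
    define S where "S n = (\<Sum>i<N n. (Y (min (p n (Suc i)) (s l)) - Y (min (p n i) (s l))) *
        (Z (min (p n (Suc i)) (s l)) - Z (min (p n i) (s l))))" for n
    have Slim: "S \<longlonglongrightarrow> (LBINT r:{0..s l}. g r)" using conv[OF l] unfolding S_def s_def by simp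
    have "(\<lambda>n. F n (s l) - S n) \<longlonglongrightarrow> 0"
    proof (rule tendstoI)
      fix \<kappa> :: real assume \<kappa>: "\<kappa> > 0"
      define \<eta> where "\<eta> = min 1 (\<kappa> / 3)"
      have \<eta>: "\<eta> > 0" "2 * (\<eta> * \<eta>) < \<kappa>"
      proof -
        show "\<eta> > 0" using \<kappa> by (simp add: \<eta>_def)
        have "\<eta> * \<eta> \<le> 1 * (\<kappa> / 3)" using \<kappa> by (intro mult_mono) (auto simp: \<eta>_def)
        then show "2 * (\<eta> * \<eta>) < \<kappa>" using \<kappa> by simp
      qed
      obtain \<delta>1 where \<delta>1: "\<delta>1 > 0" "\<And>x y. x \<in> {0..t} \<Longrightarrow> y \<in> {0..t} \<Longrightarrow> \<bar>x - y\<bar> < \<delta>1 \<Longrightarrow> \<bar>Y x - Y y\<bar> \<le> \<eta>"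
        using uniform_modulus[OF cY \<eta>(1)] by blast
      obtain \<delta>2 where \<delta>2: "\<delta>2 > 0" "\<And>x y. x \<in> {0..t} \<Longrightarrow> y \<in> {0..t} \<Longrightarrow> \<bar>x - y\<bar> < \<delta>2 \<Longrightarrow> \<bar>Z x - Z y\<bar> \<le> \<eta>"
        using uniform_modulus[OF cZ \<eta>(1)] by blast
      have "\<forall>\<^sub>F n in sequentially. \<forall>i<N n. p n (Suc i) - p n i < min \<delta>1 \<delta>2"
      proof -
        have "min \<delta>1 \<delta>2 > 0" using \<delta>1(1) \<delta>2(1) by simp
        then show ?thesis using mesh unfolding mesh_vanishes_def by blast
      qed
      then show "\<forall>\<^sub>F n in sequentially. dist (F n (s l) - S n) 0 < \<kappa>"
      proof eventually_elim
        case (elim n)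
        have "\<bar>F n (s l) - S n\<bar> \<le> 2 * (\<eta> * \<eta>)"
          unfolding F_def S_def d_def
        proof (rule stopped_sum_diff_bound)
          fix i x x' assume i: "i < N n" "x \<in> {p n i..p n (Suc i)}" "x' \<in> {p n i..p n (Suc i)}"
          have "x \<in> {0..t}" "x' \<in> {0..t}" using pr[of i n] pr[of "Suc i" n] i by auto
          moreover have "\<bar>x - x'\<bar> < \<delta>1" "\<bar>x - x'\<bar> < \<delta>2" using elim i by (auto simp: abs_if)+
          ultimately show "\<bar>Y x - Y x'\<bar> \<le> \<eta> \<and> \<bar>Z x - Z x'\<bar> \<le> \<eta>" using \<delta>1(2) \<delta>2(2) by blast
        qed (use pm \<eta> in auto)
        then show ?case using \<eta> by simp
      qed
    qed
    from tendsto_add[OF this Slim] show ?thesis by simp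
  qed
  define W where "W n = (\<Sum>l<Suc K. c (s l) * (F n (s (Suc l)) - F n (s l)))" for n
  define V where "V = (\<Sum>l<Suc K. c (s l) * ((LBINT r:{0..s (Suc l)}. g r) - (LBINT r:{0..s l}. g r)))"
  have Wlim: "W \<longlonglongrightarrow> V" unfolding W_def[abs_def] V_def by (intro tendsto_sum tendsto_mult tendsto_const tendsto_diff Flim) auto
  have VG: "\<bar>V - (LBINT r:{0..t}. c r * g r)\<bar> \<le> e * G"
  proof -
    have gsub: "set_integrable lborel {s l..s (Suc l)} g" if "l < Suc K" for l
      using sr[of l] sr[of "Suc l"] that by (intro set_integrable_subset[OF g]) auto
    have cg: "set_integrable lborel {0..t} (\<lambda>r. c r * g r)"
    proof -
      have "bounded (c ` {0..t})" by (intro compact_imp_bounded compact_continuous_image cc) simp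
      then obtain C where "\<forall>x\<in>{0..t}. \<bar>c x\<bar> \<le> C" by (auto simp: bounded_iff)
      then show ?thesis
        by (intro set_integrable_bounded_mult[OF g _ set_borel_measurable_continuous_lborel[OF cc], where C=C]) auto
    qed
    have cgsub: "set_integrable lborel {s l..s (Suc l)} (\<lambda>r. c r * g r)" if "l < Suc K" for l
      using sr[of l] sr[of "Suc l"] that by (intro set_integrable_subset[OF cg]) auto
    have 1: "(LBINT r:{0..s (Suc l)}. g r) - (LBINT r:{0..s l}. g r) = (LBINT r:{s l..s (Suc l)}. g r)" if l: "l < Suc K" for l
    proof -
      have "set_integrable lborel {0..s (Suc l)} g"
        using sr[of "Suc l"] l by (intro set_integrable_subset[OF g]) auto
      from set_lborel_integral_split[OF this, of "s l"] show ?thesis using sr[of l] sm[of l] l by auto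
    qed
    have 2: "(LBINT r:{0..t}. c r * g r) = (\<Sum>l<Suc K. LBINT r:{s l..s (Suc l)}. c r * g r)"
      using set_lborel_integral_sum[of "Suc K" s "\<lambda>r. c r * g r"] sm cg send by simp
    have ga: "set_integrable lborel {0..t} (\<lambda>r. \<bar>g r\<bar>)" by (rule set_integrable_abs[OF g])
    have 3: "G = (\<Sum>l<Suc K. LBINT r:{s l..s (Suc l)}. \<bar>g r\<bar>)"
      using set_lborel_integral_sum[of "Suc K" s "\<lambda>r. \<bar>g r\<bar>"] sm ga send by (simp add: G_def)
    have eq: "V - (LBINT r:{0..t}. c r * g r) =
      (\<Sum>l<Suc K. c (s l) * (LBINT r:{s l..s (Suc l)}. g r) - (LBINT r:{s l..s (Suc l)}. c r * g r))"
      unfolding V_def 2 sum_subtractf[symmetric] by (intro sum.cong refl) (use 1 in auto)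
    have "\<bar>c (s l) * (LBINT r:{s l..s (Suc l)}. g r) - (LBINT r:{s l..s (Suc l)}. c r * g r)\<bar>
      \<le> e * (LBINT r:{s l..s (Suc l)}. \<bar>g r\<bar>)" if l: "l < Suc K" for l
    proof -
      have i: "set_integrable lborel {s l..s (Suc l)} (\<lambda>r. c (s l) * g r)" using gsub[OF l] by simp
      have "c (s l) * (LBINT r:{s l..s (Suc l)}. g r) - (LBINT r:{s l..s (Suc l)}. c r * g r)
          = (LBINT r:{s l..s (Suc l)}. c (s l) * g r - c r * g r)"
        using set_integral_diff(2)[OF i cgsub[OF l]] by simp
      also have "\<bar>\<dots>\<bar> \<le> (LBINT r:{s l..s (Suc l)}. \<bar>c (s l) * g r - c r * g r\<bar>)"
        using set_integral_norm_bound[OF set_integral_diff(1)[OF i cgsub[OF l]]] by simp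
      also have "\<dots> \<le> (LBINT r:{s l..s (Suc l)}. e * \<bar>g r\<bar>)"
      proof (rule set_integral_mono)
        show "set_integrable lborel {s l..s (Suc l)} (\<lambda>r. \<bar>c (s l) * g r - c r * g r\<bar>)"
          by (rule set_integrable_abs[OF set_integral_diff(1)[OF i cgsub[OF l]]])
        show "set_integrable lborel {s l..s (Suc l)} (\<lambda>r. e * \<bar>g r\<bar>)"
          using set_integrable_abs[OF gsub[OF l]] by simp
        fix r assume r: "r \<in> {s l..s (Suc l)}"
        have "\<bar>c (s l) - c r\<bar> \<le> e"
          using r sr[of l] sr[of "Suc l"] l sstep[of l] by (intro \<delta>(2)) auto
        then show "\<bar>c (s l) * g r - c r * g r\<bar> \<le> e * \<bar>g r\<bar>"
          by (simp add: left_diff_distrib[symmetric] abs_mult mult_right_mono)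
      qed
      finally show ?thesis by simp
    qed
    then show ?thesis unfolding eq 3 sum_distrib_left
      by (intro order_trans[OF sum_abs] sum_mono) auto
  qed
  have near: "\<bar>(\<Sum>i<N n. w n i * d n i) - W n\<bar> \<le> 2 * e * B" if wn: "\<forall>i<N n. \<bar>w n i - c (p n i)\<bar> \<le> e" for n
  proof -
    define \<phi> where "\<phi> x = (\<Sum>l<Suc K. c (s l) * (of_bool (x < s (Suc l)) - of_bool (x < s l)))" for x
    have "W n = (\<Sum>l<Suc K. \<Sum>i<N n. c (s l) * (of_bool (p n i < s (Suc l)) - of_bool (p n i < s l)) * d n i)"
      unfolding W_def F_def sum_subtractf[symmetric] sum_distrib_left by (intro sum.cong refl) (simp only: left_diff_distrib mult.assoc)
    also have "\<dots> = (\<Sum>i<N n. \<phi> (p n i) * d n i)"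
      unfolding \<phi>_def sum_distrib_right by (rule sum.swap)
    finally have Wn: "W n = (\<Sum>i<N n. \<phi> (p n i) * d n i)" .
    have summand: "\<bar>w n i * d n i - \<phi> (p n i) * d n i\<bar> \<le> 2 * e * \<bar>d n i\<bar>" if i: "i < N n" for i
    proof (cases "p n i < t")
      case True
      have "s 0 \<le> p n i" using pr[of i n] i send by auto
      from step_function_value[where s=s and x="p n i" and c="\<lambda>l. c (s l)" and m="Suc K", OF sm this] True
      obtain l where l: "l < Suc K" "s l \<le> p n i" "p n i < s (Suc l)" "\<phi> (p n i) = c (s l)"
        unfolding \<phi>_def send by blast
      have "\<bar>c (p n i) - c (s l)\<bar> \<le> e"
        using l sr[of l] pr[of i n] i sstep[of l] by (intro \<delta>(2)) auto
      moreover have "\<bar>w n i - c (p n i)\<bar> \<le> e" using wn i by auto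
      ultimately have "\<bar>w n i - \<phi> (p n i)\<bar> \<le> 2 * e" using l(4) by linarith
      then show ?thesis by (simp add: left_diff_distrib[symmetric] abs_mult mult_right_mono)
    next
      \<comment> \<open>The step function is 0 at the right end \<open>t\<close>, but a partition
        interval starting at \<open>t\<close> is degenerate, so its product of increments
        vanishes.\<close>
      case False
      then have "p n i = t" "p n (Suc i) = t" using pr[of i n] pr[of "Suc i" n] pm[OF i] i by auto
      then have "d n i = 0" by (simp add: d_def)
      then show ?thesis by simp
    qed
    have "\<bar>(\<Sum>i<N n. w n i * d n i) - W n\<bar> \<le> (\<Sum>i<N n. 2 * e * \<bar>d n i\<bar>)"
      unfolding Wn sum_subtractf[symmetric] by (intro order_trans[OF sum_abs] sum_mono summand) simp
    also have "\<dots> = 2 * e * (\<Sum>i<N n. \<bar>d n i\<bar>)" by (simp add: sum_distrib_left)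
    also have "\<dots> \<le> 2 * e * B" using B[of n] e by (intro mult_left_mono) (auto simp: d_def)
    finally show ?thesis .
  qed
  have "\<forall>\<^sub>F n in sequentially. dist (W n) V < \<epsilon> / 2" using Wlim \<epsilon> by (intro tendstoD) auto
  with w[OF e(1)] have "\<forall>\<^sub>F n in sequentially. dist (\<Sum>i<N n. w n i * d n i) (LBINT r:{0..t}. c r * g r) < \<epsilon>"
  proof eventually_elim
    case (elim n)
    have "2 * e * B + e * G < \<epsilon> / 2" using e(2) by (simp add: distrib_left)
    then show ?case
      using near[OF elim(1)] VG elim(2) unfolding dist_real_def by linarith
  qed
  then show "\<forall>\<^sub>F n in sequentially. dist (\<Sum>i<N n. w n i * ((Y (p n (Suc i)) - Y (p n i)) * (Z (p n (Suc i)) - Z (p n i))))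
     (LBINT r:{0..t}. c r * g r) < \<epsilon>" unfolding d_def .
qed

section \<open>Products of increments of two martingales\<close>

context C2_bounded
begin

text \<open>Turns increments of \<open>f\<close> along a path into exactly weighted increments of
  the path. The value \<open>f' x\<close> on the diagonal keeps the weight close to
  \<open>f' x\<close> for small increments.\<close>

definition difference_quotient :: "real \<Rightarrow> real \<Rightarrow> real" where
  "difference_quotient x y = (if x = y then f' x else (f y - f x) / (y - x))"

lemma difference_quotient_mult: "f y - f x = difference_quotient x y * (y - x)"
  by (simp add: difference_quotient_def)

lemma abs_difference_quotient_le: "\<bar>difference_quotient x y\<bar> \<le> C1"
  using lipschitz[of y x] bound1[of x]
  by (auto simp: difference_quotient_def divide_le_eq)

lemma lipschitz_deriv: "\<bar>f' y - f' x\<bar> \<le> C2 * \<bar>y - x\<bar>"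
proof (cases x y rule: linorder_cases)
  case less
  then obtain z where "f' y - f' x = (y - x) * f'' z" using MVT2[of x y f' f''] deriv2 by blast
  then show ?thesis using bound2[of z] by (simp add: abs_mult mult.commute[of "y - x"] mult_right_mono)
next
  case greater
  then obtain z where "f' x - f' y = (x - y) * f'' z" using MVT2[of y x f' f''] deriv2 by blast
  then have "\<bar>f' y - f' x\<bar> = \<bar>y - x\<bar> * \<bar>f'' z\<bar>" by (metis abs_minus_commute abs_mult)
  then show ?thesis using bound2[of z] by (simp add: mult.commute[of "\<bar>y - x\<bar>"] mult_right_mono)
qed auto

lemma difference_quotient_near: "\<bar>difference_quotient x y - f' x\<bar> \<le> C2 * \<bar>y - x\<bar>"
proof (cases "x = y")
  case False
  obtain z where z: "x \<le> z \<and> z \<le> y \<or> y \<le> z \<and> z \<le> x" "f y - f x = f' z * (y - x)"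
    using mean_value by blast
  have "difference_quotient x y = f' z" using z(2) False by (simp add: difference_quotient_def)
  then have "\<bar>difference_quotient x y - f' x\<bar> \<le> C2 * \<bar>z - x\<bar>" using lipschitz_deriv[of z x] by simp
  also have "\<dots> \<le> C2 * \<bar>y - x\<bar>" using z(1) C2_nonneg by (intro mult_left_mono) auto
  finally show ?thesis .
qed (simp add: difference_quotient_def)

end

text \<open>In the flow, \<open>g\<close> is the rate \<open>a\<close> of the first particle
  restricted to the times at which both particles are at the same place; this is the origin of
  \<open>joint_density_le\<close>.\<close>

locale qv_martingale_pair =
  Y: qv_martingale P F T Y A a + Z: qv_martingale P F T Z B b
  for P :: "'a measure" and F T Y A a Z B b +
  fixes G :: "real \<Rightarrow> 'a \<Rightarrow> real" and g :: "'a \<Rightarrow> real \<Rightarrow> real"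
  assumes joint_qv: "joint_quadratic_variation P T Y Z G"
    and joint_density: "AE \<omega> in P. set_integrable lborel {0..T} (g \<omega>) \<and> (\<forall>t\<in>{0..T}. G t \<omega> = (LBINT r:{0..t}. g \<omega> r))"
    and joint_density_le: "\<bar>g \<omega> r\<bar> \<le> a \<omega> r"
begin

definition joint_sum :: "(real \<Rightarrow> real) \<Rightarrow> (nat \<Rightarrow> real) \<Rightarrow> nat \<Rightarrow> 'a \<Rightarrow> real" where
  "joint_sum f p n \<omega> = (\<Sum>i<n. (f (Y (p (Suc i)) \<omega>) - f (Y (p i) \<omega>)) * (f (Z (p (Suc i)) \<omega>) - f (Z (p i) \<omega>)))"

definition joint_limit :: "(real \<Rightarrow> real) \<Rightarrow> real \<Rightarrow> 'a \<Rightarrow> real" where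
  "joint_limit f' t \<omega> = (LBINT r:{0..t}. f' (Y r \<omega>) * f' (Z r \<omega>) * g \<omega> r)"

lemma abs_sum_product_le:
  "(\<Sum>i<n. \<bar>(Y (p (Suc i)) \<omega> - Y (p i) \<omega>) * (Z (p (Suc i)) \<omega> - Z (p i) \<omega>)\<bar>) \<le> Y.qsum p n \<omega> + Z.qsum p n \<omega>"
  unfolding Y.qsum_def Z.qsum_def sum.distrib[symmetric]
  by (rule sum_mono, rule abs_mult_le_sum_squares)

text \<open>Supplies the majorant for convergence in mean, with one exceptional set for all
  partitions. A product is at most a sum of squares, so the two quadratic sums control
  \<open>joint_sum\<close>; \<open>A t\<close> controls the limit through
  \<open>joint_density_le\<close>.\<close>

lemma joint_sum_limit_bound:
  assumes f: "C2_bounded f f' f'' C1 C2" and t: "t \<in> {0..T}"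
  shows "AE \<omega> in P. \<forall>p n. \<bar>joint_sum f p n \<omega> - joint_limit f' t \<omega>\<bar>
    \<le> C1\<^sup>2 * (Y.qsum p n \<omega> + Z.qsum p n \<omega> + (A t \<omega> + B t \<omega>))"
  using Y.density joint_density Z.A_nonneg[OF t] AE_space
proof eventually_elim
  case (elim \<omega>)
  interpret C2_bounded f f' f'' C1 C2 by fact
  show ?case
  proof (intro allI)
    fix p n
    have "\<bar>joint_sum f p n \<omega>\<bar> \<le> (\<Sum>i<n. C1\<^sup>2 * \<bar>(Y (p (Suc i)) \<omega> - Y (p i) \<omega>) * (Z (p (Suc i)) \<omega> - Z (p i) \<omega>)\<bar>)"
      unfolding joint_sum_def
    proof (intro order_trans[OF sum_abs] sum_mono)
      fix i
      have "\<bar>f (Y (p (Suc i)) \<omega>) - f (Y (p i) \<omega>)\<bar> * \<bar>f (Z (p (Suc i)) \<omega>) - f (Z (p i) \<omega>)\<bar>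
        \<le> (C1 * \<bar>Y (p (Suc i)) \<omega> - Y (p i) \<omega>\<bar>) * (C1 * \<bar>Z (p (Suc i)) \<omega> - Z (p i) \<omega>\<bar>)"
        using C1_nonneg by (intro mult_mono lipschitz) auto
      then show "\<bar>(f (Y (p (Suc i)) \<omega>) - f (Y (p i) \<omega>)) * (f (Z (p (Suc i)) \<omega>) - f (Z (p i) \<omega>))\<bar>
        \<le> C1\<^sup>2 * \<bar>(Y (p (Suc i)) \<omega> - Y (p i) \<omega>) * (Z (p (Suc i)) \<omega> - Z (p i) \<omega>)\<bar>"
        by (simp add: abs_mult power2_eq_square mult_ac)
    qed
    also have "\<dots> \<le> C1\<^sup>2 * (Y.qsum p n \<omega> + Z.qsum p n \<omega>)"
      unfolding sum_distrib_left[symmetric] by (intro mult_left_mono abs_sum_product_le) simp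
    finally have 1: "\<bar>joint_sum f p n \<omega>\<bar> \<le> C1\<^sup>2 * (Y.qsum p n \<omega> + Z.qsum p n \<omega>)" .
    have ai: "set_integrable lborel {0..t} (a \<omega>)" "set_integrable lborel {0..t} (g \<omega>)"
      using elim t by (auto intro: set_integrable_subset[of _ "{0..T}"])
    have co: "continuous_on {0..t} (\<lambda>r. f' (Y r \<omega>) * f' (Z r \<omega>))"
      by (intro continuous_intros continuous_on_compose2[OF cont1] continuous_on_subset[OF Y.paths] continuous_on_subset[OF Z.paths])
        (use elim t in auto)
    have b: "\<bar>f' x * f' y\<bar> \<le> C1\<^sup>2" for x y
      unfolding abs_mult power2_eq_square using bound1 C1_nonneg by (intro mult_mono) auto
    have gi: "set_integrable lborel {0..t} (\<lambda>r. f' (Y r \<omega>) * f' (Z r \<omega>) * g \<omega> r)"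
      by (rule set_integrable_bounded_mult[OF ai(2) _ set_borel_measurable_continuous_lborel[OF co] b]) auto
    have "\<bar>joint_limit f' t \<omega>\<bar> \<le> (LBINT r:{0..t}. \<bar>f' (Y r \<omega>) * f' (Z r \<omega>) * g \<omega> r\<bar>)"
      unfolding joint_limit_def using set_integral_norm_bound[OF gi] by simp
    also have "\<dots> \<le> (LBINT r:{0..t}. C1\<^sup>2 * a \<omega> r)"
    proof (rule set_integral_mono[OF set_integrable_abs[OF gi]])
      show "set_integrable lborel {0..t} (\<lambda>r. C1\<^sup>2 * a \<omega> r)" using ai by simp
      show "\<bar>f' (Y r \<omega>) * f' (Z r \<omega>) * g \<omega> r\<bar> \<le> C1\<^sup>2 * a \<omega> r" for r
        unfolding abs_mult[of "f' (Y r \<omega>) * f' (Z r \<omega>)"] using b joint_density_le by (intro mult_mono) auto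
    qed
    also have "\<dots> = C1\<^sup>2 * A t \<omega>" using elim t by simp
    also have "\<dots> \<le> C1\<^sup>2 * (A t \<omega> + B t \<omega>)" using elim by (intro mult_left_mono) auto
    finally show "\<bar>joint_sum f p n \<omega> - joint_limit f' t \<omega>\<bar> \<le> C1\<^sup>2 * (Y.qsum p n \<omega> + Z.qsum p n \<omega> + (A t \<omega> + B t \<omega>))"
      using 1 unfolding distrib_left by linarith
  qed
qed

text \<open>Almost sure convergence along a subsequence follows from
  \<open>weighted_sums_tendsto\<close>, the weights being products of difference quotients. Its
  hypothesis on stopped sums is the joint quadratic variation at the stopping point
  \<open>q\<close>: cutting a partition of \<open>[0, t]\<close> at \<open>q\<close> gives a
  partition of \<open>[0, q]\<close> whose mesh is no larger.\<close>

lemma joint_sum_tendsto: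
  fixes n :: "nat \<Rightarrow> nat" and p :: "nat \<Rightarrow> nat \<Rightarrow> real"
  assumes f: "C2_bounded f f' f'' C1 C2" and t: "t \<in> {0..T}"
    and p: "\<And>k. interval_partition t (n k) (p k)" and mesh: "mesh_vanishes n p"
    and J: "joint_limit f' t \<in> borel_measurable P"
  shows "(\<lambda>k. \<integral>\<omega>. \<bar>joint_sum f (p k) (n k) \<omega> - joint_limit f' t \<omega>\<bar> \<partial>P) \<longlonglongrightarrow> 0"
proof -
  interpret C2_bounded f f' f'' C1 C2 by fact
  have pr: "p k i \<in> {0..t}" if "i \<le> n k" for k i
    using partition_mono[of "n k" "p k" 0 i] partition_mono[of "n k" "p k" i "n k"] that p[of k]
    by (auto simp: interval_partition_def)
  have pT: "p k i \<in> {0..T}" if "i \<le> n k" for k i using pr[OF that] t by auto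
  have mY: "Y r \<in> borel_measurable P" and mZ: "Z r \<in> borel_measurable P" if "r \<in> {0..T}" for r
    using Y.square_integrable_Y[OF that] Z.square_integrable_Y[OF that] by (auto simp: square_integrable_def)
  have mS: "joint_sum f (p k) (n k) \<in> borel_measurable P" for k
    unfolding joint_sum_def
    by (intro borel_measurable_sum borel_measurable_times borel_measurable_diff
        measurable_compose[OF mY measurable_f(1)] measurable_compose[OF mZ measurable_f(1)] pT) auto
  have Q1: "tendsto_L1 P (\<lambda>k. Y.qsum (p k) (n k)) (A t)" by (rule Y.qsum_tendsto_L1_0(1)[OF t p mesh])
  have Q2: "tendsto_L1 P (\<lambda>k. Z.qsum (p k) (n k)) (B t)" by (rule Z.qsum_tendsto_L1_0(1)[OF t p mesh])
  \<comment> \<open>An enumeration of all points of all uniform grids of \<open>[0, t]\<close>;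
    \<open>min l (Suc k)\<close> makes every code meaningful.\<close>
  define q where "q j = (case prod_decode j of (l, k) \<Rightarrow> uniform_points 0 t k (min l (Suc k)))" for j
  have um: "uniform_points 0 t k l \<in> {0..t}" if "l \<le> Suc k" for k l
    using partition_mono[of "Suc k" "uniform_points 0 t k" 0 l] partition_mono[of "Suc k" "uniform_points 0 t k" l "Suc k"]
      that t uniform_points_mono[of 0 t k] by auto
  have q: "q j \<in> {0..t}" for j by (auto simp: q_def split: prod.split simp del: atLeastAtMost_iff intro!: um)
  \<comment> \<open>The first two sequences bound the total variation of the products along the
    subsequence, the others are the sums stopped at the grid times.\<close>
  define X where "X j k = (case j of 0 \<Rightarrow> Y.qsum (p k) (n k) | Suc 0 \<Rightarrow> Z.qsum (p k) (n k)
    | Suc (Suc j) \<Rightarrow> (\<lambda>\<omega>. \<Sum>i<n k. (Y (min (p k (Suc i)) (q j)) \<omega> - Y (min (p k i) (q j)) \<omega>) *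
         (Z (min (p k (Suc i)) (q j)) \<omega> - Z (min (p k i) (q j)) \<omega>)))" for j k
  define L where "L j = (case j of 0 \<Rightarrow> A t | Suc 0 \<Rightarrow> B t | Suc (Suc j) \<Rightarrow> G (q j))" for j
  have XL: "tendsto_prob P (X j) (L j)" for j
  proof -
    consider "j = 0" | "j = Suc 0" | m where "j = Suc (Suc m)" by (metis not0_implies_Suc)
    then show ?thesis
    proof cases
      case 3
      have "q m \<in> {0..T}" using q[of m] t by auto
      moreover have "interval_partition (q m) (n k) (\<lambda>i. min (p k i) (q m))" for k
        using p[of k] q[of m] by (auto simp: interval_partition_def)
      moreover have "mesh_vanishes n (\<lambda>k i. min (p k i) (q m))"
        unfolding mesh_vanishes_def
      proof (intro allI impI)
        fix \<delta> :: real assume "\<delta> > 0"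
        with mesh have "\<forall>\<^sub>F k in sequentially. \<forall>i<n k. p k (Suc i) - p k i < \<delta>" by (simp add: mesh_vanishes_def)
        then show "\<forall>\<^sub>F k in sequentially. \<forall>i<n k. min (p k (Suc i)) (q m) - min (p k i) (q m) < \<delta>"
          by eventually_elim (use \<open>\<delta> > 0\<close> in \<open>auto simp: min_def; smt (verit)\<close>)
      qed
      ultimately show ?thesis
        using joint_quadratic_variation_tendsto_prob[OF joint_qv, of "q m" n "\<lambda>k i. min (p k i) (q m)"] 3
        by (simp add: X_def[abs_def] L_def)
    qed (use Q1 Q2 in \<open>auto simp: X_def[abs_def] L_def intro!: Y.tendsto_L1_imp_prob\<close>)
  qed
  have Lm: "L j \<in> borel_measurable P" for j
    using joint_qv q[of "j - 2"] t Y.measurable_A[OF t] Z.measurable_A[OF t]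
    by (auto simp: L_def joint_quadratic_variation_def split: nat.split)
  have Xm: "X j k \<in> borel_measurable P" for j k
  proof -
    have i: "integrable P (Y.qsum (p k) (n k))" "integrable P (Z.qsum (p k) (n k))"
      using Q1 Q2 by (auto simp: tendsto_L1_def)
    have mm: "min (p k i) (q m) \<in> {0..T}" if "i \<le> n k" for i m
      using pr[OF that] q[of m] t by auto
    have "(\<lambda>\<omega>. \<Sum>i<n k. (Y (min (p k (Suc i)) (q m)) \<omega> - Y (min (p k i) (q m)) \<omega>) *
         (Z (min (p k (Suc i)) (q m)) \<omega> - Z (min (p k i) (q m)) \<omega>)) \<in> borel_measurable P" for m
      by (intro borel_measurable_sum borel_measurable_times borel_measurable_diff mY mZ mm) auto
    then show ?thesis using i by (auto simp: X_def split: nat.split)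
  qed
  show ?thesis
  proof (rule Y.integral_abs_tendsto_0_L1_dominated_subseq[OF tendsto_L1_add[OF Q1 Q2]])
    show "(\<lambda>\<omega>. joint_sum f (p k) (n k) \<omega> - joint_limit f' t \<omega>) \<in> borel_measurable P" for k
      by (intro borel_measurable_diff mS J)
    show "AE \<omega> in P. \<bar>joint_sum f (p k) (n k) \<omega> - joint_limit f' t \<omega>\<bar>
      \<le> C1\<^sup>2 * (Y.qsum (p k) (n k) \<omega> + Z.qsum (p k) (n k) \<omega> + (A t \<omega> + B t \<omega>))" for k
      using joint_sum_limit_bound[OF f t] by eventually_elim auto
    show "AE \<omega> in P. 0 \<le> A t \<omega> + B t \<omega>" using Y.A_nonneg[OF t] Z.A_nonneg[OF t] by eventually_elim auto
    fix r :: "nat \<Rightarrow> nat" assume r: "strict_mono r"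
    obtain r' where r': "strict_mono r'" "AE \<omega> in P. \<forall>j. (\<lambda>k. X j (r (r' k)) \<omega>) \<longlonglongrightarrow> L j \<omega>"
      using Y.countable_tendsto_prob_AE_subseq[of "\<lambda>j k. X j (r k)" L] tendsto_prob_subseq[OF XL r] Xm Lm by blast
    have rr: "strict_mono (\<lambda>k. r (r' k))" using r r' by (auto simp: strict_mono_def)
    have mesh': "mesh_vanishes (\<lambda>k. n (r (r' k))) (\<lambda>k. p (r (r' k)))"
      by (rule mesh_vanishes_subseq[OF mesh rr])
    have "AE \<omega> in P. (\<lambda>k. joint_sum f (p (r (r' k))) (n (r (r' k))) \<omega> - joint_limit f' t \<omega>) \<longlonglongrightarrow> 0"
      using r'(2) joint_density AE_space
    proof eventually_elim
      case (elim \<omega>)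
      have XX: "(\<lambda>k. X j (r (r' k)) \<omega>) \<longlonglongrightarrow> L j \<omega>" for j using elim by blast
      have cY: "continuous_on {0..t} (\<lambda>r. Y r \<omega>)" and cZ: "continuous_on {0..t} (\<lambda>r. Z r \<omega>)"
        using elim t by (auto intro: continuous_on_subset[OF Y.paths] continuous_on_subset[OF Z.paths])
      have QY: "(\<lambda>k. Y.qsum (p (r (r' k))) (n (r (r' k))) \<omega>) \<longlonglongrightarrow> A t \<omega>"
        using XX[of 0] by (simp add: X_def L_def)
      have QZ: "(\<lambda>k. Z.qsum (p (r (r' k))) (n (r (r' k))) \<omega>) \<longlonglongrightarrow> B t \<omega>"
        using XX[of "Suc 0"] by (simp add: X_def L_def)
      have "Bseq (\<lambda>k. Y.qsum (p (r (r' k))) (n (r (r' k))) \<omega> + Z.qsum (p (r (r' k))) (n (r (r' k))) \<omega>)"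
        by (rule convergent_imp_Bseq[OF convergentI[OF tendsto_add[OF QY QZ]]])
      then obtain M where M: "\<And>k. \<bar>Y.qsum (p (r (r' k))) (n (r (r' k))) \<omega> + Z.qsum (p (r (r' k))) (n (r (r' k))) \<omega>\<bar> \<le> M"
        unfolding Bseq_def by auto
      define w where "w k i = difference_quotient (Y (p (r (r' k)) i) \<omega>) (Y (p (r (r' k)) (Suc i)) \<omega>) *
          difference_quotient (Z (p (r (r' k)) i) \<omega>) (Z (p (r (r' k)) (Suc i)) \<omega>)" for k i
      have "(\<lambda>k. \<Sum>i<n (r (r' k)). w k i * ((Y (p (r (r' k)) (Suc i)) \<omega> - Y (p (r (r' k)) i) \<omega>) *
          (Z (p (r (r' k)) (Suc i)) \<omega> - Z (p (r (r' k)) i) \<omega>)))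
        \<longlonglongrightarrow> (LBINT r:{0..t}. (f' (Y r \<omega>) * f' (Z r \<omega>)) * g \<omega> r)"
      proof (rule weighted_sums_tendsto[OF _ p mesh' cY cZ])
        show "0 \<le> t" using t by simp
        show "continuous_on {0..t} (\<lambda>r. f' (Y r \<omega>) * f' (Z r \<omega>))"
          by (intro continuous_intros continuous_on_compose2[OF cont1 cY] continuous_on_compose2[OF cont1 cZ]) auto
        show "set_integrable lborel {0..t} (g \<omega>)"
          using elim t by (auto intro: set_integrable_subset[of _ "{0..T}"])
        show "(\<Sum>i<n (r (r' k)). \<bar>(Y (p (r (r' k)) (Suc i)) \<omega> - Y (p (r (r' k)) i) \<omega>) *
            (Z (p (r (r' k)) (Suc i)) \<omega> - Z (p (r (r' k)) i) \<omega>)\<bar>) \<le> M" for k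
          using abs_sum_product_le[of "p (r (r' k))" \<omega> "n (r (r' k))"] M[of k] by linarith
        show "(\<lambda>k. \<Sum>i<n (r (r' k)). (Y (min (p (r (r' k)) (Suc i)) (uniform_points 0 t m l)) \<omega> - Y (min (p (r (r' k)) i) (uniform_points 0 t m l)) \<omega>) *
            (Z (min (p (r (r' k)) (Suc i)) (uniform_points 0 t m l)) \<omega> - Z (min (p (r (r' k)) i) (uniform_points 0 t m l)) \<omega>))
           \<longlonglongrightarrow> (LBINT r:{0..uniform_points 0 t m l}. g \<omega> r)" if "l \<le> Suc m" for l m
        proof -
          have "q (prod_encode (l, m)) = uniform_points 0 t m l" using that by (simp add: q_def)
          moreover from this have "G (uniform_points 0 t m l) \<omega> = (LBINT r:{0..uniform_points 0 t m l}. g \<omega> r)"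
            using elim q[of "prod_encode (l, m)"] t by auto
          ultimately show ?thesis using XX[of "Suc (Suc (prod_encode (l, m)))"] by (simp add: X_def L_def)
        qed
        fix e :: real assume e: "e > 0"
        \<comment> \<open>Each of the two quotients is off by at most \<open>C2 * e'\<close> while
          the other factor is at most \<open>C1\<close>, which gives the error
          \<open>2 * C1 * C2 * e'\<close>; adding 1 avoids a division by 0.\<close>
        define e' where "e' = e / (2 * (C1 * C2 + 1))"
        have C: "0 \<le> C1 * C2" using C1_nonneg C2_nonneg by simp
        have e': "e' > 0" using e C by (simp add: e'_def)
        have e'C: "2 * (C1 * C2) * e' \<le> e"
        proof -
          have "2 * (C1 * C2) * e' \<le> (2 * (C1 * C2 + 1)) * e'" using e' by (intro mult_right_mono) auto
          also have "\<dots> = e" using C by (simp add: e'_def)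
          finally show ?thesis .
        qed
        obtain \<delta>1 where \<delta>1: "\<delta>1 > 0" "\<And>x y. x \<in> {0..t} \<Longrightarrow> y \<in> {0..t} \<Longrightarrow> \<bar>x - y\<bar> < \<delta>1 \<Longrightarrow> \<bar>Y x \<omega> - Y y \<omega>\<bar> \<le> e'"
          using uniform_modulus[OF cY e'] by blast
        obtain \<delta>2 where \<delta>2: "\<delta>2 > 0" "\<And>x y. x \<in> {0..t} \<Longrightarrow> y \<in> {0..t} \<Longrightarrow> \<bar>x - y\<bar> < \<delta>2 \<Longrightarrow> \<bar>Z x \<omega> - Z y \<omega>\<bar> \<le> e'"
          using uniform_modulus[OF cZ e'] by blast
        have "min \<delta>1 \<delta>2 > 0" using \<delta>1(1) \<delta>2(1) by simp
        then have "\<forall>\<^sub>F k in sequentially. \<forall>i<n (r (r' k)). p (r (r' k)) (Suc i) - p (r (r' k)) i < min \<delta>1 \<delta>2"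
          using mesh' unfolding mesh_vanishes_def by blast
        then show "\<forall>\<^sub>F k in sequentially. \<forall>i<n (r (r' k)). \<bar>w k i - f' (Y (p (r (r' k)) i) \<omega>) * f' (Z (p (r (r' k)) i) \<omega>)\<bar> \<le> e"
        proof eventually_elim
          case (elim k)
          show ?case
          proof (intro allI impI)
            fix i assume i: "i < n (r (r' k))"
            let ?y = "Y (p (r (r' k)) i) \<omega>" and ?y' = "Y (p (r (r' k)) (Suc i)) \<omega>"
            let ?z = "Z (p (r (r' k)) i) \<omega>" and ?z' = "Z (p (r (r' k)) (Suc i)) \<omega>"
            have le: "p (r (r' k)) i \<le> p (r (r' k)) (Suc i)" using p[of "r (r' k)"] i by (simp add: interval_partition_def)
            have lt: "p (r (r' k)) (Suc i) - p (r (r' k)) i < min \<delta>1 \<delta>2" using elim i by blast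
            have "\<bar>?y' - ?y\<bar> \<le> e'" "\<bar>?z' - ?z\<bar> \<le> e'"
              using pr[of i "r (r' k)"] pr[of "Suc i" "r (r' k)"] i le lt by (auto intro!: \<delta>1(2) \<delta>2(2))
            then have dy: "\<bar>difference_quotient ?y ?y' - f' ?y\<bar> \<le> C2 * e'" and dz: "\<bar>difference_quotient ?z ?z' - f' ?z\<bar> \<le> C2 * e'"
              using order_trans[OF difference_quotient_near mult_left_mono[OF _ C2_nonneg]] by blast+
            have "w k i - f' ?y * f' ?z = (difference_quotient ?y ?y' - f' ?y) * difference_quotient ?z ?z' + f' ?y * (difference_quotient ?z ?z' - f' ?z)"
              by (simp add: w_def algebra_simps)
            moreover have "\<bar>(difference_quotient ?y ?y' - f' ?y) * difference_quotient ?z ?z'\<bar> \<le> (C2 * e') * C1"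
              unfolding abs_mult using C2_nonneg e' by (intro mult_mono dy abs_difference_quotient_le) auto
            moreover have "\<bar>f' ?y * (difference_quotient ?z ?z' - f' ?z)\<bar> \<le> C1 * (C2 * e')"
              unfolding abs_mult using C1_nonneg by (intro mult_mono dz bound1) auto
            ultimately show "\<bar>w k i - f' ?y * f' ?z\<bar> \<le> e"
              using e'C by (simp only: mult_ac)
          qed
        qed
      qed
      moreover have "joint_sum f (p (r (r' k))) (n (r (r' k))) \<omega> = (\<Sum>i<n (r (r' k)). w k i * ((Y (p (r (r' k)) (Suc i)) \<omega> - Y (p (r (r' k)) i) \<omega>) *
          (Z (p (r (r' k)) (Suc i)) \<omega> - Z (p (r (r' k)) i) \<omega>)))" for k
        unfolding joint_sum_def w_def difference_quotient_mult[of "Y _ \<omega>"] difference_quotient_mult[of "Z _ \<omega>"]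
        by (simp add: mult_ac)
      ultimately have "(\<lambda>k. joint_sum f (p (r (r' k))) (n (r (r' k))) \<omega>) \<longlonglongrightarrow> joint_limit f' t \<omega>"
        by (simp add: joint_limit_def)
      then show ?case by (rule LIM_zero)
    qed
    with r'(1) show "\<exists>r'. strict_mono r' \<and>
       (AE \<omega> in P. (\<lambda>k. joint_sum f (p (r (r' k))) (n (r (r' k))) \<omega> - joint_limit f' t \<omega>) \<longlonglongrightarrow> 0)"
      by (intro exI[of _ r'] conjI)
  qed simp
qed

end

section \<open>Image measures and joint measurability\<close>

lemma measurable_emeasure_singleton:
  fixes \<nu> :: "real measure"
  assumes "prob_space \<nu>" and [measurable_cong]: "sets \<nu> = sets borel"
  shows "(\<lambda>x. emeasure \<nu> {x}) \<in> borel_measurable borel"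
proof -
  interpret prob_space \<nu> by fact
  have "{z \<in> space (borel \<Otimes>\<^sub>M \<nu>). fst z = snd z} \<in> sets (borel \<Otimes>\<^sub>M \<nu>)" by measurable
  from measurable_emeasure_Pair[OF this]
  have "(\<lambda>x. emeasure \<nu> (Pair x -` {z \<in> space (borel \<Otimes>\<^sub>M \<nu>). fst z = snd z})) \<in> borel_measurable borel" .
  also have "(\<lambda>x. emeasure \<nu> (Pair x -` {z \<in> space (borel \<Otimes>\<^sub>M \<nu>). fst z = snd z})) = (\<lambda>x. emeasure \<nu> {x})"
    using sets_eq_imp_space_eq[OF assms(2)]
    by (intro ext arg_cong[where f="emeasure \<nu>"]) (auto simp: space_pair_measure)
  finally show ?thesis .
qed

context
  fixes \<nu> :: "real measure" and S :: "real set"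
  assumes \<nu>: "prob_space \<nu>" and sets[measurable_cong]: "sets \<nu> = sets borel"
    and S: "finite S" "emeasure \<nu> (- S) = 0"
begin

lemma AE_finite_atomic: "AE x in \<nu>. x \<in> S"
proof -
  have sp: "space \<nu> = UNIV" using sets_eq_imp_space_eq[OF sets] by simp
  have "- S \<in> sets \<nu>" using S sets by (simp add: finite_imp_closed open_Compl)
  then show ?thesis using S by (intro AE_I[of _ _ "- S"]) (auto simp: sp)
qed

lemma nn_integral_finite_atomic: "(\<integral>\<^sup>+x. g x \<partial>\<nu>) = (\<Sum>x\<in>S. g x * emeasure \<nu> {x})"
proof -
  have [measurable]: "{x} \<in> sets \<nu>" for x using sets by simp
  have "(\<integral>\<^sup>+x. g x \<partial>\<nu>) = (\<integral>\<^sup>+x. (\<Sum>s\<in>S. g s * indicator {s} x) \<partial>\<nu>)"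
    using AE_finite_atomic
    by (intro nn_integral_cong_AE, eventually_elim) (use S in \<open>simp add: indicator_def if_distrib sum.delta cong: if_cong\<close>)
  also have "\<dots> = (\<Sum>x\<in>S. g x * emeasure \<nu> {x})"
    by (subst nn_integral_sum) (auto simp: nn_integral_cmult_indicator)
  finally show ?thesis .
qed

lemma integral_finite_atomic:
  fixes g :: "real \<Rightarrow> real"
  assumes [measurable]: "g \<in> borel_measurable borel"
  shows "(\<integral>x. g x \<partial>\<nu>) = (\<Sum>x\<in>S. g x * measure \<nu> {x})"
proof -
  interpret prob_space \<nu> by (rule \<nu>)
  have sp: "space \<nu> = UNIV" using sets_eq_imp_space_eq[OF sets] by simp
  have [measurable]: "{x} \<in> sets \<nu>" for x using sets by simp
  have "(\<integral>x. g x \<partial>\<nu>) = (\<integral>x. (\<Sum>s\<in>S. g s * indicator {s} x) \<partial>\<nu>)"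
  proof (rule integral_cong_AE)
    show "AE x in \<nu>. g x = (\<Sum>s\<in>S. g s * indicator {s} x)"
      using AE_finite_atomic by eventually_elim (use S in \<open>simp add: indicator_def if_distrib sum.delta cong: if_cong\<close>)
  qed auto
  also have "\<dots> = (\<Sum>x\<in>S. g x * measure \<nu> {x})"
    by (subst Bochner_Integration.integral_sum)
      (auto intro!: integrable_mult_right integrable_real_indicator simp: emeasure_finite less_top[symmetric] sp)
  finally show ?thesis .
qed

end

text \<open>Each atom contributes \<open>1 / emeasure \<nu> {x} * emeasure \<nu> {x} = 1\<close>, so
  the integral bounds the number of atoms. On points without mass the integrand is
  \<open>1 / 0 = \<infinity>\<close>, so these form a null set.\<close>

lemma finite_support_of_finite_inverse_mass:
  fixes \<nu> :: "real measure"
  assumes "prob_space \<nu>" and sets[measurable_cong]: "sets \<nu> = sets borel"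
    and fin: "(\<integral>\<^sup>+x. 1 / emeasure \<nu> {x} \<partial>\<nu>) < \<infinity>"
  shows "finite {x. emeasure \<nu> {x} > 0}" "emeasure \<nu> (- {x. emeasure \<nu> {x} > 0}) = 0"
    "measure_support \<nu> = {x. emeasure \<nu> {x} > 0}"
proof -
  interpret prob_space \<nu> by fact
  define S where "S = {x. emeasure \<nu> {x} > 0}"
  have sp: "space \<nu> = UNIV" using sets_eq_imp_space_eq[OF sets] by simp
  have sing[measurable]: "{x} \<in> sets \<nu>" for x using sets by simp
  have m0: "(\<lambda>x. emeasure \<nu> {x}) \<in> borel_measurable borel"
    by (rule measurable_emeasure_singleton[OF assms(1,2)])
  have m[measurable]: "(\<lambda>x. emeasure \<nu> {x}) \<in> borel_measurable \<nu>"
    using m0 by (simp add: measurable_cong_sets[OF sets refl])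
  have "{x \<in> space \<nu>. emeasure \<nu> {x} > 0} \<in> sets \<nu>" by measurable
  then have Sm[measurable]: "S \<in> sets \<nu>" by (simp add: S_def sp)
  have ne: "emeasure \<nu> {x} \<noteq> \<top>" for x using emeasure_finite by simp
  have one: "1 / emeasure \<nu> {x} * emeasure \<nu> {x} = 1" if "x \<in> S" for x
    using that ne[of x] by (simp add: S_def ennreal_divide_times ennreal_divide_self less_top[symmetric])
  have card: "of_nat (card F) \<le> (\<integral>\<^sup>+x. 1 / emeasure \<nu> {x} \<partial>\<nu>)" if "finite F" "F \<subseteq> S" for F
  proof -
    have "of_nat (card F) = (\<Sum>x\<in>F. 1 / emeasure \<nu> {x} * emeasure \<nu> {x})" using one that by (simp add: subset_iff)
    also have "\<dots> = (\<integral>\<^sup>+x. (\<Sum>s\<in>F. 1 / emeasure \<nu> {s} * indicator {s} x) \<partial>\<nu>)"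
      by (subst nn_integral_sum) (auto simp: nn_integral_cmult_indicator)
    also have "\<dots> \<le> (\<integral>\<^sup>+x. 1 / emeasure \<nu> {x} \<partial>\<nu>)"
    proof (intro nn_integral_mono)
      fix x
      have "(\<Sum>s\<in>F. 1 / emeasure \<nu> {s} * indicator {s} x) = (if x \<in> F then 1 / emeasure \<nu> {x} else 0)"
        using that(1) by (simp add: indicator_def if_distrib sum.delta cong: if_cong)
      then show "(\<Sum>s\<in>F. 1 / emeasure \<nu> {s} * indicator {s} x) \<le> 1 / emeasure \<nu> {x}" by simp
    qed
    finally show ?thesis .
  qed
  show fS: "finite {x. emeasure \<nu> {x} > 0}"
  proof (rule ccontr)
    assume "infinite {x. emeasure \<nu> {x} > 0}"
    then have inf: "infinite S" by (simp add: S_def)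
    obtain n :: nat where n: "(\<integral>\<^sup>+x. 1 / emeasure \<nu> {x} \<partial>\<nu>) < of_nat n"
      using fin ennreal_Ex_less_of_nat by auto
    obtain F where "finite F" "card F = n" "F \<subseteq> S" using infinite_arbitrarily_large[OF inf] by blast
    then show False using card[of F] n by simp
  qed
  show null: "emeasure \<nu> (- {x. emeasure \<nu> {x} > 0}) = 0"
  proof (rule ccontr)
    assume "emeasure \<nu> (- {x. emeasure \<nu> {x} > 0}) \<noteq> 0"
    then have pos: "emeasure \<nu> (- S) \<noteq> 0" by (simp add: S_def)
    have cm: "- S \<in> sets \<nu>" using sets.compl_sets[OF Sm] by (simp add: sp Compl_eq_Diff_UNIV)
    have "\<infinity> = \<infinity> * emeasure \<nu> (- S)" using pos by (simp add: ennreal_top_mult)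
    also have "\<dots> = (\<integral>\<^sup>+x. \<infinity> * indicator (- S) x \<partial>\<nu>)" using cm by (simp only: nn_integral_cmult_indicator)
    also have "\<dots> \<le> (\<integral>\<^sup>+x. 1 / emeasure \<nu> {x} \<partial>\<nu>)"
      by (intro nn_integral_mono) (auto simp: S_def indicator_def not_less)
    finally show False using fin by simp
  qed
  show "measure_support \<nu> = {x. emeasure \<nu> {x} > 0}"
  proof (intro set_eqI iffI)
    fix x assume x: "x \<in> measure_support \<nu>"
    show "x \<in> {x. emeasure \<nu> {x} > 0}"
    proof (rule ccontr)
      assume "x \<notin> {x. emeasure \<nu> {x} > 0}"
      \<comment> \<open>The complement of the finite set of atoms is open and null, so it contains
        no point of the support.\<close>
      moreover have "open (- {x. emeasure \<nu> {x} > 0})" using fS by (simp add: finite_imp_closed open_Compl)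
      ultimately have "emeasure \<nu> (- {x. emeasure \<nu> {x} > 0}) > 0" using x by (auto simp: measure_support_def)
      then show False using null by simp
    qed
  next
    fix x assume x: "x \<in> {x. emeasure \<nu> {x} > 0}"
    show "x \<in> measure_support \<nu>"
      unfolding measure_support_def
    proof (intro CollectI allI impI)
      fix U assume "open U \<and> x \<in> U"
      then have "emeasure \<nu> {x} \<le> emeasure \<nu> U" using sets by (intro emeasure_mono) auto
      then show "0 < emeasure \<nu> U" using x by (auto intro: less_le_trans)
    qed
  qed
qed

text \<open>The complement of the support is a union of open null sets, hence null by Lindelof's
  theorem; a point of a finite support is isolated in it and therefore an atom. Each atom
  contributes 1 to the integral.\<close>

lemma finite_inverse_mass_of_finite_support:
  fixes \<nu> :: "real measure"
  assumes "prob_space \<nu>" and sets[measurable_cong]: "sets \<nu> = sets borel"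
    and fin: "finite (measure_support \<nu>)"
  shows "(\<integral>\<^sup>+x. 1 / emeasure \<nu> {x} \<partial>\<nu>) < \<infinity>"
proof -
  interpret prob_space \<nu> by fact
  define S where "S = measure_support \<nu>"
  define \<F> where "\<F> = {U. open U \<and> emeasure \<nu> U = 0}"
  obtain \<F>' where F': "\<F>' \<subseteq> \<F>" "countable \<F>'" "\<Union>\<F>' = \<Union>\<F>"
    using Lindelof[of \<F>] by (auto simp: \<F>_def)
  have "- S = \<Union>\<F>'" unfolding F' by (auto simp: S_def measure_support_def \<F>_def zero_less_iff_neq_zero)
  moreover have "\<Union>\<F>' \<in> null_sets \<nu>"
    using F' sets by (intro null_sets_UN'[of \<F>' "\<lambda>x. x", simplified]) (auto simp: \<F>_def null_sets_def subset_iff)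
  ultimately have null: "emeasure \<nu> (- S) = 0" by (simp add: null_sets_def)
  have pos: "emeasure \<nu> {x} > 0" if "x \<in> S" for x
  proof -
    let ?U = "- (S - {x})"
    have "open ?U" using fin by (intro open_Compl finite_imp_closed) (simp add: S_def)
    then have "emeasure \<nu> ?U > 0" using that unfolding S_def measure_support_def by blast
    moreover have "emeasure \<nu> ?U \<le> emeasure \<nu> {x} + emeasure \<nu> (- S)"
    proof -
      have S: "- S \<in> sets \<nu>" using sets fin by (simp add: S_def finite_imp_closed open_Compl)
      have "emeasure \<nu> ?U \<le> emeasure \<nu> ({x} \<union> - S)"
        using S sets by (intro emeasure_mono sets.Un) auto
      also have "\<dots> \<le> emeasure \<nu> {x} + emeasure \<nu> (- S)" using S sets by (intro emeasure_subadditive) auto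
      finally show ?thesis .
    qed
    ultimately show ?thesis using null by simp
  qed
  have "1 / emeasure \<nu> {x} * emeasure \<nu> {x} = 1" if "x \<in> S" for x
    using pos[OF that] by (simp add: ennreal_divide_times ennreal_divide_self emeasure_finite less_top[symmetric])
  then have "(\<integral>\<^sup>+x. 1 / emeasure \<nu> {x} \<partial>\<nu>) = (\<Sum>x\<in>S. 1)"
    using nn_integral_finite_atomic[OF assms(1,2) fin null[unfolded S_def], of "\<lambda>x. 1 / emeasure \<nu> {x}"] by (simp add: S_def)
  then show ?thesis by (simp add: of_nat_less_top)
qed

text \<open>Integrating \<open>1 / \<nu> {x}\<close> counts atoms: the integral is finite iff the support is finite.
  In particular the junk value of \<^term>\<open>Gamma_pairing\<close> for an infinite support is covered.\<close>

lemma Gamma_pairing_eq: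
  fixes \<nu> :: "real measure"
  assumes \<nu>: "prob_space \<nu>" and sets[measurable_cong]: "sets \<nu> = sets borel"
    and f[measurable]: "deriv (deriv f) \<in> borel_measurable borel"
  shows "Gamma_pairing f \<nu> = (if (\<integral>\<^sup>+x. 1 / emeasure \<nu> {x} \<partial>\<nu>) < \<infinity>
     then (\<integral>x. deriv (deriv f) x * enn2real (1 / emeasure \<nu> {x}) \<partial>\<nu>) / 2 else 0)"
proof (cases "(\<integral>\<^sup>+x. 1 / emeasure \<nu> {x} \<partial>\<nu>) < \<infinity>")
  case True
  note * = finite_support_of_finite_inverse_mass[OF \<nu> sets True]
  interpret prob_space \<nu> by fact
  note [measurable] = measurable_emeasure_singleton[OF \<nu> sets]
  have "(\<integral>x. deriv (deriv f) x * enn2real (1 / emeasure \<nu> {x}) \<partial>\<nu>) =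
      (\<Sum>x | emeasure \<nu> {x} > 0. deriv (deriv f) x * enn2real (1 / emeasure \<nu> {x}) * measure \<nu> {x})"
    by (rule integral_finite_atomic[OF \<nu> sets *(1,2)]) measurable
  also have "\<dots> = (\<Sum>x | emeasure \<nu> {x} > 0. deriv (deriv f) x)"
  proof (intro sum.cong refl)
    fix x assume "x \<in> {x. emeasure \<nu> {x} > 0}"
    then have p: "measure \<nu> {x} > 0" by (simp add: emeasure_eq_measure)
    then have "enn2real (1 / emeasure \<nu> {x}) = 1 / measure \<nu> {x}"
      using divide_ennreal[of 1 "measure \<nu> {x}"] by (simp add: emeasure_eq_measure)
    then show "deriv (deriv f) x * enn2real (1 / emeasure \<nu> {x}) * measure \<nu> {x} = deriv (deriv f) x" using p by simp
  qed
  finally show ?thesis using True by (simp add: Gamma_pairing_def *(3))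
next
  case False
  then have "infinite (measure_support \<nu>)" using finite_inverse_mass_of_finite_support[OF \<nu> sets] by blast
  then show ?thesis using False by (simp add: Gamma_pairing_def)
qed

section \<open>Joint measurability of random fields\<close>

lemma right_continuous_jointly_measurable:
  fixes h :: "'w \<Rightarrow> real \<Rightarrow> real"
  assumes m: "\<And>s. (\<lambda>\<omega>. h \<omega> s) \<in> borel_measurable M"
    and rc: "\<And>\<omega> s. \<omega> \<in> space M \<Longrightarrow> continuous (at_right s) (h \<omega>)"
  shows "(\<lambda>z. h (fst z) (snd z)) \<in> borel_measurable (M \<Otimes>\<^sub>M borel)"
proof -
  \<comment> \<open>The next point of the grid of mesh \<open>1 / Suc n\<close> strictly to the
    right of \<open>s\<close>. The added 1 keeps it different from \<open>s\<close>, so that it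
    approaches \<open>s\<close> within \<open>at_right s\<close>; it takes countably many values,
    which gives measurability of the approximations.\<close>
  define g where "g n s = (real_of_int \<lfloor>real (Suc n) * s\<rfloor> + 1) / real (Suc n)" for n s
  have 1: "(\<lambda>z. h (fst z) (g n (snd z))) \<in> borel_measurable (M \<Otimes>\<^sub>M borel)" for n
  proof -
    have "(\<lambda>z. (\<lambda>i z. h (fst z) ((real_of_int i + 1) / real (Suc n))) \<lfloor>real (Suc n) * snd z\<rfloor> z)
        \<in> borel_measurable (M \<Otimes>\<^sub>M (borel :: real measure))"
    proof (rule measurable_compose_countable[where f="\<lambda>i z. h (fst z) ((real_of_int i + 1) / real (Suc n))"
          and g="\<lambda>z. \<lfloor>real (Suc n) * snd z\<rfloor>"])
      show "(\<lambda>z. h (fst z) ((real_of_int i + 1) / real (Suc n))) \<in> borel_measurable (M \<Otimes>\<^sub>M (borel :: real measure))" for i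
        by (rule measurable_compose[OF measurable_fst m])
      show "(\<lambda>z. \<lfloor>real (Suc n) * snd z\<rfloor>) \<in> M \<Otimes>\<^sub>M (borel :: real measure) \<rightarrow>\<^sub>M count_space UNIV" by measurable
    qed
    then show ?thesis by (simp only: g_def)
  qed
  have 2: "(\<lambda>n. h (fst z) (g n (snd z))) \<longlonglongrightarrow> h (fst z) (snd z)"
    if z: "z \<in> space (M \<Otimes>\<^sub>M (borel :: real measure))" for z
  proof -
    define s where "s = snd z"
    have g1: "s < g n s" "g n s \<le> s + 1 / real (Suc n)" for n
    proof -
      have "real (Suc n) * s < real_of_int \<lfloor>real (Suc n) * s\<rfloor> + 1" by linarith
      then show "s < g n s" unfolding g_def by (subst pos_less_divide_eq) (auto simp: mult.commute)
      have "real_of_int \<lfloor>real (Suc n) * s\<rfloor> + 1 \<le> (s + 1 / real (Suc n)) * real (Suc n)"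
      proof -
        have "(s + 1 / real (Suc n)) * real (Suc n) = real (Suc n) * s + 1"
          unfolding distrib_right by (simp add: mult.commute del: of_nat_Suc)
        then show ?thesis using of_int_floor_le[of "real (Suc n) * s"] by linarith
      qed
      then show "g n s \<le> s + 1 / real (Suc n)" unfolding g_def by (subst pos_divide_le_eq) auto
    qed
    have "(\<lambda>n. s + 1 / real (Suc n)) \<longlonglongrightarrow> s + 0"
      by (intro tendsto_intros) (use LIMSEQ_inverse_real_of_nat in \<open>simp add: inverse_eq_divide\<close>)
    then have up: "(\<lambda>n. s + 1 / real (Suc n)) \<longlonglongrightarrow> s" by simp
    have "(\<lambda>n. g n s) \<longlonglongrightarrow> s"
    proof (rule tendsto_sandwich[OF _ _ tendsto_const up])
      show "\<forall>\<^sub>F n in sequentially. s \<le> g n s" using less_imp_le[OF g1(1)] by (rule always_eventually[OF allI])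
      show "\<forall>\<^sub>F n in sequentially. g n s \<le> s + 1 / real (Suc n)" using g1(2) by (rule always_eventually[OF allI])
    qed
    moreover have "\<forall>\<^sub>F n in sequentially. g n s \<in> {s<..} \<and> g n s \<noteq> s"
    proof (rule always_eventually, rule allI)
      show "g n s \<in> {s<..} \<and> g n s \<noteq> s" for n using g1(1)[of n] by simp
    qed
    ultimately have "filterlim (\<lambda>n. g n s) (at_right s) sequentially"
      by (simp add: filterlim_at)
    moreover have "(h (fst z) \<longlongrightarrow> h (fst z) s) (at_right s)"
      using rc[of "fst z" s] z by (auto simp: continuous_within space_pair_measure)
    ultimately show ?thesis
      unfolding s_def[symmetric] by (rule filterlim_compose[rotated])
  qed
  show ?thesis by (rule borel_measurable_LIMSEQ_real[OF 2 1])
qed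

abbreviation unit_measure :: "real measure" where
  "unit_measure \<equiv> restrict_space lborel {0..1}"

lemma prob_space_unit_measure: "prob_space unit_measure"
  by (rule prob_spaceI) (simp add: emeasure_restrict_space)

lemma measurable_unit_measure [measurable_dest]:
  "f \<in> borel_measurable borel \<Longrightarrow> f \<in> borel_measurable unit_measure"
  by (intro measurable_restrict_space1) simp

lemma measurable_ident_unit_measure [measurable]: "(\<lambda>u. u) \<in> borel_measurable unit_measure"
  by (intro measurable_restrict_space1) simp

text \<open>In contrast to \<open>mass\<close>, which collects everything that has met
  \<open>u\<close> up to time \<open>s\<close>, this looks at time \<open>s\<close> alone and is
  thus jointly measurable in all arguments. Along the flow the two agree for fixed \<open>u\<close>
  almost surely.\<close>

definition level_mass :: "(real \<Rightarrow> real \<Rightarrow> real) \<Rightarrow> real \<Rightarrow> real \<Rightarrow> ennreal" where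
  "level_mass x u s = emeasure lborel {v\<in>{0..1}. x v s = x u s}"

lemma level_mass_le_1: "level_mass x u s \<le> 1"
proof -
  have "level_mass x u s \<le> emeasure lborel {0..1::real}"
    unfolding level_mass_def by (rule emeasure_mono) auto
  then show ?thesis by simp
qed

locale measurable_slice =
  fixes x :: "real \<Rightarrow> real \<Rightarrow> real" and s :: real
  assumes slice[measurable]: "(\<lambda>u. x u s) \<in> borel_measurable borel"
begin

lemma prob_space_image_measure: "prob_space (image_measure x s)"
  unfolding image_measure_def
  by (intro prob_space.prob_space_distr[OF prob_space_unit_measure]) (simp add: measurable_unit_measure)

lemma sets_image_measure: "sets (image_measure x s) = sets borel"
  by (simp add: image_measure_def)

lemma emeasure_image_measure: "emeasure (image_measure x s) {x u s} = level_mass x u s"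
proof -
  have "emeasure (image_measure x s) {x u s} = emeasure unit_measure ((\<lambda>v. x v s) -` {x u s} \<inter> space unit_measure)"
    unfolding image_measure_def by (rule emeasure_distr) (auto intro: measurable_unit_measure)
  also have "(\<lambda>v. x v s) -` {x u s} \<inter> space unit_measure = {v\<in>{0..1}. x v s = x u s}"
    by (auto simp: space_restrict_space)
  also have "emeasure unit_measure {v\<in>{0..1}. x v s = x u s} = level_mass x u s"
    unfolding level_mass_def by (rule emeasure_restrict_space) auto
  finally show ?thesis .
qed

lemma integral_image_measure:
  "g \<in> borel_measurable borel \<Longrightarrow> (\<integral>c. g c \<partial>image_measure x s) = (\<integral>u. (g (x u s) :: real) \<partial>unit_measure)"
  unfolding image_measure_def by (rule integral_distr) (auto intro: measurable_unit_measure)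

lemma inverse_mass_image_measure:
  "(\<integral>\<^sup>+c. 1 / emeasure (image_measure x s) {c} \<partial>image_measure x s) = (\<integral>\<^sup>+u. 1 / level_mass x u s \<partial>unit_measure)"
proof -
  define q where "q c = 1 / emeasure (image_measure x s) {c}" for c
  have [measurable]: "q \<in> borel_measurable borel"
    unfolding q_def using measurable_emeasure_singleton[OF prob_space_image_measure sets_image_measure] by measurable
  have "(\<integral>\<^sup>+c. q c \<partial>image_measure x s) = (\<integral>\<^sup>+u. q (x u s) \<partial>unit_measure)"
    unfolding image_measure_def by (rule nn_integral_distr) (auto intro: measurable_unit_measure)
  then show ?thesis by (simp only: q_def emeasure_image_measure)
qed

text \<open>Written as an average over the particles, the pairing is visibly measurable in path and
  time, which the sum over the support does not show, and it becomes accessible to Fubini's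
  theorem.\<close>

lemma Gamma_pairing_image_measure:
  assumes [measurable]: "deriv (deriv f) \<in> borel_measurable borel"
  shows "Gamma_pairing f (image_measure x s) = (if (\<integral>\<^sup>+u. 1 / level_mass x u s \<partial>unit_measure) < \<infinity>
     then (\<integral>u. deriv (deriv f) (x u s) * enn2real (1 / level_mass x u s) \<partial>unit_measure) / 2 else 0)"
proof -
  have [measurable]: "(\<lambda>c. emeasure (image_measure x s) {c}) \<in> borel_measurable borel"
    by (rule measurable_emeasure_singleton[OF prob_space_image_measure sets_image_measure])
  have "(\<integral>c. deriv (deriv f) c * enn2real (1 / emeasure (image_measure x s) {c}) \<partial>image_measure x s)
      = (\<integral>u. deriv (deriv f) (x u s) * enn2real (1 / emeasure (image_measure x s) {x u s}) \<partial>unit_measure)"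
    by (rule integral_image_measure) measurable
  then show ?thesis
    using Gamma_pairing_eq[OF prob_space_image_measure sets_image_measure assms]
    by (simp only: emeasure_image_measure inverse_mass_image_measure)
qed

end

locale measurable_field =
  fixes M :: "'w measure" and x :: "'w \<Rightarrow> real \<Rightarrow> real \<Rightarrow> real"
  assumes joint: "(\<lambda>z. x (fst z) (fst (snd z)) (snd (snd z))) \<in> borel_measurable (M \<Otimes>\<^sub>M (borel \<Otimes>\<^sub>M borel))"
begin

lemma measurable_x [measurable (raw)]:
  assumes [measurable]: "f \<in> N \<rightarrow>\<^sub>M M" "g \<in> borel_measurable N" "h \<in> borel_measurable N"
  shows "(\<lambda>p. x (f p) (g p) (h p)) \<in> borel_measurable N"
proof -
  have "(\<lambda>p. (f p, g p, h p)) \<in> N \<rightarrow>\<^sub>M M \<Otimes>\<^sub>M (borel \<Otimes>\<^sub>M borel)" by measurable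
  from measurable_compose[OF this joint] show ?thesis by simp
qed

text \<open>The level set is the section at \<open>p\<close> of the measurable set \<open>Q\<close>,
  and measures of sections are measurable.\<close>

lemma measurable_level_mass [measurable (raw)]:
  assumes [measurable]: "f \<in> N \<rightarrow>\<^sub>M M" "g \<in> borel_measurable N" "h \<in> borel_measurable N"
  shows "(\<lambda>p. level_mass (x (f p)) (g p) (h p)) \<in> borel_measurable N"
proof -
  define Q where "Q = {z \<in> space (N \<Otimes>\<^sub>M lborel). snd z \<in> {0..1} \<and> x (f (fst z)) (snd z) (h (fst z)) = x (f (fst z)) (g (fst z)) (h (fst z))}"
  have "Q \<in> sets (N \<Otimes>\<^sub>M lborel)" unfolding Q_def by measurable
  then have "(\<lambda>p. emeasure lborel (Pair p -` Q)) \<in> borel_measurable N"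
    by (rule lborel.measurable_emeasure_Pair)
  moreover have "emeasure lborel (Pair p -` Q) = level_mass (x (f p)) (g p) (h p)" if "p \<in> space N" for p
    unfolding level_mass_def Q_def using that by (intro arg_cong[where f="emeasure lborel"]) (auto simp: space_pair_measure)
  ultimately show ?thesis by (simp cong: measurable_cong)
qed

lemma measurable_slice: "\<omega> \<in> space M \<Longrightarrow> measurable_slice (x \<omega>) s"
  by unfold_locales (rule measurable_x, auto)

interpretation U: prob_space unit_measure by (rule prob_space_unit_measure)

lemma measurable_integral_image [measurable (raw)]:
  fixes \<phi> :: "real \<Rightarrow> real"
  assumes \<phi>[measurable]: "\<phi> \<in> borel_measurable borel"
    and [measurable]: "f \<in> N \<rightarrow>\<^sub>M M" "h \<in> borel_measurable N"
  shows "(\<lambda>p. \<integral>c. \<phi> c \<partial>image_measure (x (f p)) (h p)) \<in> borel_measurable N"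
proof -
  have "(\<lambda>p. \<integral>u. \<phi> (x (f p) u (h p)) \<partial>unit_measure) \<in> borel_measurable N" by measurable
  moreover have "(\<integral>c. \<phi> c \<partial>image_measure (x (f p)) (h p)) = (\<integral>u. \<phi> (x (f p) u (h p)) \<partial>unit_measure)" if "p \<in> space N" for p
    using that by (intro measurable_slice.integral_image_measure measurable_slice \<phi>) (auto intro: measurable_space[OF assms(2)])
  ultimately show ?thesis by (simp cong: measurable_cong)
qed

lemma measurable_Gamma_pairing [measurable (raw)]:
  assumes \<phi>[measurable]: "deriv (deriv \<phi>) \<in> borel_measurable borel"
    and [measurable]: "f \<in> N \<rightarrow>\<^sub>M M" "h \<in> borel_measurable N"
  shows "(\<lambda>p. Gamma_pairing \<phi> (image_measure (x (f p)) (h p))) \<in> borel_measurable N"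
proof -
  have "(\<lambda>p. if (\<integral>\<^sup>+u. 1 / level_mass (x (f p)) u (h p) \<partial>unit_measure) < \<infinity>
     then (\<integral>u. deriv (deriv \<phi>) (x (f p) u (h p)) * enn2real (1 / level_mass (x (f p)) u (h p)) \<partial>unit_measure) / 2 else 0)
     \<in> borel_measurable N" by measurable
  moreover have "Gamma_pairing \<phi> (image_measure (x (f p)) (h p)) = (if (\<integral>\<^sup>+u. 1 / level_mass (x (f p)) u (h p) \<partial>unit_measure) < \<infinity>
     then (\<integral>u. deriv (deriv \<phi>) (x (f p) u (h p)) * enn2real (1 / level_mass (x (f p)) u (h p)) \<partial>unit_measure) / 2 else 0)" if "p \<in> space N" for p
    using that by (intro measurable_slice.Gamma_pairing_image_measure measurable_slice \<phi>) (auto intro: measurable_space[OF assms(2)])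
  ultimately show ?thesis by (simp cong: measurable_cong)
qed

end

text \<open>A finite integral makes \<open>k\<close> finite almost everywhere on the interval, so
  \<open>enn2real\<close>, which sends \<infinity> to 0, loses nothing.\<close>

lemma set_integrable_of_nn_integral:
  fixes k :: "real \<Rightarrow> ennreal"
  assumes k[measurable]: "k \<in> borel_measurable borel" and a: "0 \<le> a"
    and eq: "ennreal a = (\<integral>\<^sup>+r\<in>{0..t}. k r \<partial>lborel)"
  shows "set_integrable lborel {0..t} (\<lambda>r. enn2real (k r)) \<and> (LBINT r:{0..t}. enn2real (k r)) = a"
proof -
  have fin: "AE r in lborel. k r * indicator {0..t} r \<noteq> \<infinity>"
    by (rule nn_integral_noteq_infinite) (use eq in \<open>auto simp: eq[symmetric]\<close>)
  have eq2: "(\<integral>\<^sup>+r. ennreal (indicator {0..t} r *\<^sub>R enn2real (k r)) \<partial>lborel) = ennreal a"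
    unfolding eq
  proof (rule nn_integral_cong_AE)
    show "AE r in lborel. ennreal (indicator {0..t} r *\<^sub>R enn2real (k r)) = k r * indicator {0..t} r"
      using fin by eventually_elim (auto simp: indicator_def less_top[symmetric] split: if_splits)
  qed
  have i: "integrable lborel (\<lambda>r. indicator {0..t} r *\<^sub>R enn2real (k r))"
  proof (rule integrableI_nonneg)
    show "(\<integral>\<^sup>+r. ennreal (indicator {0..t} r *\<^sub>R enn2real (k r)) \<partial>lborel) < \<infinity>" unfolding eq2 by simp
  qed auto
  have "ennreal (LBINT r:{0..t}. enn2real (k r)) = ennreal a"
    unfolding set_lebesgue_integral_def eq2[symmetric] by (rule nn_integral_eq_integral[symmetric, OF i]) auto
  moreover have "0 \<le> (LBINT r:{0..t}. enn2real (k r))"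
    unfolding set_lebesgue_integral_def by (intro Bochner_Integration.integral_nonneg) auto
  ultimately show ?thesis using a i by (simp add: set_integrable_def)
qed

section \<open>Coalescence in the flow\<close>

context modified_massive_arratia_flow
begin

abbreviation "F \<equiv> flow_filtration P T y"

text \<open>The flow with its arguments clamped to \<open>[0,1] \<times> [0,t]\<close>: on every path it is right continuous in \<open>u\<close>
  and continuous in \<open>s\<close>, hence jointly measurable even with respect to the uncompleted \<open>F t\<close>.\<close>

definition clamped :: "real \<Rightarrow> 'a \<Rightarrow> real \<Rightarrow> real \<Rightarrow> real" where
  "clamped t \<omega> u s = y \<omega> (max 0 (min 1 u)) (max 0 (min t s))"

abbreviation "z \<equiv> clamped T"

lemma clamped_eq: "u \<in> {0..1} \<Longrightarrow> s \<in> {0..t} \<Longrightarrow> clamped t \<omega> u s = y \<omega> u s"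
  by (simp add: clamped_def)

lemma path_in_skorokhod_space: "\<omega> \<in> space P \<Longrightarrow> y \<omega> \<in> skorokhod_space T"
  using measurable_space[OF random_element] by (simp add: skorokhod_borel_def space_measure_of_conv)

lemma continuous_in_time: "\<omega> \<in> space P \<Longrightarrow> u \<in> {0..1} \<Longrightarrow> continuous_on {0..T} (y \<omega> u)"
  using path_in_skorokhod_space[of \<omega>] by (simp add: skorokhod_space_def)

lemma continuous_clamped:
  assumes "\<omega> \<in> space P" "t \<in> {0..T}"
  shows "continuous_on UNIV (clamped t \<omega> u)"
proof -
  have "continuous_on UNIV (\<lambda>s. y \<omega> (max 0 (min 1 u)) (max 0 (min t s)))"
    by (rule continuous_on_compose2[OF continuous_in_time[OF assms(1)]])
      (use assms(2) in \<open>auto intro!: continuous_intros\<close>)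
  then show ?thesis by (simp add: clamped_def[abs_def])
qed

text \<open>Inside \<open>[0, 1)\<close> the uniform limit in time is evaluated at one time;
  elsewhere the clamped flow is locally constant to the right of \<open>u\<close>.\<close>

lemma right_continuous_clamped:
  assumes \<omega>: "\<omega> \<in> space P" and t: "t \<in> {0..T}"
  shows "continuous (at_right u) (\<lambda>u. clamped t \<omega> u s)"
proof -
  define \<sigma> where "\<sigma> = max 0 (min t s)"
  have \<sigma>: "\<sigma> \<in> {0..T}" using t by (auto simp: \<sigma>_def)
  have c: "clamped t \<omega> v s = y \<omega> (max 0 (min 1 v)) \<sigma>" for v by (simp add: clamped_def \<sigma>_def)
  have "((\<lambda>v. y \<omega> (max 0 (min 1 v)) \<sigma>) \<longlongrightarrow> y \<omega> (max 0 (min 1 u)) \<sigma>) (at_right u)"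
  proof -
    consider "u < 0" | "0 \<le> u" "u < 1" | "1 \<le> u" by linarith
    then show ?thesis
    proof cases
      case 1
      then have "\<forall>\<^sub>F v in at_right u. y \<omega> (max 0 (min 1 v)) \<sigma> = y \<omega> (max 0 (min 1 u)) \<sigma>"
        unfolding eventually_at_right[OF 1] by (intro exI[of _ 0]) auto
      then show ?thesis by (rule tendsto_eventually)
    next
      case 2
      then have "uniform_limit {0..T} (y \<omega>) (y \<omega> u) (at_right u)"
        using path_in_skorokhod_space[OF \<omega>] by (simp add: skorokhod_space_def)
      then have l: "((\<lambda>v. y \<omega> v \<sigma>) \<longlongrightarrow> y \<omega> u \<sigma>) (at_right u)"
        by (rule tendsto_uniform_limitI[OF _ \<sigma>])
      have "\<forall>\<^sub>F v in at_right u. y \<omega> v \<sigma> = y \<omega> (max 0 (min 1 v)) \<sigma>"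
        unfolding eventually_at_right[OF 2(2)] using 2 by (intro exI[of _ 1]) auto
      with l have "((\<lambda>v. y \<omega> (max 0 (min 1 v)) \<sigma>) \<longlongrightarrow> y \<omega> u \<sigma>) (at_right u)"
        by (rule Lim_transform_eventually)
      then show ?thesis using 2 by simp
    next
      case 3
      have "\<forall>\<^sub>F v in at_right u. y \<omega> (max 0 (min 1 v)) \<sigma> = y \<omega> (max 0 (min 1 u)) \<sigma>"
        unfolding eventually_at_right[OF less_add_one[of u]] using 3 by (intro exI[of _ "u + 1"]) auto
      then show ?thesis by (rule tendsto_eventually)
    qed
  qed
  then show ?thesis unfolding continuous_within c .
qed

text \<open>Right continuity is used twice, in time for fixed \<open>u\<close> and then in
  \<open>u\<close>. The measure \<open>M\<close> is kept general because both \<open>P\<close> and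
  \<open>F t\<close> occur, the latter with time clamped at \<open>t\<close>.\<close>

lemma measurable_field_clamped:
  assumes sp: "space M = space P" and t: "t \<in> {0..T}"
    and m: "\<And>v s. v \<in> {0..1} \<Longrightarrow> s \<in> {0..t} \<Longrightarrow> (\<lambda>\<omega>. y \<omega> v s) \<in> borel_measurable M"
  shows "measurable_field M (clamped t)"
proof
  have 1: "(\<lambda>p. clamped t (fst p) u (snd p)) \<in> borel_measurable (M \<Otimes>\<^sub>M borel)" for u
  proof (rule right_continuous_jointly_measurable)
    show "(\<lambda>\<omega>. clamped t \<omega> u s) \<in> borel_measurable M" for s
      unfolding clamped_def using t by (intro m) auto
    show "continuous (at_right s) (clamped t \<omega> u)" if "\<omega> \<in> space M" for \<omega> s
      using continuous_clamped[of \<omega> t u] that sp t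
      by (auto intro: continuous_at_imp_continuous_within simp: continuous_on_eq_continuous_at)
  qed
  have 2: "(\<lambda>q. clamped t (fst (fst q)) (snd q) (snd (fst q))) \<in> borel_measurable ((M \<Otimes>\<^sub>M borel) \<Otimes>\<^sub>M borel)"
  proof (rule right_continuous_jointly_measurable[where h="\<lambda>p u. clamped t (fst p) u (snd p)"])
    show "(\<lambda>p. clamped t (fst p) u (snd p)) \<in> borel_measurable (M \<Otimes>\<^sub>M borel)" for u by (rule 1)
    show "continuous (at_right u) (\<lambda>u. clamped t (fst p) u (snd p))"
      if "p \<in> space (M \<Otimes>\<^sub>M (borel :: real measure))" for p u
    proof -
      have "fst p \<in> space M" using that by (simp add: space_pair_measure mem_Times_iff)
      then have "fst p \<in> space P" unfolding sp .
      from right_continuous_clamped[OF this t, of u "snd p"] show ?thesis .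
    qed
  qed
  have "(\<lambda>r. ((fst r, snd (snd r)), fst (snd r))) \<in> M \<Otimes>\<^sub>M (borel \<Otimes>\<^sub>M borel) \<rightarrow>\<^sub>M ((M \<Otimes>\<^sub>M (borel :: real measure)) \<Otimes>\<^sub>M (borel :: real measure))"
    by measurable
  from measurable_compose[OF this 2]
  show "(\<lambda>z. clamped t (fst z) (fst (snd z)) (snd (snd z))) \<in> borel_measurable (M \<Otimes>\<^sub>M (borel \<Otimes>\<^sub>M borel))"
    by simp
qed

lemma space_F [simp]: "space (F t) = space P"
  by (simp add: flow_filtration_def space_measure_of_conv)

lemma sets_F: "sets (F t) = sigma_sets (space P)
     {(\<lambda>\<omega>. y \<omega> v s) -` B \<inter> space P | v s B. v \<in> {0..1} \<and> s \<in> {0..T} \<and> s \<le> t \<and> B \<in> sets borel}"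
  unfolding flow_filtration_def by (rule sets_measure_of) auto

lemma measurable_y_F:
  assumes "v \<in> {0..1}" "s \<in> {0..T}" "s \<le> t"
  shows "(\<lambda>\<omega>. y \<omega> v s) \<in> borel_measurable (F t)"
proof (rule measurableI)
  fix B :: "real set" assume "B \<in> sets borel"
  then show "(\<lambda>\<omega>. y \<omega> v s) -` B \<inter> space (F t) \<in> sets (F t)"
    unfolding sets_F space_F using assms by (intro sigma_sets.Basic) blast
qed simp

lemma measurable_y:
  assumes "v \<in> {0..1}" "s \<in> {0..T}"
  shows "(\<lambda>\<omega>. y \<omega> v s) \<in> borel_measurable P"
  using C1[OF assms(1)] assms(2)
  by (auto simp: square_integrable_martingale_on_def martingale_on_def)

lemma subalgebra_F: "subalgebra P (F t)"
  unfolding subalgebra_def sets_F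
  by (auto intro!: sets.sigma_sets_subset measurable_sets[OF measurable_y])

lemma filtration_F: "s \<le> t \<Longrightarrow> subalgebra (F t) (F s)"
  unfolding subalgebra_def sets_F space_F
  by (intro conjI refl sigma_sets_subseteq) (blast intro: order_trans)

sublocale field: measurable_field P z
  using T_pos by (intro measurable_field_clamped measurable_y) auto

lemma measurable_field_F: "t \<in> {0..T} \<Longrightarrow> measurable_field (F t) (clamped t)"
  by (intro measurable_field_clamped measurable_y_F) auto

lemma image_measure_clamped: "s \<in> {0..t} \<Longrightarrow> image_measure (clamped t \<omega>) s = image_measure (y \<omega>) s"
  unfolding image_measure_def by (rule distr_cong) (auto simp: clamped_eq space_restrict_space)

lemma monotone_flow: "AE \<omega> in P. \<forall>u\<in>{0..1}. \<forall>v\<in>{0..1}. \<forall>t\<in>{0..T}. u \<le> v \<longrightarrow> y \<omega> u t \<le> y \<omega> v t"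
  using C3 by eventually_elim (auto simp: le_less)

section \<open>Particles that meet stay together\<close>

lemma L2_martingale_z:
  assumes u: "u \<in> {0..1}"
  shows "L2_martingale P F T (\<lambda>t \<omega>. z \<omega> u t)"
proof
  show "subalgebra P (F t)" for t by (rule subalgebra_F)
  show "s \<le> t \<Longrightarrow> subalgebra (F t) (F s)" for s t by (rule filtration_F)
  have eq: "(\<lambda>\<omega>. z \<omega> u t) = (\<lambda>\<omega>. y \<omega> u t)" if "t \<in> {0..T}" for t
    using clamped_eq[OF u that] by auto
  have "square_integrable_martingale_on P F T (\<lambda>t \<omega>. y \<omega> u t)" using C1[OF u] by simp
  then show "square_integrable_martingale_on P F T (\<lambda>t \<omega>. z \<omega> u t)"
    unfolding square_integrable_martingale_on_def martingale_on_def
    using clamped_eq[OF u] by (auto simp: eq)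
qed

text \<open>A nonnegative continuous martingale is absorbed at 0: by optional stopping at the first grid
  time where it is at most \<open>e\<close>.\<close>

lemma coalescence_at:
  assumes uv: "u \<in> {0..1}" "v \<in> {0..1}" "u < v" and r: "r \<in> {0..T}"
  shows "AE \<omega> in P. (\<exists>s\<in>{0..r}. y \<omega> u s = y \<omega> v s) \<longrightarrow> y \<omega> u r = y \<omega> v r"
proof -
  interpret Yu: L2_martingale P F T "\<lambda>t \<omega>. z \<omega> u t" by (rule L2_martingale_z[OF uv(1)])
  interpret Yv: L2_martingale P F T "\<lambda>t \<omega>. z \<omega> v t" by (rule L2_martingale_z[OF uv(2)])
  define D where "D s \<omega> = z \<omega> v s - z \<omega> u s" for s \<omega>
  have Dm[measurable]: "D s \<in> borel_measurable P" for s unfolding D_def by measurable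
  have Di: "integrable P (D s)" if "s \<in> {0..T}" for s
    unfolding D_def using Yu.square_integrable_Y[OF that] Yv.square_integrable_Y[OF that]
    by (intro Bochner_Integration.integrable_diff square_integrable_imp_integrable')
  have DF: "D s \<in> borel_measurable (F s)" if "s \<in> {0..T}" for s
    unfolding D_def by (intro borel_measurable_diff Yu.adapted Yv.adapted that)
  have D0: "AE \<omega> in P. \<forall>s\<in>{0..T}. 0 \<le> D s \<omega>"
    using monotone_flow by eventually_elim (use uv in \<open>auto simp: D_def clamped_eq\<close>)
  have Dmart: "(\<integral>\<omega>. indicator H \<omega> * D r \<omega> \<partial>P) = (\<integral>\<omega>. indicator H \<omega> * D s \<omega> \<partial>P)"
    if s: "0 \<le> s" "s \<le> r" and H: "H \<in> sets (F s)" for s H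
  proof -
    have rT: "r \<le> T" using r by simp
    have h: "indicator H \<in> borel_measurable (F s)" using H by simp
    have HP: "H \<in> sets P" using H subalgebra_F by (auto simp: subalgebra_def)
    have hs: "square_integrable P (indicator H)"
      by (rule square_integrable_bounded[where K=1]) (use HP in \<open>auto simp: indicator_def\<close>)
    have st: "s \<in> {0..T}" "r \<in> {0..T}" using s r by auto
    have i: "integrable P (\<lambda>\<omega>. indicator H \<omega> * (z \<omega> w r - z \<omega> w s))" if "w = u \<or> w = v" for w
      using that Yu.square_integrable_Y[OF st(1)] Yu.square_integrable_Y[OF st(2)]
        Yv.square_integrable_Y[OF st(1)] Yv.square_integrable_Y[OF st(2)]
      by (auto intro!: square_integrable_mult[OF hs] square_integrable_diff)
    have "(\<integral>\<omega>. indicator H \<omega> * D r \<omega> \<partial>P) - (\<integral>\<omega>. indicator H \<omega> * D s \<omega> \<partial>P)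
        = (\<integral>\<omega>. indicator H \<omega> * D r \<omega> - indicator H \<omega> * D s \<omega> \<partial>P)"
      using integrable_mult_indicator[OF HP Di[OF st(1)]] integrable_mult_indicator[OF HP Di[OF st(2)]]
      by (intro Bochner_Integration.integral_diff[symmetric]) auto
    also have "\<dots> = (\<integral>\<omega>. indicator H \<omega> * (z \<omega> v r - z \<omega> v s) - indicator H \<omega> * (z \<omega> u r - z \<omega> u s) \<partial>P)"
      by (intro Bochner_Integration.integral_cong) (auto simp: D_def algebra_simps)
    also have "\<dots> = (\<integral>\<omega>. indicator H \<omega> * (z \<omega> v r - z \<omega> v s) \<partial>P) - (\<integral>\<omega>. indicator H \<omega> * (z \<omega> u r - z \<omega> u s) \<partial>P)"
      by (intro Bochner_Integration.integral_diff i) auto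
    also have "\<dots> = 0"
      using Yu.martingale_orthogonal[OF s rT h hs] Yv.martingale_orthogonal[OF s rT h hs] by simp
    finally show ?thesis by simp
  qed
  define p where "p n = uniform_points 0 r n" for n
  have pr: "p n i \<in> {0..r}" if "i \<le> Suc n" for n i
    using partition_mono[of "Suc n" "p n" 0 i] partition_mono[of "Suc n" "p n" i "Suc n"] that r
      uniform_points_mono[of 0 r n] by (auto simp: p_def)
  have pmono: "p n i \<le> p n j" if "i \<le> j" "j \<le> Suc n" for n i j
    using partition_mono[of "Suc n" "p n" i j] that r uniform_points_mono[of 0 r n] by (auto simp: p_def)
  \<comment> \<open>The grid has \<open>Suc (Suc n)\<close> points; \<open>H e n i\<close> says that
    a value at most \<open>e\<close> has been seen at one of the first \<open>i\<close> of them,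
    which is decided at the grid time with index \<open>i - 1\<close>.\<close>
  define H where "H e n i = {\<omega> \<in> space P. \<exists>j<i. D (p n j) \<omega> \<le> e}" for e n i
  have HF: "H e n i \<in> sets (F (p n (i - 1)))" if "i \<le> Suc (Suc n)" for e n i
  proof -
    have Dj: "D (p n j) \<in> borel_measurable (F (p n (i - 1)))" if "j < i" for j
    proof (rule Yu.measurable_F_mono[OF _ DF])
      show "p n j \<le> p n (i - 1)" using that \<open>i \<le> Suc (Suc n)\<close> by (intro pmono) auto
      show "p n j \<in> {0..T}" using pr[of j n] that \<open>i \<le> Suc (Suc n)\<close> r by auto
    qed
    have "(\<Union>j<i. {\<omega> \<in> space (F (p n (i - 1))). D (p n j) \<omega> \<le> e}) \<in> sets (F (p n (i - 1)))"
      by (intro sets.finite_UN borel_measurable_iff_le[THEN iffD1, rule_format] Dj) auto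
    also have "(\<Union>j<i. {\<omega> \<in> space (F (p n (i - 1))). D (p n j) \<omega> \<le> e}) = H e n i" by (auto simp: H_def)
    finally show ?thesis .
  qed
  have HP[measurable]: "H e n i \<in> sets P" for e n i unfolding H_def by measurable
  \<comment> \<open>Optional stopping by induction on the grid index. The event \<open>L\<close>
    that the level \<open>e\<close> is reached for the first time at index \<open>i\<close> is
    decided at time \<open>p n i\<close>, so the martingale property replaces \<open>D r\<close>
    there by \<open>D (p n i)\<close>, which is at most \<open>e\<close>.\<close>
  have stop: "(\<integral>\<omega>. indicator (H e n i) \<omega> * D r \<omega> \<partial>P) \<le> e * measure P (H e n i)" if "i \<le> Suc (Suc n)" for e n i
    using that
  proof (induction i)
    case 0
    then show ?case by (simp add: H_def)
  next
    case (Suc i)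
    define L where "L = {\<omega> \<in> space P. D (p n i) \<omega> \<le> e} - H e n i"
    have [measurable]: "L \<in> sets P" unfolding L_def by measurable
    have pi: "0 \<le> p n i" "p n i \<le> r" "p n i \<in> {0..T}" using pr[of i n] Suc.prems r by auto
    have LF: "L \<in> sets (F (p n i))"
    proof -
      have "{\<omega> \<in> space (F (p n i)). D (p n i) \<omega> \<le> e} \<in> sets (F (p n i))"
        using DF[OF pi(3)] by measurable
      moreover have "H e n i \<in> sets (F (p n i))"
        using HF[of i n e] Suc.prems filtration_F[OF pmono[of "i - 1" i n]] by (auto simp: subalgebra_def)
      ultimately show ?thesis unfolding L_def by auto
    qed
    have HL: "H e n (Suc i) = H e n i \<union> L" "H e n i \<inter> L = {}" by (auto simp: H_def L_def less_Suc_eq)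
    have ind: "indicator (H e n (Suc i)) \<omega> = (indicator (H e n i) \<omega> + indicator L \<omega> :: real)" for \<omega>
      using HL by (auto simp: indicator_def)
    have i: "integrable P (\<lambda>\<omega>. indicator G \<omega> * D s \<omega>)" if "G \<in> sets P" "s \<in> {0..T}" for G s
      using integrable_mult_indicator[OF that(1) Di[OF that(2)]] by simp
    have "(\<integral>\<omega>. indicator (H e n (Suc i)) \<omega> * D r \<omega> \<partial>P) =
        (\<integral>\<omega>. indicator (H e n i) \<omega> * D r \<omega> \<partial>P) + (\<integral>\<omega>. indicator L \<omega> * D r \<omega> \<partial>P)"
      unfolding ind distrib_right using r by (intro Bochner_Integration.integral_add i) auto
    also have "(\<integral>\<omega>. indicator L \<omega> * D r \<omega> \<partial>P) = (\<integral>\<omega>. indicator L \<omega> * D (p n i) \<omega> \<partial>P)"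
      by (rule Dmart[OF pi(1,2) LF])
    also have "\<dots> \<le> (\<integral>\<omega>. e * indicator L \<omega> \<partial>P)"
    proof (rule integral_mono)
      show "integrable P (\<lambda>\<omega>. indicator L \<omega> * D (p n i) \<omega>)" by (intro i pi) measurable
      show "integrable P (\<lambda>\<omega>. e * indicator L \<omega>)"
        by (intro integrable_mult_right integrable_real_indicator) (auto simp: emeasure_finite less_top[symmetric])
    qed (auto simp: L_def indicator_def)
    also have "\<dots> = e * measure P L" by simp
    also have "(\<integral>\<omega>. indicator (H e n i) \<omega> * D r \<omega> \<partial>P) \<le> e * measure P (H e n i)" using Suc by simp
    also have "e * measure P (H e n i) + e * measure P L = e * measure P (H e n (Suc i))"
      unfolding HL using HL(2) by (subst finite_measure_Union) (auto simp: distrib_left)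
    finally show ?case by simp
  qed
  \<comment> \<open>The paths that come down to \<open>e\<close> on all sufficiently fine grids.
    Fatou's lemma transfers the bound for \<open>H\<close> to \<open>N e\<close>, and by uniform
    continuity every path touching 0 up to time \<open>r\<close> lies in all \<open>N e\<close> with
    \<open>e > 0\<close>.\<close>
  define N where "N e = {\<omega> \<in> space P. \<forall>\<^sub>F n in sequentially. \<omega> \<in> H e n (Suc (Suc n))}" for e
  have Nm[measurable]: "N e \<in> sets P" for e
  proof -
    have "N e = (\<Union>k. \<Inter>n. {\<omega> \<in> space P. k \<le> n \<longrightarrow> \<omega> \<in> H e n (Suc (Suc n))})"
      by (auto simp: N_def eventually_sequentially)
    also have "\<dots> \<in> sets P" by measurable
    finally show ?thesis .
  qed
  have DrP: "AE \<omega> in P. 0 \<le> D r \<omega>" using D0 by eventually_elim (use r in auto)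
  have Nle: "(\<integral>\<^sup>+\<omega>. ennreal (D r \<omega>) * indicator (N e) \<omega> \<partial>P) \<le> ennreal e" if e: "e > 0" for e
  proof -
    have "(\<integral>\<^sup>+\<omega>. ennreal (D r \<omega>) * indicator (N e) \<omega> \<partial>P)
      \<le> (\<integral>\<^sup>+\<omega>. liminf (\<lambda>n. ennreal (D r \<omega>) * indicator (H e n (Suc (Suc n))) \<omega>) \<partial>P)"
    proof (rule nn_integral_mono)
      fix \<omega> assume "\<omega> \<in> space P"
      show "ennreal (D r \<omega>) * indicator (N e) \<omega> \<le> liminf (\<lambda>n. ennreal (D r \<omega>) * indicator (H e n (Suc (Suc n))) \<omega>)"
      proof (cases "\<omega> \<in> N e")
        case True
        then have "\<forall>\<^sub>F n in sequentially. \<omega> \<in> H e n (Suc (Suc n))" by (simp add: N_def)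
        then have "\<forall>\<^sub>F n in sequentially. ennreal (D r \<omega>) \<le> ennreal (D r \<omega>) * indicator (H e n (Suc (Suc n))) \<omega>"
          by eventually_elim simp
        then have "ennreal (D r \<omega>) \<le> liminf (\<lambda>n. ennreal (D r \<omega>) * indicator (H e n (Suc (Suc n))) \<omega>)"
          by (rule Liminf_bounded)
        then show ?thesis using True by simp
      qed simp
    qed
    also have "\<dots> \<le> liminf (\<lambda>n. \<integral>\<^sup>+\<omega>. ennreal (D r \<omega>) * indicator (H e n (Suc (Suc n))) \<omega> \<partial>P)"
      by (rule nn_integral_liminf) measurable
    also have "\<dots> \<le> liminf (\<lambda>n. ennreal e)"
    proof (rule Liminf_mono, rule always_eventually, rule allI)
      fix n
      have i: "integrable P (\<lambda>\<omega>. indicator (H e n (Suc (Suc n))) \<omega> * D r \<omega>)"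
        using integrable_mult_indicator[OF HP Di[OF r]] by simp
      have "(\<integral>\<^sup>+\<omega>. ennreal (D r \<omega>) * indicator (H e n (Suc (Suc n))) \<omega> \<partial>P) =
          (\<integral>\<^sup>+\<omega>. ennreal (indicator (H e n (Suc (Suc n))) \<omega> * D r \<omega>) \<partial>P)"
        by (intro nn_integral_cong) (auto simp: indicator_def)
      also have "\<dots> = ennreal (\<integral>\<omega>. indicator (H e n (Suc (Suc n))) \<omega> * D r \<omega> \<partial>P)"
        using DrP by (intro nn_integral_eq_integral i) (auto elim!: eventually_mono)
      also have "\<dots> \<le> ennreal e"
      proof (rule ennreal_leI)
        have "e * measure P (H e n (Suc (Suc n))) \<le> e * 1" using e by (intro mult_left_mono) auto
        then show "(\<integral>\<omega>. indicator (H e n (Suc (Suc n))) \<omega> * D r \<omega> \<partial>P) \<le> e"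
          using stop[of "Suc (Suc n)" n e] by simp
      qed
      finally show "(\<integral>\<^sup>+\<omega>. ennreal (D r \<omega>) * indicator (H e n (Suc (Suc n))) \<omega> \<partial>P) \<le> ennreal e" .
    qed
    also have "\<dots> = ennreal e" by (simp add: Liminf_const)
    finally show ?thesis .
  qed
  define N0 where "N0 = (\<Inter>m. N (1 / real (Suc m)))"
  have N0m[measurable]: "N0 \<in> sets P" unfolding N0_def by measurable
  have "(\<integral>\<^sup>+\<omega>. ennreal (D r \<omega>) * indicator N0 \<omega> \<partial>P) \<le> ennreal (1 / real (Suc m))" for m
  proof -
    have "(\<integral>\<^sup>+\<omega>. ennreal (D r \<omega>) * indicator N0 \<omega> \<partial>P) \<le> (\<integral>\<^sup>+\<omega>. ennreal (D r \<omega>) * indicator (N (1 / real (Suc m))) \<omega> \<partial>P)"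
      by (intro nn_integral_mono mult_left_mono) (auto simp: N0_def indicator_def)
    also have "\<dots> \<le> ennreal (1 / real (Suc m))" by (rule Nle) simp
    finally show ?thesis .
  qed
  moreover have "(\<lambda>m. ennreal (1 / real (Suc m))) \<longlonglongrightarrow> ennreal 0"
    using LIMSEQ_inverse_real_of_nat by (intro tendsto_ennrealI) (simp add: inverse_eq_divide)
  ultimately have "(\<integral>\<^sup>+\<omega>. ennreal (D r \<omega>) * indicator N0 \<omega> \<partial>P) \<le> ennreal 0"
    by (intro LIMSEQ_le_const) auto
  then have "(\<integral>\<^sup>+\<omega>. ennreal (D r \<omega>) * indicator N0 \<omega> \<partial>P) = 0" by simp
  then have "AE \<omega> in P. ennreal (D r \<omega>) * indicator N0 \<omega> = 0"
    by (subst (asm) nn_integral_0_iff_AE) auto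
  then show ?thesis
    using D0 AE_space
  proof eventually_elim
    case (elim \<omega>)
    show ?case
    proof
      assume "\<exists>s\<in>{0..r}. y \<omega> u s = y \<omega> v s"
      then obtain s where s: "s \<in> {0..r}" "y \<omega> u s = y \<omega> v s" by blast
      have sT: "s \<in> {0..T}" using s r by auto
      have Ds: "D s \<omega> = 0" using s sT uv by (simp add: D_def clamped_eq)
      have cD: "continuous_on {0..r} (\<lambda>s. D s \<omega>)"
        unfolding D_def using continuous_clamped[OF elim(3), of T] T_pos
        by (intro continuous_on_diff) (auto intro: continuous_on_subset)
      have "\<omega> \<in> N e" if e: "e > 0" for e
      proof -
        obtain \<delta> where \<delta>: "\<delta> > 0" "\<And>a b. a \<in> {0..r} \<Longrightarrow> b \<in> {0..r} \<Longrightarrow> \<bar>a - b\<bar> < \<delta> \<Longrightarrow> \<bar>D a \<omega> - D b \<omega>\<bar> \<le> e"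
          using uniform_modulus[OF cD e] by blast
        have "\<forall>\<^sub>F n in sequentially. (r - 0) / real (Suc n) < \<delta>" by (rule eventually_uniform_step_less[OF \<delta>(1)])
        then have "\<forall>\<^sub>F n in sequentially. \<omega> \<in> H e n (Suc (Suc n))"
        proof eventually_elim
          case (elim n)
          obtain j where j: "j < Suc (Suc n)" "\<bar>p n j - s\<bar> < \<delta>"
          proof (cases "s < r")
            case True
            have "p n 0 \<le> s" using s by (simp add: p_def)
            \<comment> \<open>Only the location of the grid interval containing \<open>s\<close> is
              used, hence the coefficients 0.\<close>
            with step_function_value[where s="p n" and x=s and m="Suc n" and c="\<lambda>_. 0"] True
            obtain l where l: "l < Suc n" "p n l \<le> s" "s < p n (Suc l)"
              using uniform_points_mono[of 0 r n] r by (auto simp: p_def)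
            have "p n (Suc l) - p n l < \<delta>" using elim unfolding p_def uniform_points_step .
            then show ?thesis using l by (intro that[of l]) auto
          next
            case False
            then show ?thesis using s \<delta> by (intro that[of "Suc n"]) (auto simp: p_def)
          qed
          have "\<bar>D (p n j) \<omega> - D s \<omega>\<bar> \<le> e" using j s pr[of j n] by (intro \<delta>(2)) auto
          then have "D (p n j) \<omega> \<le> e" using Ds by simp
          then show ?case using j \<open>\<omega> \<in> space P\<close> by (auto simp: H_def)
        qed
        then show ?thesis using elim by (simp add: N_def)
      qed
      then have "\<omega> \<in> N0" by (simp add: N0_def)
      then have "D r \<omega> \<le> 0" using elim by (simp add: ennreal_eq_0_iff)
      moreover have "0 \<le> D r \<omega>" using elim(2) r by blast
      ultimately have "D r \<omega> = 0" by simp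
      then show "y \<omega> u r = y \<omega> v r" using r uv by (simp add: D_def clamped_eq)
    qed
  qed
qed

text \<open>The exceptional set of \<open>coalescence_at\<close> depends on \<open>r\<close>.
  Rational \<open>r\<close> leave one null set for the pair \<open>u\<close>, \<open>v\<close>, and
  continuity of the difference extends the conclusion to all times.\<close>

lemma coalescence:
  assumes uv: "u \<in> {0..1}" "v \<in> {0..1}"
  shows "AE \<omega> in P. \<forall>s t. 0 \<le> s \<longrightarrow> s \<le> t \<longrightarrow> t \<le> T \<longrightarrow> y \<omega> u s = y \<omega> v s \<longrightarrow> y \<omega> u t = y \<omega> v t"
proof -
  have less: "AE \<omega> in P. \<forall>s t. 0 \<le> s \<longrightarrow> s \<le> t \<longrightarrow> t \<le> T \<longrightarrow> y \<omega> u s = y \<omega> v s \<longrightarrow> y \<omega> u t = y \<omega> v t"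
    if uv: "u \<in> {0..1}" "v \<in> {0..1}" "u < v" for u v
  proof -
    have "AE \<omega> in P. \<forall>r\<in>\<rat> \<inter> {0..T}. (\<exists>s\<in>{0..r}. y \<omega> u s = y \<omega> v s) \<longrightarrow> y \<omega> u r = y \<omega> v r"
      by (subst AE_ball_countable) (auto intro!: coalescence_at[OF uv] simp: countable_rat)
    then show ?thesis
      using AE_space
    proof eventually_elim
      case (elim \<omega>)
      show ?case
      proof (intro allI impI)
        fix s t assume st: "0 \<le> s" "s \<le> t" "t \<le> T" and eq: "y \<omega> u s = y \<omega> v s"
        show "y \<omega> u t = y \<omega> v t"
        proof (cases "s < t")
          case True
          have c: "continuous_on {s..t} (\<lambda>r. y \<omega> u r - y \<omega> v r)"
            by (intro continuous_on_diff continuous_on_subset[OF continuous_in_time[OF elim(2)]]) (use uv st in auto)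
          show ?thesis
          proof (rule ccontr)
            assume ne: "y \<omega> u t \<noteq> y \<omega> v t"
            \<comment> \<open>Half of the gap at time \<open>t\<close>: at a rational time close to
              \<open>t\<close> the particles agree, so the modulus of continuity would give
              \<open>2 * e \<le> e\<close>.\<close>
            define e where "e = \<bar>y \<omega> u t - y \<omega> v t\<bar> / 2"
            have e: "e > 0" using ne by (simp add: e_def)
            obtain \<delta> where \<delta>: "\<delta> > 0" "\<And>a b. a \<in> {s..t} \<Longrightarrow> b \<in> {s..t} \<Longrightarrow> \<bar>a - b\<bar> < \<delta> \<Longrightarrow>
                \<bar>(y \<omega> u a - y \<omega> v a) - (y \<omega> u b - y \<omega> v b)\<bar> \<le> e"
              using uniform_modulus[OF c e] by blast
            obtain r where r: "r \<in> \<rat>" "max s (t - \<delta>) < r" "r < t"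
              using Rats_dense_in_real[of "max s (t - \<delta>)" t] True \<delta>(1) by auto
            have "r \<in> \<rat> \<inter> {0..T}" "s \<in> {0..r}" using r st by auto
            then have "y \<omega> u r = y \<omega> v r" using elim(1) eq by blast
            moreover have "\<bar>(y \<omega> u t - y \<omega> v t) - (y \<omega> u r - y \<omega> v r)\<bar> \<le> e"
              using r True by (intro \<delta>(2)) auto
            ultimately have "2 * e \<le> e" by (simp add: e_def)
            then show False using e by simp
          qed
        qed (use eq st in auto)
      qed
    qed
  qed
  consider "u < v" | "v < u" | "u = v" by linarith
  then show ?thesis
  proof cases
    case 2
    show ?thesis using less[OF uv(2,1) 2] by eventually_elim metis
  qed (use less uv in auto)
qed

text \<open>For fixed \<open>u\<close>, the particles that have met \<open>u\<close> are those sitting at its place, up to the two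
  ends of the cluster.\<close>

lemma mass_eq_level_mass:
  assumes u: "u \<in> {0..1}"
  shows "AE \<omega> in P. \<forall>s\<in>{0..T}. mass (y \<omega>) u s = level_mass (z \<omega>) u s"
proof -
  have "AE \<omega> in P. \<forall>q\<in>\<rat> \<inter> {0..1}. \<forall>s t. 0 \<le> s \<longrightarrow> s \<le> t \<longrightarrow> t \<le> T \<longrightarrow> y \<omega> u s = y \<omega> q s \<longrightarrow> y \<omega> u t = y \<omega> q t"
  proof (subst AE_ball_countable)
    show "countable (\<rat> \<inter> {0..1::real})" by (simp add: countable_rat)
  qed (intro ballI coalescence u, simp)
  then show ?thesis
    using monotone_flow AE_space
  proof eventually_elim
    case (elim \<omega>)
    show ?case
    proof
      fix s assume s: "s \<in> {0..T}"
      define J where "J = {v\<in>{0..1}. \<exists>s'\<in>{0..s}. y \<omega> v s' = y \<omega> u s'}"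
      define I where "I = {v\<in>{0..1}. z \<omega> v s = z \<omega> u s}"
      have Ieq: "I = {v\<in>{0..1}. y \<omega> v s = y \<omega> u s}" using s u by (auto simp: I_def clamped_eq)
      have IJ: "I \<subseteq> J" using s by (auto simp: Ieq J_def)
      have Im: "I \<in> sets lborel"
      proof -
        have "(\<lambda>v. z \<omega> v s) \<in> borel_measurable lborel" using elim(3) by (intro field.measurable_x) auto
        then have "{v \<in> space lborel. v \<in> {0..1} \<and> z \<omega> v s = z \<omega> u s} \<in> sets lborel" by measurable
        then show ?thesis by (simp add: I_def)
      qed
      have mono: "y \<omega> a r \<le> y \<omega> b r" if "a \<in> {0..1}" "b \<in> {0..1}" "a \<le> b" "r \<in> {0..T}" for a b r
        using elim(2) that by blast
      have co: "y \<omega> u s = y \<omega> q s" if "q \<in> \<rat>" "q \<in> {0..1}" "s' \<in> {0..s}" "y \<omega> u s' = y \<omega> q s'" for q s'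
      proof -
        have "q \<in> \<rat> \<inter> {0..1}" "0 \<le> s'" "s' \<le> s" "s \<le> T" using that s by auto
        then show ?thesis using elim(1) that(4) by blast
      qed
      \<comment> \<open>To the right of \<open>u\<close> only the last particle of \<open>J\<close>
        can be missing from \<open>I\<close>. If \<open>b\<close> in \<open>J\<close> lies beyond
        \<open>a\<close>, a rational \<open>q\<close> between them is squeezed onto \<open>u\<close>
        when \<open>b\<close> meets \<open>u\<close>; it then stays with \<open>u\<close> and
        squeezes \<open>a\<close> onto it. Coalescence is invoked for rational partners only, so one
        null set serves all particles.\<close>
      have up: "\<not> a < b" if h: "a \<in> J - I" "b \<in> J" "u < a" for a b
      proof
        assume "a < b"
        obtain q where q: "q \<in> \<rat>" "a < q" "q < b" using Rats_dense_in_real[OF \<open>a < b\<close>] by blast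
        obtain s' where s': "s' \<in> {0..s}" "y \<omega> b s' = y \<omega> u s'" using h by (auto simp: J_def)
        have r: "a \<in> {0..1}" "b \<in> {0..1}" "q \<in> {0..1}" "s' \<in> {0..T}" using h q s' s by (auto simp: J_def)
        have "y \<omega> u s' = y \<omega> q s'" using mono[of u q s'] mono[of q b s'] r u q s' h by auto
        then have "y \<omega> u s = y \<omega> q s" using co q r s' by blast
        then have "y \<omega> a s = y \<omega> u s" using mono[of u a s] mono[of a q s] r u q s h by auto
        then show False using h r by (simp add: Ieq)
      qed
      have down: "\<not> b < a" if h: "a \<in> J - I" "b \<in> J" "a < u" for a b
      proof
        assume "b < a"
        obtain q where q: "q \<in> \<rat>" "b < q" "q < a" using Rats_dense_in_real[OF \<open>b < a\<close>] by blast
        obtain s' where s': "s' \<in> {0..s}" "y \<omega> b s' = y \<omega> u s'" using h by (auto simp: J_def)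
        have r: "a \<in> {0..1}" "b \<in> {0..1}" "q \<in> {0..1}" "s' \<in> {0..T}" using h q s' s by (auto simp: J_def)
        have "y \<omega> u s' = y \<omega> q s'" using mono[of q u s'] mono[of b q s'] r u q s' h by auto
        then have "y \<omega> u s = y \<omega> q s" using co q r s' by blast
        then have "y \<omega> a s = y \<omega> u s" using mono[of a u s] mono[of q a s] r u q s h by auto
        then show False using h r by (simp add: Ieq)
      qed
      have uI: "u \<in> I" using u by (simp add: Ieq)
      have subsingleton: "finite X" if "\<And>a b. a \<in> X \<Longrightarrow> b \<in> X \<Longrightarrow> a = b" for X :: "real set"
      proof (cases "X = {}")
        case False
        then obtain a where "a \<in> X" by blast
        then have "X = {a}" using that by blast
        then show ?thesis by simp
      qed simp
      have "finite ((J - I) \<inter> {u<..})"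
        by (rule subsingleton) (metis DiffD1 Int_iff greaterThan_iff linorder_neqE_linordered_idom up)
      moreover have "finite ((J - I) \<inter> {..<u})"
        by (rule subsingleton) (metis DiffD1 Int_iff lessThan_iff linorder_neqE_linordered_idom down)
      moreover have "J - I \<subseteq> (J - I) \<inter> {u<..} \<union> (J - I) \<inter> {..<u}"
      proof
        fix x assume x: "x \<in> J - I"
        then have "x \<noteq> u" using uI by auto
        with x show "x \<in> (J - I) \<inter> {u<..} \<union> (J - I) \<inter> {..<u}" by (auto simp: neq_iff)
      qed
      ultimately have "finite (J - I)" by (meson finite_UnI finite_subset)
      then have "J - I \<in> null_sets lborel" by (rule finite_imp_null_set_lborel)
      from emeasure_Un_null_set[OF Im this] have "emeasure lborel J = emeasure lborel I"
        using IJ by (simp add: Un_absorb1 Un_Diff_cancel)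
      then show "mass (y \<omega>) u s = level_mass (z \<omega>) u s"
        by (simp add: mass_def level_mass_def J_def I_def)
    qed
  qed
qed

text \<open>The set of meeting times is closed, so its infimum is attained if there is one, and from
  then on the particles agree. The inserted \<open>T\<close> makes the left side true at
  \<open>s = T\<close> whether or not the particles have met; hence the restriction to
  \<open>s < T\<close>.\<close>

lemma meeting_time_le_iff:
  assumes uv: "u \<in> {0..1}" "v \<in> {0..1}"
  shows "AE \<omega> in P. \<forall>s\<in>{0..<T}. meeting_time T (y \<omega>) u v \<le> s \<longleftrightarrow> z \<omega> u s = z \<omega> v s"
  using coalescence[OF uv] AE_space
proof eventually_elim
  case (elim \<omega>)
  show ?case
  proof
    fix s assume s: "s \<in> {0..<T}"
    define M where "M = {t\<in>{0..T}. y \<omega> u t = y \<omega> v t}"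
    have cM: "closed M"
    proof -
      have "closed ({t\<in>{0..T}. y \<omega> u t - y \<omega> v t \<in> {0}})"
        using continuous_closed_preimage[of "{0..T}" "\<lambda>t. y \<omega> u t - y \<omega> v t" "{0}"]
          continuous_in_time[OF elim(2)] uv by (auto intro!: continuous_on_diff simp: vimage_def Int_def)
      then show ?thesis by (simp add: M_def)
    qed
    have bM: "bdd_below (insert T M)" using T_pos by (intro bdd_belowI[of _ 0]) (auto simp: M_def)
    have mt: "meeting_time T (y \<omega>) u v = Inf (insert T M)" by (simp add: meeting_time_def M_def)
    have "Inf (insert T M) \<in> insert T M"
      by (rule closed_contains_Inf) (use cM bM in auto)
    moreover have "meeting_time T (y \<omega>) u v \<le> s" if "s \<in> M"
      unfolding mt by (rule cInf_lower) (use that bM in auto)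
    moreover have "y \<omega> u s = y \<omega> v s" if "r \<in> M" "r \<le> s" for r
      using elim(1) that s by (auto simp: M_def)
    ultimately have "meeting_time T (y \<omega>) u v \<le> s \<longleftrightarrow> y \<omega> u s = y \<omega> v s"
      using s mt by (auto simp: M_def)
    then show "meeting_time T (y \<omega>) u v \<le> s \<longleftrightarrow> z \<omega> u s = z \<omega> v s"
      using s uv by (simp add: clamped_eq)
  qed
qed

text \<open>The densities of \<open>[y u]\<close> and \<open>[y u, y v]\<close> with respect to time.\<close>

definition rate :: "'a \<Rightarrow> real \<Rightarrow> real \<Rightarrow> real" where
  "rate \<omega> u r = enn2real (1 / level_mass (z \<omega>) u r)"

definition joint_rate :: "real \<Rightarrow> real \<Rightarrow> 'a \<Rightarrow> real \<Rightarrow> real" where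
  "joint_rate u v \<omega> r = (if z \<omega> u r = z \<omega> v r then rate \<omega> u r else 0)"

lemma rate_nonneg: "0 \<le> rate \<omega> u r" by (simp add: rate_def)

lemma measurable_rate [measurable (raw)]:
  assumes [measurable]: "f \<in> N \<rightarrow>\<^sub>M P" "g \<in> borel_measurable N" "h \<in> borel_measurable N"
  shows "(\<lambda>p. rate (f p) (g p) (h p)) \<in> borel_measurable N"
  unfolding rate_def by measurable

lemma measurable_joint_rate [measurable (raw)]:
  assumes [measurable]: "f \<in> N \<rightarrow>\<^sub>M P" "g \<in> borel_measurable N" "g' \<in> borel_measurable N" "h \<in> borel_measurable N"
  shows "(\<lambda>p. joint_rate (g p) (g' p) (f p) (h p)) \<in> borel_measurable N"
  unfolding joint_rate_def by measurable

text \<open>Restates the given quadratic variation through \<open>level_mass\<close> and coincidence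
  at the current time, which are jointly measurable. The last clause stays in the extended reals,
  because \<open>rate\<close> sends an infinite inverse mass to 0 and would hide it.\<close>

lemma quadratic_variation_density:
  assumes uv: "u \<in> {0..1}" "v \<in> {0..1}"
  obtains A where "joint_quadratic_variation P T (\<lambda>t \<omega>. z \<omega> u t) (\<lambda>t \<omega>. z \<omega> v t) A"
    "AE \<omega> in P. set_integrable lborel {0..T} (joint_rate u v \<omega>) \<and> (\<forall>t\<in>{0..T}. A t \<omega> = (LBINT r:{0..t}. joint_rate u v \<omega> r))"
    "AE \<omega> in P. 0 \<le> A T \<omega> \<and> ennreal (A T \<omega>) =
       (\<integral>\<^sup>+r\<in>{0..T}. (if z \<omega> u r = z \<omega> v r then 1 else 0) / level_mass (z \<omega>) u r \<partial>lborel)"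
proof -
  obtain A where qv: "joint_quadratic_variation P T (\<lambda>t \<omega>. y \<omega> u t) (\<lambda>t \<omega>. y \<omega> v t) A"
    and A: "AE \<omega> in P. \<forall>t\<in>{0..T}. 0 \<le> A t \<omega> \<and>
          ennreal (A t \<omega>) =
            (\<integral>\<^sup>+s\<in>{0..t}. (if meeting_time T (y \<omega>) u v \<le> s then 1 else 0) / mass (y \<omega>) u s \<partial>lborel)"
    using C4[OF uv] by blast
  have A': "AE \<omega> in P. \<forall>t\<in>{0..T}. 0 \<le> A t \<omega> \<and>
          ennreal (A t \<omega>) =
            (\<integral>\<^sup>+r\<in>{0..t}. (if z \<omega> u r = z \<omega> v r then 1 else 0) / level_mass (z \<omega>) u r \<partial>lborel)"
    using A mass_eq_level_mass[OF uv(1)] meeting_time_le_iff[OF uv]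
  proof eventually_elim
    case (elim \<omega>)
    show ?case
    proof (intro ballI conjI)
      fix t assume t: "t \<in> {0..T}"
      show "0 \<le> A t \<omega>" using elim(1) t by blast
      have "(\<integral>\<^sup>+s\<in>{0..t}. (if meeting_time T (y \<omega>) u v \<le> s then 1 else 0) / mass (y \<omega>) u s \<partial>lborel)
         = (\<integral>\<^sup>+r\<in>{0..t}. (if z \<omega> u r = z \<omega> v r then 1 else 0) / level_mass (z \<omega>) u r \<partial>lborel)"
      proof (rule nn_integral_cong_AE)
        show "AE s in lborel. (if meeting_time T (y \<omega>) u v \<le> s then 1 else 0) / mass (y \<omega>) u s * indicator {0..t} s
           = (if z \<omega> u s = z \<omega> v s then 1 else 0) / level_mass (z \<omega>) u s * indicator {0..t} s"
          \<comment> \<open>Time \<open>T\<close> is discarded since the meeting time is at most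
            \<open>T\<close> even for particles that never meet.\<close>
          using AE_lborel_singleton[of T]
        proof eventually_elim
          case (elim s)
          show ?case
          proof (cases "s \<in> {0..t}")
            case True
            then have "s \<in> {0..<T}" "s \<in> {0..T}" using elim t by auto
            then show ?thesis
              using \<open>\<forall>s\<in>{0..T}. mass (y \<omega>) u s = level_mass (z \<omega>) u s\<close>
                \<open>\<forall>s\<in>{0..<T}. meeting_time T (y \<omega>) u v \<le> s \<longleftrightarrow> z \<omega> u s = z \<omega> v s\<close> by simp
          qed simp
        qed
      qed
      then show "ennreal (A t \<omega>) = (\<integral>\<^sup>+r\<in>{0..t}. (if z \<omega> u r = z \<omega> v r then 1 else 0) / level_mass (z \<omega>) u r \<partial>lborel)"
        using elim(1) t by simp
    qed
  qed
  show ?thesis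
  proof
    have zy: "z \<omega> w t = y \<omega> w t" if "w \<in> {0..1}" "t \<in> {0..T}" for \<omega> w t using clamped_eq[OF that] .
    have sum_eq: "(\<Sum>i<n. (z \<omega> u (p (Suc i)) - z \<omega> u (p i)) * (z \<omega> v (p (Suc i)) - z \<omega> v (p i))) =
        (\<Sum>i<n. (y \<omega> u (p (Suc i)) - y \<omega> u (p i)) * (y \<omega> v (p (Suc i)) - y \<omega> v (p i)))"
      if "t \<in> {0..T}" "interval_partition t n p" for t n p \<omega>
    proof (intro sum.cong refl)
      fix i assume i: "i \<in> {..<n}"
      have "p j \<in> {0..T}" if "j \<le> n" for j
        using partition_mono[of n p 0 j] partition_mono[of n p j n] that \<open>t \<in> {0..T}\<close> \<open>interval_partition t n p\<close>
        by (auto simp: interval_partition_def)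
      then have "p i \<in> {0..T}" "p (Suc i) \<in> {0..T}" using i by auto
      then show "(z \<omega> u (p (Suc i)) - z \<omega> u (p i)) * (z \<omega> v (p (Suc i)) - z \<omega> v (p i)) =
        (y \<omega> u (p (Suc i)) - y \<omega> u (p i)) * (y \<omega> v (p (Suc i)) - y \<omega> v (p i))"
        using uv by (simp add: zy)
    qed
    show "joint_quadratic_variation P T (\<lambda>t \<omega>. z \<omega> u t) (\<lambda>t \<omega>. z \<omega> v t) A"
      unfolding joint_quadratic_variation_def
    proof (intro conjI ballI allI impI)
      fix t \<epsilon> \<eta> :: real assume t: "t \<in> {0..T}" and "\<epsilon> > 0" "\<eta> > 0"
      then obtain \<delta> where "\<delta> > 0" and \<delta>: "\<And>n p. interval_partition t n p \<and> (\<forall>i<n. p (Suc i) - p i < \<delta>) \<Longrightarrow>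
        measure P {\<omega>\<in>space P.
          \<bar>(\<Sum>i<n. (y \<omega> u (p (Suc i)) - y \<omega> u (p i)) * (y \<omega> v (p (Suc i)) - y \<omega> v (p i))) - A t \<omega>\<bar> > \<epsilon>} < \<eta>"
        using qv unfolding joint_quadratic_variation_def by meson
      then show "\<exists>\<delta>>0. \<forall>n p. interval_partition t n p \<and> (\<forall>i<n. p (Suc i) - p i < \<delta>) \<longrightarrow>
        measure P {\<omega>\<in>space P.
          \<bar>(\<Sum>i<n. (z \<omega> u (p (Suc i)) - z \<omega> u (p i)) * (z \<omega> v (p (Suc i)) - z \<omega> v (p i))) - A t \<omega>\<bar> > \<epsilon>} < \<eta>"
        using sum_eq[OF t] by (intro exI[of _ \<delta>]) auto
    qed (use qv in \<open>auto simp: joint_quadratic_variation_def\<close>)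
    show "AE \<omega> in P. 0 \<le> A T \<omega> \<and> ennreal (A T \<omega>) =
       (\<integral>\<^sup>+r\<in>{0..T}. (if z \<omega> u r = z \<omega> v r then 1 else 0) / level_mass (z \<omega>) u r \<partial>lborel)"
      using A' by eventually_elim (use T_pos in auto)
    show "AE \<omega> in P. set_integrable lborel {0..T} (joint_rate u v \<omega>) \<and> (\<forall>t\<in>{0..T}. A t \<omega> = (LBINT r:{0..t}. joint_rate u v \<omega> r))"
      using A' AE_space
    proof eventually_elim
      case (elim \<omega>)
      let ?k = "\<lambda>r. (if z \<omega> u r = z \<omega> v r then 1 else 0) / level_mass (z \<omega>) u r"
      have jr: "joint_rate u v \<omega> = (\<lambda>r. enn2real (?k r))"
        by (auto simp: joint_rate_def rate_def fun_eq_iff)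
      have c: "(\<lambda>r. \<omega>) \<in> (borel :: real measure) \<rightarrow>\<^sub>M P" using elim(2) by simp
      have m1: "(\<lambda>r. z \<omega> w r) \<in> borel_measurable borel" for w
        by (rule field.measurable_x[OF c]) auto
      have m2: "(\<lambda>r. level_mass (z \<omega>) u r) \<in> borel_measurable borel"
        by (rule field.measurable_level_mass[OF c]) auto
      have "{r \<in> space borel. z \<omega> u r = z \<omega> v r} \<in> sets borel"
        by (rule borel_measurable_eq[OF m1 m1])
      then have k: "?k \<in> borel_measurable borel"
        by (intro borel_measurable_divide_ennreal measurable_If m2) auto
      have *: "set_integrable lborel {0..t} (\<lambda>r. enn2real (?k r)) \<and> (LBINT r:{0..t}. enn2real (?k r)) = A t \<omega>"
        if "t \<in> {0..T}" for t
        using set_integrable_of_nn_integral[OF k, of "A t \<omega>" t] elim(1) that by blast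
      have "T \<in> {0..T}" using T_pos by simp
      show ?case unfolding jr
      proof (intro conjI ballI)
        show "set_integrable lborel {0..T} (\<lambda>r. enn2real (?k r))" by (rule *[OF \<open>T \<in> {0..T}\<close>, THEN conjunct1])
        show "A t \<omega> = (LBINT r:{0..t}. enn2real (?k r))" if "t \<in> {0..T}" for t
          by (rule *[OF that, THEN conjunct2, symmetric])
      qed
    qed
  qed
qed

lemma qv_martingale_z:
  assumes u: "u \<in> {0..1}"
  obtains A where "qv_martingale P F T (\<lambda>t \<omega>. z \<omega> u t) A (\<lambda>\<omega>. rate \<omega> u)"
    "AE \<omega> in P. 0 \<le> A T \<omega> \<and> ennreal (A T \<omega>) = (\<integral>\<^sup>+r\<in>{0..T}. 1 / level_mass (z \<omega>) u r \<partial>lborel)"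
proof -
  obtain A where A: "joint_quadratic_variation P T (\<lambda>t \<omega>. z \<omega> u t) (\<lambda>t \<omega>. z \<omega> u t) A"
    "AE \<omega> in P. set_integrable lborel {0..T} (joint_rate u u \<omega>) \<and> (\<forall>t\<in>{0..T}. A t \<omega> = (LBINT r:{0..t}. joint_rate u u \<omega> r))"
    "AE \<omega> in P. 0 \<le> A T \<omega> \<and> ennreal (A T \<omega>) =
       (\<integral>\<^sup>+r\<in>{0..T}. (if z \<omega> u r = z \<omega> u r then 1 else 0) / level_mass (z \<omega>) u r \<partial>lborel)"
    using quadratic_variation_density[OF u u] by blast
  have jr: "joint_rate u u \<omega> = rate \<omega> u" for \<omega> by (auto simp: joint_rate_def)
  interpret L2_martingale P F T "\<lambda>t \<omega>. z \<omega> u t" by (rule L2_martingale_z[OF u])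
  have "qv_martingale P F T (\<lambda>t \<omega>. z \<omega> u t) A (\<lambda>\<omega>. rate \<omega> u)"
  proof
    show "continuous_on {0..T} (\<lambda>t. z \<omega> u t)" if "\<omega> \<in> space P" for \<omega>
      using continuous_clamped[OF that, of T] T_pos by (auto intro: continuous_on_subset)
  qed (use A rate_nonneg in \<open>auto simp: jr\<close>)
  then show ?thesis using that A(3) by simp
qed

lemma qv_martingale_pair_z:
  assumes uv: "u \<in> {0..1}" "v \<in> {0..1}"
    and A: "qv_martingale P F T (\<lambda>t \<omega>. z \<omega> u t) A (\<lambda>\<omega>. rate \<omega> u)"
    and B: "qv_martingale P F T (\<lambda>t \<omega>. z \<omega> v t) B (\<lambda>\<omega>. rate \<omega> v)"
  obtains G where "qv_martingale_pair P F T (\<lambda>t \<omega>. z \<omega> u t) A (\<lambda>\<omega>. rate \<omega> u)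
      (\<lambda>t \<omega>. z \<omega> v t) B (\<lambda>\<omega>. rate \<omega> v) G (joint_rate u v)"
proof -
  obtain G where G: "joint_quadratic_variation P T (\<lambda>t \<omega>. z \<omega> u t) (\<lambda>t \<omega>. z \<omega> v t) G"
    "AE \<omega> in P. set_integrable lborel {0..T} (joint_rate u v \<omega>) \<and> (\<forall>t\<in>{0..T}. G t \<omega> = (LBINT r:{0..t}. joint_rate u v \<omega> r))"
    using quadratic_variation_density[OF uv] by blast
  interpret Y: qv_martingale P F T "\<lambda>t \<omega>. z \<omega> u t" A "\<lambda>\<omega>. rate \<omega> u" by (rule A)
  interpret Z: qv_martingale P F T "\<lambda>t \<omega>. z \<omega> v t" B "\<lambda>\<omega>. rate \<omega> v" by (rule B)
  have "qv_martingale_pair P F T (\<lambda>t \<omega>. z \<omega> u t) A (\<lambda>\<omega>. rate \<omega> u)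
      (\<lambda>t \<omega>. z \<omega> v t) B (\<lambda>\<omega>. rate \<omega> v) G (joint_rate u v)"
    by unfold_locales (use G in \<open>auto simp: joint_rate_def rate_nonneg\<close>)
  then show ?thesis by (rule that)
qed

end

section \<open>The martingale property\<close>

lemma ennreal_abs_integral_le:
  "ennreal \<bar>\<integral>x. f x \<partial>M\<bar> \<le> (\<integral>\<^sup>+x. ennreal \<bar>f x\<bar> \<partial>M)" for f :: "'a \<Rightarrow> real"
proof (cases "integrable M f")
  case True
  then show ?thesis using integral_norm_bound_ennreal[OF True] by simp
qed (simp add: not_integrable_integral_eq)

lemma continuous_on_indefinite_set_integral:
  fixes g :: "real \<Rightarrow> real"
  assumes g: "set_integrable lborel {0..T} g"
  shows "continuous_on {0..T} (\<lambda>t. LBINT r:{0..t}. g r)"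
proof (rule continuous_on_sequentiallyI)
  fix t :: "nat \<Rightarrow> real" and a assume t: "\<forall>n. t n \<in> {0..T}" and a: "a \<in> {0..T}" and lim: "t \<longlonglongrightarrow> a"
  show "(\<lambda>n. LBINT r:{0..t n}. g r) \<longlonglongrightarrow> (LBINT r:{0..a}. g r)"
    unfolding set_lebesgue_integral_def
  proof (rule integral_dominated_convergence)
    show "integrable lborel (\<lambda>r. \<bar>indicator {0..T} r *\<^sub>R g r\<bar>)"
      using g unfolding set_integrable_def by (rule integrable_abs)
    have "integrable lborel (\<lambda>r. indicator {0..s} r *\<^sub>R g r)" if "s \<in> {0..T}" for s
      using set_integrable_subset[OF g, of "{0..s}"] that by (auto simp: set_integrable_def)
    then show "(\<lambda>r. indicator {0..a} r *\<^sub>R g r) \<in> borel_measurable lborel"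
      "(\<lambda>r. indicator {0..t n} r *\<^sub>R g r) \<in> borel_measurable lborel" for n
      using a t by blast+
    show "AE r in lborel. norm (indicator {0..t n} r *\<^sub>R g r) \<le> \<bar>indicator {0..T} r *\<^sub>R g r\<bar>" for n
      using t[rule_format, of n] by (auto simp: indicator_def)
    show "AE r in lborel. (\<lambda>n. indicator {0..t n} r *\<^sub>R g r) \<longlonglongrightarrow> indicator {0..a} r *\<^sub>R g r"
      using AE_lborel_singleton[of a]
    proof eventually_elim
      case (elim r)
      have "\<forall>\<^sub>F n in sequentially. (indicator {0..t n} r :: real) = indicator {0..a} r"
      proof (cases "r < a")
        case True
        show ?thesis using order_tendstoD(1)[OF lim True] by eventually_elim (use True in \<open>auto simp: indicator_def\<close>)
      next
        case False
        then have ar: "a < r" using elim by simp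
        show ?thesis using order_tendstoD(2)[OF lim ar] by eventually_elim (use ar in \<open>auto simp: indicator_def\<close>)
      qed
      then have "\<forall>\<^sub>F n in sequentially. indicator {0..t n} r *\<^sub>R g r = indicator {0..a} r *\<^sub>R g r"
        by eventually_elim simp
      then show ?case by (rule tendsto_eventually)
    qed
  qed
qed

section \<open>Moment bounds uniform in the particle\<close>

context modified_massive_arratia_flow
begin

interpretation U: prob_space unit_measure by (rule prob_space_unit_measure)
interpretation PU: pair_sigma_finite P unit_measure by unfold_locales
interpretation UL: pair_sigma_finite unit_measure "lborel :: real measure" by unfold_locales

lemma path_measurable:
  assumes "\<omega> \<in> space P" "g \<in> borel_measurable N" "h \<in> borel_measurable N"
  shows "(\<lambda>p. z \<omega> (g p) (h p)) \<in> borel_measurable N"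
    and "(\<lambda>p. level_mass (z \<omega>) (g p) (h p)) \<in> borel_measurable N"
    and "(\<lambda>p. rate \<omega> (g p) (h p)) \<in> borel_measurable N"
  using field.measurable_x[of "\<lambda>_. \<omega>" N g h] field.measurable_level_mass[of "\<lambda>_. \<omega>" N g h]
    measurable_rate[of "\<lambda>_. \<omega>" N g h] assms by auto

lemma measurable_fst_snd_unit [measurable]:
  "fst \<in> borel_measurable (unit_measure \<Otimes>\<^sub>M M)" "snd \<in> borel_measurable (M \<Otimes>\<^sub>M unit_measure)"
  using measurable_compose[OF measurable_fst measurable_ident_unit_measure]
    measurable_compose[OF measurable_snd measurable_ident_unit_measure] by auto

lemma ennreal_rate_le: "ennreal (rate \<omega> u r) \<le> 1 / level_mass (z \<omega>) u r"
  unfolding rate_def by (cases "1 / level_mass (z \<omega>) u r") auto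

text \<open>By monotonicity every particle lies between the two extreme ones, so a single square
  integrable variable dominates the whole flow at time \<open>t\<close>.\<close>

definition bound_process :: "real \<Rightarrow> 'a \<Rightarrow> real" where
  "bound_process t \<omega> = \<bar>z \<omega> 0 t\<bar> + \<bar>z \<omega> 1 t\<bar>"

lemma bounded_flow: "AE \<omega> in P. \<forall>u\<in>{0..1}. \<forall>t\<in>{0..T}. \<bar>z \<omega> u t\<bar> \<le> bound_process t \<omega>"
  using monotone_flow
proof eventually_elim
  case (elim \<omega>)
  show ?case
  proof (intro ballI)
    fix u t :: real assume ut: "u \<in> {0..1}" "t \<in> {0..T}"
    then have "y \<omega> 0 t \<le> y \<omega> u t" "y \<omega> u t \<le> y \<omega> 1 t" using elim by auto
    then show "\<bar>z \<omega> u t\<bar> \<le> bound_process t \<omega>"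
      using ut by (auto simp: clamped_eq bound_process_def)
  qed
qed

lemma square_integrable_bound_process:
  assumes t: "t \<in> {0..T}"
  shows "square_integrable P (bound_process t)"
proof -
  have "square_integrable P (\<lambda>\<omega>. \<bar>z \<omega> u t\<bar>)" if "u \<in> {0..1}" for u
    using L2_martingale.square_integrable_Y[OF L2_martingale_z[OF that] t] by (simp add: square_integrable_def)
  then show ?thesis unfolding bound_process_def[abs_def] by (intro square_integrable_add) auto
qed

definition second_moment_bound :: "real \<Rightarrow> real" where
  "second_moment_bound t = (\<integral>\<omega>. (bound_process t \<omega>)\<^sup>2 \<partial>P)"

lemma second_moment_le:
  assumes u: "u \<in> {0..1}" and t: "t \<in> {0..T}"
  shows "(\<integral>\<omega>. (z \<omega> u t)\<^sup>2 \<partial>P) \<le> second_moment_bound t"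
  unfolding second_moment_bound_def
proof (rule integral_mono_AE)
  show "integrable P (\<lambda>\<omega>. (z \<omega> u t)\<^sup>2)" "integrable P (\<lambda>\<omega>. (bound_process t \<omega>)\<^sup>2)"
    using square_integrable_bound_process[OF t] L2_martingale.square_integrable_Y[OF L2_martingale_z[OF u] t]
    by (auto simp: square_integrable_def)
  show "AE \<omega> in P. (z \<omega> u t)\<^sup>2 \<le> (bound_process t \<omega>)\<^sup>2"
    using bounded_flow
  proof eventually_elim
    case (elim \<omega>)
    then have "\<bar>z \<omega> u t\<bar> \<le> bound_process t \<omega>" using u t by blast
    then show ?case using power_mono[of "\<bar>z \<omega> u t\<bar>" "bound_process t \<omega>" 2] by simp
  qed
qed

abbreviation total_rate :: "'a \<Rightarrow> real \<Rightarrow> ennreal" where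
  "total_rate \<omega> u \<equiv> (\<integral>\<^sup>+r\<in>{0..T}. (1 / level_mass (z \<omega>) u r) \<partial>lborel)"

text \<open>Kept in the extended reals with the integrand \<open>1 / level_mass\<close>: finiteness
  of its average over \<open>u\<close> will also exclude clusters of mass 0 for almost all particles
  and times.\<close>

lemma expected_inverse_mass:
  assumes u: "u \<in> {0..1}"
  shows "(\<integral>\<^sup>+\<omega>. total_rate \<omega> u \<partial>P) \<le> ennreal (second_moment_bound T)"
proof -
  obtain A where A: "qv_martingale P F T (\<lambda>t \<omega>. z \<omega> u t) A (\<lambda>\<omega>. rate \<omega> u)"
    "AE \<omega> in P. 0 \<le> A T \<omega> \<and> ennreal (A T \<omega>) = (total_rate \<omega> u)"
    using qv_martingale_z[OF u] by blast
  interpret qv_martingale P F T "\<lambda>t \<omega>. z \<omega> u t" A "\<lambda>\<omega>. rate \<omega> u" by (rule A)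
  have T: "T \<in> {0..T}" using T_pos by simp
  have "(\<integral>\<^sup>+\<omega>. total_rate \<omega> u \<partial>P) = (\<integral>\<^sup>+\<omega>. ennreal (A T \<omega>) \<partial>P)"
    using A(2) by (intro nn_integral_cong_AE, eventually_elim) simp
  also have "\<dots> = ennreal (\<integral>\<omega>. A T \<omega> \<partial>P)"
    by (rule nn_integral_eq_integral[OF integrable_A[OF T] A_nonneg[OF T]])
  also have "\<dots> \<le> ennreal (second_moment_bound T)"
  proof (rule ennreal_leI)
    have "0 \<le> (\<integral>\<omega>. (z \<omega> u 0)\<^sup>2 \<partial>P)" by simp
    then show "(\<integral>\<omega>. A T \<omega> \<partial>P) \<le> second_moment_bound T"
      using expectation_A[OF T] second_moment_le[OF u T] by linarith
  qed
  finally show ?thesis .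
qed

lemma measurable_inverse_mass_triple:
  "(\<lambda>p. 1 / level_mass (z (fst (fst p))) (snd (fst p)) (snd p) * indicator {0..T} (snd p))
     \<in> borel_measurable ((P \<Otimes>\<^sub>M unit_measure) \<Otimes>\<^sub>M lborel)"
  by measurable

lemma total_inverse_mass_finite:
  "(\<integral>\<^sup>+\<omega>. \<integral>\<^sup>+u. total_rate \<omega> u \<partial>unit_measure \<partial>P) < \<infinity>"
proof -
  have m: "(\<lambda>(\<omega>, u). total_rate \<omega> u) \<in> borel_measurable (P \<Otimes>\<^sub>M unit_measure)"
    using lborel.borel_measurable_nn_integral_fst[OF measurable_inverse_mass_triple]
    by (simp add: case_prod_unfold)
  have "(\<integral>\<^sup>+\<omega>. \<integral>\<^sup>+u. total_rate \<omega> u \<partial>unit_measure \<partial>P)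
     = (\<integral>\<^sup>+u. \<integral>\<^sup>+\<omega>. total_rate \<omega> u \<partial>P \<partial>unit_measure)"
    using PU.Fubini[OF m] by simp
  also have "\<dots> \<le> (\<integral>\<^sup>+u. ennreal (second_moment_bound T) \<partial>unit_measure)"
    by (intro nn_integral_mono expected_inverse_mass) (simp add: space_restrict_space)
  also have "\<dots> < \<infinity>" using U.emeasure_space_1 by (simp add: ennreal_mult_less_top)
  finally show ?thesis .
qed

text \<open>One event of probability 1, independent of \<open>u\<close> and \<open>t\<close>, on
  which the arguments become pathwise: finiteness of the averaged total rate justifies Fubini's
  theorem in particle and time, and the extreme particles dominate all others.\<close>

definition regular_path :: "'a \<Rightarrow> bool" where
  "regular_path \<omega> \<longleftrightarrow> \<omega> \<in> space P \<and>
    (\<integral>\<^sup>+u. total_rate \<omega> u \<partial>unit_measure) < \<infinity> \<and>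
    (\<forall>u\<in>{0..1}. \<forall>t\<in>{0..T}. \<bar>z \<omega> u t\<bar> \<le> bound_process t \<omega>)"

lemma AE_regular_path: "AE \<omega> in P. regular_path \<omega>"
proof -
  have m: "(\<lambda>\<omega>. \<integral>\<^sup>+u. total_rate \<omega> u \<partial>unit_measure) \<in> borel_measurable P"
    by measurable
  from nn_integral_PInf_AE[OF m] total_inverse_mass_finite
  have "AE \<omega> in P. (\<integral>\<^sup>+u. total_rate \<omega> u \<partial>unit_measure) \<noteq> \<infinity>" by simp
  then show ?thesis using bounded_flow AE_space
    by eventually_elim (auto simp: regular_path_def less_top[symmetric])
qed

section \<open>Identities on a regular path\<close>

context
  fixes \<omega> assumes reg: "regular_path \<omega>"
begin

lemma regular_space: "\<omega> \<in> space P" using reg by (simp add: regular_path_def)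

lemma measurable_inverse_mass_path:
  "(\<lambda>p. 1 / level_mass (z \<omega>) (fst p) (snd p) * indicator {0..T} (snd p)) \<in> borel_measurable (unit_measure \<Otimes>\<^sub>M lborel)"
proof -
  have [measurable]: "(\<lambda>p. level_mass (z \<omega>) (fst p) (snd p)) \<in> borel_measurable (unit_measure \<Otimes>\<^sub>M (lborel :: real measure))"
    by (rule path_measurable(2)[OF regular_space]) measurable
  show ?thesis by measurable
qed

lemma integrable_rate_product:
  assumes c: "(\<lambda>p. c (fst p) (snd p)) \<in> borel_measurable (unit_measure \<Otimes>\<^sub>M lborel)"
    and b: "\<And>u r. \<bar>c u r\<bar> \<le> C" and S: "S \<subseteq> {0..T}" "S \<in> sets borel"
  shows "integrable (unit_measure \<Otimes>\<^sub>M lborel) (\<lambda>(u, r). indicator S r *\<^sub>R (c u r * rate \<omega> u r :: real))"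
proof (rule integrableI_bounded)
  have [measurable]: "(\<lambda>p. rate \<omega> (fst p) (snd p)) \<in> borel_measurable (unit_measure \<Otimes>\<^sub>M (lborel :: real measure))"
    by (rule path_measurable(3)[OF regular_space]) measurable
  note [measurable] = c S(2)
  show "(\<lambda>(u, r). indicator S r *\<^sub>R (c u r * rate \<omega> u r :: real)) \<in> borel_measurable (unit_measure \<Otimes>\<^sub>M lborel)"
    unfolding case_prod_unfold by measurable
  have C: "0 \<le> C" using b[of 0 0] by simp
  have "(\<integral>\<^sup>+p. ennreal (norm (case p of (u, r) \<Rightarrow> indicator S r *\<^sub>R (c u r * rate \<omega> u r))) \<partial>(unit_measure \<Otimes>\<^sub>M lborel))
     \<le> (\<integral>\<^sup>+p. ennreal C * (1 / level_mass (z \<omega>) (fst p) (snd p) * indicator {0..T} (snd p)) \<partial>(unit_measure \<Otimes>\<^sub>M lborel))"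
  proof (rule nn_integral_mono)
    fix p :: "real \<times> real"
    obtain u r where p: "p = (u, r)" by (cases p)
    show "ennreal (norm (case p of (u, r) \<Rightarrow> indicator S r *\<^sub>R (c u r * rate \<omega> u r)))
        \<le> ennreal C * (1 / level_mass (z \<omega>) (fst p) (snd p) * indicator {0..T} (snd p))"
    proof (cases "r \<in> S")
      case True
      have "ennreal (\<bar>c u r\<bar> * rate \<omega> u r) \<le> ennreal (C * rate \<omega> u r)"
        using b rate_nonneg by (intro ennreal_leI mult_right_mono) auto
      also have "\<dots> = ennreal C * ennreal (rate \<omega> u r)" using C by (simp add: ennreal_mult')
      also have "\<dots> \<le> ennreal C * (1 / level_mass (z \<omega>) u r)" by (intro mult_left_mono ennreal_rate_le) simp
      finally show ?thesis using True S(1) rate_nonneg[of \<omega> u r] by (auto simp: p abs_mult)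
    qed (simp add: p)
  qed
  also have "\<dots> = ennreal C * (\<integral>\<^sup>+u. total_rate \<omega> u \<partial>unit_measure)"
    using measurable_inverse_mass_path
    by (simp add: nn_integral_cmult lborel.nn_integral_fst[OF measurable_inverse_mass_path, symmetric])
  also have "\<dots> < \<infinity>" using reg by (simp add: regular_path_def ennreal_mult_less_top)
  finally show "(\<integral>\<^sup>+p. ennreal (norm (case p of (u, r) \<Rightarrow> indicator S r *\<^sub>R (c u r * rate \<omega> u r))) \<partial>(unit_measure \<Otimes>\<^sub>M lborel)) < \<infinity>" .
qed

text \<open>By Tonelli's theorem the finite averaged total rate is a time integral of these
  quantities. Their finiteness means that the image measure has finite support, so
  \<open>Gamma_pairing\<close> has its proper value at almost every time.\<close>

lemma AE_inverse_mass_finite: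
  "AE r in lborel. r \<in> {0..T} \<longrightarrow> (\<integral>\<^sup>+u. 1 / level_mass (z \<omega>) u r \<partial>unit_measure) < \<infinity>"
proof -
  let ?f = "\<lambda>p. 1 / level_mass (z \<omega>) (fst p) (snd p) * indicator {0..T} (snd p)"
  have "(\<integral>\<^sup>+r. \<integral>\<^sup>+u. ?f (u, r) \<partial>unit_measure \<partial>lborel) = (\<integral>\<^sup>+u. \<integral>\<^sup>+r. ?f (u, r) \<partial>lborel \<partial>unit_measure)"
    using UL.nn_integral_snd[OF measurable_inverse_mass_path] lborel.nn_integral_fst[OF measurable_inverse_mass_path] by simp
  then have fin: "(\<integral>\<^sup>+r. \<integral>\<^sup>+u. ?f (u, r) \<partial>unit_measure \<partial>lborel) \<noteq> \<infinity>"
    using reg by (auto simp: regular_path_def)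
  have "(\<lambda>r. \<integral>\<^sup>+u. ?f (u, r) \<partial>unit_measure) \<in> borel_measurable lborel"
    using U.borel_measurable_nn_integral_fst[of "\<lambda>q. ?f (snd q, fst q)" lborel]
      measurable_compose[OF measurable_pair_swap'[of lborel unit_measure] measurable_inverse_mass_path]
    by (simp add: case_prod_unfold)
  from nn_integral_PInf_AE[OF this fin] show ?thesis
    by eventually_elim (auto simp: less_top[symmetric])
qed

context
  fixes f :: "real \<Rightarrow> real" and C1 C2 assumes f: "C2_bounded f (deriv f) (deriv (deriv f)) C1 C2"
begin

interpretation C2_bounded f "deriv f" "deriv (deriv f)" C1 C2 by (rule f)

lemma measurable_path_rate_integrand:
  "(\<lambda>p. deriv (deriv f) (z \<omega> (fst p) (snd p))) \<in> borel_measurable (unit_measure \<Otimes>\<^sub>M lborel)"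
  by (rule measurable_compose[OF path_measurable(1)[OF regular_space] measurable_f(3)]) measurable

lemma path_slice: "measurable_slice (z \<omega>) s"
  by (rule field.measurable_slice[OF regular_space])

lemma Gamma_pairing_path:
  "AE r in lborel. r \<in> {0..T} \<longrightarrow> Gamma_pairing f (image_measure (z \<omega>) r) =
     (\<integral>u. deriv (deriv f) (z \<omega> u r) * rate \<omega> u r \<partial>unit_measure) / 2"
  using AE_inverse_mass_finite
  by eventually_elim (simp add: measurable_slice.Gamma_pairing_image_measure[OF path_slice measurable_f(3)] rate_def)

text \<open>Fubini's theorem exchanges the time integral with the average over the particles; the
  factor 2 in the proof undoes the 1/2 in \<open>Gamma_pairing\<close>.\<close>

lemma Gamma_integral_path:
  assumes st: "0 \<le> s" "s \<le> t" "t \<le> T"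
  shows "set_integrable lborel {s..t} (\<lambda>r. Gamma_pairing f (image_measure (z \<omega>) r))"
    and "(LBINT r:{s..t}. Gamma_pairing f (image_measure (z \<omega>) r)) =
      (\<integral>u. (LBINT r:{s..t}. deriv (deriv f) (z \<omega> u r) * rate \<omega> u r) \<partial>unit_measure) / 2"
    and "integrable unit_measure (\<lambda>u. LBINT r:{s..t}. deriv (deriv f) (z \<omega> u r) * rate \<omega> u r)"
proof -
  have sub: "{s..t} \<subseteq> {0..T}" using st by auto
  have i: "integrable (unit_measure \<Otimes>\<^sub>M lborel) (\<lambda>(u, r). indicator {s..t} r *\<^sub>R (deriv (deriv f) (z \<omega> u r) * rate \<omega> u r))"
    by (rule integrable_rate_product[OF measurable_path_rate_integrand bound2 sub]) simp
  have ae: "AE r in lborel. (\<integral>u. indicator {s..t} r *\<^sub>R (deriv (deriv f) (z \<omega> u r) * rate \<omega> u r) \<partial>unit_measure) =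
      2 * (indicator {s..t} r *\<^sub>R Gamma_pairing f (image_measure (z \<omega>) r))"
    using Gamma_pairing_path by eventually_elim (use sub in \<open>auto simp: indicator_def\<close>)
  have m: "(\<lambda>r. indicator {s..t} r *\<^sub>R Gamma_pairing f (image_measure (z \<omega>) r)) \<in> borel_measurable lborel"
  proof -
    have "(\<lambda>r. Gamma_pairing f (image_measure (z \<omega>) r)) \<in> borel_measurable lborel"
      by (rule field.measurable_Gamma_pairing[OF measurable_f(3)]) (use regular_space in auto)
    then show ?thesis by measurable
  qed
  have i2: "integrable lborel (\<lambda>r. \<integral>u. indicator {s..t} r *\<^sub>R (deriv (deriv f) (z \<omega> u r) * rate \<omega> u r) \<partial>unit_measure)"
    using UL.integrable_snd[OF i] by simp
  have "integrable lborel (\<lambda>r. 2 * (indicator {s..t} r *\<^sub>R Gamma_pairing f (image_measure (z \<omega>) r)))"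
    by (rule integrable_cong_AE_imp[OF i2 _ ae]) (use m in measurable)
  then show "set_integrable lborel {s..t} (\<lambda>r. Gamma_pairing f (image_measure (z \<omega>) r))"
    by (simp add: set_integrable_def)
  have "2 * (LBINT r:{s..t}. Gamma_pairing f (image_measure (z \<omega>) r)) =
      (\<integral>r. 2 * (indicator {s..t} r *\<^sub>R Gamma_pairing f (image_measure (z \<omega>) r)) \<partial>lborel)"
    by (simp add: set_lebesgue_integral_def)
  also have "\<dots> = (\<integral>r. \<integral>u. indicator {s..t} r *\<^sub>R (deriv (deriv f) (z \<omega> u r) * rate \<omega> u r) \<partial>unit_measure \<partial>lborel)"
    using ae m borel_measurable_integrable[OF i2] by (intro integral_cong_AE) (auto elim!: eventually_mono)
  also have "\<dots> = (\<integral>u. \<integral>r. indicator {s..t} r *\<^sub>R (deriv (deriv f) (z \<omega> u r) * rate \<omega> u r) \<partial>lborel \<partial>unit_measure)"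
    by (rule UL.Fubini_integral[OF i])
  finally show "(LBINT r:{s..t}. Gamma_pairing f (image_measure (z \<omega>) r)) =
      (\<integral>u. (LBINT r:{s..t}. deriv (deriv f) (z \<omega> u r) * rate \<omega> u r) \<partial>unit_measure) / 2"
    by (simp add: set_lebesgue_integral_def)
  show "integrable unit_measure (\<lambda>u. LBINT r:{s..t}. deriv (deriv f) (z \<omega> u r) * rate \<omega> u r)"
    using UL.integrable_fst[OF i] by (simp add: set_lebesgue_integral_def)
qed

lemma f_path_bound: "u \<in> {0..1} \<Longrightarrow> t \<in> {0..T} \<Longrightarrow> \<bar>f (z \<omega> u t)\<bar> \<le> \<bar>f 0\<bar> + C1 * bound_process t \<omega>"
  using linear_growth[of "z \<omega> u t"] reg mult_left_mono[OF _ C1_nonneg, of "\<bar>z \<omega> u t\<bar>" "bound_process t \<omega>"]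
  by (auto simp: regular_path_def)

lemma integrable_f_path:
  assumes t: "t \<in> {0..T}"
  shows "integrable unit_measure (\<lambda>u. f (z \<omega> u t))"
proof (rule U.integrable_const_bound)
  show "AE u in unit_measure. norm (f (z \<omega> u t)) \<le> \<bar>f 0\<bar> + C1 * bound_process t \<omega>"
    using f_path_bound[OF _ t] by (intro AE_I2) (auto simp: space_restrict_space)
  show "(\<lambda>u. f (z \<omega> u t)) \<in> borel_measurable unit_measure"
    by (rule measurable_compose[OF path_measurable(1)[OF regular_space] measurable_f(1)]) measurable
qed

lemma integral_image_path: "(\<integral>x. \<phi> x \<partial>image_measure (z \<omega>) t) = (\<integral>u. \<phi> (z \<omega> u t) \<partial>unit_measure)"
  if "\<phi> \<in> borel_measurable borel" for \<phi> :: "real \<Rightarrow> real"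
  by (rule measurable_slice.integral_image_measure[OF path_slice that])

text \<open>Dominated convergence over the particles; the majorant can be a constant because
  \<open>bound_process\<close> is continuous in time, hence bounded on
  \<open>[0, T]\<close>.\<close>

lemma continuous_on_f_path: "continuous_on {0..T} (\<lambda>t. \<integral>u. f (z \<omega> u t) \<partial>unit_measure)"
proof (rule continuous_on_sequentiallyI)
  fix t :: "nat \<Rightarrow> real" and a assume t: "\<forall>n. t n \<in> {0..T}" and a: "a \<in> {0..T}" and lim: "t \<longlonglongrightarrow> a"
  have TT: "T \<in> {0..T}" using T_pos by simp
  have c: "continuous_on UNIV (z \<omega> u)" for u by (rule continuous_clamped[OF regular_space TT])
  have "continuous_on {0..T} (\<lambda>t. bound_process t \<omega>)"
    unfolding bound_process_def by (intro continuous_intros continuous_on_subset[OF c]) auto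
  then have "bounded ((\<lambda>t. bound_process t \<omega>) ` {0..T})" by (intro compact_imp_bounded compact_continuous_image) auto
  then obtain B where B: "\<forall>t\<in>{0..T}. \<bar>bound_process t \<omega>\<bar> \<le> B" by (auto simp: bounded_iff)
  show "(\<lambda>n. \<integral>u. f (z \<omega> u (t n)) \<partial>unit_measure) \<longlonglongrightarrow> (\<integral>u. f (z \<omega> u a) \<partial>unit_measure)"
  proof (rule integral_dominated_convergence[where w="\<lambda>_. \<bar>f 0\<bar> + C1 * B"])
    show "(\<lambda>u. f (z \<omega> u a)) \<in> borel_measurable unit_measure" "(\<lambda>u. f (z \<omega> u (t n))) \<in> borel_measurable unit_measure" for n
      using integrable_f_path a t by (blast intro: borel_measurable_integrable)+
    show "AE u in unit_measure. (\<lambda>n. f (z \<omega> u (t n))) \<longlonglongrightarrow> f (z \<omega> u a)"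
    proof (rule AE_I2)
      fix u
      have "isCont (z \<omega> u) a" using c[of u] by (simp add: continuous_on_eq_continuous_at)
      then have "(\<lambda>n. z \<omega> u (t n)) \<longlonglongrightarrow> z \<omega> u a" using lim by (rule isCont_tendsto_compose)
      moreover have "isCont f (z \<omega> u a)" using cont0 by (simp add: continuous_on_eq_continuous_at)
      ultimately show "(\<lambda>n. f (z \<omega> u (t n))) \<longlonglongrightarrow> f (z \<omega> u a)" by (rule isCont_tendsto_compose[rotated])
    qed
    show "AE u in unit_measure. norm (f (z \<omega> u (t n))) \<le> \<bar>f 0\<bar> + C1 * B" for n
    proof (rule AE_I2)
      fix u assume "u \<in> space unit_measure"
      then have "\<bar>f (z \<omega> u (t n))\<bar> \<le> \<bar>f 0\<bar> + C1 * bound_process (t n) \<omega>"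
        using t by (intro f_path_bound) (auto simp: space_restrict_space)
      also have "\<dots> \<le> \<bar>f 0\<bar> + C1 * B"
        using B t C1_nonneg by (intro add_left_mono mult_left_mono) (auto simp: abs_le_iff)
      finally show "norm (f (z \<omega> u (t n))) \<le> \<bar>f 0\<bar> + C1 * B" by simp
    qed
  qed auto
qed

end

end

text \<open>Up to time \<open>t\<close> the process depends only on the flow clamped at
  \<open>t\<close>, which is jointly measurable with respect to \<open>F t\<close>. The equality
  holds on every path, so adaptedness follows without changing the process on a null set.\<close>

lemma flow_process_clamped:
  "t' \<in> {0..t} \<Longrightarrow> flow_process y f t' \<omega> = flow_process (clamped t) f t' \<omega>"
  unfolding flow_process_def
  by (auto intro!: arg_cong2[where f="(-)"] set_lebesgue_integral_cong simp: image_measure_clamped)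

section \<open>Averaging the martingales of the single particles\<close>

context
  fixes f :: "real \<Rightarrow> real" and C1 C2 assumes f: "C2_bounded f (deriv f) (deriv (deriv f)) C1 C2"
begin

interpretation C2_bounded f "deriv f" "deriv (deriv f)" C1 C2 by (rule f)

lemma flow_process_adapted:
  assumes t: "t \<in> {0..T}"
  shows "flow_process y f t \<in> borel_measurable (F t)"
proof -
  interpret A: measurable_field "F t" "clamped t" by (rule measurable_field_F[OF t])
  have "(\<lambda>p. Gamma_pairing f (image_measure (clamped t (fst p)) (snd p))) \<in> borel_measurable (F t \<Otimes>\<^sub>M lborel)"
    by (rule A.measurable_Gamma_pairing[OF measurable_f(3)]) auto
  then have "(\<lambda>p. indicator {0..t} (snd p) *\<^sub>R Gamma_pairing f (image_measure (clamped t (fst p)) (snd p))) \<in> borel_measurable (F t \<Otimes>\<^sub>M lborel)"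
    by measurable
  then have 1: "(\<lambda>\<omega>. LBINT s:{0..t}. Gamma_pairing f (image_measure (clamped t \<omega>) s)) \<in> borel_measurable (F t)"
    unfolding set_lebesgue_integral_def
    by (intro lborel.borel_measurable_lebesgue_integral) (simp add: case_prod_unfold)
  have 2: "(\<lambda>\<omega>. \<integral>x. f x \<partial>image_measure (clamped t \<omega>) t) \<in> borel_measurable (F t)"
    by (rule A.measurable_integral_image[OF measurable_f(1)]) auto
  have eq: "flow_process y f t = (\<lambda>\<omega>. flow_process (clamped t) f t \<omega>)"
    using flow_process_clamped[of t t] t by auto
  show ?thesis unfolding eq unfolding flow_process_def by (rule borel_measurable_diff[OF 2 1])
qed

text \<open>The increment over \<open>[s, t]\<close> of the martingale attached to the single
  particle \<open>u\<close>, whose average over \<open>u\<close> is the increment of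
  \<open>flow_process\<close>.\<close>

definition compensated :: "real \<Rightarrow> real \<Rightarrow> real \<Rightarrow> 'a \<Rightarrow> real" where
  "compensated s t u \<omega> = f (z \<omega> u t) - f (z \<omega> u s) -
     (LBINT r:{s..t}. deriv (deriv f) (z \<omega> u r) * rate \<omega> u r) / 2"

lemma flow_process_path:
  assumes "regular_path \<omega>" "t \<in> {0..T}"
  shows "flow_process y f t \<omega> = (\<integral>u. f (z \<omega> u t) \<partial>unit_measure) - (LBINT r:{0..t}. Gamma_pairing f (image_measure (z \<omega>) r))"
proof -
  have eq: "flow_process y f t \<omega> = (\<integral>x. f x \<partial>image_measure (z \<omega>) t) - (LBINT r:{0..t}. Gamma_pairing f (image_measure (z \<omega>) r))"
    unfolding flow_process_def using assms(2)
    by (auto intro!: arg_cong2[where f="(-)"] set_lebesgue_integral_cong simp: image_measure_clamped)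
  show ?thesis unfolding eq integral_image_path[OF assms(1) f measurable_f(1)] ..
qed

lemma flow_process_increment:
  assumes reg: "regular_path \<omega>" and st: "0 \<le> s" "s \<le> t" "t \<le> T"
  shows "flow_process y f t \<omega> - flow_process y f s \<omega> = (\<integral>u. compensated s t u \<omega> \<partial>unit_measure)"
proof -
  have sT: "s \<in> {0..T}" "t \<in> {0..T}" using st by auto
  have "(LBINT r:{0..t}. Gamma_pairing f (image_measure (z \<omega>) r)) =
     (LBINT r:{0..s}. Gamma_pairing f (image_measure (z \<omega>) r)) + (LBINT r:{s..t}. Gamma_pairing f (image_measure (z \<omega>) r))"
    using Gamma_integral_path(1)[OF reg f, of 0 t] st by (intro set_lborel_integral_split) auto
  then show ?thesis
    unfolding compensated_def flow_process_path[OF reg sT(1)] flow_process_path[OF reg sT(2)]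
    using Gamma_integral_path(2,3)[OF reg f st] integrable_f_path[OF reg f sT(1)] integrable_f_path[OF reg f sT(2)] by simp
qed

lemma measurable_rate_integral:
  "(\<lambda>p. LBINT r:{s..t}. deriv (deriv f) (z (fst p) (snd p) r) * rate (fst p) (snd p) r) \<in> borel_measurable (P \<Otimes>\<^sub>M unit_measure)"
  unfolding set_lebesgue_integral_def by measurable

text \<open>Justifies exchanging expectation and average over the particles. The terms with
  \<open>f\<close> are controlled by \<open>bound_process\<close>, the drift by \<open>C2\<close>
  times the total rate.\<close>

lemma integrable_compensated:
  assumes st: "0 \<le> s" "s \<le> t" "t \<le> T"
  shows "integrable (P \<Otimes>\<^sub>M unit_measure) (\<lambda>(\<omega>, u). compensated s t u \<omega>)"
proof -
  have i1: "integrable (P \<Otimes>\<^sub>M unit_measure) (\<lambda>p. f (z (fst p) (snd p) r))" if r: "r \<in> {0..T}" for r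
  proof (rule integrableI_bounded)
    show m: "(\<lambda>p. f (z (fst p) (snd p) r)) \<in> borel_measurable (P \<Otimes>\<^sub>M unit_measure)" by measurable
    have bi: "integrable P (\<lambda>\<omega>. \<bar>f 0\<bar> + C1 * bound_process r \<omega>)"
      using square_integrable_imp_integrable'[OF square_integrable_bound_process[OF r]] by auto
    have "(\<integral>\<^sup>+p. ennreal (norm (f (z (fst p) (snd p) r))) \<partial>(P \<Otimes>\<^sub>M unit_measure))
        = (\<integral>\<^sup>+\<omega>. \<integral>\<^sup>+u. ennreal (norm (f (z \<omega> u r))) \<partial>unit_measure \<partial>P)"
      using U.nn_integral_fst[of "\<lambda>p. ennreal (norm (f (z (fst p) (snd p) r)))" P] m by simp
    also have "\<dots> \<le> (\<integral>\<^sup>+\<omega>. ennreal (\<bar>f 0\<bar> + C1 * bound_process r \<omega>) \<partial>P)"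
    proof (rule nn_integral_mono_AE)
      show "AE \<omega> in P. (\<integral>\<^sup>+u. ennreal (norm (f (z \<omega> u r))) \<partial>unit_measure) \<le> ennreal (\<bar>f 0\<bar> + C1 * bound_process r \<omega>)"
        using AE_regular_path
      proof eventually_elim
        case (elim \<omega>)
        have "(\<integral>\<^sup>+u. ennreal (norm (f (z \<omega> u r))) \<partial>unit_measure) \<le> (\<integral>\<^sup>+u. ennreal (\<bar>f 0\<bar> + C1 * bound_process r \<omega>) \<partial>unit_measure)"
          using f_path_bound[OF elim f _ r] by (intro nn_integral_mono ennreal_leI) (auto simp: space_restrict_space)
        then show ?case using U.emeasure_space_1 by simp
      qed
    qed
    also have "\<dots> < \<infinity>"
      using bi by (subst nn_integral_eq_integral) (auto simp: bound_process_def C1_nonneg)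
    finally show "(\<integral>\<^sup>+p. ennreal (norm (f (z (fst p) (snd p) r))) \<partial>(P \<Otimes>\<^sub>M unit_measure)) < \<infinity>" .
  qed
  have i2: "integrable (P \<Otimes>\<^sub>M unit_measure) (\<lambda>p. LBINT r:{s..t}. deriv (deriv f) (z (fst p) (snd p) r) * rate (fst p) (snd p) r)"
  proof (rule integrableI_bounded[OF measurable_rate_integral])
    let ?I = "\<lambda>p. LBINT r:{s..t}. deriv (deriv f) (z (fst p) (snd p) r) * rate (fst p) (snd p) r"
    have pt: "ennreal (norm (?I p)) \<le> ennreal C2 * (total_rate (fst p) (snd p))" if p: "fst p \<in> space P" for p
    proof -
      have "ennreal (norm (?I p)) \<le> (\<integral>\<^sup>+r. ennreal \<bar>indicator {s..t} r *\<^sub>R (deriv (deriv f) (z (fst p) (snd p) r) * rate (fst p) (snd p) r)\<bar> \<partial>lborel)"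
        unfolding set_lebesgue_integral_def using ennreal_abs_integral_le by simp
      also have "\<dots> \<le> (\<integral>\<^sup>+r. ennreal C2 * (1 / level_mass (z (fst p)) (snd p) r * indicator {0..T} r) \<partial>lborel)"
      proof (rule nn_integral_mono)
        fix r
        show "ennreal \<bar>indicator {s..t} r *\<^sub>R (deriv (deriv f) (z (fst p) (snd p) r) * rate (fst p) (snd p) r)\<bar>
          \<le> ennreal C2 * (1 / level_mass (z (fst p)) (snd p) r * indicator {0..T} r)"
        proof (cases "r \<in> {s..t}")
          case True
          have "ennreal (\<bar>deriv (deriv f) (z (fst p) (snd p) r)\<bar> * rate (fst p) (snd p) r) \<le> ennreal (C2 * rate (fst p) (snd p) r)"
            using bound2 rate_nonneg by (intro ennreal_leI mult_right_mono) auto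
          also have "\<dots> = ennreal C2 * ennreal (rate (fst p) (snd p) r)" using C2_nonneg by (simp add: ennreal_mult')
          also have "\<dots> \<le> ennreal C2 * (1 / level_mass (z (fst p)) (snd p) r)" by (intro mult_left_mono ennreal_rate_le) simp
          finally show ?thesis using True st rate_nonneg[of "fst p" "snd p" r] by (auto simp: abs_mult)
        qed simp
      qed
      also have "\<dots> = ennreal C2 * (total_rate (fst p) (snd p))"
      proof (rule nn_integral_cmult)
        have "(\<lambda>r. level_mass (z (fst p)) (snd p) r) \<in> borel_measurable (lborel :: real measure)"
          by (rule path_measurable(2)[OF p]) auto
        then show "(\<lambda>r. 1 / level_mass (z (fst p)) (snd p) r * indicator {0..T} r) \<in> borel_measurable lborel" by measurable
      qed
      finally show ?thesis .
    qed
    have m: "(\<lambda>p. total_rate (fst p) (snd p)) \<in> borel_measurable (P \<Otimes>\<^sub>M unit_measure)"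
      using lborel.borel_measurable_nn_integral_fst[OF measurable_inverse_mass_triple] by simp
    have "(\<integral>\<^sup>+p. ennreal (norm (?I p)) \<partial>(P \<Otimes>\<^sub>M unit_measure))
       \<le> (\<integral>\<^sup>+p. ennreal C2 * (total_rate (fst p) (snd p)) \<partial>(P \<Otimes>\<^sub>M unit_measure))"
      by (intro nn_integral_mono pt) (auto simp: space_pair_measure)
    also have "\<dots> = ennreal C2 * (\<integral>\<^sup>+p. (total_rate (fst p) (snd p)) \<partial>(P \<Otimes>\<^sub>M unit_measure))"
      by (rule nn_integral_cmult[OF m])
    also have "\<dots> < \<infinity>"
      using U.nn_integral_fst[OF m] total_inverse_mass_finite by (simp add: ennreal_mult_less_top)
    finally show "(\<integral>\<^sup>+p. ennreal (norm (?I p)) \<partial>(P \<Otimes>\<^sub>M unit_measure)) < \<infinity>" .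
  qed
  have "s \<in> {0..T}" "t \<in> {0..T}" using st by auto
  then have "integrable (P \<Otimes>\<^sub>M unit_measure) (\<lambda>p. f (z (fst p) (snd p) t) - f (z (fst p) (snd p) s) -
      (LBINT r:{s..t}. deriv (deriv f) (z (fst p) (snd p) r) * rate (fst p) (snd p) r) / 2)"
    by (intro Bochner_Integration.integrable_diff i1 i2 integrable_divide)
  then show ?thesis by (simp add: compensated_def case_prod_unfold)
qed

lemma compensated_mean_zero:
  assumes u: "u \<in> {0..1}" and st: "0 \<le> s" "s \<le> t" "t \<le> T" and H: "H \<in> sets (F s)"
  shows "(\<integral>\<omega>. indicator H \<omega> * compensated s t u \<omega> \<partial>P) = 0"
proof -
  obtain A where A: "qv_martingale P F T (\<lambda>t \<omega>. z \<omega> u t) A (\<lambda>\<omega>. rate \<omega> u)"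
    using qv_martingale_z[OF u] by blast
  have I: "(\<lambda>\<omega>. LBINT r:{s..t}. deriv (deriv f) (z \<omega> u r) * rate \<omega> u r) \<in> borel_measurable P"
    unfolding set_lebesgue_integral_def by measurable
  show ?thesis
    unfolding compensated_def
    by (rule qv_martingale.ito_expectation[OF A f st _ _ I, where K=1]) (use H in \<open>auto simp: indicator_def\<close>)
qed

text \<open>A conditional expectation is characterised by integrals over events \<open>H\<close> of
  \<open>F s\<close>. For these, Fubini's theorem reduces the claim to the mean of
  \<open>indicator H\<close> times \<open>compensated s t u\<close>, which is 0 for every
  \<open>u\<close>. With the value at time 0 subtracted, integrability is that of averaged
  \<open>compensated\<close>.\<close>

lemma martingale_flow_process:
  "martingale_on P F T (\<lambda>t \<omega>. flow_process y f t \<omega> - flow_process y f 0 \<omega>)"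
proof -
  define W where "W t \<omega> = flow_process y f t \<omega> - flow_process y f 0 \<omega>" for t \<omega>
  have T0: "0 \<in> {0..T}" using T_pos by simp
  have Wm: "W t \<in> borel_measurable (F t)" if "t \<in> {0..T}" for t
    unfolding W_def using measurable_from_subalg[OF filtration_F flow_process_adapted[OF T0], of t]
      flow_process_adapted[OF that] that by auto
  have WP: "W t \<in> borel_measurable P" if "t \<in> {0..T}" for t
    by (rule measurable_from_subalg[OF subalgebra_F Wm[OF that]])
  have Wae: "AE \<omega> in P. W t \<omega> - W s \<omega> = (\<integral>u. compensated s t u \<omega> \<partial>unit_measure)" if "0 \<le> s" "s \<le> t" "t \<le> T" for s t
    using AE_regular_path by eventually_elim (use flow_process_increment[OF _ that] in \<open>simp add: W_def\<close>)
  have Wi: "integrable P (W t)" if t: "t \<in> {0..T}" for t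
  proof -
    have "integrable P (\<lambda>\<omega>. \<integral>u. compensated 0 t u \<omega> \<partial>unit_measure)"
      using PU.integrable_fst[OF integrable_compensated[of 0 t]] t by simp
    then show ?thesis
    proof (rule integrable_cong_AE_imp)
      show "AE \<omega> in P. (\<integral>u. compensated 0 t u \<omega> \<partial>unit_measure) = W t \<omega>"
        using Wae[of 0 t] t by (auto simp: W_def elim!: eventually_mono)
    qed (rule WP[OF t])
  qed
  show ?thesis
    unfolding martingale_on_def W_def[symmetric, abs_def]
  proof (intro conjI ballI)
    fix s t assume s: "s \<in> {0..T}" and t: "t \<in> {s..T}"
    have st: "0 \<le> s" "s \<le> t" "t \<le> T" "t \<in> {0..T}" using s t by auto
    interpret S: finite_measure_subalgebra P "F s" by unfold_locales (rule subalgebra_F)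
    show "AE \<omega> in P. real_cond_exp P (F s) (W t) \<omega> = W s \<omega>"
    proof (rule S.real_cond_exp_charact)
      fix H assume H: "H \<in> sets (F s)"
      then have HP: "H \<in> sets P" using subalgebra_F by (auto simp: subalgebra_def)
      have ic: "integrable (P \<Otimes>\<^sub>M unit_measure) (\<lambda>(\<omega>, u). indicator H \<omega> * compensated s t u \<omega>)"
      proof (rule iffD1[OF Bochner_Integration.integrable_cong[OF refl]])
        show "integrable (P \<Otimes>\<^sub>M unit_measure) (\<lambda>p. (case p of (\<omega>, u) \<Rightarrow> compensated s t u \<omega>) * indicator (H \<times> space unit_measure) p)"
          by (intro integrable_real_mult_indicator pair_measureI HP sets.top integrable_compensated st)
      qed (auto simp: indicator_def space_pair_measure)
      have i: "integrable P (\<lambda>\<omega>. indicator H \<omega> * W r \<omega>)" if "r \<in> {0..T}" for r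
        using integrable_mult_indicator[OF HP Wi[OF that]] by simp
      have "(\<integral>\<omega>. indicator H \<omega> * W t \<omega> \<partial>P) - (\<integral>\<omega>. indicator H \<omega> * W s \<omega> \<partial>P) =
          (\<integral>\<omega>. indicator H \<omega> * W t \<omega> - indicator H \<omega> * W s \<omega> \<partial>P)"
        by (rule Bochner_Integration.integral_diff[symmetric]) (rule i st s)+
      also have "\<dots> = (\<integral>\<omega>. \<integral>u. indicator H \<omega> * compensated s t u \<omega> \<partial>unit_measure \<partial>P)"
      proof (rule integral_cong_AE)
        show "AE \<omega> in P. indicator H \<omega> * W t \<omega> - indicator H \<omega> * W s \<omega> = (\<integral>u. indicator H \<omega> * compensated s t u \<omega> \<partial>unit_measure)"
          using Wae[OF st(1-3)] by eventually_elim (simp add: right_diff_distrib[symmetric])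
        show "(\<lambda>\<omega>. indicator H \<omega> * W t \<omega> - indicator H \<omega> * W s \<omega>) \<in> borel_measurable P"
          by (intro borel_measurable_diff borel_measurable_integrable[OF i] st s)
        show "(\<lambda>\<omega>. \<integral>u. indicator H \<omega> * compensated s t u \<omega> \<partial>unit_measure) \<in> borel_measurable P"
          by (rule borel_measurable_integrable[OF PU.integrable_fst[OF ic]])
      qed
      also have "\<dots> = (\<integral>u. \<integral>\<omega>. indicator H \<omega> * compensated s t u \<omega> \<partial>P \<partial>unit_measure)"
        by (rule PU.Fubini_integral[OF ic, symmetric])
      also have "\<dots> = (\<integral>u. 0 \<partial>unit_measure)"
        by (intro Bochner_Integration.integral_cong refl compensated_mean_zero st H) (simp add: space_restrict_space)
      finally show "(\<integral>\<omega>\<in>H. W t \<omega> \<partial>P) = (\<integral>\<omega>\<in>H. W s \<omega> \<partial>P)" by (simp add: set_lebesgue_integral_def)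
    qed (use Wi Wm s st in auto)
  qed (use Wm Wi in auto)
qed

end

end

section \<open>The quadratic variation\<close>

text \<open>If no mesh size worked, there would be bad partitions with mesh below
  \<open>1 / Suc k\<close> for every \<open>k\<close>; along a subsequence their sums converge
  almost surely, hence in probability, a contradiction. So only sequences of partitions and almost
  sure subsequential limits have to be examined.\<close>

lemma (in prob_space) joint_quadratic_variationI:
  assumes A: "\<And>t. t \<in> {0..T} \<Longrightarrow> A t \<in> borel_measurable M" "continuous_process_on M T A"
    and X: "\<And>t. t \<in> {0..T} \<Longrightarrow> X t \<in> borel_measurable M"
    and Y: "\<And>t. t \<in> {0..T} \<Longrightarrow> Y t \<in> borel_measurable M"
    and sub: "\<And>t n p. t \<in> {0..T} \<Longrightarrow> (\<And>k. interval_partition t (n k) (p k)) \<Longrightarrow> mesh_vanishes n p \<Longrightarrow>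
      \<exists>r::nat\<Rightarrow>nat. strict_mono r \<and> (AE \<omega> in M. (\<lambda>k. \<Sum>i<n (r k). (X (p (r k) (Suc i)) \<omega> - X (p (r k) i) \<omega>) *
        (Y (p (r k) (Suc i)) \<omega> - Y (p (r k) i) \<omega>)) \<longlonglongrightarrow> A t \<omega>)"
  shows "joint_quadratic_variation M T X Y A"
  unfolding joint_quadratic_variation_def
proof (intro conjI ballI allI impI)
  fix t \<epsilon> \<eta> :: real assume t: "t \<in> {0..T}" and \<epsilon>: "\<epsilon> > 0" and \<eta>: "\<eta> > 0"
  define S where "S n p \<omega> = (\<Sum>i<n. (X (p (Suc i)) \<omega> - X (p i) \<omega>) * (Y (p (Suc i)) \<omega> - Y (p i) \<omega>))" for n p \<omega>
  show "\<exists>\<delta>>0. \<forall>n p. interval_partition t n p \<and> (\<forall>i<n. p (Suc i) - p i < \<delta>) \<longrightarrow>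
     measure M {\<omega>\<in>space M. \<bar>(\<Sum>i<n. (X (p (Suc i)) \<omega> - X (p i) \<omega>) * (Y (p (Suc i)) \<omega> - Y (p i) \<omega>)) - A t \<omega>\<bar> > \<epsilon>} < \<eta>"
  proof (rule ccontr)
    assume neg: "\<not> ?thesis"
    have "\<exists>n p. interval_partition t n p \<and> (\<forall>i<n. p (Suc i) - p i < 1 / real (Suc k)) \<and>
        \<not> measure M {\<omega>\<in>space M. \<bar>S n p \<omega> - A t \<omega>\<bar> > \<epsilon>} < \<eta>" for k
    proof -
      have "1 / real (Suc k) > 0" by simp
      then show ?thesis using neg unfolding S_def by blast
    qed
    then have "\<forall>k. \<exists>q. interval_partition t (fst q) (snd q) \<and> (\<forall>i<fst q. snd q (Suc i) - snd q i < 1 / real (Suc k)) \<and>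
        \<not> measure M {\<omega>\<in>space M. \<bar>S (fst q) (snd q) \<omega> - A t \<omega>\<bar> > \<epsilon>} < \<eta>"
      by (simp only: split_paired_Ex fst_conv snd_conv) blast
    from choice[OF this] obtain q where q: "\<And>k. interval_partition t (fst (q k)) (snd (q k)) \<and>
        (\<forall>i<fst (q k). snd (q k) (Suc i) - snd (q k) i < 1 / real (Suc k)) \<and>
        \<not> measure M {\<omega>\<in>space M. \<bar>S (fst (q k)) (snd (q k)) \<omega> - A t \<omega>\<bar> > \<epsilon>} < \<eta>" by blast
    define n p where "n k = fst (q k)" and "p k = snd (q k)" for k
    have np: "\<And>k. interval_partition t (n k) (p k)" "\<And>k i. i < n k \<Longrightarrow> p k (Suc i) - p k i < 1 / real (Suc k)"
       "\<And>k. \<not> measure M {\<omega>\<in>space M. \<bar>S (n k) (p k) \<omega> - A t \<omega>\<bar> > \<epsilon>} < \<eta>"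
      using q by (auto simp: n_def p_def)
    have mesh: "mesh_vanishes n p"
      unfolding mesh_vanishes_def
    proof (intro allI impI)
      fix \<delta> :: real assume "\<delta> > 0"
      from eventually_uniform_step_less[OF this, of 1 0]
      show "\<forall>\<^sub>F k in sequentially. \<forall>i<n k. p k (Suc i) - p k i < \<delta>"
      proof eventually_elim
        case (elim k)
        show ?case
        proof (intro allI impI)
          fix i assume "i < n k"
          from np(2)[OF this] elim show "p k (Suc i) - p k i < \<delta>" by (simp only: diff_zero)
        qed
      qed
    qed
    obtain r :: "nat \<Rightarrow> nat" where r: "AE \<omega> in M. (\<lambda>k. S (n (r k)) (p (r k)) \<omega>) \<longlonglongrightarrow> A t \<omega>"
      using sub[OF t np(1) mesh] unfolding S_def by blast
    have [measurable]: "S (n k) (p k) \<in> borel_measurable M" for k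
    proof -
      have "p k i \<in> {0..T}" if "i \<le> n k" for i
        using partition_mono[of "n k" "p k" 0 i] partition_mono[of "n k" "p k" i "n k"] that np(1)[of k] t
        by (auto simp: interval_partition_def)
      then show ?thesis unfolding S_def by (intro borel_measurable_sum borel_measurable_times borel_measurable_diff X Y) auto
    qed
    have [measurable]: "A t \<in> borel_measurable M" by (rule A(1)[OF t])
    have "(\<lambda>k. \<integral>\<omega>. indicator {\<omega>\<in>space M. \<bar>S (n (r k)) (p (r k)) \<omega> - A t \<omega>\<bar> > \<epsilon>} \<omega> \<partial>M) \<longlonglongrightarrow> (\<integral>\<omega>. (0::real) \<partial>M)"
    proof (rule integral_dominated_convergence[where w="\<lambda>_. 1"])
      show "AE \<omega> in M. (\<lambda>k. indicator {\<omega>\<in>space M. \<bar>S (n (r k)) (p (r k)) \<omega> - A t \<omega>\<bar> > \<epsilon>} \<omega> :: real) \<longlonglongrightarrow> 0"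
        using r
      proof eventually_elim
        case (elim \<omega>)
        from tendstoD[OF elim \<epsilon>] have "\<forall>\<^sub>F k in sequentially. indicator {\<omega>\<in>space M. \<bar>S (n (r k)) (p (r k)) \<omega> - A t \<omega>\<bar> > \<epsilon>} \<omega> = (0::real)"
          by eventually_elim (auto simp: dist_real_def indicator_def)
        then show ?case by (rule tendsto_eventually)
      qed
    qed (auto simp: indicator_def)
    then have "(\<lambda>k. measure M {\<omega>\<in>space M. \<bar>S (n (r k)) (p (r k)) \<omega> - A t \<omega>\<bar> > \<epsilon>}) \<longlonglongrightarrow> 0"
      by (simp add: Int_absorb2 Collect_conj_eq)
    from order_tendstoD(2)[OF this \<eta>] np(3) show False by (simp add: eventually_sequentially)
  qed
qed (use A in auto)

text \<open>With increments \<open>a\<close> of \<open>X\<close> and \<open>b\<close> of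
  \<open>V\<close>, \<open>(a - b)\<^sup>2 - a\<^sup>2 = (b - 2 * a) * b\<close>. For a fine mesh
  both are at most \<open>e\<close> in modulus, and \<open>\<bar>b\<bar>\<close> is at most the
  integral of \<open>\<bar>g\<bar>\<close> over the interval, so the errors add up to at most
  \<open>3 * e * G\<close>.\<close>

lemma finite_variation_perturbation:
  fixes X g :: "real \<Rightarrow> real" and p :: "nat \<Rightarrow> nat \<Rightarrow> real" and N :: "nat \<Rightarrow> nat"
  assumes X: "continuous_on {0..t} X" and g: "set_integrable lborel {0..t} g"
    and part: "\<And>k. interval_partition t (N k) (p k)" and mesh: "mesh_vanishes N p"
  defines "V \<equiv> \<lambda>s. LBINT r:{0..s}. g r"
  shows "(\<lambda>k. (\<Sum>i<N k. ((X (p k (Suc i)) - V (p k (Suc i))) - (X (p k i) - V (p k i)))\<^sup>2)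
     - (\<Sum>i<N k. (X (p k (Suc i)) - X (p k i))\<^sup>2)) \<longlonglongrightarrow> 0"
proof (rule tendstoI)
  fix \<epsilon> :: real assume \<epsilon>: "\<epsilon> > 0"
  define G where "G = (LBINT r:{0..t}. \<bar>g r\<bar>)"
  have G0: "0 \<le> G" unfolding G_def set_lebesgue_integral_def by (intro Bochner_Integration.integral_nonneg) auto
  define e where "e = \<epsilon> / (3 * (G + 1))"
  have e: "e > 0" using \<epsilon> G0 by (simp add: e_def)
  have eG: "3 * e * G < \<epsilon>"
  proof -
    have "3 * e * G < 3 * e * (G + 1)" using e by simp
    also have "\<dots> = \<epsilon>"
    proof -
      have "3 * (x / (3 * c)) * c = x" if "c > 0" for x c :: real using that by simp
      from this[of "G + 1" \<epsilon>] show ?thesis using G0 by (simp only: e_def)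
    qed
    finally show ?thesis .
  qed
  have pm: "p k i \<le> p k (Suc i)" if "i < N k" for k i using part[of k] that by (auto simp: interval_partition_def)
  have pr: "p k i \<in> {0..t}" if "i \<le> N k" for k i
    using partition_mono[of "N k" "p k" 0 i] partition_mono[of "N k" "p k" i "N k"] pm that part[of k]
    by (auto simp: interval_partition_def)
  have cV: "continuous_on {0..t} V" unfolding V_def by (rule continuous_on_indefinite_set_integral[OF g])
  obtain \<delta>1 where \<delta>1: "\<delta>1 > 0" "\<And>x y. x \<in> {0..t} \<Longrightarrow> y \<in> {0..t} \<Longrightarrow> \<bar>x - y\<bar> < \<delta>1 \<Longrightarrow> \<bar>X x - X y\<bar> \<le> e"
    using uniform_modulus[OF X e] by blast
  obtain \<delta>2 where \<delta>2: "\<delta>2 > 0" "\<And>x y. x \<in> {0..t} \<Longrightarrow> y \<in> {0..t} \<Longrightarrow> \<bar>x - y\<bar> < \<delta>2 \<Longrightarrow> \<bar>V x - V y\<bar> \<le> e"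
    using uniform_modulus[OF cV e] by blast
  have "min \<delta>1 \<delta>2 > 0" using \<delta>1(1) \<delta>2(1) by simp
  then have "\<forall>\<^sub>F k in sequentially. \<forall>i<N k. p k (Suc i) - p k i < min \<delta>1 \<delta>2"
    using mesh unfolding mesh_vanishes_def by blast
  then show "\<forall>\<^sub>F k in sequentially. dist ((\<Sum>i<N k. ((X (p k (Suc i)) - V (p k (Suc i))) - (X (p k i) - V (p k i)))\<^sup>2)
     - (\<Sum>i<N k. (X (p k (Suc i)) - X (p k i))\<^sup>2)) 0 < \<epsilon>"
  proof eventually_elim
    case (elim k)
    have summand: "\<bar>((X (p k (Suc i)) - V (p k (Suc i))) - (X (p k i) - V (p k i)))\<^sup>2 - (X (p k (Suc i)) - X (p k i))\<^sup>2\<bar>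
        \<le> 3 * e * (LBINT r:{p k i..p k (Suc i)}. \<bar>g r\<bar>)" if i: "i < N k" for i
    proof -
      define a where "a = X (p k (Suc i)) - X (p k i)"
      define b where "b = V (p k (Suc i)) - V (p k i)"
      have r: "p k i \<in> {0..t}" "p k (Suc i) \<in> {0..t}" using pr i by auto
      have lt: "p k (Suc i) - p k i < min \<delta>1 \<delta>2" using elim i by blast
      have "\<bar>a\<bar> \<le> e" "\<bar>b\<bar> \<le> e"
        unfolding a_def b_def using r lt pm[OF i] by (auto intro!: \<delta>1(2) \<delta>2(2))
      have gi: "set_integrable lborel {0..p k (Suc i)} g" "set_integrable lborel {p k i..p k (Suc i)} g"
        using r by (auto intro!: set_integrable_subset[OF g])
      have "b = (LBINT r:{p k i..p k (Suc i)}. g r)"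
        unfolding b_def V_def using set_lborel_integral_split[OF gi(1), of "p k i"] r pm[OF i] by simp
      then have bg: "\<bar>b\<bar> \<le> (LBINT r:{p k i..p k (Suc i)}. \<bar>g r\<bar>)"
        using set_integral_norm_bound[OF gi(2)] by simp
      have "((X (p k (Suc i)) - V (p k (Suc i))) - (X (p k i) - V (p k i)))\<^sup>2 - (X (p k (Suc i)) - X (p k i))\<^sup>2 = (b - 2 * a) * b"
        by (simp add: a_def b_def power2_eq_square algebra_simps)
      also have "\<bar>(b - 2 * a) * b\<bar> \<le> (3 * e) * (LBINT r:{p k i..p k (Suc i)}. \<bar>g r\<bar>)"
        unfolding abs_mult using \<open>\<bar>a\<bar> \<le> e\<close> \<open>\<bar>b\<bar> \<le> e\<close> bg e by (intro mult_mono) auto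
      finally show ?thesis .
    qed
    have "\<bar>(\<Sum>i<N k. ((X (p k (Suc i)) - V (p k (Suc i))) - (X (p k i) - V (p k i)))\<^sup>2) - (\<Sum>i<N k. (X (p k (Suc i)) - X (p k i))\<^sup>2)\<bar>
       \<le> (\<Sum>i<N k. 3 * e * (LBINT r:{p k i..p k (Suc i)}. \<bar>g r\<bar>))"
      unfolding sum_subtractf[symmetric] by (intro order_trans[OF sum_abs] sum_mono summand) simp
    also have "\<dots> = 3 * e * G"
    proof -
      have ends: "p k 0 = 0" "p k (N k) = t" using part[of k] by (auto simp: interval_partition_def)
      have "G = (\<Sum>i<N k. LBINT r:{p k i..p k (Suc i)}. \<bar>g r\<bar>)"
        using set_lborel_integral_sum[of "N k" "p k" "\<lambda>r. \<bar>g r\<bar>"] pm set_integrable_abs[OF g] by (simp add: ends G_def)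
      then show ?thesis by (simp add: sum_distrib_left)
    qed
    finally show ?case using eG by simp
  qed
qed

context modified_massive_arratia_flow
begin

interpretation U: prob_space unit_measure by (rule prob_space_unit_measure)
interpretation PU: pair_sigma_finite P unit_measure by unfold_locales
interpretation UL: pair_sigma_finite unit_measure "lborel :: real measure" by unfold_locales

context
  fixes f :: "real \<Rightarrow> real" and C1 C2 assumes f: "C2_bounded f (deriv f) (deriv (deriv f)) C1 C2"
begin

interpretation C2_bounded f "deriv f" "deriv (deriv f)" C1 C2 by (rule f)

section \<open>Products of increments of two particles\<close>

definition pair_sum :: "(nat \<Rightarrow> real) \<Rightarrow> nat \<Rightarrow> 'a \<Rightarrow> real \<Rightarrow> real \<Rightarrow> real" where
  "pair_sum p n \<omega> u v = (\<Sum>i<n. (f (z \<omega> u (p (Suc i))) - f (z \<omega> u (p i))) * (f (z \<omega> v (p (Suc i))) - f (z \<omega> v (p i))))"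

definition pair_limit :: "real \<Rightarrow> 'a \<Rightarrow> real \<Rightarrow> real \<Rightarrow> real" where
  "pair_limit t \<omega> u v = (LBINT r:{0..t}. deriv f (z \<omega> u r) * deriv f (z \<omega> v r) * joint_rate u v \<omega> r)"

lemma measurable_pair_sum [measurable (raw)]:
  assumes [measurable]: "a \<in> N \<rightarrow>\<^sub>M P" "b \<in> borel_measurable N" "c \<in> borel_measurable N"
  shows "(\<lambda>x. pair_sum p n (a x) (b x) (c x)) \<in> borel_measurable N"
  unfolding pair_sum_def by measurable

lemma measurable_pair_limit [measurable (raw)]:
  assumes [measurable]: "a \<in> N \<rightarrow>\<^sub>M P" "b \<in> borel_measurable N" "c \<in> borel_measurable N"
  shows "(\<lambda>x. pair_limit t (a x) (b x) (c x)) \<in> borel_measurable N"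
  unfolding pair_limit_def set_lebesgue_integral_def by measurable

text \<open>Besides convergence for a fixed pair, averaging over the pairs requires a majorant
  uniform in \<open>u\<close> and \<open>v\<close>. Its factor 4 counts the two quadratic sums and
  the two quadratic variations, each with mean at most \<open>second_moment_bound t\<close>.\<close>

lemma pair_estimate:
  assumes uv: "u \<in> {0..1}" "v \<in> {0..1}" and t: "t \<in> {0..T}"
    and p: "\<And>k. interval_partition t (n k) (p k)" and mesh: "mesh_vanishes n p"
  shows "(\<lambda>k. \<integral>\<^sup>+\<omega>. ennreal \<bar>pair_sum (p k) (n k) \<omega> u v - pair_limit t \<omega> u v\<bar> \<partial>P) \<longlonglongrightarrow> 0"
    and "(\<integral>\<^sup>+\<omega>. ennreal \<bar>pair_sum (p k) (n k) \<omega> u v - pair_limit t \<omega> u v\<bar> \<partial>P)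
      \<le> ennreal (C1\<^sup>2 * (4 * second_moment_bound t))"
proof -
  obtain A where A: "qv_martingale P F T (\<lambda>t \<omega>. z \<omega> u t) A (\<lambda>\<omega>. rate \<omega> u)" using qv_martingale_z[OF uv(1)] by blast
  obtain B where B: "qv_martingale P F T (\<lambda>t \<omega>. z \<omega> v t) B (\<lambda>\<omega>. rate \<omega> v)" using qv_martingale_z[OF uv(2)] by blast
  obtain G where G: "qv_martingale_pair P F T (\<lambda>t \<omega>. z \<omega> u t) A (\<lambda>\<omega>. rate \<omega> u)
      (\<lambda>t \<omega>. z \<omega> v t) B (\<lambda>\<omega>. rate \<omega> v) G (joint_rate u v)"
    using qv_martingale_pair_z[OF uv A B] by blast
  interpret J: qv_martingale_pair P F T "\<lambda>t \<omega>. z \<omega> u t" A "\<lambda>\<omega>. rate \<omega> u" "\<lambda>t \<omega>. z \<omega> v t" B "\<lambda>\<omega>. rate \<omega> v" G "joint_rate u v"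
    by (rule G)
  have S: "J.joint_sum f p n \<omega> = pair_sum p n \<omega> u v" for p n \<omega> by (simp add: J.joint_sum_def pair_sum_def)
  have L: "J.joint_limit (deriv f) t \<omega> = pair_limit t \<omega> u v" for \<omega> by (simp add: J.joint_limit_def pair_limit_def)
  have Lm: "J.joint_limit (deriv f) t \<in> borel_measurable P"
    unfolding L[abs_def] by measurable
  have pk: "0 \<le> p k 0" "p k (n k) \<le> T" "p k 0 = 0" "p k (n k) = t" for k
    using p[of k] t by (auto simp: interval_partition_def)
  have pm: "p k i \<le> p k (Suc i)" if "i < n k" for k i using p[of k] that by (simp add: interval_partition_def)
  have sq0: "0 \<le> (\<integral>\<omega>. (z \<omega> w 0)\<^sup>2 \<partial>P)" for w by simp
  have QY: "integrable P (J.Y.qsum (p k) (n k))" "(\<integral>\<omega>. J.Y.qsum (p k) (n k) \<omega> \<partial>P) \<le> second_moment_bound t" for k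
  proof -
    have *: "integrable P (J.Y.qsum (p k) (n k))" "(\<integral>\<omega>. J.Y.qsum (p k) (n k) \<omega> \<partial>P) = (\<integral>\<omega>. (z \<omega> u t)\<^sup>2 \<partial>P) - (\<integral>\<omega>. (z \<omega> u 0)\<^sup>2 \<partial>P)"
      using J.Y.qsum_expectation_1[of "p k" "n k", OF pk(1,2) pm] by (simp_all add: pk(3,4))
    then show "integrable P (J.Y.qsum (p k) (n k))" "(\<integral>\<omega>. J.Y.qsum (p k) (n k) \<omega> \<partial>P) \<le> second_moment_bound t"
      using second_moment_le[OF uv(1) t] sq0[of u] by linarith+
  qed
  have QZ: "integrable P (J.Z.qsum (p k) (n k))" "(\<integral>\<omega>. J.Z.qsum (p k) (n k) \<omega> \<partial>P) \<le> second_moment_bound t" for k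
  proof -
    have *: "integrable P (J.Z.qsum (p k) (n k))" "(\<integral>\<omega>. J.Z.qsum (p k) (n k) \<omega> \<partial>P) = (\<integral>\<omega>. (z \<omega> v t)\<^sup>2 \<partial>P) - (\<integral>\<omega>. (z \<omega> v 0)\<^sup>2 \<partial>P)"
      using J.Z.qsum_expectation_1[of "p k" "n k", OF pk(1,2) pm] by (simp_all add: pk(3,4))
    then show "integrable P (J.Z.qsum (p k) (n k))" "(\<integral>\<omega>. J.Z.qsum (p k) (n k) \<omega> \<partial>P) \<le> second_moment_bound t"
      using second_moment_le[OF uv(2) t] sq0[of v] by linarith+
  qed
  have AB: "integrable P (A t)" "(\<integral>\<omega>. A t \<omega> \<partial>P) \<le> second_moment_bound t" "integrable P (B t)" "(\<integral>\<omega>. B t \<omega> \<partial>P) \<le> second_moment_bound t"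
    using J.Y.integrable_A[OF t] J.Z.integrable_A[OF t] J.Y.expectation_A[OF t] J.Z.expectation_A[OF t]
      second_moment_le[OF uv(1) t] second_moment_le[OF uv(2) t] sq0[of u] sq0[of v] by linarith+
  let ?D = "\<lambda>k \<omega>. pair_sum (p k) (n k) \<omega> u v - pair_limit t \<omega> u v"
  let ?B = "\<lambda>k \<omega>. C1\<^sup>2 * (J.Y.qsum (p k) (n k) \<omega> + J.Z.qsum (p k) (n k) \<omega> + (A t \<omega> + B t \<omega>))"
  have Bi: "integrable P (?B k)" for k using QY QZ AB by auto
  have bound: "AE \<omega> in P. \<bar>?D k \<omega>\<bar> \<le> ?B k \<omega>" for k
    using J.joint_sum_limit_bound[OF f t] by eventually_elim (simp add: S L)
  have Di: "integrable P (?D k)" for k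
    by (rule Bochner_Integration.integrable_bound[OF Bi[of k]]) (use bound[of k] in \<open>auto elim!: eventually_mono\<close>)
  have nn: "(\<integral>\<^sup>+\<omega>. ennreal \<bar>?D k \<omega>\<bar> \<partial>P) = ennreal (\<integral>\<omega>. \<bar>?D k \<omega>\<bar> \<partial>P)" for k
    using Di[of k] by (intro nn_integral_eq_integral) auto
  have "(\<lambda>k. \<integral>\<omega>. \<bar>?D k \<omega>\<bar> \<partial>P) \<longlonglongrightarrow> 0"
    using J.joint_sum_tendsto[OF f t p mesh Lm] by (simp add: S L)
  from tendsto_ennrealI[OF this] show "(\<lambda>k. \<integral>\<^sup>+\<omega>. ennreal \<bar>?D k \<omega>\<bar> \<partial>P) \<longlonglongrightarrow> 0" by (simp add: nn)
  have "(\<integral>\<omega>. \<bar>?D k \<omega>\<bar> \<partial>P) \<le> (\<integral>\<omega>. ?B k \<omega> \<partial>P)"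
    using bound[of k] Di[of k] Bi[of k] by (intro integral_mono_AE) auto
  also have "\<dots> = C1\<^sup>2 * ((\<integral>\<omega>. J.Y.qsum (p k) (n k) \<omega> \<partial>P) + (\<integral>\<omega>. J.Z.qsum (p k) (n k) \<omega> \<partial>P) + ((\<integral>\<omega>. A t \<omega> \<partial>P) + (\<integral>\<omega>. B t \<omega> \<partial>P)))"
    using QY(1) QZ(1) AB by simp
  also have "\<dots> \<le> C1\<^sup>2 * (4 * second_moment_bound t)"
    using QY(2)[of k] QZ(2)[of k] AB by (intro mult_left_mono) auto
  finally show "(\<integral>\<^sup>+\<omega>. ennreal \<bar>?D k \<omega>\<bar> \<partial>P) \<le> ennreal (C1\<^sup>2 * (4 * second_moment_bound t))"
    unfolding nn by (rule ennreal_leI)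
qed

text \<open>Dominated convergence over \<open>v\<close> and then over \<open>u\<close>, both times
  with the constant of \<open>pair_estimate\<close>, which averaging does not change as the measure
  has mass 1.\<close>

lemma pair_estimate_integrated:
  assumes t: "t \<in> {0..T}"
    and p: "\<And>k. interval_partition t (n k) (p k)" and mesh: "mesh_vanishes n p"
  shows "(\<lambda>k. \<integral>\<^sup>+u. \<integral>\<^sup>+v. \<integral>\<^sup>+\<omega>. ennreal \<bar>pair_sum (p k) (n k) \<omega> u v - pair_limit t \<omega> u v\<bar> \<partial>P \<partial>unit_measure \<partial>unit_measure) \<longlonglongrightarrow> 0"
    and "(\<integral>\<^sup>+u. \<integral>\<^sup>+v. \<integral>\<^sup>+\<omega>. ennreal \<bar>pair_sum (p k) (n k) \<omega> u v - pair_limit t \<omega> u v\<bar> \<partial>P \<partial>unit_measure \<partial>unit_measure) < \<infinity>"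
proof -
  let ?g = "\<lambda>k u v. \<integral>\<^sup>+\<omega>. ennreal \<bar>pair_sum (p k) (n k) \<omega> u v - pair_limit t \<omega> u v\<bar> \<partial>P"
  let ?C = "ennreal (C1\<^sup>2 * (4 * second_moment_bound t))"
  have sp: "u \<in> {0..1}" if "u \<in> space unit_measure" for u using that by (simp add: space_restrict_space)
  have C: "(\<integral>\<^sup>+v. ?C \<partial>unit_measure) = ?C" using U.emeasure_space_1 by simp
  have m1: "(\<lambda>v. ?g k u v) \<in> borel_measurable unit_measure" for k u by measurable
  have m2: "(\<lambda>u. \<integral>\<^sup>+v. ?g k u v \<partial>unit_measure) \<in> borel_measurable unit_measure" for k by measurable
  have b2: "(\<integral>\<^sup>+v. ?g k u v \<partial>unit_measure) \<le> ?C" if u: "u \<in> space unit_measure" for k u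
  proof -
    have "(\<integral>\<^sup>+v. ?g k u v \<partial>unit_measure) \<le> (\<integral>\<^sup>+v. ?C \<partial>unit_measure)"
      by (intro nn_integral_mono pair_estimate(2)[OF sp[OF u] sp t p mesh])
    then show ?thesis unfolding C .
  qed
  have l2: "(\<lambda>k. \<integral>\<^sup>+v. ?g k u v \<partial>unit_measure) \<longlonglongrightarrow> 0" if u: "u \<in> space unit_measure" for u
  proof -
    have "(\<lambda>k. \<integral>\<^sup>+v. ?g k u v \<partial>unit_measure) \<longlonglongrightarrow> (\<integral>\<^sup>+v. 0 \<partial>unit_measure)"
    proof (rule nn_integral_dominated_convergence[where w="\<lambda>_. ?C"])
      show "AE v in unit_measure. ?g k u v \<le> ?C" for k
        by (intro AE_I2 pair_estimate(2)[OF sp[OF u] sp t p mesh])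
      show "AE v in unit_measure. (\<lambda>k. ?g k u v) \<longlonglongrightarrow> 0"
        by (intro AE_I2 pair_estimate(1)[OF sp[OF u] sp t p mesh])
      show "(\<integral>\<^sup>+v. ?C \<partial>unit_measure) < \<infinity>" unfolding C by simp
    qed (use m1 in auto)
    then show ?thesis by simp
  qed
  have "(\<lambda>k. \<integral>\<^sup>+u. \<integral>\<^sup>+v. ?g k u v \<partial>unit_measure \<partial>unit_measure) \<longlonglongrightarrow> (\<integral>\<^sup>+u. 0 \<partial>unit_measure)"
  proof (rule nn_integral_dominated_convergence[where w="\<lambda>_. ?C"])
    show "AE u in unit_measure. (\<integral>\<^sup>+v. ?g k u v \<partial>unit_measure) \<le> ?C" for k by (intro AE_I2 b2)
    show "AE u in unit_measure. (\<lambda>k. \<integral>\<^sup>+v. ?g k u v \<partial>unit_measure) \<longlonglongrightarrow> 0" by (intro AE_I2 l2)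
    show "(\<integral>\<^sup>+v. ?C \<partial>unit_measure) < \<infinity>" unfolding C by simp
  qed (use m2 in auto)
  then show "(\<lambda>k. \<integral>\<^sup>+u. \<integral>\<^sup>+v. ?g k u v \<partial>unit_measure \<partial>unit_measure) \<longlonglongrightarrow> 0" by simp
  have "(\<integral>\<^sup>+u. \<integral>\<^sup>+v. ?g k u v \<partial>unit_measure \<partial>unit_measure) \<le> (\<integral>\<^sup>+u. ?C \<partial>unit_measure)"
    by (intro nn_integral_mono b2)
  also have "\<dots> < \<infinity>" unfolding C by simp
  finally show "(\<integral>\<^sup>+u. \<integral>\<^sup>+v. ?g k u v \<partial>unit_measure \<partial>unit_measure) < \<infinity>" .
qed

section \<open>Averaging over pairs of particles\<close>

definition empirical_mean :: "real \<Rightarrow> 'a \<Rightarrow> real" where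
  "empirical_mean s \<omega> = (\<integral>u. f (z \<omega> u s) \<partial>unit_measure)"

context
  fixes \<omega> assumes reg: "regular_path \<omega>"
begin

lemma AE_total_rate_finite: "AE u in unit_measure. total_rate \<omega> u < \<infinity>"
proof -
  have "(\<lambda>u. total_rate \<omega> u) \<in> borel_measurable unit_measure"
    using lborel.borel_measurable_nn_integral_fst[OF measurable_inverse_mass_path[OF reg]] by simp
  from nn_integral_PInf_AE[OF this] show ?thesis using reg by (auto simp: regular_path_def less_top)
qed

text \<open>At a fixed time the integrand is constant in \<open>v\<close> on the cluster of
  \<open>u\<close> and 0 off it, and the measure of the cluster is the reciprocal of the rate. The
  bound by \<open>C1\<^sup>2\<close> times the inverse mass, together with a finite total rate,
  permits integrating over \<open>v\<close> before time.\<close>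

lemma integral_pair_limit_inner:
  assumes u: "u \<in> {0..1}" "total_rate \<omega> u < \<infinity>" and t: "t \<in> {0..T}"
  shows "integrable unit_measure (\<lambda>v. pair_limit t \<omega> u v)"
    and "(\<integral>v. pair_limit t \<omega> u v \<partial>unit_measure) = (LBINT r:{0..t}. (deriv f (z \<omega> u r))\<^sup>2)"
proof -
  define h where "h v r = indicator {0..t} r *\<^sub>R (deriv f (z \<omega> u r) * deriv f (z \<omega> v r) * joint_rate u v \<omega> r)" for v r
  have sp: "\<omega> \<in> space P" by (rule regular_space[OF reg])
  have mz: "(\<lambda>q. z \<omega> u (snd q)) \<in> borel_measurable (unit_measure \<Otimes>\<^sub>M (lborel :: real measure))"
    "(\<lambda>q. z \<omega> (fst q) (snd q)) \<in> borel_measurable (unit_measure \<Otimes>\<^sub>M (lborel :: real measure))"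
    "(\<lambda>q. rate \<omega> u (snd q)) \<in> borel_measurable (unit_measure \<Otimes>\<^sub>M (lborel :: real measure))"
    by (rule path_measurable[OF sp]; measurable)+
  have mj: "(\<lambda>q. joint_rate u (fst q) \<omega> (snd q)) \<in> borel_measurable (unit_measure \<Otimes>\<^sub>M (lborel :: real measure))"
    unfolding joint_rate_def by (intro measurable_If mz borel_measurable_eq[OF mz(1,2)]) auto
  have hm: "(\<lambda>(v, r). h v r) \<in> borel_measurable (unit_measure \<Otimes>\<^sub>M lborel)"
    unfolding h_def case_prod_unfold
    by (intro borel_measurable_scaleR borel_measurable_times mj measurable_compose[OF mz(1) measurable_f(2)]
        measurable_compose[OF mz(2) measurable_f(2)]) measurable
  have hb: "ennreal \<bar>h v r\<bar> \<le> ennreal (C1\<^sup>2) * (1 / level_mass (z \<omega>) u r * indicator {0..T} r)" for v r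
  proof (cases "r \<in> {0..t}")
    case True
    have "\<bar>deriv f (z \<omega> u r) * deriv f (z \<omega> v r)\<bar> \<le> C1\<^sup>2"
      unfolding abs_mult power2_eq_square using bound1 C1_nonneg by (intro mult_mono) auto
    then have "\<bar>deriv f (z \<omega> u r) * deriv f (z \<omega> v r) * joint_rate u v \<omega> r\<bar> \<le> C1\<^sup>2 * rate \<omega> u r"
      unfolding abs_mult[of "deriv f (z \<omega> u r) * deriv f (z \<omega> v r)"]
      using rate_nonneg by (intro mult_mono) (auto simp: joint_rate_def)
    then have "ennreal \<bar>h v r\<bar> \<le> ennreal (C1\<^sup>2 * rate \<omega> u r)" using True by (intro ennreal_leI) (simp add: h_def)
    also have "\<dots> = ennreal (C1\<^sup>2) * ennreal (rate \<omega> u r)" by (simp add: ennreal_mult')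
    also have "\<dots> \<le> ennreal (C1\<^sup>2) * (1 / level_mass (z \<omega>) u r)" by (intro mult_left_mono ennreal_rate_le) simp
    finally show ?thesis using True t by simp
  qed (simp add: h_def)
  have ml: "(\<lambda>r. 1 / level_mass (z \<omega>) u r * indicator {0..T} r) \<in> borel_measurable lborel"
  proof -
    have "(\<lambda>r. level_mass (z \<omega>) u r) \<in> borel_measurable (lborel :: real measure)"
      by (rule path_measurable(2)[OF sp]) auto
    then show ?thesis by measurable
  qed
  have hi: "integrable (unit_measure \<Otimes>\<^sub>M lborel) (\<lambda>(v, r). h v r)"
  proof (rule integrableI_bounded[OF hm])
    have m: "(\<lambda>q. ennreal (norm (case q of (v, r) \<Rightarrow> h v r))) \<in> borel_measurable (unit_measure \<Otimes>\<^sub>M lborel)"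
      using hm by measurable
    have "(\<integral>\<^sup>+q. ennreal (norm (case q of (v, r) \<Rightarrow> h v r)) \<partial>(unit_measure \<Otimes>\<^sub>M lborel))
       = (\<integral>\<^sup>+v. \<integral>\<^sup>+r. ennreal \<bar>h v r\<bar> \<partial>lborel \<partial>unit_measure)"
      using lborel.nn_integral_fst[OF m] by simp
    also have "\<dots> \<le> (\<integral>\<^sup>+v. ennreal (C1\<^sup>2) * total_rate \<omega> u \<partial>unit_measure)"
      unfolding nn_integral_cmult[OF ml, symmetric] by (intro nn_integral_mono hb)
    also have "\<dots> < \<infinity>" using U.emeasure_space_1 u(2) by (simp add: ennreal_mult_less_top)
    finally show "(\<integral>\<^sup>+q. ennreal (norm (case q of (v, r) \<Rightarrow> h v r)) \<partial>(unit_measure \<Otimes>\<^sub>M lborel)) < \<infinity>" .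
  qed
  have pl: "pair_limit t \<omega> u v = (\<integral>r. h v r \<partial>lborel)" for v
    by (simp add: pair_limit_def h_def set_lebesgue_integral_def)
  show "integrable unit_measure (\<lambda>v. pair_limit t \<omega> u v)" unfolding pl by (rule UL.integrable_fst[OF hi])
  have "(\<integral>v. pair_limit t \<omega> u v \<partial>unit_measure) = (\<integral>r. \<integral>v. h v r \<partial>unit_measure \<partial>lborel)"
    unfolding pl by (rule UL.Fubini_integral[OF hi, symmetric])
  also have "\<dots> = (\<integral>r. indicator {0..t} r *\<^sub>R (deriv f (z \<omega> u r))\<^sup>2 \<partial>lborel)"
  proof (rule integral_cong_AE)
    show "(\<lambda>r. \<integral>v. h v r \<partial>unit_measure) \<in> borel_measurable lborel"
      by (rule borel_measurable_integrable[OF UL.integrable_snd[OF hi]])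
    have "(\<lambda>r. z \<omega> u r) \<in> borel_measurable (lborel :: real measure)" by (rule path_measurable(1)[OF sp]) auto
    from measurable_compose[OF this measurable_f(2)]
    show "(\<lambda>r. indicator {0..t} r *\<^sub>R (deriv f (z \<omega> u r))\<^sup>2) \<in> borel_measurable lborel" by measurable
    have "(\<integral>\<^sup>+r. 1 / level_mass (z \<omega>) u r * indicator {0..T} r \<partial>lborel) \<noteq> \<infinity>" using u(2) by simp
    from nn_integral_PInf_AE[OF ml this]
    show "AE r in lborel. (\<integral>v. h v r \<partial>unit_measure) = indicator {0..t} r *\<^sub>R (deriv f (z \<omega> u r))\<^sup>2"
    proof eventually_elim
      case (elim r)
      show ?case
      proof (cases "r \<in> {0..t}")
        case True
        \<comment> \<open>A finite inverse mass forces the cluster of \<open>u\<close> to have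
          positive mass; at mass 0 \<open>rate\<close> would take the default value 0 and nothing
          would cancel.\<close>
        then have "1 / level_mass (z \<omega>) u r \<noteq> \<infinity>" using elim t by auto
        then have lm: "level_mass (z \<omega>) u r \<noteq> 0" by auto
        define m where "m = enn2real (level_mass (z \<omega>) u r)"
        have lt: "level_mass (z \<omega>) u r < \<top>" using level_mass_le_1[of "z \<omega>" u r] by (rule le_less_trans) simp
        have m: "level_mass (z \<omega>) u r = ennreal m" using lt by (simp add: m_def)
        have mp: "m > 0" using lm lt unfolding m_def by (simp add: enn2real_positive_iff zero_less_iff_neq_zero)
        have rate: "rate \<omega> u r = 1 / m"
          using mp divide_ennreal[of 1 m] by (simp add: rate_def m)
        have sl: "(\<lambda>v. z \<omega> v r) \<in> borel_measurable borel"
          using measurable_slice.slice[OF path_slice[OF reg f]] .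
        define E where "E = {v\<in>{0..1}. z \<omega> v r = z \<omega> u r}"
        have E: "E \<in> sets unit_measure" "measure unit_measure E = m"
        proof -
          have "E = {v \<in> space borel. z \<omega> v r = z \<omega> u r} \<inter> {0..1}" by (auto simp: E_def)
          moreover have "{v \<in> space borel. z \<omega> v r = z \<omega> u r} \<in> sets borel" using sl by measurable
          ultimately have Eb: "E \<in> sets borel" by simp
          have sub: "E \<subseteq> {0..1}" by (auto simp: E_def)
          show "E \<in> sets unit_measure" by (simp add: sets_restrict_space_iff sub Eb)
          have "emeasure unit_measure E = emeasure lborel E"
            by (rule emeasure_restrict_space) (simp_all add: sub)
          then show "measure unit_measure E = m" by (simp add: measure_def m_def level_mass_def E_def)
        qed
        have "(\<integral>v. h v r \<partial>unit_measure) = (\<integral>v. ((deriv f (z \<omega> u r))\<^sup>2 / m) * indicator E v \<partial>unit_measure)"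
        proof (rule Bochner_Integration.integral_cong[OF refl])
          fix v assume "v \<in> space unit_measure"
          then have "v \<in> {0..1}" by (simp add: space_restrict_space)
          then show "h v r = ((deriv f (z \<omega> u r))\<^sup>2 / m) * indicator E v"
            using True by (auto simp: h_def joint_rate_def rate E_def power2_eq_square)
        qed
        also have "\<dots> = (deriv f (z \<omega> u r))\<^sup>2 / m * m"
        proof -
          have "E \<inter> {0..1} = E" by (auto simp: E_def)
          then show ?thesis using E by simp
        qed
        finally show ?thesis using True mp by simp
      qed (simp add: h_def)
    qed
  qed
  finally show "(\<integral>v. pair_limit t \<omega> u v \<partial>unit_measure) = (LBINT r:{0..t}. (deriv f (z \<omega> u r))\<^sup>2)"
    by (simp add: set_lebesgue_integral_def)
qed

text \<open>On a regular path the total rate is finite for almost every \<open>u\<close> only, hence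
  the almost everywhere form of the first claim.\<close>

lemma integral_pair_limit:
  assumes t: "t \<in> {0..T}"
  shows "AE u in unit_measure. integrable unit_measure (\<lambda>v. pair_limit t \<omega> u v)"
    and "integrable unit_measure (\<lambda>u. \<integral>v. pair_limit t \<omega> u v \<partial>unit_measure)"
    and "(\<integral>u. \<integral>v. pair_limit t \<omega> u v \<partial>unit_measure \<partial>unit_measure) = (LBINT r:{0..t}. \<integral>u. (deriv f (z \<omega> u r))\<^sup>2 \<partial>unit_measure)"
proof -
  have sp: "\<omega> \<in> space P" by (rule regular_space[OF reg])
  have spu: "AE u in unit_measure. u \<in> {0..1}" by (intro AE_I2) (simp add: space_restrict_space)
  show "AE u in unit_measure. integrable unit_measure (\<lambda>v. pair_limit t \<omega> u v)"
    using AE_total_rate_finite spu by eventually_elim (rule integral_pair_limit_inner(1)[OF _ _ t])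
  have ae: "AE u in unit_measure. (\<integral>v. pair_limit t \<omega> u v \<partial>unit_measure) = (LBINT r:{0..t}. (deriv f (z \<omega> u r))\<^sup>2)"
    using AE_total_rate_finite spu by eventually_elim (rule integral_pair_limit_inner(2)[OF _ _ t])
  have pm: "(\<lambda>q. \<integral>v. pair_limit t (fst q) (snd q) v \<partial>unit_measure) \<in> borel_measurable (P \<Otimes>\<^sub>M unit_measure)"
    by measurable
  have m: "(\<lambda>u. \<integral>v. pair_limit t \<omega> u v \<partial>unit_measure) \<in> borel_measurable unit_measure"
    using measurable_Pair2[OF pm sp] by simp
  define h where "h u r = indicator {0..t} r *\<^sub>R (deriv f (z \<omega> u r))\<^sup>2" for u r
  have hi: "integrable (unit_measure \<Otimes>\<^sub>M lborel) (\<lambda>(u, r). h u r)"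
  proof (rule integrableI_bounded)
    have "(\<lambda>q. z \<omega> (fst q) (snd q)) \<in> borel_measurable (unit_measure \<Otimes>\<^sub>M (lborel :: real measure))"
      by (rule path_measurable(1)[OF sp]) measurable
    from measurable_compose[OF this measurable_f(2)]
    show hm: "(\<lambda>(u, r). h u r) \<in> borel_measurable (unit_measure \<Otimes>\<^sub>M lborel)"
      unfolding h_def case_prod_unfold by measurable
    then have m: "(\<lambda>q. ennreal (norm (case q of (u, r) \<Rightarrow> h u r))) \<in> borel_measurable (unit_measure \<Otimes>\<^sub>M lborel)"
      by measurable
    have "(\<integral>\<^sup>+q. ennreal (norm (case q of (u, r) \<Rightarrow> h u r)) \<partial>(unit_measure \<Otimes>\<^sub>M lborel))
       = (\<integral>\<^sup>+u. \<integral>\<^sup>+r. ennreal \<bar>h u r\<bar> \<partial>lborel \<partial>unit_measure)"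
      using lborel.nn_integral_fst[OF m] by simp
    also have "\<dots> \<le> (\<integral>\<^sup>+u. \<integral>\<^sup>+r. ennreal (C1\<^sup>2) * indicator {0..t} r \<partial>lborel \<partial>unit_measure)"
    proof (intro nn_integral_mono)
      fix u r
      have "(deriv f (z \<omega> u r))\<^sup>2 \<le> C1\<^sup>2" using power_mono[OF bound1, of _ 2] by simp
      then show "ennreal \<bar>h u r\<bar> \<le> ennreal (C1\<^sup>2) * indicator {0..t} r"
        by (auto simp: h_def indicator_def intro!: ennreal_leI)
    qed
    also have "\<dots> < \<infinity>" using U.emeasure_space_1 t by (simp add: nn_integral_cmult_indicator ennreal_mult_less_top)
    finally show "(\<integral>\<^sup>+q. ennreal (norm (case q of (u, r) \<Rightarrow> h u r)) \<partial>(unit_measure \<Otimes>\<^sub>M lborel)) < \<infinity>" .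
  qed
  have hi1: "integrable unit_measure (\<lambda>u. LBINT r:{0..t}. (deriv f (z \<omega> u r))\<^sup>2)"
    using UL.integrable_fst[OF hi] by (simp add: h_def set_lebesgue_integral_def)
  show "integrable unit_measure (\<lambda>u. \<integral>v. pair_limit t \<omega> u v \<partial>unit_measure)"
    by (rule integrable_cong_AE_imp[OF hi1 m]) (use ae in \<open>auto elim!: eventually_mono\<close>)
  have "(\<integral>u. \<integral>v. pair_limit t \<omega> u v \<partial>unit_measure \<partial>unit_measure) = (\<integral>u. (LBINT r:{0..t}. (deriv f (z \<omega> u r))\<^sup>2) \<partial>unit_measure)"
    by (rule integral_cong_AE[OF m borel_measurable_integrable[OF hi1] ae])
  also have "\<dots> = (\<integral>r. \<integral>u. h u r \<partial>unit_measure \<partial>lborel)"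
    using UL.Fubini_integral[OF hi] by (simp add: h_def set_lebesgue_integral_def)
  also have "\<dots> = (LBINT r:{0..t}. \<integral>u. (deriv f (z \<omega> u r))\<^sup>2 \<partial>unit_measure)"
    by (simp add: h_def set_lebesgue_integral_def)
  finally show "(\<integral>u. \<integral>v. pair_limit t \<omega> u v \<partial>unit_measure \<partial>unit_measure) = (LBINT r:{0..t}. \<integral>u. (deriv f (z \<omega> u r))\<^sup>2 \<partial>unit_measure)" .
qed

text \<open>The square of an average is the double average of products, so the sum of squares is the
  double average of \<open>pair_sum\<close>, just as the limit is that of \<open>pair_limit\<close>.
  The absolute value then moves inside, once per average.\<close>

lemma squared_increments_error:
  assumes t: "t \<in> {0..T}" and p: "interval_partition t n p"
  shows "ennreal \<bar>(\<Sum>i<n. (empirical_mean (p (Suc i)) \<omega> - empirical_mean (p i) \<omega>)\<^sup>2) - (LBINT r:{0..t}. \<integral>u. (deriv f (z \<omega> u r))\<^sup>2 \<partial>unit_measure)\<bar>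
    \<le> (\<integral>\<^sup>+u. \<integral>\<^sup>+v. ennreal \<bar>pair_sum p n \<omega> u v - pair_limit t \<omega> u v\<bar> \<partial>unit_measure \<partial>unit_measure)"
proof -
  have pT: "p i \<in> {0..T}" if "i \<le> n" for i
    using partition_mono[of n p 0 i] partition_mono[of n p i n] that p t by (auto simp: interval_partition_def)
  define d where "d i u = f (z \<omega> u (p (Suc i))) - f (z \<omega> u (p i))" for i u
  define D where "D i = empirical_mean (p (Suc i)) \<omega> - empirical_mean (p i) \<omega>" for i
  have di: "integrable unit_measure (d i)" and dD: "(\<integral>u. d i u \<partial>unit_measure) = D i" if "i < n" for i
    using integrable_f_path[OF reg f pT[of i]] integrable_f_path[OF reg f pT[of "Suc i"]] that
    by (auto simp: d_def[abs_def] D_def empirical_mean_def)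
  have ps: "pair_sum p n \<omega> u v = (\<Sum>i<n. d i u * d i v)" for u v by (simp add: pair_sum_def d_def)
  have i1: "integrable unit_measure (\<lambda>v. pair_sum p n \<omega> u v)" for u
    unfolding ps using di by (intro Bochner_Integration.integrable_sum integrable_mult_right) auto
  have s1: "(\<integral>v. pair_sum p n \<omega> u v \<partial>unit_measure) = (\<Sum>i<n. d i u * D i)" for u
    unfolding ps using di dD by (subst Bochner_Integration.integral_sum) auto
  have i2: "integrable unit_measure (\<lambda>u. \<integral>v. pair_sum p n \<omega> u v \<partial>unit_measure)"
    unfolding s1 using di by (intro Bochner_Integration.integrable_sum integrable_mult_left) auto
  have s2: "(\<integral>u. \<integral>v. pair_sum p n \<omega> u v \<partial>unit_measure \<partial>unit_measure) = (\<Sum>i<n. (D i)\<^sup>2)"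
    unfolding s1 using di dD by (subst Bochner_Integration.integral_sum) (auto simp: power2_eq_square)
  note L = integral_pair_limit[OF t]
  have "(\<Sum>i<n. (D i)\<^sup>2) - (LBINT r:{0..t}. \<integral>u. (deriv f (z \<omega> u r))\<^sup>2 \<partial>unit_measure)
     = (\<integral>u. (\<integral>v. pair_sum p n \<omega> u v \<partial>unit_measure) - (\<integral>v. pair_limit t \<omega> u v \<partial>unit_measure) \<partial>unit_measure)"
    unfolding s2[symmetric] L(3)[symmetric] by (rule Bochner_Integration.integral_diff[OF i2 L(2), symmetric])
  then have "ennreal \<bar>(\<Sum>i<n. (D i)\<^sup>2) - (LBINT r:{0..t}. \<integral>u. (deriv f (z \<omega> u r))\<^sup>2 \<partial>unit_measure)\<bar>
     \<le> (\<integral>\<^sup>+u. ennreal \<bar>(\<integral>v. pair_sum p n \<omega> u v \<partial>unit_measure) - (\<integral>v. pair_limit t \<omega> u v \<partial>unit_measure)\<bar> \<partial>unit_measure)"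
    using ennreal_abs_integral_le by simp
  also have "\<dots> \<le> (\<integral>\<^sup>+u. \<integral>\<^sup>+v. ennreal \<bar>pair_sum p n \<omega> u v - pair_limit t \<omega> u v\<bar> \<partial>unit_measure \<partial>unit_measure)"
  proof (rule nn_integral_mono_AE)
    show "AE u in unit_measure. ennreal \<bar>(\<integral>v. pair_sum p n \<omega> u v \<partial>unit_measure) - (\<integral>v. pair_limit t \<omega> u v \<partial>unit_measure)\<bar>
       \<le> (\<integral>\<^sup>+v. ennreal \<bar>pair_sum p n \<omega> u v - pair_limit t \<omega> u v\<bar> \<partial>unit_measure)"
      using L(1)
    proof eventually_elim
      case (elim u)
      have "(\<integral>v. pair_sum p n \<omega> u v \<partial>unit_measure) - (\<integral>v. pair_limit t \<omega> u v \<partial>unit_measure)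
          = (\<integral>v. pair_sum p n \<omega> u v - pair_limit t \<omega> u v \<partial>unit_measure)"
        by (rule Bochner_Integration.integral_diff[OF i1 elim, symmetric])
      then show ?case using ennreal_abs_integral_le by simp
    qed
  qed
  finally show ?thesis by (simp add: D_def)
qed

end

text \<open>The claimed quadratic variation expressed through the clamped flow, for which
  measurability in \<open>\<omega>\<close> is at hand.\<close>

definition flow_bracket :: "real \<Rightarrow> 'a \<Rightarrow> real" where
  "flow_bracket t \<omega> = (LBINT r:{0..t}. \<integral>u. (deriv f (z \<omega> u r))\<^sup>2 \<partial>unit_measure)"

lemma flow_bracket_eq:
  assumes "\<omega> \<in> space P" "t \<in> {0..T}"
  shows "(LBINT s:{0..t}. (\<integral>x. (deriv f x)\<^sup>2 \<partial>image_measure (y \<omega>) s)) = flow_bracket t \<omega>"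
  unfolding flow_bracket_def
proof (rule set_lebesgue_integral_cong)
  show "\<forall>s. s \<in> {0..t} \<longrightarrow> (\<integral>x. (deriv f x)\<^sup>2 \<partial>image_measure (y \<omega>) s) = (\<integral>u. (deriv f (z \<omega> u s))\<^sup>2 \<partial>unit_measure)"
  proof (intro allI impI)
    fix s assume s: "s \<in> {0..t}"
    have "image_measure (y \<omega>) s = image_measure (z \<omega>) s" using s assms(2) by (intro image_measure_clamped[symmetric]) auto
    then show "(\<integral>x. (deriv f x)\<^sup>2 \<partial>image_measure (y \<omega>) s) = (\<integral>u. (deriv f (z \<omega> u s))\<^sup>2 \<partial>unit_measure)"
      using measurable_slice.integral_image_measure[OF field.measurable_slice[OF assms(1)], of "\<lambda>x. (deriv f x)\<^sup>2" s] by simp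
  qed
qed simp

lemma measurable_flow_bracket: "flow_bracket t \<in> borel_measurable P"
  unfolding flow_bracket_def set_lebesgue_integral_def by measurable

lemma measurable_empirical_mean: "empirical_mean s \<in> borel_measurable P"
  unfolding empirical_mean_def by measurable

text \<open>Tonelli's theorem turns the mean of the pathwise error bound into the double average of
  the means for fixed pairs, which tends to 0; convergence in mean then yields the almost sure
  subsequence.\<close>

lemma empirical_mean_subseq:
  assumes t: "t \<in> {0..T}"
    and p: "\<And>k. interval_partition t (n k) (p k)" and mesh: "mesh_vanishes n p"
  shows "\<exists>r::nat\<Rightarrow>nat. strict_mono r \<and>
    (AE \<omega> in P. (\<lambda>k. (\<Sum>i<n (r k). (empirical_mean (p (r k) (Suc i)) \<omega> - empirical_mean (p (r k) i) \<omega>)\<^sup>2)) \<longlonglongrightarrow> flow_bracket t \<omega>)"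
proof -
  define D where "D k \<omega> = (\<Sum>i<n k. (empirical_mean (p k (Suc i)) \<omega> - empirical_mean (p k i) \<omega>)\<^sup>2) - flow_bracket t \<omega>" for k \<omega>
  let ?I = "\<lambda>k. \<integral>\<^sup>+u. \<integral>\<^sup>+v. \<integral>\<^sup>+\<omega>. ennreal \<bar>pair_sum (p k) (n k) \<omega> u v - pair_limit t \<omega> u v\<bar> \<partial>P \<partial>unit_measure \<partial>unit_measure"
  have Dm[measurable]: "D k \<in> borel_measurable P" for k
    unfolding D_def using measurable_empirical_mean measurable_flow_bracket by measurable
  have DI: "(\<integral>\<^sup>+\<omega>. ennreal \<bar>D k \<omega>\<bar> \<partial>P) \<le> ?I k" for k
  proof -
    have "(\<integral>\<^sup>+\<omega>. ennreal \<bar>D k \<omega>\<bar> \<partial>P) \<le> (\<integral>\<^sup>+\<omega>. \<integral>\<^sup>+u. \<integral>\<^sup>+v. ennreal \<bar>pair_sum (p k) (n k) \<omega> u v - pair_limit t \<omega> u v\<bar> \<partial>unit_measure \<partial>unit_measure \<partial>P)"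
      using AE_regular_path unfolding D_def flow_bracket_def
      by (intro nn_integral_mono_AE, eventually_elim) (rule squared_increments_error[OF _ t p])
    also have "\<dots> = (\<integral>\<^sup>+u. \<integral>\<^sup>+\<omega>. \<integral>\<^sup>+v. ennreal \<bar>pair_sum (p k) (n k) \<omega> u v - pair_limit t \<omega> u v\<bar> \<partial>unit_measure \<partial>P \<partial>unit_measure)"
    proof -
      have "(\<lambda>(\<omega>, u). \<integral>\<^sup>+v. ennreal \<bar>pair_sum (p k) (n k) \<omega> u v - pair_limit t \<omega> u v\<bar> \<partial>unit_measure) \<in> borel_measurable (P \<Otimes>\<^sub>M unit_measure)"
        unfolding case_prod_unfold by measurable
      from PU.Fubini[OF this] show ?thesis by simp
    qed
    also have "\<dots> = ?I k"
    proof (rule nn_integral_cong)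
      fix u
      have "(\<lambda>(\<omega>, v). ennreal \<bar>pair_sum (p k) (n k) \<omega> u v - pair_limit t \<omega> u v\<bar>) \<in> borel_measurable (P \<Otimes>\<^sub>M unit_measure)"
        unfolding case_prod_unfold by measurable
      from PU.Fubini[OF this]
      show "(\<integral>\<^sup>+\<omega>. \<integral>\<^sup>+v. ennreal \<bar>pair_sum (p k) (n k) \<omega> u v - pair_limit t \<omega> u v\<bar> \<partial>unit_measure \<partial>P) =
         (\<integral>\<^sup>+v. \<integral>\<^sup>+\<omega>. ennreal \<bar>pair_sum (p k) (n k) \<omega> u v - pair_limit t \<omega> u v\<bar> \<partial>P \<partial>unit_measure)" by simp
    qed
    finally show ?thesis .
  qed
  have Di: "integrable P (D k)" for k
    by (rule integrableI_bounded[OF Dm]) (use le_less_trans[OF DI pair_estimate_integrated(2)[OF t p mesh]] in simp)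
  have "(\<lambda>k. \<integral>\<^sup>+\<omega>. ennreal \<bar>D k \<omega>\<bar> \<partial>P) \<longlonglongrightarrow> 0"
    by (rule tendsto_sandwich[OF _ _ tendsto_const pair_estimate_integrated(1)[OF t p mesh]]) (use DI in auto)
  then have "(\<lambda>k. enn2real (\<integral>\<^sup>+\<omega>. ennreal \<bar>D k \<omega>\<bar> \<partial>P)) \<longlonglongrightarrow> 0"
    by (intro tendsto_enn2real) auto
  then have "(\<lambda>k. \<integral>\<omega>. norm (D k \<omega>) \<partial>P) \<longlonglongrightarrow> 0"
    by (simp add: integral_eq_nn_integral)
  from tendsto_L1_AE_subseq[OF Di this] obtain r :: "nat \<Rightarrow> nat" where
    r: "strict_mono r" "AE \<omega> in P. (\<lambda>k. D (r k) \<omega>) \<longlonglongrightarrow> 0" by blast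
  from r(2) have "AE \<omega> in P. (\<lambda>k. (\<Sum>i<n (r k). (empirical_mean (p (r k) (Suc i)) \<omega> - empirical_mean (p (r k) i) \<omega>)\<^sup>2)) \<longlonglongrightarrow> flow_bracket t \<omega>"
    by eventually_elim (simp add: D_def LIM_zero_iff)
  with r(1) show ?thesis by blast
qed

lemma continuous_flow_bracket: "AE \<omega> in P. continuous_on {0..T} (\<lambda>t. flow_bracket t \<omega>)"
  using AE_space
proof eventually_elim
  case (elim \<omega>)
  have "(\<lambda>p. z \<omega> (snd p) (fst p)) \<in> borel_measurable ((lborel :: real measure) \<Otimes>\<^sub>M unit_measure)"
    by (rule path_measurable(1)[OF elim]) measurable
  from measurable_compose[OF this measurable_f(2)]
  have m: "(\<lambda>r. \<integral>u. (deriv f (z \<omega> u r))\<^sup>2 \<partial>unit_measure) \<in> borel_measurable lborel"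
    by (intro U.borel_measurable_lebesgue_integral) (simp add: case_prod_unfold)
  have b: "\<bar>\<integral>u. (deriv f (z \<omega> u r))\<^sup>2 \<partial>unit_measure\<bar> \<le> C1\<^sup>2" for r
  proof -
    have "ennreal \<bar>\<integral>u. (deriv f (z \<omega> u r))\<^sup>2 \<partial>unit_measure\<bar> \<le> (\<integral>\<^sup>+u. ennreal (C1\<^sup>2) \<partial>unit_measure)"
      using power_mono[OF bound1, of _ 2] by (intro order_trans[OF ennreal_abs_integral_le] nn_integral_mono ennreal_leI) simp
    also have "\<dots> = ennreal (C1\<^sup>2)" using U.emeasure_space_1 by simp
    finally show ?thesis by simp
  qed
  have one: "set_integrable lborel {0..T} (\<lambda>r. 1 :: real)"
    unfolding set_integrable_def by (simp del: integrable_indicator_iff) (auto intro!: integrable_real_indicator simp: less_imp_le[OF T_pos])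
  have "set_integrable lborel {0..T} (\<lambda>r. (\<integral>u. (deriv f (z \<omega> u r))\<^sup>2 \<partial>unit_measure) * 1)"
    by (rule set_integrable_bounded_mult[OF one _ _ b]) (use m in \<open>auto simp: set_borel_measurable_def\<close>)
  then show ?case unfolding flow_bracket_def by (intro continuous_on_indefinite_set_integral) simp
qed

text \<open>On a regular path the process is \<open>empirical_mean\<close> minus an indefinite
  integral, so \<open>finite_variation_perturbation\<close> reduces its squared increments to those
  of \<open>empirical_mean\<close>.\<close>

lemma quadratic_variation_flow_process:
  "quadratic_variation P T (flow_process y f) (\<lambda>t \<omega>. LBINT s:{0..t}. (\<integral>x. (deriv f x)\<^sup>2 \<partial>image_measure (y \<omega>) s))"
  unfolding quadratic_variation_def
proof (rule joint_quadratic_variationI)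
  let ?A = "\<lambda>t \<omega>. LBINT s:{0..t}. (\<integral>x. (deriv f x)\<^sup>2 \<partial>image_measure (y \<omega>) s)"
  show "?A t \<in> borel_measurable P" if "t \<in> {0..T}" for t
    using measurable_flow_bracket[of t] flow_bracket_eq[OF _ that] by (simp cong: measurable_cong)
  show "continuous_process_on P T ?A"
    unfolding continuous_process_on_def using continuous_flow_bracket AE_space
  proof eventually_elim
    case (elim \<omega>)
    from elim(1) show ?case by (rule continuous_on_eq) (simp only: flow_bracket_eq[OF elim(2)])
  qed
  show "flow_process y f t \<in> borel_measurable P" if "t \<in> {0..T}" for t
    by (rule measurable_from_subalg[OF subalgebra_F flow_process_adapted[OF f that]])
  then show "flow_process y f t \<in> borel_measurable P" if "t \<in> {0..T}" for t using that .
  fix t and n :: "nat \<Rightarrow> nat" and p assume t: "t \<in> {0..T}" and p: "\<And>k. interval_partition t (n k) (p k)" and mesh: "mesh_vanishes n p"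
  obtain r :: "nat \<Rightarrow> nat" where r: "strict_mono r"
    "AE \<omega> in P. (\<lambda>k. (\<Sum>i<n (r k). (empirical_mean (p (r k) (Suc i)) \<omega> - empirical_mean (p (r k) i) \<omega>)\<^sup>2)) \<longlonglongrightarrow> flow_bracket t \<omega>"
    using empirical_mean_subseq[OF t p mesh] by blast
  have mesh': "mesh_vanishes (\<lambda>k. n (r k)) (\<lambda>k. p (r k))"
    by (rule mesh_vanishes_subseq[OF mesh r(1)])
  have "AE \<omega> in P. (\<lambda>k. \<Sum>i<n (r k). (flow_process y f (p (r k) (Suc i)) \<omega> - flow_process y f (p (r k) i) \<omega>) *
      (flow_process y f (p (r k) (Suc i)) \<omega> - flow_process y f (p (r k) i) \<omega>)) \<longlonglongrightarrow> ?A t \<omega>"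
    using r(2) AE_regular_path
  proof eventually_elim
    case (elim \<omega>)
    note reg = elim(2)
    have tT: "{0..t} \<subseteq> {0..T}" using t by auto
    have c: "continuous_on {0..t} (\<lambda>s. empirical_mean s \<omega>)"
      unfolding empirical_mean_def by (rule continuous_on_subset[OF continuous_on_f_path[OF reg f] tT])
    have g: "set_integrable lborel {0..t} (\<lambda>r. Gamma_pairing f (image_measure (z \<omega>) r))"
      using Gamma_integral_path(1)[OF reg f, of 0 t] t by simp
    have fp: "flow_process y f (p k i) \<omega> = empirical_mean (p k i) \<omega> - (LBINT r:{0..p k i}. Gamma_pairing f (image_measure (z \<omega>) r))" if "i \<le> n k" for k i
    proof -
      have "p k i \<in> {0..T}"
        using partition_mono[of "n k" "p k" 0 i] partition_mono[of "n k" "p k" i "n k"] that p[of k] t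
        by (auto simp: interval_partition_def)
      then show ?thesis by (simp add: flow_process_path[OF f reg] empirical_mean_def)
    qed
    have "(\<lambda>k. \<Sum>i<n (r k). (flow_process y f (p (r k) (Suc i)) \<omega> - flow_process y f (p (r k) i) \<omega>)\<^sup>2) \<longlonglongrightarrow> flow_bracket t \<omega>"
    proof -
      have eq: "(\<Sum>i<n (r k). (flow_process y f (p (r k) (Suc i)) \<omega> - flow_process y f (p (r k) i) \<omega>)\<^sup>2) =
          (\<Sum>i<n (r k). ((empirical_mean (p (r k) (Suc i)) \<omega> - (LBINT s:{0..p (r k) (Suc i)}. Gamma_pairing f (image_measure (z \<omega>) s))) -
            (empirical_mean (p (r k) i) \<omega> - (LBINT s:{0..p (r k) i}. Gamma_pairing f (image_measure (z \<omega>) s))))\<^sup>2)" for k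
        by (intro sum.cong refl) (simp add: fp)
      show ?thesis
        unfolding eq using tendsto_add[OF finite_variation_perturbation[OF c g p mesh'] elim(1)] by simp
    qed
    then show ?case using flow_bracket_eq[OF regular_space[OF reg] t] by (simp add: power2_eq_square)
  qed
  with r(1) show "\<exists>r. strict_mono r \<and> (AE \<omega> in P. (\<lambda>k. \<Sum>i<n (r k). (flow_process y f (p (r k) (Suc i)) \<omega> - flow_process y f (p (r k) i) \<omega>) *
      (flow_process y f (p (r k) (Suc i)) \<omega> - flow_process y f (p (r k) i) \<omega>)) \<longlonglongrightarrow> ?A t \<omega>)" by blast
qed

text \<open>Guarantees that the drift in \<open>flow_process\<close> is a genuine integral and not
  the default value 0 assigned to a non-integrable function.\<close>

lemma set_integrable_Gamma:
  "AE \<omega> in P. set_integrable lborel {0..T} (\<lambda>s. Gamma_pairing f (image_measure (y \<omega>) s))"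
  using AE_regular_path
proof eventually_elim
  case (elim \<omega>)
  have "set_integrable lborel {0..T} (\<lambda>s. Gamma_pairing f (image_measure (z \<omega>) s))"
    using Gamma_integral_path(1)[OF elim f, of 0 T] T_pos by simp
  then show ?case
    by (subst set_integrable_cong[OF refl refl, of _ _ "\<lambda>s. Gamma_pairing f (image_measure (z \<omega>) s)"])
      (simp_all add: image_measure_clamped)
qed

lemma continuous_flow_process: "continuous_process_on P T (flow_process y f)"
  unfolding continuous_process_on_def using AE_regular_path
proof eventually_elim
  case (elim \<omega>)
  have "continuous_on {0..T} (\<lambda>t. (\<integral>u. f (z \<omega> u t) \<partial>unit_measure) - (LBINT r:{0..t}. Gamma_pairing f (image_measure (z \<omega>) r)))"
    using Gamma_integral_path(1)[OF elim f, of 0 T] T_pos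
    by (intro continuous_on_diff continuous_on_f_path[OF elim f] continuous_on_indefinite_set_integral) simp
  then show ?case by (rule continuous_on_eq) (simp only: flow_process_path[OF f elim])
qed

text \<open>The compensated process is a true martingale, so no localization is needed.\<close>

lemma local_martingale_flow_process: "local_martingale_on P F T (flow_process y f)"
  unfolding local_martingale_on_def
proof (intro conjI ballI exI[of _ "\<lambda>_ _. T"] allI)
  show "flow_process y f t \<in> borel_measurable (F t)" if "t \<in> {0..T}" for t by (rule flow_process_adapted[OF f that])
  show "stopping_time F (\<lambda>_. T)" by (rule stopping_time_const)
  have "(\<lambda>\<omega>. flow_process y f (min t T) \<omega> - flow_process y f 0 \<omega>) = (\<lambda>\<omega>. flow_process y f t \<omega> - flow_process y f 0 \<omega>)"
    if "t \<le> T" for t using that by (simp add: min_absorb1)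
  then show "martingale_on P F T (\<lambda>t \<omega>. flow_process y f (min t T) \<omega> - flow_process y f 0 \<omega>)"
    using martingale_flow_process[OF f] unfolding martingale_on_def by simp
qed (use T_pos in simp_all)

end

end

theorem proposition1p2:
  fixes P :: "'a measure" and T :: real and y :: "'a \<Rightarrow> real \<Rightarrow> real \<Rightarrow> real"
    and f :: "real \<Rightarrow> real"
  assumes "modified_massive_arratia_flow P T y"
    and "f differentiable_on UNIV"
    and "deriv f differentiable_on UNIV"
    and "continuous_on UNIV (deriv (deriv f))"
    and "bounded (range (deriv f))"
    and "bounded (range (deriv (deriv f)))"
  shows "(AE \<omega> in P. set_integrable lborel {0..T}
            (\<lambda>s. Gamma_pairing f (image_measure (y \<omega>) s))) \<and>
         continuous_process_on P T (flow_process y f) \<and>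
         local_martingale_on P (flow_filtration P T y) T (flow_process y f) \<and>
         quadratic_variation P T (flow_process y f)
           (\<lambda>t \<omega>. LBINT s:{0..t}. (\<integral>x. (deriv f x)\<^sup>2 \<partial>image_measure (y \<omega>) s))"
proof -
  interpret modified_massive_arratia_flow P T y by fact
  obtain C1 where C1: "\<And>x. \<bar>deriv f x\<bar> \<le> C1" using assms(5) by (auto simp: bounded_iff)
  obtain C2 where C2: "\<And>x. \<bar>deriv (deriv f) x\<bar> \<le> C2" using assms(6) by (auto simp: bounded_iff)
  have f: "C2_bounded f (deriv f) (deriv (deriv f)) C1 C2"
  proof
    show "(f has_real_derivative deriv f x) (at x)" "(deriv f has_real_derivative deriv (deriv f) x) (at x)" for x
      using assms(2,3) by (auto simp: DERIV_deriv_iff_real_differentiable differentiable_on_def)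
  qed (use assms(4) C1 C2 in auto)
  show ?thesis
    using set_integrable_Gamma[OF f] continuous_flow_process[OF f] local_martingale_flow_process[OF f]
      quadratic_variation_flow_process[OF f] by blast
qed

end
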